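(* Consider the problem (E-MIQP) $$\min\ x^{\mathsf T} H x + h^{\mathsf T} x \quad \text{s.t.}\quad (x-c)^{\mathsf T} Q (x-c) \le 1,\quad x \in \mathbb{Z}^p \times \mathbb{R}^{n-p},$$ where $H \in \mathbb{Q}^{n\times n}$ is symmetric, $Q \in \mathbb{Q}^{n \times n}$ is symmetric positive definite, $h, c \in \mathbb{Q}^n$, and $p \in \{0,\dots,n\}$. There is an algorithm which, for any $\epsilon \in (0,1]$, either finds an $\epsilon$-approximate solution to (E-MIQP), or finds a nonzero vector $d \in \mathbb{Z}^n$ with $d_{p+1} = \cdots = d_n = 0$ and a scalar $\rho \in \mathbb{Q}$ such that $$\{d^{\mathsf T} x : x \in \mathcal{E}(c,Q)\} \subseteq \left[\rho,\ \rho + 19\,p\,2^{p(p-1)/4}/\epsilon\right].$$ The running time of the algorithm is polynomial in the size of (E-MIQP) and in $\log(1/\epsilon)$.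
   Context: $\mathcal{E}(c,Q) := \{x \in \mathbb{R}^n : (x-c)^{\mathsf T} Q (x-c) \le 1\}$. $\log$ is the base-2 logarithm. For an optimization problem $\inf\{f(x) : x \in \mathcal{S}\}$, let $f_{\inf}$ and $f_{\sup}$ denote the infimum and supremum of $f$ on $\mathcal{S}$. For $\epsilon \in [0,1]$, a point $x^\diamond \in \mathcal{S}$ is an $\epsilon$-approximate solution if $f(x^\diamond) - f_{\inf} \le \epsilon \cdot (f_{\sup} - f_{\inf})$. The size of rational numbers, vectors, matrices, and optimization problems is the standard bit size: essentially the number of bits required to encode the object in binary. *)

theory Defs
  imports
    Complex_Main
    "HOL-Library.Log_Nat"
    "HOL-Computational_Algebra.Polynomial"
    "Jordan_Normal_Form.Matrix"
begin

section \<open>Mixed integer quadratic programs over an ellipsoid\<close>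

definition pos_def_mat :: "nat \<Rightarrow> real mat \<Rightarrow> bool" where
  "pos_def_mat n A \<longleftrightarrow> A \<in> carrier_mat n n \<and> transpose_mat A = A \<and>
     (\<forall>x \<in> carrier_vec n. x \<noteq> 0\<^sub>v n \<longrightarrow> x \<bullet> (A *\<^sub>v x) > 0)"

definition ellipsoid :: "real vec \<Rightarrow> real mat \<Rightarrow> real vec set" where
  "ellipsoid c Q = {x \<in> carrier_vec (dim_vec c). (x - c) \<bullet> (Q *\<^sub>v (x - c)) \<le> 1}"

definition mixed_integer_points :: "nat \<Rightarrow> nat \<Rightarrow> real vec set" where
  "mixed_integer_points n p = {x \<in> carrier_vec n. \<forall>i<p. x $ i \<in> \<int>}"

definition quadratic_objective :: "real mat \<Rightarrow> real vec \<Rightarrow> real vec \<Rightarrow> real" where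
  "quadratic_objective H h x = x \<bullet> (H *\<^sub>v x) + h \<bullet> x"

text \<open>
  \<open>Inf\<close> and \<open>Sup\<close> on the reals are the true infimum and supremum only for nonempty bounded sets.
  Here this is harmless: membership of \<open>x\<close> makes the feasible set nonempty, and a continuous
  objective is bounded on a bounded feasible set such as a subset of an ellipsoid.
\<close>

definition approx_solution :: "real \<Rightarrow> ('a \<Rightarrow> real) \<Rightarrow> 'a set \<Rightarrow> 'a \<Rightarrow> bool" where
  "approx_solution \<epsilon> f S x \<longleftrightarrow>
     x \<in> S \<and> f x - (INF y\<in>S. f y) \<le> \<epsilon> * ((SUP y\<in>S. f y) - (INF y\<in>S. f y))"

section \<open>Model of computation\<close>

text \<open>
  A random access machine with structured control and the logarithmic cost criterion: every
  operation is charged the number of bits of all integers it handles, addresses included.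
  The memory consists of integer arrays, of which a program mentions only finitely many;
  a scalar variable is a single cell of an array.
  Up to a polynomial, this cost is the running time of a Turing machine.
\<close>

datatype expr =
    Const int
  | Read nat expr
  | Plus expr expr
  | Minus expr expr
  | Times expr expr
  | Div expr expr

datatype com =
    Skip
  | Write nat expr expr
  | Seq com com
  | Cond expr com com
  | While expr com

type_synonym memory = "nat \<Rightarrow> int \<Rightarrow> int"

text \<open>A sign bit followed by the binary digits of the absolute value.\<close>

definition int_size :: "int \<Rightarrow> nat" where
  "int_size a = 1 + floorlog 2 (nat \<bar>a\<bar>)"

primrec eval :: "memory \<Rightarrow> expr \<Rightarrow> int" where
  "eval m (Const k) = k"
| "eval m (Read a e) = m a (eval m e)"
| "eval m (Plus e f) = eval m e + eval m f"
| "eval m (Minus e f) = eval m e - eval m f"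
| "eval m (Times e f) = eval m e * eval m f"
| "eval m (Div e f) = eval m e div eval m f"

primrec eval_cost :: "memory \<Rightarrow> expr \<Rightarrow> nat" where
  "eval_cost m (Const k) = int_size k"
| "eval_cost m (Read a e) =
     eval_cost m e + int_size (eval m e) + int_size (m a (eval m e))"
| "eval_cost m (Plus e f) =
     eval_cost m e + eval_cost m f + int_size (eval m e) + int_size (eval m f)"
| "eval_cost m (Minus e f) =
     eval_cost m e + eval_cost m f + int_size (eval m e) + int_size (eval m f)"
| "eval_cost m (Times e f) =
     eval_cost m e + eval_cost m f + int_size (eval m e) + int_size (eval m f)"
| "eval_cost m (Div e f) =
     eval_cost m e + eval_cost m f + int_size (eval m e) + int_size (eval m f)"

text \<open>
  \<open>run prog m t m'\<close>: started in memory \<open>m\<close>, the program halts after time \<open>t\<close> in memory \<open>m'\<close>.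
  A guard counts as true iff its value is positive.
\<close>

inductive run :: "com \<Rightarrow> memory \<Rightarrow> nat \<Rightarrow> memory \<Rightarrow> bool" where
  run_Skip: "run Skip m 1 m"
| run_Write: "run (Write a e f) m
      (1 + eval_cost m e + eval_cost m f + int_size (eval m e) + int_size (eval m f))
      (m(a := (m a)(eval m e := eval m f)))"
| run_Seq: "run (Seq c d) m (1 + t + u) m''" if "run c m t m'" and "run d m' u m''"
| run_Cond_True: "run (Cond e c d) m (1 + eval_cost m e + t) m'"
    if "eval m e > 0" and "run c m t m'"
| run_Cond_False: "run (Cond e c d) m (1 + eval_cost m e + t) m'"
    if "\<not> eval m e > 0" and "run d m t m'"
| run_While_True: "run (While e c) m (1 + eval_cost m e + t + u) m''"
    if "eval m e > 0" and "run c m t m'" and "run (While e c) m' u m''"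
| run_While_False: "run (While e c) m (1 + eval_cost m e) m" if "\<not> eval m e > 0"

inductive_cases run_SkipE: "run Skip m t m'"
inductive_cases run_WriteE: "run (Write a e f) m t m'"
inductive_cases run_SeqE: "run (Seq c d) m t m'"
inductive_cases run_CondE: "run (Cond e c d) m t m'"
inductive_cases run_WhileE: "run (While e c) m t m'"

lemma run_deterministic:
  "run c m t m' \<Longrightarrow> run c m u m'' \<Longrightarrow> t = u \<and> m' = m''"
proof (induction arbitrary: u m'' rule: run.induct)
  case (run_Skip m)
  then show ?case by (auto elim: run_SkipE)
next
  case (run_Write a e f m)
  from run_Write.prems show ?case by (rule run_WriteE) simp
next
  case (run_Seq c m t m1 d t2 m2)
  obtain u1 u2 n where *: "u = Suc (u1 + u2)" "run c m u1 n" "run d n u2 m''"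
    by (rule run_SeqE[OF run_Seq.prems]) blast
  from run_Seq.IH(1)[OF *(2)] *(3) have "t = u1" "run d m1 u2 m''" by simp_all
  with run_Seq.IH(2)[of u2 m''] *(1) show ?case by simp
next
  case (run_Cond_True m e c t m1 d)
  obtain u1 where *: "u = Suc (eval_cost m e + u1)" "run c m u1 m''"
    by (rule run_CondE[OF run_Cond_True.prems]) (use run_Cond_True.hyps(1) in blast)+
  from run_Cond_True.IH[OF *(2)] *(1) show ?case by simp
next
  case (run_Cond_False m e d t m1 c)
  obtain u1 where *: "u = Suc (eval_cost m e + u1)" "run d m u1 m''"
    by (rule run_CondE[OF run_Cond_False.prems]) (use run_Cond_False.hyps(1) in blast)+
  from run_Cond_False.IH[OF *(2)] *(1) show ?case by simp
next
  case (run_While_True m e c t m1 t2 m2)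
  obtain u1 u2 n where *: "u = Suc (eval_cost m e + u1 + u2)" "run c m u1 n"
      "run (While e c) n u2 m''"
    by (rule run_WhileE[OF run_While_True.prems]) (use run_While_True.hyps(1) in blast)+
  from run_While_True.IH(1)[OF *(2)] *(3) have "t = u1" "run (While e c) m1 u2 m''" by simp_all
  with run_While_True.IH(2)[of u2 m''] *(1) show ?case by simp
next
  case (run_While_False m e c)
  show ?case by (rule run_WhileE[OF run_While_False.prems]) (use run_While_False.hyps in simp_all)
qed

section \<open>Input, output and size\<close>

definition encode_rat :: "rat \<Rightarrow> int list" where
  "encode_rat r = [fst (quotient_of r), snd (quotient_of r)]"

definition encode_vec :: "rat vec \<Rightarrow> int list" where
  "encode_vec v = concat (map encode_rat (list_of_vec v))"

definition encode_mat :: "rat mat \<Rightarrow> int list" where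
  "encode_mat A = concat (map encode_vec (rows A))"

definition encode_miqp ::
  "nat \<Rightarrow> nat \<Rightarrow> rat mat \<Rightarrow> rat vec \<Rightarrow> rat mat \<Rightarrow> rat vec \<Rightarrow> int list" where
  "encode_miqp n p H h Q c =
     [int n, int p] @ encode_mat H @ encode_vec h @ encode_mat Q @ encode_vec c"

definition miqp_size ::
  "nat \<Rightarrow> nat \<Rightarrow> rat mat \<Rightarrow> rat vec \<Rightarrow> rat mat \<Rightarrow> rat vec \<Rightarrow> nat" where
  "miqp_size n p H h Q c = sum_list (map int_size (encode_miqp n p H h Q c))"

text \<open>The digit of weight \<open>2 ^ (- i)\<close> in the binary expansion of \<open>\<epsilon>\<close>; for \<open>\<epsilon> \<le> 1\<close>, digit 0 is the integer part.\<close>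

definition binary_digit :: "real \<Rightarrow> nat \<Rightarrow> int" where
  "binary_digit \<epsilon> i = \<lfloor>2 ^ i * \<epsilon>\<rfloor> mod 2"

text \<open>
  Array 0 holds a finite list of integers and array 1 the binary expansion of \<open>\<epsilon>\<close>; everything
  else is 0. Giving \<open>\<epsilon>\<close> by its digits lets it be an arbitrary real and makes a running time
  bounded in terms of \<open>log 2 (1 / \<epsilon>)\<close> alone meaningful: the program pays only for digits it reads,
  whereas the bit size of a rational \<open>\<epsilon>\<close> is not bounded in terms of \<open>log 2 (1 / \<epsilon>)\<close>.
\<close>

definition initial_memory :: "int list \<Rightarrow> real \<Rightarrow> memory" where
  "initial_memory xs \<epsilon> = (\<lambda>a i.
     if a = 0 \<and> 0 \<le> i \<and> i < int (length xs) then xs ! nat i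
     else if a = 1 \<and> 0 \<le> i then binary_digit \<epsilon> (nat i)
     else 0)"

text \<open>
  Results are read from array 2. Cell 0 tells which of the two kinds of result follows.
  Rationals occupy two cells, a numerator and a positive denominator, not necessarily coprime.
\<close>

definition holds_rat :: "memory \<Rightarrow> int \<Rightarrow> rat \<Rightarrow> bool" where
  "holds_rat m i r \<longleftrightarrow> m 2 (i + 1) > 0 \<and> r = of_int (m 2 i) / of_int (m 2 (i + 1))"

definition outputs_point :: "memory \<Rightarrow> rat vec \<Rightarrow> bool" where
  "outputs_point m x \<longleftrightarrow> m 2 0 = 0 \<and> (\<forall>i<dim_vec x. holds_rat m (1 + 2 * int i) (x $ i))"

definition outputs_direction :: "memory \<Rightarrow> int vec \<Rightarrow> rat \<Rightarrow> bool" where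
  "outputs_direction m d \<rho> \<longleftrightarrow> m 2 0 = 1 \<and> (\<forall>i<dim_vec d. m 2 (1 + int i) = d $ i) \<and>
     holds_rat m (1 + int (dim_vec d)) \<rho>"

end

(*
Minimise the objective over the whole ellipsoid first. With b = 2 H c + h the minimiser relative to
the centre is y(l) = -(H + l Q)^-1 b / 2 for the right multiplier l >= 0. Bisection finds it closely
enough: either y(0) works, or a bad and a good multiplier become so close that the segment from
y(hi) to a point outside the ellipsoid, where the Lagrangian is almost as small, crosses the boundary
in a point w with f(c + w) - min f tiny compared with the range of f.

Let W be a basis of Z^p, reduced (in the sense of LLL, with q_i <= 4 q_(i+1)) for the form Q^-1, with
orthogonalised squared lengths q_0, ..., q_(p-1), and let tau be the sum of the 1 / (4 q_j). Every
point can be moved to a mixed integer point by making its products with the rows integral one after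
the other, along Q-orthogonal directions; this costs squared Q-distance at most tau. If
tau <= (e / 16)^2, rounding c + (1 - e / 16) w gives a feasible point, and since the range of f on the
ellipsoid bounds its Lipschitz constant there up to a factor 5 / 2, it is an e-approximate
solution. Otherwise some q_j is small, hence so is q_0 <= 4^j q_j, and the ellipsoid is thin in the
direction of the first row of W: its width there is 2 sqrt q_0 <= 16 sqrt (sum of 4^j) / e. Here e is a
dyadic approximation of epsilon with e <= epsilon <= 9/8 e, which accounts for 18 of the 19 in the
bound; the last one pays for the rational approximation of sqrt q_0 in the computation of rho.

For the running time, the algorithm is written with a few combinators that preserve "computable in
polynomial time". These come with a compiler from a first order functional language on binary trees
to the random access machine, so that costs need only be bounded for functions on trees.
*)
theory Submission
  imports Defs "Jordan_Normal_Form.Determinant"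
begin

text \<open>The guarantee is relative to the range of the objective on the feasible points, which is
  unknown and could a priori be tiny. Small \<open>tau\<close> settles this: rounding then finds a
  feasible point near every point of the ellipsoid, so the feasible points form a net and the
  objective varies on them by at least 3/8 of its range on the ellipsoid. For the same reason
  feasibility never has to be decided. Neither the optimal multiplier nor the minimiser need be
  rational, and H + l Q may be singular at the optimum. Hence nothing is solved exactly.
  Definiteness is decided by a rational orthogonalisation; when it fails, it leaves a direction of
  nonpositive curvature, and a long step along this direction replaces the missing minimiser. A
  polynomial number of arithmetic operations says nothing about bit sizes. Every loop therefore
  comes with a bound on all its iterates, and for rationals this is always obtained in the same way:
  an integer that clears the denominators, and a bound on the absolute value.\<close>

type_synonym rmat = "rat list list"

section \<open>Binary trees and a functional language with a cost measure\<close>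

datatype val = VInt int | VPair val val

primrec vsize :: "val => nat" where
 "vsize (VInt a) = int_size a"
| "vsize (VPair x y) = 1 + vsize x + vsize y"

text \<open>The right spine of a tree is the loop counter of \<open>KIter\<close>: for a list it is
  the length, for a unary number the value.\<close>

primrec spine :: "val => nat" where
 "spine (VInt a) = 0"
| "spine (VPair x y) = Suc (spine y)"

primrec left :: "val => val" where
 "left (VInt a) = VInt a" | "left (VPair x y) = x"

primrec right :: "val => val" where
 "right (VInt a) = VInt a" | "right (VPair x y) = y"

text \<open>Projections and \<open>num\<close> are total, so every program is defined on every tree;
  the value 1 at a pair is what the heap stores there.\<close>

primrec num :: "val => int" where
 "num (VInt a) = a" | "num (VPair x y) = 1"

primrec unary :: "nat => val" where
 "unary 0 = VInt 0" | "unary (Suc n) = VPair (VInt 0) (unary n)"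

text \<open>Loops run along the spine of a tree that already exists, so every program terminates.
  \<open>KBits\<close> turns the bit length of an integer into such a spine; Euclid's algorithm and
  the bisections take their iteration counts from it.\<close>

datatype prg =
  KId
 | KConst int
 | KLeft
 | KRight
 | KPair prg prg
 | KComp prg prg
 | KAdd
 | KSub
 | KMul
 | KDiv
 | KIf prg prg prg
 | KIter prg
 | KBits

primrec sem :: "prg => val => val" where
 "sem KId v = v"
| "sem (KConst a) v = VInt a"
| "sem KLeft v = left v"
| "sem KRight v = right v"
| "sem (KPair f g) v = VPair (sem f v) (sem g v)"
| "sem (KComp f g) v = sem f (sem g v)"
| "sem KAdd v = VInt (num (left v) + num (right v))"
| "sem KSub v = VInt (num (left v) - num (right v))"
| "sem KMul v = VInt (num (left v) * num (right v))"
| "sem KDiv v = VInt (num (left v) div num (right v))"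
| "sem (KIf c f g) v = (if num (sem c v) > 0 then sem f v else sem g v)"
| "sem (KIter f) v = (sem f ^^ spine (left v)) (right v)"
| "sem KBits v = unary (floorlog 2 (nat (num v)))"

text \<open>Every case is at least the size of the argument and of the result, so cost also bounds
  the heap that a program consumes. The square for \<open>KBits\<close> stems from its loop, which
  halves the number once per bit and handles the whole number each time.\<close>

primrec cost :: "prg => val => nat" where
 "cost KId v = vsize v"
| "cost (KConst a) v = vsize v + int_size a"
| "cost KLeft v = vsize v"
| "cost KRight v = vsize v"
| "cost (KPair f g) v = 1 + cost f v + cost g v"
| "cost (KComp f g) v = cost f (sem g v) + cost g v"
| "cost KAdd v = vsize v + vsize (sem KAdd v)"
| "cost KSub v = vsize v + vsize (sem KSub v)"
| "cost KMul v = vsize v + vsize (sem KMul v)"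
| "cost KDiv v = vsize v + vsize (sem KDiv v)"
| "cost (KIf c f g) v = cost c v + (if num (sem c v) > 0 then cost f v else cost g v)"
| "cost (KIter f) v = vsize v + (\<Sum>i<spine (left v). 1 + cost f ((sem f ^^ i) (right v)))"
| "cost KBits v = 4 * vsize v * vsize v"

lemma int_size_pos: "0 < int_size a"
 by (simp add: int_size_def)

lemma vsize_pos: "0 < vsize v"
 by (cases v) (auto simp: int_size_pos)

lemma vsize_left: "vsize (left v) \<le> vsize v" and vsize_right: "vsize (right v) \<le> vsize v"
 by (cases v; simp)+

lemma spine_le_vsize: "spine v \<le> vsize v"
 by (induction v) auto

lemma int_size_num: "int_size (num v) \<le> vsize v + 1"
 by (cases v) (auto simp: int_size_def floorlog_def)

lemma vsize_unary: "vsize (unary n) = 2 * n + 1"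
 by (induction n) (auto simp: int_size_def floorlog_def)

lemma spine_unary: "spine (unary n) = n"
 by (induction n) auto

lemma floorlog_nat_le: "floorlog 2 (nat a) < int_size a"
proof -
 have "floorlog 2 (nat a) \<le> floorlog 2 (nat \<bar>a\<bar>)" by (rule floorlog_mono) auto
 thus ?thesis by (simp add: int_size_def)
qed

lemma floorlog_num_le: "floorlog 2 (nat (num v)) \<le> vsize v"
 using floorlog_nat_le[of "num v"] int_size_num[of v] by simp

text \<open>Because of this, a polynomial cost bound is at once a polynomial bound on the size of
  the result, and compositions need no separate treatment of sizes.\<close>

lemma vsize_sem_le: "vsize (sem f v) \<le> cost f v"
proof (induction f arbitrary: v)
 case (KComp f g)
 show ?case using KComp.IH(1)[of "sem g v"] by simp
next
 case (KIter f)
 show ?case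
 proof (cases "spine (left v)")
  case 0
  thus ?thesis using vsize_right[of v] by simp
 next
  case (Suc n)
  thus ?thesis using KIter.IH[of "(sem f ^^ n) (right v)"] by simp
 qed
next
 case KBits
 have "vsize v \<le> vsize v * vsize v" using vsize_pos[of v] by simp
 hence "2 * floorlog 2 (nat (num v)) + 1 \<le> 4 * (vsize v * vsize v)"
  using floorlog_num_le[of v] vsize_pos[of v] by linarith
 thus ?case by (simp add: vsize_unary)
next
 case (KPair f g)
 show ?case using KPair.IH(1)[of v] KPair.IH(2)[of v] by simp
qed (auto simp: vsize_left vsize_right intro: trans_le_add2)

lemma cost_pos: "0 < cost f v"
 using vsize_sem_le[of f v] vsize_pos[of "sem f v"] by linarith

section \<open>Compilation\<close>

text \<open>
 Values live in a heap that only grows. Cell \<open>i\<close> of the arrays 3, 4, 5 holds the integer (1 for a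
 pair), the left and the right component of node \<open>i\<close>; an integer node is its own component, whereas
 the components of a pair have smaller addresses, which is how the two kinds are told apart.
 Array 6 holds registers and cell 0 of array 7 the number of heap nodes in use.
\<close>

primrec rep :: "memory => val => int => bool" where
 "rep m (VInt a) i \<longleftrightarrow> 0 \<le> i \<and> i < m 7 0 \<and> m 3 i = a \<and> m 4 i = i \<and> m 5 i = i"
| "rep m (VPair x y) i \<longleftrightarrow> 0 \<le> i \<and> i < m 7 0 \<and> m 3 i = 1 \<and> m 5 i < i \<and>
   rep m x (m 4 i) \<and> rep m y (m 5 i)"

abbreviation reg :: "nat => expr" where "reg r \<equiv> Read 6 (Const (int r))"
abbreviation setreg :: "nat => expr => com" where "setreg r \<equiv> Write 6 (Const (int r))"
abbreviation hp :: expr where "hp \<equiv> Read 7 (Const 0)"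

definition alloc_int :: "nat => expr => com" where
 "alloc_int d e = Seq (Write 3 hp e) (Seq (Write 4 hp hp) (Seq (Write 5 hp hp)
   (Seq (setreg d hp) (Write 7 (Const 0) (Plus hp (Const 1))))))"

definition alloc_pair :: "nat => nat => nat => com" where
 "alloc_pair d a b = Seq (Write 3 hp (Const 1)) (Seq (Write 4 hp (reg a)) (Seq (Write 5 hp (reg b))
   (Seq (setreg d hp) (Write 7 (Const 0) (Plus hp (Const 1))))))"

text \<open>Argument and result share register \<open>d\<close>; subprograms work in registers above
  those still needed, so nothing below \<open>d\<close> changes. In \<open>KIter\<close> register
  \<open>d + 1\<close> walks down the counter; its guard, an address minus the address of the right
  component, is positive exactly at a pair.\<close>

primrec compile :: "prg => nat => com" where
 "compile KId d = Skip"
| "compile (KConst a) d = alloc_int d (Const a)"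
| "compile KLeft d = setreg d (Read 4 (reg d))"
| "compile KRight d = setreg d (Read 5 (reg d))"
| "compile (KPair f g) d =
   Seq (setreg (d + 1) (reg d)) (Seq (compile f (d + 1))
   (Seq (setreg (d + 2) (reg d)) (Seq (compile g (d + 2)) (alloc_pair d (d + 1) (d + 2)))))"
| "compile (KComp f g) d = Seq (compile g d) (compile f d)"
| "compile KAdd d = alloc_int d (Plus (Read 3 (Read 4 (reg d))) (Read 3 (Read 5 (reg d))))"
| "compile KSub d = alloc_int d (Minus (Read 3 (Read 4 (reg d))) (Read 3 (Read 5 (reg d))))"
| "compile KMul d = alloc_int d (Times (Read 3 (Read 4 (reg d))) (Read 3 (Read 5 (reg d))))"
| "compile KDiv d = alloc_int d (Div (Read 3 (Read 4 (reg d))) (Read 3 (Read 5 (reg d))))"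
| "compile (KIf c f g) d =
   Seq (setreg (d + 1) (reg d)) (Seq (compile c (d + 1))
   (Cond (Read 3 (reg (d + 1))) (compile f d) (compile g d)))"
| "compile (KIter f) d =
   Seq (setreg (d + 1) (Read 4 (reg d))) (Seq (setreg (d + 2) (Read 5 (reg d)))
   (Seq (While (Minus (reg (d + 1)) (Read 5 (reg (d + 1))))
      (Seq (compile f (d + 2)) (setreg (d + 1) (Read 5 (reg (d + 1))))))
    (setreg d (reg (d + 2)))))"
| "compile KBits d =
   Seq (setreg (d + 1) (Read 3 (reg d))) (Seq (alloc_int (d + 2) (Const 0)) (Seq (alloc_int d (Const 0))
    (While (reg (d + 1)) (Seq (setreg (d + 1) (Div (reg (d + 1)) (Const 2))) (alloc_pair d (d + 2) d)))))"

section \<open>Machine runs with upper bounds on the time\<close>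

definition runs :: "com => memory => nat => memory => bool" where
 "runs c m b m' \<longleftrightarrow> (\<exists>t. run c m t m' \<and> t \<le> b)"

lemma runs_mono: "runs c m b m' ==> b \<le> b' ==> runs c m b' m'"
 unfolding runs_def by (meson le_trans)

lemma runs_Skip: "1 \<le> b ==> runs Skip m b m"
 unfolding runs_def using run_Skip by blast

lemma runs_Seq: "runs c m b m1 ==> runs d m1 b' m2 ==> runs (Seq c d) m (1 + b + b') m2"
 unfolding runs_def by (metis run_Seq add_mono le_refl)

lemma runs_Cond:
 "(if eval m e > 0 then runs c m b m' else runs d m b m') ==>
  runs (Cond e c d) m (1 + eval_cost m e + b) m'"
 unfolding runs_def
 by (cases "eval m e > 0") (force intro: run_Cond_True run_Cond_False)+

lemma runs_While_False: "\<not> eval m e > 0 ==> runs (While e c) m (1 + eval_cost m e) m"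
 unfolding runs_def by (blast intro: run_While_False)

lemma runs_While_True:
 assumes "eval m e > 0" "runs c m b m1" "runs (While e c) m1 b' m2"
 shows "runs (While e c) m (1 + eval_cost m e + b + b') m2"
proof -
 from assms(2,3) obtain t u where "run c m t m1" "t \<le> b" "run (While e c) m1 u m2" "u \<le> b'"
  unfolding runs_def by blast
 thus ?thesis unfolding runs_def using run_While_True[OF assms(1)]
  by (intro exI[of _ "1 + eval_cost m e + t + u"]) simp
qed

text \<open>With one bound on all intermediate values, an expression costs at most that bound times
  the constant \<open>len\<close>. This replaces exact bookkeeping of the logarithmic costs.\<close>

primrec small :: "memory => nat => expr => bool" where
 "small m b (Const k) \<longleftrightarrow> int_size k \<le> b"
| "small m b (Read a e) \<longleftrightarrow> small m b e \<and> int_size (m a (eval m e)) \<le> b"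
| "small m b (Plus e f) \<longleftrightarrow> small m b e \<and> small m b f \<and> int_size (eval m e + eval m f) \<le> b"
| "small m b (Minus e f) \<longleftrightarrow> small m b e \<and> small m b f \<and> int_size (eval m e - eval m f) \<le> b"
| "small m b (Times e f) \<longleftrightarrow> small m b e \<and> small m b f \<and> int_size (eval m e * eval m f) \<le> b"
| "small m b (Div e f) \<longleftrightarrow> small m b e \<and> small m b f \<and> int_size (eval m e div eval m f) \<le> b"

primrec len :: "expr => nat" where
 "len (Const k) = 1"
| "len (Read a e) = 2 + len e"
| "len (Plus e f) = 2 + len e + len f"
| "len (Minus e f) = 2 + len e + len f"
| "len (Times e f) = 2 + len e + len f"
| "len (Div e f) = 2 + len e + len f"

lemma int_size_eval_small: "small m b e ==> int_size (eval m e) \<le> b"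
 by (cases e) auto

lemma eval_cost_small: "small m b e ==> eval_cost m e \<le> len e * b"
proof (induction e)
 case (Read a e)
 thus ?case using int_size_eval_small[of m b e] by simp
next
 case (Plus e f)
 thus ?case using int_size_eval_small[of m b e] int_size_eval_small[of m b f]
  by (simp add: algebra_simps)
next
 case (Minus e f)
 thus ?case using int_size_eval_small[of m b e] int_size_eval_small[of m b f]
  by (simp add: algebra_simps)
next
 case (Times e f)
 thus ?case using int_size_eval_small[of m b e] int_size_eval_small[of m b f]
  by (simp add: algebra_simps)
next
 case (Div e f)
 thus ?case using int_size_eval_small[of m b e] int_size_eval_small[of m b f]
  by (simp add: algebra_simps)
qed simp

lemma small_pos: "small m b e ==> 1 \<le> b"
 using int_size_eval_small[of m b e] int_size_pos[of "eval m e"] by linarith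

lemma runs_Write:
 assumes "small m b e" "small m b f"
 shows "runs (Write a e f) m ((len e + len f + 3) * b) (m(a := (m a)(eval m e := eval m f)))"
proof -
 have "1 + eval_cost m e + eval_cost m f + int_size (eval m e) + int_size (eval m f)
   \<le> b + len e * b + len f * b + b + b"
  using eval_cost_small[OF assms(1)] eval_cost_small[OF assms(2)]
   int_size_eval_small[OF assms(1)] int_size_eval_small[OF assms(2)] small_pos[OF assms(1)]
  by (intro add_mono)
 also have "\<dots> = (len e + len f + 3) * b" by (simp add: algebra_simps)
 finally show ?thesis unfolding runs_def using run_Write[of a e f m] by blast
qed

text \<open>A crude linear bound in place of the logarithm. Addresses are charged by their value
  below, which is harmless as only polynomiality matters.\<close>

lemma int_size_le_nat: "int_size a \<le> nat \<bar>a\<bar> + 1"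
proof -
 have "floorlog 2 n \<le> n" for n :: nat
  by (rule floorlog_leI) (use less_exp[of n] in \<open>simp_all\<close>)
 thus ?thesis by (simp add: int_size_def)
qed

lemma int_size_le: "\<bar>a\<bar> \<le> int b ==> int_size a \<le> b + 1"
 using int_size_le_nat[of a] by linarith

text \<open>The frame condition of compiled code: only fresh heap cells and registers from
  \<open>d\<close> on may change, hence trees built earlier stay represented.\<close>

definition extends :: "nat => memory => memory => bool" where
 "extends d m m' \<longleftrightarrow> m 7 0 \<le> m' 7 0 \<and> (\<forall>r<int d. m' 6 r = m 6 r) \<and>
   (\<forall>i. 0 \<le> i \<and> i < m 7 0 --> m' 3 i = m 3 i \<and> m' 4 i = m 4 i \<and> m' 5 i = m 5 i)"

lemma extends_trans: "extends d m m' ==> extends d m' m'' ==> extends d m m''"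
 by (auto simp: extends_def)

lemma extends_mono: "extends d' m m' ==> d \<le> d' ==> extends d m m'"
 by (auto simp: extends_def)

lemma extends_refl: "extends d m m"
 by (auto simp: extends_def)

lemma extends_reg: "extends d m m' ==> r < d ==> m' 6 (int r) = m 6 (int r)"
 by (auto simp: extends_def)

lemma rep_bounds: "rep m v i ==> 0 \<le> i \<and> i < m 7 0"
 by (cases v) auto

lemma rep_mono: "extends d m m' ==> rep m v i ==> rep m' v i"
proof (induction v arbitrary: i)
 case (VInt a)
 thus ?case by (auto simp: extends_def)
next
 case (VPair x y)
 from VPair.prems have "m' 3 i = m 3 i" "m' 4 i = m 4 i" "m' 5 i = m 5 i" "m 7 0 \<le> m' 7 0"
  by (auto simp: extends_def)
 with VPair show ?case by auto
qed

lemma rep_left: "rep m v i ==> rep m (left v) (m 4 i)"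
 by (cases v) auto

lemma rep_right: "rep m v i ==> rep m (right v) (m 5 i)"
 by (cases v) auto

lemma rep_num: "rep m v i ==> m 3 i = num v"
 by (cases v) auto

lemma extends_setreg: "d \<le> r ==> extends d m (m(6 := (m 6)(int r := p)))"
 by (auto simp: extends_def)

lemma rep_setreg: "rep (m(6 := f)) v i = rep m v i"
 by (induction v arbitrary: i) auto

lemma extends_alloc:
 "0 \<le> m 7 0 ==> extends d m (m(3 := (m 3)(m 7 0 := a), 4 := (m 4)(m 7 0 := b),
   5 := (m 5)(m 7 0 := c), 6 := (m 6)(int d := m 7 0), 7 := (m 7)(0 := m 7 0 + 1)))"
 by (auto simp: extends_def)

lemma int_size_pointer: "0 \<le> p ==> p \<le> int b ==> int_size p \<le> b + 1"
 by (rule int_size_le) simp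

lemma alloc_int:
 assumes e: "small m b e" and "\<And>k. 0 \<le> k ==> k \<le> 7 ==> int_size k \<le> b" and d: "int_size (int d) \<le> b"
  and hp: "0 \<le> m 7 0" "m 7 0 + 2 \<le> int b"
 obtains m' where "runs (alloc_int d e) m ((50 + len e) * b) m'"
  "rep m' (VInt (eval m e)) (m' 6 (int d))" "extends d m m'" "m' 7 0 = m 7 0 + 1"
  "\<And>r. r \<noteq> d ==> m' 6 (int r) = m 6 (int r)"
proof -
 have h: "int_size (m 7 0) \<le> b" "int_size (m 7 0 + 1) \<le> b"
  using hp int_size_pointer[of "m 7 0" "b - 1"] int_size_pointer[of "m 7 0 + 1" "b - 1"]
  by (auto simp: of_nat_diff)
 have c: "int_size 0 \<le> b" "int_size 1 \<le> b" using assms(2) by auto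
 have b: "1 \<le> b" using small_pos[OF e] .
 let ?m1 = "m(3 := (m 3)(m 7 0 := eval m e))"
 let ?m2 = "?m1(4 := (m 4)(m 7 0 := m 7 0))"
 let ?m3 = "?m2(5 := (m 5)(m 7 0 := m 7 0))"
 let ?m4 = "?m3(6 := (m 6)(int d := m 7 0))"
 let ?m5 = "?m4(7 := (m 7)(0 := m 7 0 + 1))"
 have 1: "runs (Write 3 hp e) m ((len hp + len e + 3) * b) ?m1"
  using runs_Write[of m b hp e 3] e h c by simp
 have 2: "runs (Write 4 hp hp) ?m1 ((len hp + len hp + 3) * b) ?m2"
  using runs_Write[of ?m1 b hp hp 4] h c by simp
 have 3: "runs (Write 5 hp hp) ?m2 ((len hp + len hp + 3) * b) ?m3"
  using runs_Write[of ?m2 b hp hp 5] h c by (simp add: fun_upd_twist)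
 have 4: "runs (setreg d hp) ?m3 ((len (Const (int d)) + len hp + 3) * b) ?m4"
  using runs_Write[of ?m3 b "Const (int d)" hp 6] h c d by simp
 have 5: "runs (Write 7 (Const 0) (Plus hp (Const 1))) ?m4
   ((len (Const 0) + len (Plus hp (Const 1)) + 3) * b) ?m5"
  using runs_Write[of ?m4 b "Const 0" "Plus hp (Const 1)" 7] h c by simp
 have "runs (alloc_int d e) m ((50 + len e) * b) ?m5"
  unfolding alloc_int_def
  by (rule runs_mono[OF runs_Seq[OF 1 runs_Seq[OF 2 runs_Seq[OF 3 runs_Seq[OF 4 5]]]]])
    (use b in \<open>simp add: algebra_simps\<close>)
 moreover have "rep ?m5 (VInt (eval m e)) (?m5 6 (int d))" using hp by auto
 moreover have "extends d m ?m5" by (rule extends_alloc) (use hp in auto)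
 ultimately show ?thesis using that[of ?m5] by auto
qed

lemma alloc_pair:
 assumes x: "rep m x (m 6 (int p))" and y: "rep m y (m 6 (int q))"
  and "\<And>k. 0 \<le> k ==> k \<le> 7 ==> int_size k \<le> b"
  and r: "int_size (int d) \<le> b" "int_size (int p) \<le> b" "int_size (int q) \<le> b"
  and hp: "m 7 0 + 2 \<le> int b"
 obtains m' where "runs (alloc_pair d p q) m (60 * b) m'"
  "rep m' (VPair x y) (m' 6 (int d))" "extends d m m'" "m' 7 0 = m 7 0 + 1"
  "\<And>r. r \<noteq> d ==> m' 6 (int r) = m 6 (int r)"
proof -
 have px: "0 \<le> m 6 (int p)" "m 6 (int p) < m 7 0" and py: "0 \<le> m 6 (int q)" "m 6 (int q) < m 7 0"
  using rep_bounds[OF x] rep_bounds[OF y] by auto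
 have h: "int_size (m 7 0) \<le> b" "int_size (m 7 0 + 1) \<le> b" "int_size (m 6 (int p)) \<le> b"
   "int_size (m 6 (int q)) \<le> b"
  using hp px py int_size_pointer[of "m 7 0" "b - 1"] int_size_pointer[of "m 7 0 + 1" "b - 1"]
   int_size_pointer[of "m 6 (int p)" "b - 1"] int_size_pointer[of "m 6 (int q)" "b - 1"]
  by (auto simp: of_nat_diff)
 have c: "int_size 0 \<le> b" "int_size 1 \<le> b" using assms(3) by auto
 have b: "1 \<le> b" using c int_size_pos[of 0] by linarith
 let ?m1 = "m(3 := (m 3)(m 7 0 := 1))"
 let ?m2 = "?m1(4 := (m 4)(m 7 0 := m 6 (int p)))"
 let ?m3 = "?m2(5 := (m 5)(m 7 0 := m 6 (int q)))"
 let ?m4 = "?m3(6 := (m 6)(int d := m 7 0))"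
 let ?m5 = "?m4(7 := (m 7)(0 := m 7 0 + 1))"
 have 1: "runs (Write 3 hp (Const 1)) m ((len hp + len (Const 1) + 3) * b) ?m1"
  using runs_Write[of m b hp "Const 1" 3] h c by simp
 have 2: "runs (Write 4 hp (reg p)) ?m1 ((len hp + len (reg p) + 3) * b) ?m2"
  using runs_Write[of ?m1 b hp "reg p" 4] h c r by simp
 have 3: "runs (Write 5 hp (reg q)) ?m2 ((len hp + len (reg q) + 3) * b) ?m3"
  using runs_Write[of ?m2 b hp "reg q" 5] h c r by (simp add: fun_upd_twist)
 have 4: "runs (setreg d hp) ?m3 ((len (Const (int d)) + len hp + 3) * b) ?m4"
  using runs_Write[of ?m3 b "Const (int d)" hp 6] h c r by simp
 have 5: "runs (Write 7 (Const 0) (Plus hp (Const 1))) ?m4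
   ((len (Const 0) + len (Plus hp (Const 1)) + 3) * b) ?m5"
  using runs_Write[of ?m4 b "Const 0" "Plus hp (Const 1)" 7] h c by simp
 have "runs (alloc_pair d p q) m (60 * b) ?m5"
  unfolding alloc_pair_def
  by (rule runs_mono[OF runs_Seq[OF 1 runs_Seq[OF 2 runs_Seq[OF 3 runs_Seq[OF 4 5]]]]])
    (use b in \<open>simp add: algebra_simps\<close>)
 moreover have e: "extends d m ?m5" by (rule extends_alloc) (use px in auto)
 moreover have "rep ?m5 (VPair x y) (?m5 6 (int d))"
  using rep_mono[OF e x] rep_mono[OF e y] px py by auto
 ultimately show ?thesis using that[of ?m5] by auto
qed

section \<open>Correctness and running time of compiled programs\<close>

text \<open>\<open>B\<close> bounds every address that can occur, since the heap grows by at most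
  the cost. It stays fixed while costs add up, so a time bound of the form
  \<open>K * (cost * B)\<close> is closed under sequencing.\<close>

definition compiles :: "prg => nat => nat => bool" where
 "compiles f d K \<longleftrightarrow> (\<forall>m v B. rep m v (m 6 (int d)) \<and> m 7 0 + int (cost f v) \<le> int B -->
   (\<exists>m'. runs (compile f d) m (K * (cost f v * B)) m' \<and> rep m' (sem f v) (m' 6 (int d)) \<and>
    extends d m m' \<and> m' 7 0 \<le> m 7 0 + int (cost f v)))"

text \<open>A common bound on the sizes of all numbers occurring in a single instruction.\<close>

lemma word_bounds:
 fixes d :: nat
 assumes "rep m v i" "vsize v \<le> c" "m 7 0 + int c \<le> int B"
 defines "w \<equiv> (d + 10) * (c * B)"
 shows "\<And>k. 0 \<le> k ==> k \<le> 7 ==> int_size k \<le> w" "\<And>r. r \<le> d + 2 ==> int_size (int r) \<le> w"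
  "\<And>p. 0 \<le> p ==> p \<le> m 7 0 + int c ==> int_size p \<le> w"
  "\<And>a. int_size a \<le> c + 1 ==> int_size a \<le> w" "m 7 0 + int c + 2 \<le> int w"
  "int_size (1 + int d) \<le> w" "int_size (2 + int d) \<le> w" "1 \<le> B" "1 \<le> c"
proof -
 have i: "0 \<le> i" "i < m 7 0" using rep_bounds[OF assms(1)] by auto
 have c: "1 \<le> c" using assms(2) vsize_pos[of v] by linarith
 have B: "1 \<le> B" using i assms(3) by linarith
 show "1 \<le> c" "1 \<le> B" using c B by auto
 have w: "(d + 10) + B + c \<le> w + 2"
 proof -
  have "d + 10 + B + c \<le> (d + 10) * (c * B) + 2"
  proof -
   obtain c' B' where [simp]: "c = Suc c'" "B = Suc B'" using c B by (metis not0_implies_Suc not_one_le_zero)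
   show ?thesis by (simp add: algebra_simps)
  qed
  thus ?thesis by (simp add: w_def)
 qed
 have w2: "B * 10 \<le> w" "c * 10 \<le> w" "(d + 10) \<le> w"
 proof -
  obtain c' B' where [simp]: "c = Suc c'" "B = Suc B'" using c B by (metis not0_implies_Suc not_one_le_zero)
  show "B * 10 \<le> w" "c * 10 \<le> w" "(d + 10) \<le> w" by (simp_all add: w_def algebra_simps)
 qed
 show "int_size k \<le> w" if "k \<le> 7" "0 \<le> k" for k
  using int_size_pointer[of k 7] that w2 by simp
 show r: "int_size (int r) \<le> w" if "r \<le> d + 2" for r
  using int_size_pointer[of "int r" "d + 2"] that w2 by simp
 show "int_size (1 + int d) \<le> w" "int_size (2 + int d) \<le> w"
  using r[of "d + 1"] r[of "d + 2"] by simp_all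
 show "int_size p \<le> w" if "0 \<le> p" "p \<le> m 7 0 + int c" for p
  using int_size_pointer[of p B] that assms(3) w2 B by simp
 show "int_size a \<le> w" if "int_size a \<le> c + 1" for a using that w2 c by simp
 show "m 7 0 + int c + 2 \<le> int w" using assms(3) w2 B by simp
qed

lemma runs_setreg_reg:
 assumes "int_size (int d) \<le> w" "int_size (int r) \<le> w" "int_size (m 6 (int r)) \<le> w"
 shows "runs (setreg d (reg r)) m (7 * w) (m(6 := (m 6)(int d := m 6 (int r))))"
 using runs_Write[of m w "Const (int d)" "reg r" 6] assms by simp

lemma runs_setreg_Read:
 assumes "int_size (int d) \<le> w" "int_size (int r) \<le> w" "int_size (m 6 (int r)) \<le> w"
  "int_size (m a (m 6 (int r))) \<le> w"
 shows "runs (setreg d (Read a (reg r))) m (9 * w) (m(6 := (m 6)(int d := m a (m 6 (int r)))))"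
 using runs_Write[of m w "Const (int d)" "Read a (reg r)" 6] assms by simp

lemma compilesI:
 assumes "\<And>m v B. rep m v (m 6 (int d)) ==> m 7 0 + int (cost f v) \<le> int B ==>
   \<exists>m'. runs (compile f d) m (K * (cost f v * B)) m' \<and> rep m' (sem f v) (m' 6 (int d)) \<and>
    extends d m m' \<and> m' 7 0 \<le> m 7 0 + int (cost f v)"
 shows "compiles f d K"
 using assms by (auto simp: compiles_def)

lemma compilesE:
 assumes "compiles f d K" "rep m v (m 6 (int d))" "m 7 0 + int (cost f v) \<le> int B"
 obtains m' where "runs (compile f d) m (K * (cost f v * B)) m'" "rep m' (sem f v) (m' 6 (int d))"
  "extends d m m'" "m' 7 0 \<le> m 7 0 + int (cost f v)"
 using assms unfolding compiles_def by meson

lemma compiles_Id: "compiles KId d 1"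
proof (rule compilesI, goal_cases)
 case a: (1 m v B)
 have "1 \<le> cost KId v * B"
  using word_bounds(8,9)[OF a(1) _ a(2)] by simp
 thus ?case
  using runs_Skip[of _ m] a by (intro exI[of _ m]) (auto intro: extends_refl)
qed

lemma compiles_Read:
 assumes f: "compile f d = setreg d (Read a (reg d))" "\<And>v. cost f v = vsize v"
  and r: "\<And>m v i. rep m v i ==> rep m (sem f v) (m a i)"
 shows "compiles f d (9 * (d + 10))"
proof (rule compilesI, goal_cases)
 case a: (1 m v B)
 note w = word_bounds(1-7)[OF a(1) _ a(2), where d=d, unfolded f(2), OF le_refl]
 note l = r[OF a(1)]
 have "runs (compile f d) m (9 * ((d + 10) * (cost f v * B))) (m(6 := (m 6)(int d := m a (m 6 (int d)))))"
  unfolding f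
  by (rule runs_setreg_Read) (use w(2,3) rep_bounds[OF a(1)] rep_bounds[OF l] in auto)
 thus ?case
  using l by (intro exI[of _ "m(6 := (m 6)(int d := m a (m 6 (int d))))"])
    (simp add: rep_setreg mult.assoc extends_setreg del: mult_Suc distrib_left_numeral)
qed

lemma compiles_Left: "compiles KLeft d (9 * (d + 10))"
 by (rule compiles_Read) (simp_all, erule rep_left)

lemma compiles_Right: "compiles KRight d (9 * (d + 10))"
 by (rule compiles_Read) (simp_all, erule rep_right)

lemma compiles_alloc_int:
 assumes f: "compile f d = alloc_int d e"
  and s: "\<And>v. vsize v \<le> cost f v"
  and e: "\<And>m v. rep m v (m 6 (int d)) ==> sem f v = VInt (eval m e)"
  and sm: "\<And>m v w. rep m v (m 6 (int d)) ==> int_size (int d) \<le> w ==>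
    \<forall>p. 0 \<le> p \<and> p < m 7 0 --> int_size p \<le> w ==>
    \<forall>a. int_size a \<le> cost f v + 1 --> int_size a \<le> w ==> small m w e"
 shows "compiles f d ((50 + len e) * (d + 10))"
proof (rule compilesI, goal_cases)
 case a: (1 m v B)
 define w where "w = (d + 10) * (cost f v * B)"
 note wb = word_bounds(1-7)[OF a(1) s a(2), where d=d, folded w_def]
 obtain m' where m': "runs (alloc_int d e) m ((50 + len e) * w) m'"
  "rep m' (VInt (eval m e)) (m' 6 (int d))" "extends d m m'" "m' 7 0 = m 7 0 + 1"
 proof (rule alloc_int[of m w e d])
  show "small m w e"
   by (rule sm[OF a(1)]) (use wb(2,3,4) in auto)
  show "0 \<le> m 7 0" using rep_bounds[OF a(1)] by simp
  show "m 7 0 + 2 \<le> int w" using wb(5) by simp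
 qed (use wb(1,2) in auto)
 thus ?case
  using e[OF a(1)] cost_pos[of f v] by (intro exI[of _ m']) (simp add: f w_def mult.assoc)
qed

lemma compiles_Const: "\<exists>K. compiles (KConst a) d K"
proof (rule exI, rule compiles_alloc_int)
 show "compile (KConst a) d = alloc_int d (Const a)" by simp
qed auto

lemma int_size_left: "int_size (num (left v)) \<le> vsize v + 1"
 using int_size_num[of "left v"] vsize_left[of v] by simp

lemma int_size_right: "int_size (num (right v)) \<le> vsize v + 1"
 using int_size_num[of "right v"] vsize_right[of v] by simp

lemma rep_arith:
 assumes "rep m v (m 6 (int d))"
 shows "m 3 (m 4 (m 6 (int d))) = num (left v)" "m 3 (m 5 (m 6 (int d))) = num (right v)"
  "0 \<le> m 6 (int d) \<and> m 6 (int d) < m 7 0" "0 \<le> m 4 (m 6 (int d)) \<and> m 4 (m 6 (int d)) < m 7 0"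
  "0 \<le> m 5 (m 6 (int d)) \<and> m 5 (m 6 (int d)) < m 7 0"
 using rep_num[OF rep_left[OF assms]] rep_num[OF rep_right[OF assms]] rep_bounds[OF assms]
  rep_bounds[OF rep_left[OF assms]] rep_bounds[OF rep_right[OF assms]] by auto

lemma compiles_arith:
 "\<exists>K. compiles KAdd d K" "\<exists>K. compiles KSub d K" "\<exists>K. compiles KMul d K" "\<exists>K. compiles KDiv d K"
 by (rule exI, rule compiles_alloc_int, simp, simp, simp add: rep_arith,
   simp add: rep_arith int_size_left int_size_right trans_le_add1 trans_le_add2 le_SucI;
   insert int_size_left int_size_right, smt (verit, best) add_Suc_right le_add1 le_trans nat_add_left_cancel_le plus_1_eq_Suc)+

lemma vsize_le_cost: "vsize v \<le> cost f v"
 by (induction f arbitrary: v) (auto intro: trans_le_add1 trans_le_add2 le_SucI)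

lemma compiles_Pair:
 assumes f: "compiles f (d + 1) Kf" and g: "compiles g (d + 2) Kg"
 shows "compiles (KPair f g) d (Kf + Kg + 100 * (d + 10))"
proof (rule compilesI, goal_cases)
 case a: (1 m v B)
 define c where "c = cost (KPair f g) v"
 have c: "c = 1 + cost f v + cost g v" by (simp add: c_def)
 define w where "w = (d + 10) * (c * B)"
 note wb = word_bounds(1-7)[OF a(1) vsize_le_cost a(2), where d=d, folded c_def, folded w_def]
 have w1: "1 \<le> w" using wb(1)[of 0] int_size_pos[of 0] by simp
 have i: "0 \<le> m 6 (int d)" "m 6 (int d) < m 7 0" using rep_bounds[OF a(1)] by auto
 define m1 where "m1 = m(6 := (m 6)(int (d + 1) := m 6 (int d)))"
 have r1: "runs (setreg (d + 1) (reg d)) m (7 * w) m1"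
  unfolding m1_def by (rule runs_setreg_reg) (use wb(2,3,6,7) i in auto)
 have e1: "extends (d + 1) m m1" unfolding m1_def by (rule extends_setreg) simp
 have v1: "rep m1 v (m1 6 (int (d + 1)))" "m1 7 0 = m 7 0"
  using a(1) by (auto simp: m1_def rep_setreg)
 obtain m2 where r2: "runs (compile f (d + 1)) m1 (Kf * (cost f v * B)) m2"
  and v2: "rep m2 (sem f v) (m2 6 (int (d + 1)))" and e2: "extends (d + 1) m1 m2"
  and h2: "m2 7 0 \<le> m1 7 0 + int (cost f v)"
  by (rule compilesE[OF f v1(1)]) (use a v1 in auto)
 have e02: "extends (d + 1) m m2" using e1 e2 by (rule extends_trans)
 have v2': "rep m2 v (m2 6 (int d))"
  using rep_mono[OF e02 a(1)] extends_reg[OF e02, of d] by simp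
 define m3 where "m3 = m2(6 := (m2 6)(int (d + 2) := m2 6 (int d)))"
 have r3: "runs (setreg (d + 2) (reg d)) m2 (7 * w) m3"
  unfolding m3_def
  by (rule runs_setreg_reg) (use wb(2,3,6,7) i extends_reg[OF e02, of d] in auto)
 have e3: "extends (d + 2) m2 m3" unfolding m3_def by (rule extends_setreg) simp
 have v3: "rep m3 v (m3 6 (int (d + 2)))" "m3 7 0 = m2 7 0" "rep m3 (sem f v) (m3 6 (int (d + 1)))"
  using v2 v2' by (auto simp: m3_def rep_setreg)
 obtain m4 where r4: "runs (compile g (d + 2)) m3 (Kg * (cost g v * B)) m4"
  and v4: "rep m4 (sem g v) (m4 6 (int (d + 2)))" and e4: "extends (d + 2) m3 m4"
  and h4: "m4 7 0 \<le> m3 7 0 + int (cost g v)"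
  by (rule compilesE[OF g v3(1)]) (use a v1 v3 h2 in auto)
 have v4': "rep m4 (sem f v) (m4 6 (int (d + 1)))"
  using rep_mono[OF e4 v3(3)] extends_reg[OF e4, of "d + 1"] by simp
 have h5: "m4 7 0 + 1 \<le> m 7 0 + int c" using h4 h2 v1 v3 c by simp
 obtain m5 where r5: "runs (alloc_pair d (d + 1) (d + 2)) m4 (60 * w) m5"
  and v5: "rep m5 (VPair (sem f v) (sem g v)) (m5 6 (int d))" and e5: "extends d m4 m5"
  and h5': "m5 7 0 = m4 7 0 + 1"
  by (rule alloc_pair[OF v4' v4, of w d]) (use wb h5 in auto)
 have "extends d m m5"
  using extends_trans[OF extends_mono[OF e02] extends_trans[OF extends_mono[OF e3]
   extends_trans[OF extends_mono[OF e4] e5]]] by simp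
 moreover have "runs (compile (KPair f g) d) m ((Kf + Kg + 100 * (d + 10)) * (c * B)) m5"
  unfolding compile.simps
 proof (rule runs_mono[OF runs_Seq[OF r1 runs_Seq[OF r2 runs_Seq[OF r3 runs_Seq[OF r4 r5]]]]])
  have "Kf * (cost f v * B) \<le> Kf * (c * B)" "Kg * (cost g v * B) \<le> Kg * (c * B)"
   by (rule mult_le_mono2, rule mult_le_mono1, simp add: c)+
  moreover have "(Kf + Kg + 100 * (d + 10)) * (c * B) = Kf * (c * B) + Kg * (c * B) + 100 * w"
   unfolding w_def by (simp only: add_mult_distrib mult.assoc)
  ultimately show "1 + 7 * w + (1 + Kf * (cost f v * B) + (1 + 7 * w + (1 + Kg * (cost g v * B) + 60 * w)))
    \<le> (Kf + Kg + 100 * (d + 10)) * (c * B)"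
   using w1 by linarith
 qed
 ultimately show ?case
  using v5 h5 h5' by (intro exI[of _ m5]) (simp add: c_def)
qed

lemma compiles_Comp:
 assumes f: "compiles f d Kf" and g: "compiles g d Kg"
 shows "compiles (KComp f g) d (Kf + Kg + 1)"
proof (rule compilesI, goal_cases)
 case a: (1 m v B)
 obtain m1 where 1: "runs (compile g d) m (Kg * (cost g v * B)) m1"
  "rep m1 (sem g v) (m1 6 (int d))" "extends d m m1" "m1 7 0 \<le> m 7 0 + int (cost g v)"
  by (rule compilesE[OF g a(1)]) (use a in auto)
 obtain m2 where 2: "runs (compile f d) m1 (Kf * (cost f (sem g v) * B)) m2"
  "rep m2 (sem f (sem g v)) (m2 6 (int d))" "extends d m1 m2" "m2 7 0 \<le> m1 7 0 + int (cost f (sem g v))"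
  by (rule compilesE[OF f 1(2)]) (use a 1 in auto)
 have B: "1 \<le> B" using rep_bounds[OF a(1)] a(2) by linarith
 have "1 \<le> cost (KComp f g) v * B" using B cost_pos[of "KComp f g" v]
  by (simp only: One_nat_def Suc_le_eq nat_0_less_mult_iff)
 moreover have "Kf * (cost f (sem g v) * B) \<le> Kf * (cost (KComp f g) v * B)"
  "Kg * (cost g v * B) \<le> Kg * (cost (KComp f g) v * B)" by auto
 ultimately have "1 + Kg * (cost g v * B) + Kf * (cost f (sem g v) * B)
   \<le> (Kf + Kg + 1) * (cost (KComp f g) v * B)" unfolding add_mult_distrib by linarith
 hence "runs (compile (KComp f g) d) m ((Kf + Kg + 1) * (cost (KComp f g) v * B)) m2"
  using runs_mono[OF runs_Seq[OF 1(1) 2(1)]] by simp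
 thus ?case
  using 1 2 extends_trans[OF 1(3) 2(3)] by (intro exI[of _ m2]) simp
qed

lemma compiles_mono: "compiles f d K ==> K \<le> K' ==> compiles f d K'"
 unfolding compiles_def by (meson mult_le_mono1 runs_mono)

lemma compiles_If:
 assumes c: "compiles c (d + 1) K" and f: "compiles f d K" and g: "compiles g d K"
 shows "compiles (KIf c f g) d (2 * K + 100 * (d + 10))"
proof (rule compilesI, goal_cases)
 case a: (1 m v B)
 define b where "b = cost (KIf c f g) v"
 define h where "h = (if num (sem c v) > 0 then f else g)"
 have b: "b = cost c v + cost h v" by (simp add: b_def h_def)
 define w where "w = (d + 10) * (b * B)"
 note wb = word_bounds(1-7)[OF a(1) vsize_le_cost a(2), where d=d, folded b_def, folded w_def]
 have w1: "1 \<le> w" using wb(1)[of 0] int_size_pos[of 0] by simp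
 have i: "0 \<le> m 6 (int d)" "m 6 (int d) < m 7 0" using rep_bounds[OF a(1)] by auto
 define m1 where "m1 = m(6 := (m 6)(int (d + 1) := m 6 (int d)))"
 have r1: "runs (setreg (d + 1) (reg d)) m (7 * w) m1"
  unfolding m1_def by (rule runs_setreg_reg) (use wb(2,3,6,7) i in auto)
 have e1: "extends (d + 1) m m1" unfolding m1_def by (rule extends_setreg) simp
 have v1: "rep m1 v (m1 6 (int (d + 1)))" "m1 7 0 = m 7 0"
  using a(1) by (auto simp: m1_def rep_setreg)
 obtain m2 where r2: "runs (compile c (d + 1)) m1 (K * (cost c v * B)) m2"
  and v2: "rep m2 (sem c v) (m2 6 (int (d + 1)))" and e2: "extends (d + 1) m1 m2"
  and h2: "m2 7 0 \<le> m1 7 0 + int (cost c v)"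
  by (rule compilesE[OF c v1(1)]) (use a b v1 in \<open>auto simp: b_def\<close>)
 have e02: "extends (d + 1) m m2" using e1 e2 by (rule extends_trans)
 have v2': "rep m2 v (m2 6 (int d))"
  using rep_mono[OF e02 a(1)] extends_reg[OF e02, of d] by simp
 have h: "compiles h d K" using f g by (simp add: h_def)
 obtain m3 where r3: "runs (compile h d) m2 (K * (cost h v * B)) m3"
  and v3: "rep m3 (sem h v) (m3 6 (int d))" and e3: "extends d m2 m3"
  and h3: "m3 7 0 \<le> m2 7 0 + int (cost h v)"
  by (rule compilesE[OF h v2']) (use a b v1 h2 in \<open>auto simp: b_def\<close>)
 let ?e = "Read 3 (reg (d + 1))"
 have ev: "eval m2 ?e = num (sem c v)" using rep_num[OF v2] by simp
 have p: "0 \<le> m2 6 (int (d + 1))" "m2 6 (int (d + 1)) < m2 7 0" using rep_bounds[OF v2] by auto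
 have "small m2 w ?e"
 proof -
  have "int_size (num (sem c v)) \<le> b + 1"
   using int_size_num[of "sem c v"] vsize_sem_le[of c v] b by simp
  thus ?thesis using wb(2,3,4,6) p h2 v1 b ev by simp
 qed
 hence "eval_cost m2 ?e \<le> 5 * w" using eval_cost_small by fastforce
 moreover have r4: "runs (Cond ?e (compile f d) (compile g d)) m2
   (1 + eval_cost m2 ?e + K * (cost h v * B)) m3"
  by (rule runs_Cond) (use r3 ev in \<open>auto simp: h_def\<close>)
 moreover have "K * (cost h v * B) \<le> K * (b * B)" "K * (cost c v * B) \<le> K * (b * B)"
  using b by (auto intro!: mult_le_mono)
 moreover have "(2 * K + 100 * (d + 10)) * (b * B) = K * (b * B) + K * (b * B) + 100 * w"
  unfolding w_def by (simp only: add_mult_distrib mult.assoc mult_2)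
 ultimately have "runs (compile (KIf c f g) d) m ((2 * K + 100 * (d + 10)) * (b * B)) m3"
  unfolding compile.simps
  by (intro runs_mono[OF runs_Seq[OF r1 runs_Seq[OF r2 r4]]])
   (use w1 in linarith)
 moreover have "extends d m m3" using extends_trans[OF extends_mono[OF e02] e3] by simp
 ultimately show ?case
  using v3 h3 h2 v1(2) by (intro exI[of _ m3]) (auto simp: b_def h_def split: if_splits)
qed

lemma pointer_bounds:
 fixes d :: nat
 assumes "1 \<le> B"
 defines "w \<equiv> (d + 10) * B"
 shows "\<And>p. 0 \<le> p ==> p \<le> int B ==> int_size p \<le> w" "int_size (int d) \<le> w"
  "int_size (1 + int d) \<le> w" "int_size (2 + int d) \<le> w"
proof -
 have w: "B * 10 \<le> w" "d + 10 \<le> w"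
 proof -
  obtain B' where [simp]: "B = Suc B'" using assms by (metis not0_implies_Suc not_one_le_zero)
  show "B * 10 \<le> w" "d + 10 \<le> w" by (simp_all add: w_def algebra_simps)
 qed
 show "int_size p \<le> w" if "0 \<le> p" "p \<le> int B" for p
  using int_size_pointer[of p B] that w(1) assms(1) by linarith
 show "int_size (int d) \<le> w" "int_size (1 + int d) \<le> w" "int_size (2 + int d) \<le> w"
  using int_size_pointer[of "int d" "d"] int_size_pointer[of "1 + int d" "d + 1"]
   int_size_pointer[of "2 + int d" "d + 2"] w by simp_all
qed

definition iter_cost :: "prg => nat => val => nat" where
 "iter_cost f n y = (\<Sum>i<n. 1 + cost f ((sem f ^^ i) y))"

lemma iter_cost_0: "iter_cost f 0 y = 0"
 by (simp add: iter_cost_def)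

lemma iter_cost_Suc: "iter_cost f (Suc n) y = 1 + cost f y + iter_cost f n (sem f y)"
 unfolding iter_cost_def by (simp add: sum.lessThan_Suc_shift funpow_swap1 del: sum.lessThan_Suc)

lemma cost_Iter: "cost (KIter f) v = vsize v + iter_cost f (spine (left v)) (right v)"
 by (simp add: iter_cost_def)

text \<open>Induction on the counter tree itself: the counter register moves to the right component
  in each pass, and the loop stops at an integer node, whose right component is the node
  itself.\<close>

lemma compile_Iter_loop:
 assumes f: "compiles f (d + 2) K" and w: "w = (d + 10) * B"
 defines "loop \<equiv> While (Minus (reg (d + 1)) (Read 5 (reg (d + 1))))
      (Seq (compile f (d + 2)) (setreg (d + 1) (Read 5 (reg (d + 1)))))"
 shows "rep m u (m 6 (1 + int d)) ==> rep m y (m 6 (2 + int d)) ==>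
  m 7 0 + int (iter_cost f (spine u) y) \<le> int B ==>
  \<exists>m'. runs loop m (K * (iter_cost f (spine u) y * B) + (spine u + 1) * (30 * w)) m' \<and>
   rep m' ((sem f ^^ spine u) y) (m' 6 (2 + int d)) \<and> extends (d + 1) m m' \<and>
   m' 7 0 \<le> m 7 0 + int (iter_cost f (spine u) y)"
proof (induction u arbitrary: m y)
 case (VInt a)
 have p: "0 \<le> m 6 (1 + int d)" "m 6 (1 + int d) < m 7 0" using VInt(1) by auto
 have B: "1 \<le> B" using p VInt(3) by simp
 note pb = pointer_bounds[OF B, where d=d, folded w]
 let ?e = "Minus (reg (d + 1)) (Read 5 (reg (d + 1)))"
 have "small m w ?e" using pb p VInt by auto
 hence "eval_cost m ?e \<le> 10 * w" using eval_cost_small by fastforce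
 moreover have "1 \<le> w" using B w by simp
 ultimately have "1 + eval_cost m ?e \<le> 30 * w" by linarith
 moreover have "\<not> eval m ?e > 0" using VInt(1) by simp
 ultimately have "runs loop m (30 * w) m" unfolding loop_def
  by (intro runs_mono[OF runs_While_False]) auto
 thus ?case using VInt by (intro exI[of _ m]) (auto intro: extends_refl simp: iter_cost_0)
next
 case (VPair x u)
 let ?S = "iter_cost f (spine u)"
 have S: "iter_cost f (spine (VPair x u)) y = 1 + cost f y + ?S (sem f y)"
  by (simp add: iter_cost_Suc)
 have p: "0 \<le> m 6 (1 + int d)" "m 6 (1 + int d) < m 7 0" "m 5 (m 6 (1 + int d)) < m 6 (1 + int d)"
   and u: "rep m u (m 5 (m 6 (1 + int d)))"
  using VPair.prems(1) by auto
 have q: "0 \<le> m 5 (m 6 (1 + int d))" using rep_bounds[OF u] by simp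
 have hB: "m 7 0 + 1 + int (cost f y) + int (?S (sem f y)) \<le> int B"
  using VPair.prems(3) unfolding S by simp
 have B: "1 \<le> B" using p hB by linarith
 note pb = pointer_bounds[OF B, where d=d, folded w]
 let ?e = "Minus (reg (d + 1)) (Read 5 (reg (d + 1)))"
 have "small m w ?e" using pb p q hB by auto
 hence ce: "eval_cost m ?e \<le> 10 * w" using eval_cost_small by fastforce
 have w1: "1 \<le> w" using B w by simp
 have ev: "eval m ?e > 0" using p by simp
 obtain m1 where r1: "runs (compile f (d + 2)) m (K * (cost f y * B)) m1"
  and y1: "rep m1 (sem f y) (m1 6 (int (d + 2)))" and e1: "extends (d + 2) m m1"
  and h1: "m1 7 0 \<le> m 7 0 + int (cost f y)"
  by (rule compilesE[OF f, of m y B]) (use VPair.prems(2) hB in auto)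
 have reg1: "m1 6 (1 + int d) = m 6 (1 + int d)" using extends_reg[OF e1, of "d + 1"] by simp
 have "m1 5 (m 6 (1 + int d)) = m 5 (m 6 (1 + int d))" using e1 p by (auto simp: extends_def)
 note eq = reg1 this
 define m2 where "m2 = m1(6 := (m1 6)(int (d + 1) := m1 5 (m1 6 (int (d + 1)))))"
 have r2: "runs (setreg (d + 1) (Read 5 (reg (d + 1)))) m1 (9 * w) m2"
  unfolding m2_def by (rule runs_setreg_Read) (use pb p q hB eq in auto)
 have e2: "extends (d + 1) m1 m2" unfolding m2_def by (rule extends_setreg) simp
 have u2: "rep m2 u (m2 6 (1 + int d))"
  using rep_mono[OF e1 u] by (simp add: m2_def eq rep_setreg)
 have y2: "rep m2 (sem f y) (m2 6 (2 + int d))" using y1 by (simp add: m2_def rep_setreg)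
 have h2: "m2 7 0 = m1 7 0" by (simp add: m2_def)
 obtain m3 where r3: "runs loop m2 (K * (?S (sem f y) * B) + (spine u + 1) * (30 * w)) m3"
  and y3: "rep m3 ((sem f ^^ spine u) (sem f y)) (m3 6 (2 + int d))" and e3: "extends (d + 1) m2 m3"
  and h3: "m3 7 0 \<le> m2 7 0 + int (?S (sem f y))"
  using VPair.IH(2)[OF u2 y2] hB h1 h2 by auto
 have "runs loop m (K * (iter_cost f (spine (VPair x u)) y * B) + (spine (VPair x u) + 1) * (30 * w)) m3"
  unfolding S loop_def
  by (rule runs_mono[OF runs_While_True[OF ev runs_Seq[OF r1 r2] r3[unfolded loop_def]]])
   (use ce w1 in \<open>simp add: add_mult_distrib add_mult_distrib2\<close>)
 moreover have "extends (d + 1) m m3"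
  using extends_trans[OF extends_mono[OF e1] extends_trans[OF e2 e3]] by simp
 moreover have "(sem f ^^ spine (VPair x u)) y = (sem f ^^ spine u) (sem f y)" by (simp add: funpow_swap1)
 ultimately show ?case using y3 h1 h2 h3 S by (intro exI[of _ m3]) (simp only:, simp)
qed

lemma compiles_Iter:
 assumes f: "compiles f (d + 2) K"
 shows "compiles (KIter f) d (K + 100 * (d + 10))"
proof (rule compilesI, goal_cases)
 case a: (1 m v B)
 define c where "c = cost (KIter f) v"
 define n where "n = spine (left v)"
 define S where "S = iter_cost f n (right v)"
 have c: "c = vsize v + S" by (simp add: c_def S_def n_def cost_Iter del: cost.simps)
 have nc: "n + 1 \<le> 2 * c"
  using spine_le_vsize[of "left v"] vsize_left[of v] vsize_pos[of v] c by (simp add: n_def)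
 define w where "w = (d + 10) * B"
 have i: "0 \<le> m 6 (int d)" "m 6 (int d) < m 7 0" using rep_bounds[OF a(1)] by auto
 have B: "1 \<le> B" using i a(2) by linarith
 have hB0: "m 7 0 \<le> int B" using a(2) by linarith
 note pb = pointer_bounds[OF B, where d=d, folded w_def]
 have w1: "1 \<le> w" using B w_def by simp
 note l = rep_left[OF a(1)] and r = rep_right[OF a(1)]
 have i2: "0 \<le> m 4 (m 6 (int d))" "m 4 (m 6 (int d)) < m 7 0"
   "0 \<le> m 5 (m 6 (int d))" "m 5 (m 6 (int d)) < m 7 0"
  using rep_bounds[OF l] rep_bounds[OF r] by auto
 define m1 where "m1 = m(6 := (m 6)(int (d + 1) := m 4 (m 6 (int d))))"
 have r1: "runs (setreg (d + 1) (Read 4 (reg d))) m (9 * w) m1"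
  unfolding m1_def by (rule runs_setreg_Read) (use pb i i2 hB0 in auto)
 define m2 where "m2 = m1(6 := (m1 6)(int (d + 2) := m1 5 (m1 6 (int d))))"
 have r2: "runs (setreg (d + 2) (Read 5 (reg d))) m1 (9 * w) m2"
  unfolding m2_def by (rule runs_setreg_Read) (use pb i i2 hB0 in \<open>auto simp: m1_def\<close>)
 have l2: "rep m2 (left v) (m2 6 (1 + int d))" and r2': "rep m2 (right v) (m2 6 (2 + int d))"
  using l r by (simp_all add: m1_def m2_def rep_setreg)
 have h2: "m2 7 0 = m 7 0" by (simp add: m1_def m2_def)
 have e2: "extends (d + 1) m m2"
  unfolding m2_def m1_def by (rule extends_trans[OF extends_setreg extends_setreg]) auto
 have hB: "m2 7 0 + int S \<le> int B" using a(2) c h2 unfolding c_def by linarith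
 obtain m3 where r3: "runs (While (Minus (reg (d + 1)) (Read 5 (reg (d + 1))))
      (Seq (compile f (d + 2)) (setreg (d + 1) (Read 5 (reg (d + 1)))))) m2
      (K * (S * B) + (n + 1) * (30 * w)) m3"
  and y3: "rep m3 ((sem f ^^ n) (right v)) (m3 6 (2 + int d))" and e3: "extends (d + 1) m2 m3"
  and h3: "m3 7 0 \<le> m2 7 0 + int S"
  using compile_Iter_loop[OF f w_def l2 r2'] hB unfolding S_def n_def by blast
 define m4 where "m4 = m3(6 := (m3 6)(int d := m3 6 (int (d + 2))))"
 have y3': "0 \<le> m3 6 (2 + int d)" "m3 6 (2 + int d) < m3 7 0" using rep_bounds[OF y3] by auto
 have r4: "runs (setreg d (reg (d + 2))) m3 (7 * w) m4"
  unfolding m4_def by (rule runs_setreg_reg) (use pb y3' h3 hB in auto)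
 have e4: "extends d m3 m4" unfolding m4_def by (rule extends_setreg) simp
 have "K * (S * B) \<le> K * (c * B)" by (rule mult_le_mono2, rule mult_le_mono1) (simp add: c)
 moreover have "(n + 1) * (30 * w) \<le> 2 * c * (30 * w)" by (rule mult_le_mono1[OF nc])
 moreover have "(K + 100 * (d + 10)) * (c * B) = K * (c * B) + 100 * (c * w)"
  by (simp add: w_def algebra_simps)
 moreover have "1 * w \<le> c * w" by (rule mult_le_mono1) (use c vsize_pos[of v] in simp)
 ultimately have "runs (compile (KIter f) d) m ((K + 100 * (d + 10)) * (c * B)) m4"
  unfolding compile.simps
  by (intro runs_mono[OF runs_Seq[OF r1 runs_Seq[OF r2 runs_Seq[OF r3 r4]]]]) (use w1 in linarith)
 moreover have "extends d m m4"
  using extends_trans[OF extends_mono[OF e2] extends_trans[OF extends_mono[OF e3] e4]] by simp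
 moreover have "rep m4 (sem (KIter f) v) (m4 6 (int d))"
  using y3 by (simp add: m4_def rep_setreg n_def)
 moreover have "m4 7 0 \<le> m 7 0 + int c" using h3 h2 c by (simp add: m4_def)
 ultimately show ?case
  unfolding c_def by blast
qed

lemma compile_Bits_loop:
 assumes k7: "\<And>k. 0 \<le> k ==> k \<le> 7 ==> int_size k \<le> w"
  and d: "int_size (int d) \<le> w" "int_size (1 + int d) \<le> w" "int_size (2 + int d) \<le> w"
  and M: "M + 2 \<le> int w"
 defines "loop \<equiv> While (reg (d + 1)) (Seq (setreg (d + 1) (Div (reg (d + 1)) (Const 2))) (alloc_pair d (d + 2) d))"
 shows "m 6 (1 + int d) = z ==> int_size z \<le> w ==> (\<And>z'. 0 \<le> z' ==> z' \<le> z ==> int_size z' \<le> w) ==>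
  rep m (VInt 0) (m 6 (2 + int d)) ==> rep m (unary j) (m 6 (int d)) ==>
  m 7 0 + int (floorlog 2 (nat z)) \<le> M ==>
  \<exists>m'. runs loop m ((floorlog 2 (nat z) + 1) * (100 * w)) m' \<and>
   rep m' (unary (j + floorlog 2 (nat z))) (m' 6 (int d)) \<and> extends d m m' \<and>
   m' 7 0 = m 7 0 + int (floorlog 2 (nat z))"
proof (induction "nat z" arbitrary: z m j rule: less_induct)
 case less
 have w1: "1 \<le> w" using k7[of 0] int_size_pos[of 0] by simp
 let ?e = "reg (d + 1)"
 have "small m w ?e" using d less.prems by simp
 hence ce: "eval_cost m ?e \<le> 3 * w" using eval_cost_small by fastforce
 have ev: "eval m ?e = z" using less.prems by simp
 show ?case
 proof (cases "z > 0")
  case False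
  hence "floorlog 2 (nat z) = 0" by (simp add: floorlog_def)
  moreover have "runs loop m (100 * w) m" unfolding loop_def
   by (rule runs_mono[OF runs_While_False]) (use ce w1 ev False in auto)
  ultimately show ?thesis using less.prems by (intro exI[of _ m]) (auto intro: extends_refl)
 next
  case True
  have fl: "floorlog 2 (nat z) = floorlog 2 (nat (z div 2)) + 1"
   using True compute_floorlog[of 2 "nat z"] by (simp add: nat_div_distrib)
  define m1 where "m1 = m(6 := (m 6)(int (d + 1) := z div 2))"
  have z2: "int_size (z div 2) \<le> w" using True less.prems(3)[of "z div 2"] by simp
  have "runs (setreg (d + 1) (Div (reg (d + 1)) (Const 2))) m ((len (Const (int (d + 1))) + len (Div (reg (d + 1)) (Const 2)) + 3) * w) m1"
   using runs_Write[of m w "Const (int (d + 1))" "Div (reg (d + 1)) (Const 2)" 6] d less.prems k7[of 2] z2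
   by (simp add: m1_def)
  hence r1: "runs (setreg (d + 1) (Div (reg (d + 1)) (Const 2))) m (10 * w) m1" by simp
  have e1: "extends (d + 1) m m1" unfolding m1_def by (rule extends_setreg) simp
  have x1: "rep m1 (VInt 0) (m1 6 (int (d + 2)))" and y1: "rep m1 (unary j) (m1 6 (int d))" and z1: "m1 6 (1 + int d) = z div 2"
   using less.prems by (auto simp: m1_def rep_setreg)
  obtain m2 where r2: "runs (alloc_pair d (d + 2) d) m1 (60 * w) m2"
   and y2: "rep m2 (VPair (VInt 0) (unary j)) (m2 6 (int d))" and e2: "extends d m1 m2" and h2: "m2 7 0 = m1 7 0 + 1"
   and g2: "\<And>r. r \<noteq> d ==> m2 6 (int r) = m1 6 (int r)"
   by (rule alloc_pair[OF x1 y1 k7, of d]) (use d M less.prems fl in \<open>auto simp: m1_def\<close>)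
  have y2': "rep m2 (unary (Suc j)) (m2 6 (int d))" using y2 by simp
  have z2': "m2 6 (1 + int d) = z div 2" using g2[of "d + 1"] z1 by simp
  have x2: "rep m2 (VInt 0) (m2 6 (2 + int d))" using rep_mono[OF e2 x1] g2[of "d + 2"] by simp
  have h2': "m2 7 0 = m 7 0 + 1" using h2 by (simp add: m1_def)
  obtain m3 where r3: "runs loop m2 ((floorlog 2 (nat (z div 2)) + 1) * (100 * w)) m3"
   and y3: "rep m3 (unary (Suc j + floorlog 2 (nat (z div 2)))) (m3 6 (int d))" and e3: "extends d m2 m3"
   and h3: "m3 7 0 = m2 7 0 + int (floorlog 2 (nat (z div 2)))"
  proof -
   have "\<And>z'. 0 \<le> z' ==> z' \<le> z div 2 ==> int_size z' \<le> w"
    using less.prems(3) True by simp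
   moreover have "nat (z div 2) < nat z" using True by simp
   moreover have "m2 7 0 + int (floorlog 2 (nat (z div 2))) \<le> M" using less.prems(6) h2' fl by simp
   ultimately show ?thesis using less.hyps[of "z div 2" m2 "Suc j", OF _ z2' z2 _ x2 y2'] that by blast
  qed
  have "runs loop m ((floorlog 2 (nat z) + 1) * (100 * w)) m3"
   unfolding loop_def fl
   by (rule runs_mono[OF runs_While_True[OF _ runs_Seq[OF r1 r2] r3[unfolded loop_def]]])
    (use ce w1 ev True in simp_all)
  thus ?thesis using y3 e1 e2 e3 h3 h2' fl extends_trans[OF extends_mono[OF e1] extends_trans[OF e2 e3]]
   by (intro exI[of _ m3]) simp
 qed
qed

lemma compiles_Bits: "compiles KBits d (1200 * (d + 10))"
proof (rule compilesI, goal_cases)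
 case a: (1 m v B)
 \<comment> \<open>Large enough for the heap nodes created here: the shared zero, the leaf of the
   unary number and one pair per bit.\<close>
 define c where "c = 4 * vsize v"
 define k where "k = floorlog 2 (nat (num v))"
 have s1: "1 \<le> vsize v" using vsize_pos[of v] by simp
 have kc: "k + 2 \<le> c" "k + 1 \<le> 2 * vsize v"
  using floorlog_num_le[of v] s1 by (simp_all add: c_def k_def)
 have cc: "c \<le> cost KBits v" using s1 by (simp add: c_def)
 have hB: "m 7 0 + int c \<le> int B" using a(2) cc by linarith
 define w where "w = (d + 10) * (c * B)"
 have vc: "vsize v \<le> c" by (simp add: c_def)
 note wb = word_bounds(1-7)[OF a(1) vc hB, where d=d, folded w_def]
 have w1: "1 \<le> w" using wb(1)[of 0] int_size_pos[of 0] by simp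
 have i: "0 \<le> m 6 (int d)" "m 6 (int d) < m 7 0" using rep_bounds[OF a(1)] by auto
 have nv: "int_size z \<le> w" if "0 \<le> z" "z \<le> num v" for z
 proof -
  have "int_size z \<le> int_size (num v)" unfolding int_size_def
   using that by (intro add_mono floorlog_mono) auto
  thus ?thesis using int_size_num[of v] vc by (intro wb(4)) linarith
 qed
 have nv': "int_size (num v) \<le> w" using int_size_num[of v] vc by (intro wb(4)) linarith
 define m1 where "m1 = m(6 := (m 6)(int (d + 1) := m 3 (m 6 (int d))))"
 have r1: "runs (setreg (d + 1) (Read 3 (reg d))) m (9 * w) m1"
  unfolding m1_def by (rule runs_setreg_Read) (use wb(2,3,6,7) i nv' rep_num[OF a(1)] in auto)
 have e1: "extends d m m1" unfolding m1_def by (rule extends_setreg) simp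
 obtain m2 where r2: "runs (alloc_int (d + 2) (Const 0)) m1 ((50 + len (Const 0)) * w) m2"
  and v2: "rep m2 (VInt (eval m1 (Const 0))) (m2 6 (int (d + 2)))" and e2: "extends (d + 2) m1 m2"
  and h2: "m2 7 0 = m1 7 0 + 1" and g2: "\<And>r. r \<noteq> d + 2 ==> m2 6 (int r) = m1 6 (int r)"
  by (rule alloc_int[of m1 w "Const 0" "d + 2"]) (use wb(1)[of 0] wb i in \<open>auto simp: m1_def\<close>)
 obtain m3 where r3: "runs (alloc_int d (Const 0)) m2 ((50 + len (Const 0)) * w) m3"
  and v3: "rep m3 (VInt (eval m2 (Const 0))) (m3 6 (int d))" and e3: "extends d m2 m3"
  and h3: "m3 7 0 = m2 7 0 + 1" and g3: "\<And>r. r \<noteq> d ==> m3 6 (int r) = m2 6 (int r)"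
  by (rule alloc_int[of m2 w "Const 0" d]) (use wb(1)[of 0] wb i h2 kc in \<open>auto simp: m1_def\<close>)
 have h: "m3 7 0 = m 7 0 + 2" using h2 h3 by (simp add: m1_def)
 have z3: "m3 6 (1 + int d) = num v"
  using g3[of "d + 1"] g2[of "d + 1"] rep_num[OF a(1)] by (simp add: m1_def)
 have x3: "rep m3 (VInt 0) (m3 6 (2 + int d))"
  using rep_mono[OF e3 v2] g3[of "d + 2"] by simp
 have u3: "rep m3 (unary 0) (m3 6 (int d))" using v3 by simp
 have M: "m 7 0 + int c + 2 \<le> int w" using wb(5) by simp
 have hM: "m3 7 0 + int (floorlog 2 (nat (num v))) \<le> m 7 0 + int c" using h kc by (simp add: k_def)
 obtain m4 where r4: "runs (While (reg (d + 1)) (Seq (setreg (d + 1) (Div (reg (d + 1)) (Const 2))) (alloc_pair d (d + 2) d))) m3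
    ((k + 1) * (100 * w)) m4"
  and u4: "rep m4 (unary (0 + k)) (m4 6 (int d))" and e4: "extends d m3 m4" and h4: "m4 7 0 = m3 7 0 + int k"
  using compile_Bits_loop[OF wb(1) wb(2)[of d] wb(6,7) M z3 nv' nv x3 u3 hM, folded k_def] by auto
 have k1: "(k + 1) * (100 * w) \<le> 2 * vsize v * (100 * w)" by (rule mult_le_mono1[OF kc(2)])
 have "1 * w \<le> vsize v * w" by (rule mult_le_mono1[OF s1])
 moreover have "1200 * (d + 10) * (cost KBits v * B) = 1200 * (vsize v * w)"
  by (simp add: w_def c_def)
 moreover have "(50 + len (Const 0)) * w = 51 * w" by simp
 ultimately have "runs (compile KBits d) m (1200 * (d + 10) * (cost KBits v * B)) m4"
  unfolding compile.simps
  by (intro runs_mono[OF runs_Seq[OF r1 runs_Seq[OF r2 runs_Seq[OF r3 r4]]]]) (use w1 k1 in linarith)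
 moreover have "extends d m m4"
  using extends_trans[OF e1 extends_trans[OF extends_mono[OF e2] extends_trans[OF e3 e4]]] by simp
 moreover have "m4 7 0 \<le> m 7 0 + int (cost KBits v)" using h4 h kc cc by linarith
 ultimately show ?case
  using u4 by (intro exI[of _ m4]) (simp add: k_def)
qed

lemma compiles_exists: "\<exists>K. compiles f d K"
proof (induction f arbitrary: d)
 case (KIf c f g)
 obtain K1 K2 K3 where "compiles c (d + 1) K1" "compiles f d K2" "compiles g d K3"
  using KIf.IH by meson
 hence "compiles c (d + 1) (K1 + K2 + K3)" "compiles f d (K1 + K2 + K3)" "compiles g d (K1 + K2 + K3)"
  by (auto elim: compiles_mono)
 thus ?case using compiles_If by blast
qed (blast intro: compiles_Id compiles_Left compiles_Right compiles_Const compiles_arith compiles_Bits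
  compiles_Pair compiles_Comp compiles_Iter)+

section \<open>Functions computable in polynomial time\<close>

text \<open>Natural numbers are coded in unary, integers in binary, rationals in lowest terms.\<close>

class enc = fixes enc :: "'a => val"

instantiation int :: enc begin
definition "enc_int (a::int) = VInt a"
instance ..
end

instantiation nat :: enc begin
definition "enc_nat (n::nat) = unary n"
instance ..
end

instantiation bool :: enc begin
definition "enc_bool b = VInt (if b then 1 else 0)"
instance ..
end

instantiation prod :: (enc, enc) enc begin
definition "enc_prod z = VPair (enc (fst z)) (enc (snd z))"
instance ..
end

instantiation rat :: enc begin
definition "enc_rat (r::rat) = enc (quotient_of r)"
instance ..
end

instantiation list :: (enc) enc begin
primrec enc_list where
 "enc_list [] = VInt 0"
| "enc_list (x # xs) = VPair (enc x) (enc_list xs)"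
instance ..
end

definition sz :: "'a::enc => nat" where "sz x = vsize (enc x)"

lemma sz_pos: "1 \<le> sz x"
 using vsize_pos[of "enc x"] by (simp add: sz_def)

lemma enc_prod_Pair [simp]: "enc (x, y) = VPair (enc x) (enc y)"
 by (simp add: enc_prod_def)

lemma sz_Pair: "sz (x, y) = 1 + sz x + sz y"
 by (simp add: sz_def)

lemma sz_nat: "sz (n::nat) = 2 * n + 1"
 by (simp add: sz_def enc_nat_def vsize_unary)

lemma sz_int: "sz (a::int) = int_size a"
 by (simp add: sz_def enc_int_def)

lemma sz_Nil: "sz [] = 1"
 by (simp add: sz_def int_size_def floorlog_def)

lemma sz_Cons: "sz (x # xs) = 1 + sz x + sz xs"
 by (simp add: sz_def)

lemma length_le_sz: "length xs \<le> sz xs"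
 by (induction xs) (auto simp: sz_Cons)

lemma sz_mem: "x \<in> set xs ==> sz x \<le> sz xs"
 by (induction xs) (auto simp: sz_Cons)

lemma spine_list: "spine (enc (xs::'a::enc list)) = length xs"
 by (induction xs) auto

lemma spine_nat: "spine (enc (n::nat)) = n"
 by (simp add: enc_nat_def spine_unary)

subsection \<open>Polynomial bounds\<close>

text \<open>Since \<open>sz x + 1\<close> is at least 2, raising the exponent absorbs constant
  factors and sums, so a single power describes the whole class. The set \<open>S\<close> carries
  the promises on the input under which sizes stay bounded.\<close>

definition PB :: "'x::enc set => ('x => nat) => bool" where
 "PB S b \<longleftrightarrow> (\<exists>k. \<forall>x\<in>S. b x \<le> (sz x + 1) ^ k)"

lemma PB_mono: "PB S c ==> (\<And>x. x \<in> S ==> b x \<le> c x) ==> PB S b"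
 unfolding PB_def by (meson le_trans)

lemma PB_subset: "PB T b ==> S \<subseteq> T ==> PB S b"
 unfolding PB_def by (meson subsetD)

lemma PB_sz: "PB S sz"
 unfolding PB_def by (rule exI[of _ 1]) auto

lemma PB_const: "PB S (%_. c)"
 unfolding PB_def
proof (intro exI[of _ c] ballI)
 fix x assume "x \<in> S"
 have "c \<le> 2 ^ c" using less_exp[of c] by simp
 also have "\<dots> \<le> (sz x + 1) ^ c" by (rule power_mono) (use sz_pos[of x] in auto)
 finally show "c \<le> (sz x + 1) ^ c" .
qed

lemma PB_add: assumes "PB S b" "PB S c" shows "PB S (%x. b x + c x)"
proof -
 from assms obtain k l where kl: "\<forall>x\<in>S. b x \<le> (sz x + 1) ^ k" "\<forall>x\<in>S. c x \<le> (sz x + 1) ^ l"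
  unfolding PB_def by blast
 show ?thesis unfolding PB_def
 proof (intro exI[of _ "k + l + 1"] ballI)
  fix x assume x: "x \<in> S"
  define a where "a = sz x + 1"
  have a: "2 \<le> a" using sz_pos[of x] by (simp add: a_def)
  have "a ^ k \<le> a ^ (k + l)" "a ^ l \<le> a ^ (k + l)" using a by (auto intro!: power_increasing)
  hence "b x + c x \<le> 2 * a ^ (k + l)" using kl x unfolding a_def by fastforce
  also have "\<dots> \<le> a * a ^ (k + l)" using a by simp
  finally show "b x + c x \<le> (sz x + 1) ^ (k + l + 1)" by (simp add: a_def)
 qed
qed

lemma PB_mult: assumes "PB S b" "PB S c" shows "PB S (%x. b x * c x)"
proof -
 from assms obtain k l where kl: "\<forall>x\<in>S. b x \<le> (sz x + 1) ^ k" "\<forall>x\<in>S. c x \<le> (sz x + 1) ^ l"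
  unfolding PB_def by blast
 show ?thesis unfolding PB_def
  by (rule exI[of _ "k + l"]) (use kl in \<open>auto simp: power_add intro!: mult_le_mono\<close>)
qed

lemma PB_power: "PB S b ==> PB S (%x. b x ^ n)"
 by (induction n) (auto intro: PB_const PB_mult)

lemmas PB_intros = PB_sz PB_const PB_add PB_mult PB_power

lemma PB_comp:
 assumes "PB T b" "PB S (%x. sz (f x))" "\<And>x. x \<in> S ==> f x \<in> T"
 shows "PB S (%x. b (f x))"
proof -
 from assms(1) obtain k where k: "\<forall>x\<in>T. b x \<le> (sz x + 1) ^ k" unfolding PB_def by blast
 have "PB S (%x. (sz (f x) + 1) ^ k)" by (intro PB_intros assms)
 thus ?thesis by (rule PB_mono) (use k assms(3) in auto)
qed

text \<open>A bound for the pair becomes a bound in the parameter alone once the size of the second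
  component is controlled. This makes the cost of a loop body uniform over all passes.\<close>

lemma PB_uniform:
 fixes b :: "'x::enc \<times> 'i::enc => nat"
 assumes "PB T b" "PB S B"
 obtains c where "PB S c" "\<And>x y. x \<in> S ==> (x, y) \<in> T ==> sz y \<le> B x ==> b (x, y) \<le> c x"
proof -
 from assms(1) obtain k where k: "\<forall>x\<in>T. b x \<le> (sz x + 1) ^ k" unfolding PB_def by blast
 show ?thesis
 proof (rule that[of "%x. (sz x + B x + 2) ^ k"])
  show "PB S (%x. (sz x + B x + 2) ^ k)" by (intro PB_intros assms)
 next
  fix x y assume a: "x \<in> S" "(x, y) \<in> T" "sz y \<le> B x"
  have "b (x, y) \<le> (sz (x, y) + 1) ^ k" using k a by blast
  also have "\<dots> \<le> (sz x + B x + 2) ^ k" using a by (intro power_mono) (auto simp: sz_Pair)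
  finally show "b (x, y) \<le> (sz x + B x + 2) ^ k" .
 qed
qed

subsection \<open>Closure properties\<close>

definition FP :: "'x::enc set => ('x => 'y::enc) => bool" where
 "FP S f \<longleftrightarrow> (\<exists>F. (\<forall>x\<in>S. sem F (enc x) = enc (f x)) \<and> PB S (%x. cost F (enc x)))"

lemma FP_I:
 "(\<And>x. x \<in> S ==> sem F (enc x) = enc (f x)) ==> PB S (%x. cost F (enc x)) ==> FP S f"
 unfolding FP_def by blast

lemma FP_E:
 assumes "FP S f"
 obtains F where "\<And>x. x \<in> S ==> sem F (enc x) = enc (f x)" "PB S (%x. cost F (enc x))"
 using assms unfolding FP_def by blast

lemma FP_sz: assumes "FP S f" shows "PB S (%x. sz (f x))"
proof -
 from assms obtain F where F: "\<And>x. x \<in> S ==> sem F (enc x) = enc (f x)" "PB S (%x. cost F (enc x))"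
  by (rule FP_E) blast
 show ?thesis by (rule PB_mono[OF F(2)]) (metis F(1) sz_def vsize_sem_le)
qed

lemma FP_subset: "FP T f ==> S \<subseteq> T ==> FP S f"
 unfolding FP_def using PB_subset by (meson subsetD)

lemma FP_enc_cong: "FP S g ==> (\<And>x. x \<in> S ==> enc (f x) = enc (g x)) ==> FP S f"
 unfolding FP_def by simp

lemma FP_cong: "FP S g ==> (\<And>x. x \<in> S ==> f x = g x) ==> FP S f"
 by (rule FP_enc_cong) auto

lemma FP_id: "FP S (%x. x)"
 by (rule FP_I[of _ KId]) (auto simp: sz_def[symmetric] PB_sz)

lemma const_prg: "\<exists>F k. \<forall>v. sem F v = w \<and> cost F v \<le> k * vsize v"
proof (induction w)
 case (VInt a)
 have "cost (KConst a) v \<le> (1 + int_size a) * vsize v" for v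
  using vsize_pos[of v] by simp
 thus ?case by (intro exI[of _ "KConst a"] exI[of _ "1 + int_size a"]) auto
next
 case (VPair x y)
 then obtain F k G l where "\<forall>v. sem F v = x \<and> cost F v \<le> k * vsize v"
  "\<forall>v. sem G v = y \<and> cost G v \<le> l * vsize v" by blast
 thus ?case
 proof (intro exI[of _ "KPair F G"] exI[of _ "k + l + 1"] allI conjI)
  fix v
  have "cost F v \<le> k * vsize v" "cost G v \<le> l * vsize v" "1 \<le> vsize v"
   using VPair VPair vsize_pos[of v] \<open>\<forall>v. sem F v = x \<and> cost F v \<le> k * vsize v\<close>
    \<open>\<forall>v. sem G v = y \<and> cost G v \<le> l * vsize v\<close> by auto
  thus "cost (KPair F G) v \<le> (k + l + 1) * vsize v" by (simp add: add_mult_distrib)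
 qed auto
qed

lemma FP_const: "FP S (%_. c)"
proof -
 obtain F k where F: "\<forall>v. sem F v = enc c \<and> cost F v \<le> k * vsize v" using const_prg by blast
 have "PB S (%x. k * sz x)" by (intro PB_intros)
 hence "PB S (%x. cost F (enc x))" by (rule PB_mono) (use F in \<open>simp add: sz_def\<close>)
 thus ?thesis using F by (auto intro: FP_I)
qed

lemma FP_compose:
 assumes "FP T g" "FP S f" "\<And>x. x \<in> S ==> f x \<in> T"
 shows "FP S (%x. g (f x))"
proof -
 from assms(1,2) obtain F G where F: "\<And>x. x \<in> S ==> sem F (enc x) = enc (f x)" "PB S (%x. cost F (enc x))"
  and G: "\<And>x. x \<in> T ==> sem G (enc x) = enc (g x)" "PB T (%x. cost G (enc x))"
  by (elim FP_E) blast
 have "PB S (%x. cost G (enc (f x)) + cost F (enc x))"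
  by (intro PB_add F PB_comp[OF G(2)] FP_sz assms)
 hence "PB S (%x. cost (KComp G F) (enc x))" by (rule PB_mono) (simp add: F)
 thus ?thesis by (rule FP_I[rotated]) (use F G assms in auto)
qed

lemma FP_Pair:
 assumes "FP S f" "FP S g" shows "FP S (%x. (f x, g x))"
proof -
 from assms obtain F G where F: "\<And>x. x \<in> S ==> sem F (enc x) = enc (f x)" "PB S (%x. cost F (enc x))"
  and G: "\<And>x. x \<in> S ==> sem G (enc x) = enc (g x)" "PB S (%x. cost G (enc x))"
  by (elim FP_E) blast
 have "PB S (%x. 1 + cost F (enc x) + cost G (enc x))" by (intro PB_intros F G)
 thus ?thesis by (intro FP_I[of _ "KPair F G"]) (use F G in auto)
qed

lemma FP_prim:
 assumes "FP S f" "\<And>x. x \<in> S ==> sem F (enc (f x)) = enc (g x)" "PB S (%x. cost F (enc (f x)))"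
 shows "FP S g"
proof -
 from assms obtain G where G: "\<And>x. x \<in> S ==> sem G (enc x) = enc (f x)" "PB S (%x. cost G (enc x))"
  by (elim FP_E) blast
 have "PB S (%x. cost F (enc (f x)) + cost G (enc x))" by (intro PB_intros G assms)
 hence "PB S (%x. cost (KComp F G) (enc x))" by (rule PB_mono) (simp add: G)
 thus ?thesis by (rule FP_I[rotated]) (use G assms in auto)
qed

lemma FP_fst: assumes "FP S f" shows "FP S (%x. fst (f x))"
 by (rule FP_prim[OF assms, of KLeft])
   (use FP_sz[OF assms] in \<open>auto simp: enc_prod_def sz_def\<close>)

lemma FP_snd: assumes "FP S f" shows "FP S (%x. snd (f x))"
 by (rule FP_prim[OF assms, of KRight])
   (use FP_sz[OF assms] in \<open>auto simp: enc_prod_def sz_def\<close>)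

text \<open>Each branch has to be computable only where it is taken, which admits partial functions
  such as \<open>hd\<close>.\<close>

lemma FP_If_dom:
 assumes "FP S b" "FP {x \<in> S. b x} f" "FP {x \<in> S. \<not> b x} g"
 shows "FP S (%x. if b x then f x else g x)"
proof -
 from assms obtain B F G where B: "\<And>x. x \<in> S ==> sem B (enc x) = enc (b x)" "PB S (%x. cost B (enc x))"
  and F: "\<And>x. x \<in> {x \<in> S. b x} ==> sem F (enc x) = enc (f x)" "PB {x \<in> S. b x} (%x. cost F (enc x))"
  and G: "\<And>x. x \<in> {x \<in> S. \<not> b x} ==> sem G (enc x) = enc (g x)" "PB {x \<in> S. \<not> b x} (%x. cost G (enc x))"
  by (elim FP_E) blast
 from F(2) G(2) obtain k l where k: "\<forall>x\<in>{x \<in> S. b x}. cost F (enc x) \<le> (sz x + 1) ^ k"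
  and l: "\<forall>x\<in>{x \<in> S. \<not> b x}. cost G (enc x) \<le> (sz x + 1) ^ l" unfolding PB_def by blast
 have "PB S (%x. cost B (enc x) + ((sz x + 1) ^ k + (sz x + 1) ^ l))"
  by (intro PB_intros B)
 hence "PB S (%x. cost (KIf B F G) (enc x))"
  by (rule PB_mono) (use k l in \<open>auto simp: B enc_bool_def trans_le_add1 trans_le_add2\<close>)
 thus ?thesis by (rule FP_I[rotated]) (use B F G in \<open>auto simp: enc_bool_def\<close>)
qed

lemma FP_If:
 assumes "FP S b" "FP S f" "FP S g"
 shows "FP S (%x. if b x then f x else g x)"
 by (rule FP_If_dom) (auto intro: assms FP_subset)

text \<open>Polynomially many polynomial steps need not be polynomial, as repeated squaring shows;
  hence the bound \<open>B\<close> on all iterates, whose proof is the real work in each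
  application. The set \<open>T\<close> lets the step rely on an invariant of the loop.\<close>

lemma FP_iter_spine:
 assumes f: "FP T (%z. f (fst z) (snd z))" and l: "FP S l" and n: "\<And>x. x \<in> S ==> n x = spine (enc (l x))"
  and a: "FP S a" and T: "\<And>x i. x \<in> S ==> i < n x ==> (x, (f x ^^ i) (a x)) \<in> T"
  and B: "PB S B" "\<And>x i. x \<in> S ==> i \<le> n x ==> sz ((f x ^^ i) (a x)) \<le> B x"
 shows "FP S (%x. (f x ^^ n x) (a x))"
proof -
 from f l a obtain F L A where F: "\<And>x. x \<in> T ==> sem F (enc x) = enc (f (fst x) (snd x))" "PB T (%x. cost F (enc x))"
  and L: "\<And>x. x \<in> S ==> sem L (enc x) = enc (l x)" "PB S (%x. cost L (enc x))"
  and A: "\<And>x. x \<in> S ==> sem A (enc x) = enc (a x)" "PB S (%x. cost A (enc x))"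
  by (elim FP_E) blast
 obtain c where c: "PB S c" "\<And>x y. x \<in> S ==> (x, y) \<in> T ==> sz y \<le> B x ==> cost F (enc (x, y)) \<le> c x"
  using PB_uniform[OF F(2) B(1)] by blast
 \<comment> \<open>The parameter travels along in the loop state, because \<open>KIter\<close>
   passes nothing else to its body.\<close>
 define body where "body = KPair KLeft F"
 have body: "(sem body ^^ i) (VPair (enc x) (enc (a x))) = VPair (enc x) (enc ((f x ^^ i) (a x)))"
  if "x \<in> S" "i \<le> n x" for x i
  using that(2)
 proof (induction i)
  case (Suc i)
  thus ?case using F(1)[OF T[OF that(1), of i]] by (simp add: body_def)
 qed simp
 define G where "G = KComp KRight (KComp (KIter body) (KPair L (KPair KId A)))"
 have "sem G (enc x) = enc ((f x ^^ n x) (a x))" if "x \<in> S" for x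
  using body[OF that, of "n x"] L(1)[OF that] A(1)[OF that] n[OF that] by (simp add: G_def)
 moreover have "PB S (%x. cost G (enc x))"
 proof (rule PB_mono)
  have nPB: "PB S (%x. spine (enc (l x)))"
   by (rule PB_mono[OF FP_sz[OF l]]) (simp add: sz_def spine_le_vsize)
  show "PB S (%x. (1 + sz x + B x) + (1 + sz (l x) + (1 + sz x + sz (a x)))
    + spine (enc (l x)) * (3 + sz x + B x + c x) + (1 + cost L (enc x) + (1 + sz x + cost A (enc x))))"
   by (intro PB_intros B(1) c(1) FP_sz[OF l] FP_sz[OF a] L A nPB)
 next
  fix x assume x: "x \<in> S"
  have "(\<Sum>i<n x. 1 + cost body ((sem body ^^ i) (VPair (enc x) (enc (a x)))))
    \<le> (\<Sum>i<n x. 3 + sz x + B x + c x)"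
  proof (rule sum_mono)
   fix i assume "i \<in> {..<n x}"
   hence i: "i < n x" by simp
   have b: "sz ((f x ^^ i) (a x)) \<le> B x" using B(2)[OF x, of i] i by simp
   have "cost F (enc (x, (f x ^^ i) (a x))) \<le> c x" by (rule c(2)[OF x T[OF x i] b])
   thus "1 + cost body ((sem body ^^ i) (VPair (enc x) (enc (a x)))) \<le> 3 + sz x + B x + c x"
    using body[OF x, of i] i b by (simp add: body_def sz_def)
  qed
  also have "\<dots> = spine (enc (l x)) * (3 + sz x + B x + c x)" using n[OF x] by simp
  finally have s: "(\<Sum>i<n x. 1 + cost body ((sem body ^^ i) (VPair (enc x) (enc (a x)))))
    \<le> spine (enc (l x)) * (3 + sz x + B x + c x)" .
  have "sz ((f x ^^ n x) (a x)) \<le> B x" by (rule B(2)[OF x]) simp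
  thus "cost G (enc x) \<le> (1 + sz x + B x) + (1 + sz (l x) + (1 + sz x + sz (a x)))
    + spine (enc (l x)) * (3 + sz x + B x + c x) + (1 + cost L (enc x) + (1 + sz x + cost A (enc x)))"
   using s body[OF x, of "n x"] L(1)[OF x] A(1)[OF x] n[OF x] by (simp add: G_def sz_def)
 qed
 ultimately show ?thesis by (rule FP_I)
qed

lemma FP_iter:
 fixes n :: "'x::enc => nat"
 assumes "FP T (%z. f (fst z) (snd z))" "FP S n" "FP S a"
  "\<And>x i. x \<in> S ==> i < n x ==> (x, (f x ^^ i) (a x)) \<in> T"
  "PB S B" "\<And>x i. x \<in> S ==> i \<le> n x ==> sz ((f x ^^ i) (a x)) \<le> B x"
 shows "FP S (%x. (f x ^^ n x) (a x))"
 by (rule FP_iter_spine[OF assms(1,2) _ assms(3-6)]) (simp_all add: spine_nat)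

lemma PB_nat: "FP S n ==> PB S (n :: 'x::enc => nat)"
 by (rule PB_mono[OF FP_sz]) (auto simp: sz_nat)

subsection \<open>Booleans, natural numbers and integers\<close>

lemma FP_not: "FP S b ==> FP S (%x. \<not> b x)"
 by (rule FP_cong[OF FP_If[OF _ FP_const[of _ False] FP_const[of _ True]]]) auto

lemma FP_conj: "FP S b ==> FP S c ==> FP S (%x. b x \<and> c x)"
 by (rule FP_cong[OF FP_If[of S b c "%_. False"]]) (auto intro: FP_const)

lemma FP_disj: "FP S b ==> FP S c ==> FP S (%x. b x \<or> c x)"
 by (rule FP_cong[OF FP_If[of S b "%_. True" c]]) (auto intro: FP_const)

text \<open>A unary number is coded like a list of zeros, so the successor is a
  \<open>Cons\<close>.\<close>

lemma FP_Suc: assumes "FP S n" shows "FP S (%x. Suc (n x))"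
 using FP_Pair[OF FP_const[of S "0::int"] assms] by (rule FP_enc_cong) (simp add: enc_nat_def enc_int_def)

lemma FP_pred: assumes "FP S n" shows "FP S (%x. n x - Suc 0)"
proof (rule FP_prim[OF assms, of KRight])
 fix x show "sem KRight (enc (n x)) = enc (n x - Suc 0)" by (cases "n x") (auto simp: enc_nat_def)
 show "PB S (%x. cost KRight (enc (n x)))" using FP_sz[OF assms] by (simp add: sz_def)
qed

lemma FP_nat_add: assumes "FP S m" "FP S n" shows "FP S (%x. m x + n x :: nat)"
proof -
 have eq: "(Suc ^^ i) a = i + a" for i a by (induction i) auto
 have "FP S (%x. ((%y. Suc y) ^^ m x) (n x))"
 proof (rule FP_iter[where T=UNIV and B="%x. 2 * m x + 2 * n x + 1"])
  show "PB S (%x. 2 * m x + 2 * n x + 1)" by (intro PB_intros PB_nat assms)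
 qed (auto intro!: FP_Suc FP_snd FP_id assms simp: eq sz_nat)
 thus ?thesis by (rule FP_cong) (simp add: eq)
qed

lemma FP_nat_mult: assumes "FP S m" "FP S n" shows "FP S (%x. m x * n x :: nat)"
proof -
 have eq: "((%y. k + y) ^^ i) 0 = i * k" for i k :: nat by (induction i) auto
 have "FP S (%x. ((%y. n x + y) ^^ m x) 0)"
 proof (rule FP_iter[where T="S \<times> UNIV" and B="%x. 2 * (m x * n x) + 1"])
  show "PB S (%x. 2 * (m x * n x) + 1)" by (intro PB_intros PB_nat assms)
  show "FP (S \<times> UNIV) (%z. n (fst z) + snd z)"
   by (intro FP_nat_add FP_compose[OF assms(2)] FP_fst FP_snd FP_id) auto
 qed (auto intro!: FP_const assms mult_le_mono1 simp: eq sz_nat)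
 thus ?thesis by (rule FP_cong) (simp add: eq)
qed

lemma FP_length: assumes "FP S l" shows "FP S (%x. length (l x))"
proof -
 have eq: "(Suc ^^ i) 0 = i" for i by (induction i) auto
 have "FP S (%x. ((%y. Suc y) ^^ length (l x)) 0)"
 proof (rule FP_iter_spine[where T=UNIV and B="%x. 2 * sz (l x) + 1", OF _ assms])
  show "PB S (%x. 2 * sz (l x) + 1)" by (intro PB_intros FP_sz assms)
 qed (auto intro!: FP_Suc FP_snd FP_id FP_const simp: eq sz_nat spine_list intro: order.trans[OF _ length_le_sz])
 thus ?thesis by (rule FP_cong) (simp add: eq)
qed

lemma int_size_mult: "int_size (a * b) \<le> int_size a + int_size b"
proof -
 have "nat \<bar>a\<bar> < 2 ^ floorlog 2 (nat \<bar>a\<bar>)" "nat \<bar>b\<bar> < 2 ^ floorlog 2 (nat \<bar>b\<bar>)"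
  by (rule floorlog_leD; simp)+
 hence "nat \<bar>a * b\<bar> < 2 ^ (floorlog 2 (nat \<bar>a\<bar>) + floorlog 2 (nat \<bar>b\<bar>))"
  unfolding power_add abs_mult nat_mult_distrib[OF abs_ge_zero] by (intro mult_strict_mono) auto
 hence "floorlog 2 (nat \<bar>a * b\<bar>) \<le> floorlog 2 (nat \<bar>a\<bar>) + floorlog 2 (nat \<bar>b\<bar>)"
  by (intro floorlog_leI) auto
 thus ?thesis by (simp add: int_size_def)
qed

lemma int_size_mono: "\<bar>a\<bar> \<le> \<bar>b\<bar> ==> int_size a \<le> int_size b"
 unfolding int_size_def by (intro add_mono floorlog_mono) auto

lemma int_size_less: "nat \<bar>a\<bar> < 2 ^ k ==> int_size a \<le> k + 1"
 unfolding int_size_def using floorlog_leI[of "nat \<bar>a\<bar>" 2 k] by simp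

lemma abs_less_int_size: "\<bar>a\<bar> < 2 ^ int_size a"
proof -
 have "nat \<bar>a\<bar> < 2 ^ floorlog 2 (nat \<bar>a\<bar>)" by (rule floorlog_leD) simp_all
 also have "\<dots> \<le> 2 ^ int_size a" by (rule power_increasing) (auto simp: int_size_def)
 finally have "int (nat \<bar>a\<bar>) < int (2 ^ int_size a)" by (simp only: of_nat_less_iff)
 thus ?thesis by simp
qed

lemma int_size_le_pow: "\<bar>a\<bar> \<le> 2 ^ k ==> int_size a \<le> k + 2"
proof -
 assume "\<bar>a\<bar> \<le> 2 ^ k"
 moreover have "(0::int) < 2 ^ k" by simp
 ultimately have "\<bar>a\<bar> < 2 * 2 ^ k" by linarith
 hence "int (nat \<bar>a\<bar>) < int (2 ^ (k + 1))" by simp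
 thus ?thesis using int_size_less[of a "k + 1"] by (simp only: of_nat_less_iff) simp
qed

lemma int_size_add: "int_size (a + b) \<le> int_size a + int_size b + 2"
proof (rule order.trans[OF int_size_le_pow])
 have "\<bar>a + b\<bar> \<le> 2 ^ int_size a * 1 + 1 * 2 ^ int_size b"
  using abs_less_int_size[of a] abs_less_int_size[of b] by simp
 also have "\<dots> \<le> 2 ^ (int_size a + int_size b)"
 proof -
  have "(2::int) \<le> 2 ^ int_size a" "(2::int) \<le> 2 ^ int_size b"
   using int_size_pos[of a] int_size_pos[of b] self_le_power[of "2::int"] by auto
  hence "0 \<le> ((2::int) ^ int_size a - 2) * (2 ^ int_size b - 2)" by simp
  thus ?thesis using \<open>(2::int) \<le> 2 ^ int_size a\<close> \<open>(2::int) \<le> 2 ^ int_size b\<close>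
   by (simp add: power_add algebra_simps)
 qed
 finally show "\<bar>a + b\<bar> \<le> 2 ^ (int_size a + int_size b)" .
qed simp

lemma int_size_minus: "int_size (- a) = int_size a"
 by (simp add: int_size_def)

lemma FP_int_arith:
 assumes a: "FP S a" and b: "FP S b"
  and F: "\<And>u v. sem F (VPair (VInt u) (VInt v)) = VInt (g u v)"
   "\<And>v. cost F v = vsize v + vsize (sem F v)"
  and g: "\<And>u v. int_size (g u v) \<le> int_size u + int_size v + 2"
 shows "FP S (%x. g (a x) (b x))"
proof (rule FP_prim[OF FP_Pair[OF a b], of F])
 have "PB S (%x. (1 + sz (a x) + sz (b x)) + (sz (a x) + sz (b x) + 2))"
  by (intro PB_intros FP_sz a b)
 thus "PB S (%x. cost F (enc (a x, b x)))"
  by (rule PB_mono) (use g in \<open>simp add: F enc_int_def sz_def\<close>)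
qed (simp add: F enc_int_def)

lemma FP_int_add: "FP S a ==> FP S b ==> FP S (%x. a x + b x :: int)"
 by (rule FP_int_arith[where F=KAdd and g="(+)"]) (simp_all only: int_size_add sem.simps cost.simps left.simps right.simps num.simps)

lemma FP_int_diff: "FP S a ==> FP S b ==> FP S (%x. a x - b x :: int)"
 by (rule FP_int_arith[where F=KSub and g="(-)"])
  (use int_size_add[of _ "- _"] in \<open>auto simp: int_size_minus\<close>)

lemma FP_int_mult: "FP S a ==> FP S b ==> FP S (%x. a x * b x :: int)"
 by (rule FP_int_arith[where F=KMul and g="(*)"]) (auto intro: order.trans[OF int_size_mult])

lemma abs_div_le: "\<bar>a div b\<bar> \<le> \<bar>a\<bar>" for a b :: int
proof -
 have pos: "\<bar>a div b\<bar> \<le> \<bar>a\<bar>" if "0 < b" for a b :: int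
 proof (cases "0 \<le> a")
  case True
  have "b * (a div b) \<le> a" using mult_div_mod_eq[of b a] pos_mod_sign[OF that, of a] by linarith
  moreover have "0 \<le> a div b" using that True by (simp add: pos_imp_zdiv_nonneg_iff)
  moreover have "1 * (a div b) \<le> b * (a div b)" by (rule mult_right_mono) (use that calculation in auto)
  ultimately show ?thesis by simp
 next
  case False
  have "a < b * (a div b + 1)"
   using mult_div_mod_eq[of b a] pos_mod_bound[OF that, of a] unfolding distrib_left by linarith
  moreover have "a div b < 0" using that False by (simp add: pos_imp_zdiv_neg_iff)
  moreover have "b * (a div b + 1) \<le> 1 * (a div b + 1)"
   by (rule mult_right_mono_neg) (use that calculation in auto)
  ultimately show ?thesis by simp
 qed
 show ?thesis using pos[of b a] pos[of "- b" "- a"] by (cases "b = 0"; cases "0 < b") auto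
qed

lemma FP_int_div: "FP S a ==> FP S b ==> FP S (%x. a x div b x :: int)"
 by (rule FP_int_arith[where F=KDiv and g="(div)"])
  (auto intro: order.trans[OF int_size_mono[OF abs_div_le]])

lemma FP_int_mod: "FP S a ==> FP S b ==> FP S (%x. a x mod b x :: int)"
 unfolding minus_div_mult_eq_mod[symmetric] by (intro FP_int_diff FP_int_mult FP_int_div)

lemma FP_int_uminus: "FP S a ==> FP S (%x. - a x :: int)"
 using FP_int_diff[OF FP_const[of S 0]] by simp

lemma FP_int_less: assumes "FP S a" "FP S b" shows "FP S (%x. a x < (b x :: int))"
proof -
 have d: "FP S (%x. b x - a x)" using assms by (intro FP_int_diff)
 show ?thesis
 proof (rule FP_prim[OF d, of "KIf KId (KConst 1) (KConst 0)"])
  have "PB S (%x. sz (b x - a x) + (sz (b x - a x) + 2))" by (intro PB_intros FP_sz d)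
  thus "PB S (%x. cost (KIf KId (KConst 1) (KConst 0)) (enc (b x - a x)))"
   by (rule PB_mono) (auto simp: sz_def int_size_def floorlog_def)
 qed (auto simp: enc_int_def enc_bool_def)
qed

lemma FP_int_le: "FP S a ==> FP S b ==> FP S (%x. a x \<le> (b x :: int))"
 unfolding not_less[symmetric] by (intro FP_not FP_int_less)

lemma FP_int_eq: "FP S a ==> FP S b ==> FP S (%x. a x = (b x :: int))"
 unfolding order_eq_iff by (intro FP_conj FP_int_le)

lemma FP_int_abs: "FP S a ==> FP S (%x. \<bar>a x\<bar> :: int)"
 unfolding abs_if by (intro FP_If FP_int_less FP_const FP_int_uminus)

lemma FP_of_nat: assumes "FP S n" shows "FP S (%x. int (n x))"
proof -
 have eq: "((%y. y + 1) ^^ i) 0 = int i" for i by (induction i) auto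
 have "FP S (%x. ((%y. y + 1) ^^ n x) (0::int))"
 proof (rule FP_iter[where T=UNIV and B="%x. n x + 1"])
  show "PB S (%x. n x + 1)" by (intro PB_intros PB_nat assms)
 qed (auto intro!: FP_int_add FP_snd FP_id FP_const assms simp: eq sz_int intro: order.trans[OF int_size_le_nat])
 thus ?thesis by (rule FP_cong) (simp add: eq)
qed

lemma FP_nat_less: "FP S m ==> FP S n ==> FP S (%x. m x < (n x :: nat))"
 unfolding of_nat_less_iff[where 'a=int, symmetric] by (intro FP_int_less FP_of_nat)

lemma FP_nat_eq: "FP S m ==> FP S n ==> FP S (%x. m x = (n x :: nat))"
 unfolding of_nat_eq_iff[where 'a=int, symmetric] by (intro FP_int_eq FP_of_nat)

lemma FP_bits: assumes "FP S a" shows "FP S (%x. floorlog 2 (nat (a x)))"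
proof (rule FP_prim[OF assms, of KBits])
 have "PB S (%x. 4 * sz (a x) * sz (a x))" by (intro PB_intros FP_sz assms)
 thus "PB S (%x. cost KBits (enc (a x)))" by (simp add: sz_def)
qed (simp add: enc_int_def enc_nat_def)

subsection \<open>Lists\<close>

lemma FP_Nil: "FP S (%x. [])"
 by (rule FP_const)

lemma FP_Cons: assumes "FP S a" "FP S l" shows "FP S (%x. a x # l x)"
 using FP_Pair[OF assms] by (rule FP_enc_cong) simp

lemma FP_tl: assumes "FP S l" shows "FP S (%x. tl (l x))"
proof (rule FP_prim[OF assms, of KRight])
 fix x show "sem KRight (enc (l x)) = enc (tl (l x))" by (cases "l x") auto
 show "PB S (%x. cost KRight (enc (l x)))" using FP_sz[OF assms] by (simp add: sz_def)
qed

lemma FP_hd: assumes "FP S l" "\<And>x. x \<in> S ==> l x \<noteq> []" shows "FP S (%x. hd (l x))"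
proof (rule FP_prim[OF assms(1), of KLeft])
 show "sem KLeft (enc (l x)) = enc (hd (l x))" if "x \<in> S" for x
  using assms(2)[OF that] by (cases "l x") auto
 show "PB S (%x. cost KLeft (enc (l x)))" using FP_sz[OF assms(1)] by (simp add: sz_def)
qed

lemma FP_null: assumes "FP S l" shows "FP S (%x. l x = [])"
proof -
 have "FP S (%x. length (l x) = 0)" by (intro FP_nat_eq FP_length FP_const assms)
 thus ?thesis by simp
qed

lemma sz_drop: "sz (drop i l) \<le> sz l"
 by (induction l arbitrary: i) (auto simp: sz_Cons drop_Cons' split: nat.split intro: le_SucI trans_le_add2)

lemma sz_take: "sz (take i l) \<le> sz l"
 by (induction l arbitrary: i) (auto simp: sz_Cons take_Cons' sz_Nil)

lemma funpow_tl: "(tl ^^ i) l = drop i l"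
 by (induction i) (auto simp: drop_Suc tl_drop)

lemma FP_drop: assumes "FP S i" "FP S l" shows "FP S (%x. drop (i x) (l x))"
proof -
 have "FP S (%x. ((%y. tl y) ^^ i x) (l x))"
 proof (rule FP_iter[where T=UNIV and B="%x. sz (l x)"])
  show "PB S (%x. sz (l x))" by (intro FP_sz assms)
 qed (auto intro!: FP_tl FP_snd FP_id assms simp: funpow_tl sz_drop)
 thus ?thesis by (simp add: funpow_tl)
qed

text \<open>Total access with a default, so that reading an entry requires no proof that the index
  is in range. In particular \<open>vx\<close> and \<open>mx\<close> below are zero outside the
  lists.\<close>

definition elt :: "'a => 'a list => nat => 'a" where
 "elt d l i = (if i < length l then l ! i else d)"

lemma FP_elt: assumes "FP S l" "FP S i" shows "FP S (%x. elt d (l x) (i x))"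
proof -
 have "FP S (%x. if i x < length (l x) then hd (drop (i x) (l x)) else d)"
  by (intro FP_If_dom FP_nat_less FP_length FP_const FP_hd FP_drop assms; (rule FP_subset)?)
   (auto intro: assms)
 thus ?thesis by (rule FP_cong) (auto simp: elt_def hd_drop_conv_nth)
qed

lemma FP_foldl:
 assumes f: "FP T (%z. f (fst z) (fst (snd z)) (snd (snd z)))" and l: "FP S l" and a: "FP S a"
  and T: "\<And>x i. x \<in> S ==> i < length (l x) ==> (x, foldl (f x) (a x) (take i (l x)), l x ! i) \<in> T"
  and B: "PB S B" "\<And>x i. x \<in> S ==> i \<le> length (l x) ==> sz (foldl (f x) (a x) (take i (l x))) \<le> B x"
 shows "FP S (%x. foldl (f x) (a x) (l x))"
proof -
 define g where "g x z = (f x (fst z) (hd (snd z)), tl (snd z))" for x z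
 have g: "(g x ^^ i) (a x, l x) = (foldl (f x) (a x) (take i (l x)), drop i (l x))" if "i \<le> length (l x)" for x i
  using that
  by (induction i) (auto simp: g_def take_Suc_conv_app_nth hd_drop_conv_nth tl_drop drop_Suc)
 let ?T = "{(x, z). snd z \<noteq> [] \<and> (x, fst z, hd (snd z)) \<in> T}"
 have "FP ?T (%w. (f (fst w) (fst (snd w)) (hd (snd (snd w)))))"
 proof -
  have "FP ?T (%w. (fst w, fst (snd w), hd (snd (snd w))))"
   by (intro FP_Pair FP_fst FP_snd FP_hd FP_id) auto
  from FP_compose[OF f this] show ?thesis by auto
 qed
 hence "FP ?T (%z. g (fst z) (snd z))"
  unfolding g_def by (intro FP_Pair FP_tl FP_snd FP_id)
 hence "FP S (%x. (g x ^^ length (l x)) (a x, l x))"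
 proof (rule FP_iter[where B="%x. 1 + B x + sz (l x)"])
  show "PB S (%x. 1 + B x + sz (l x))" by (intro PB_intros B FP_sz l)
  show "FP S (%x. length (l x))" by (intro FP_length l)
  show "FP S (%x. (a x, l x))" by (intro FP_Pair a l)
 qed (auto simp: g hd_drop_conv_nth sz_Pair T intro: add_mono B(2) sz_drop)
 from FP_fst[OF this] show ?thesis by (simp add: g)
qed

lemma sz_append: "sz (l @ m) + 1 = sz l + sz m"
 by (induction l) (auto simp: sz_Nil sz_Cons)

lemma sz_rev: "sz (rev l) = sz l"
proof (induction l)
 case (Cons a l)
 thus ?case using sz_append[of "rev l" "[a]"] by (simp add: sz_Cons sz_Nil)
qed simp

lemma FP_rev: assumes "FP S l" shows "FP S (%x. rev (l x))"
proof -
 have eq: "foldl (%acc y. y # acc) a l = rev l @ a" for l a :: "'b list" by (induction l arbitrary: a) auto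
 have "FP S (%x. foldl (%acc y. y # acc) [] (l x))"
 proof (rule FP_foldl[where T=UNIV and B="%x. sz (l x)"])
  show "PB S (%x. sz (l x))" by (intro FP_sz assms)
 qed (auto intro!: FP_Cons FP_snd FP_fst FP_id FP_const assms simp: eq sz_rev sz_take)
 thus ?thesis by (simp add: eq)
qed

lemma FP_append: assumes "FP S l" "FP S m" shows "FP S (%x. l x @ m x)"
proof -
 have eq: "foldl (%acc y. y # acc) a l = rev l @ a" for l a :: "'b list" by (induction l arbitrary: a) auto
 have "FP S (%x. foldl (%acc y. y # acc) (m x) (rev (l x)))"
 proof (rule FP_foldl[where T=UNIV and B="%x. sz (l x) + sz (m x)"])
  show "PB S (%x. sz (l x) + sz (m x))" by (intro PB_add FP_sz assms)
  show "sz (foldl (%acc y. y # acc) (m x) (take i (rev (l x)))) \<le> sz (l x) + sz (m x)" for x i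
   using sz_append[of "rev (take i (rev (l x)))" "m x"] sz_take[of i "rev (l x)"] by (simp add: eq sz_rev)
 qed (auto intro!: FP_Cons FP_snd FP_fst FP_id FP_const FP_rev assms)
 thus ?thesis by (simp add: eq)
qed

lemma sz_map_le: "(\<And>y. y \<in> set l ==> sz (f y) \<le> b) ==> sz (map f l) \<le> 1 + length l * (1 + b)"
proof (induction l)
 case (Cons a l)
 hence "sz (f a) \<le> b" "sz (map f l) \<le> 1 + length l * (1 + b)" by auto
 thus ?case by (simp add: sz_Cons)
qed (simp add: sz_Nil)

lemma FP_tab:
 assumes f: "FP {z. fst z \<in> S \<and> snd z < n (fst z)} (%z. f (fst z) (snd z))" and n: "FP S n"
 shows "FP S (%x. map (f x) [0..<n x])"
proof -
 let ?T = "{z. fst z \<in> S \<and> snd z < n (fst z)}"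
 \<comment> \<open>The index counts down, so that every new entry is put in front of the
   list.\<close>
 define g where "g x z = (fst z - Suc 0, f x (fst z - Suc 0) # snd z)" for x z
 have g: "(g x ^^ i) (n x, []) = (n x - i, map (f x) [n x - i..<n x])" if "i \<le> n x" for x i
  using that
 proof (induction i)
  case (Suc i)
  hence "[n x - Suc i..<n x] = (n x - Suc i) # [n x - i..<n x]"
   by (subst upt_conv_Cons) (auto simp: Suc_diff_Suc)
  thus ?case using Suc by (simp add: g_def)
 qed simp
 let ?U = "{(x, z). x \<in> S \<and> 0 < fst z \<and> fst z \<le> n x}"
 have "FP ?U (%w. f (fst w) (fst (snd w) - Suc 0))"
 proof -
  have "FP ?U (%w. (fst w, fst (snd w) - Suc 0))"
   by (intro FP_Pair FP_fst FP_snd FP_pred FP_id)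
  hence "FP ?U (%w. f (fst (fst w, fst (snd w) - Suc 0)) (snd (fst w, fst (snd w) - Suc 0)))"
   by (rule FP_compose[OF f]) auto
  thus ?thesis by simp
 qed
 hence gFP: "FP ?U (%z. g (fst z) (snd z))"
  unfolding g_def by (intro FP_Pair FP_Cons FP_pred FP_fst FP_snd FP_id)
 have Bn: "PB S (%x. 2 * n x + 1)" by (intro PB_intros PB_nat n)
 obtain c where c: "PB S c" "\<And>x y. x \<in> S ==> (x, y) \<in> ?T ==> sz y \<le> 2 * n x + 1 ==> sz (f (fst (x, y)) (snd (x, y))) \<le> c x"
  by (rule PB_uniform[OF FP_sz[OF f] Bn]) (rule that)
 have "FP S (%x. (g x ^^ n x) (n x, []))"
 proof (rule FP_iter[OF gFP n, where B="%x. 1 + (2 * n x + 1) + (1 + n x * (1 + c x))"])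
  show "FP S (%x. (n x, []))" by (intro FP_Pair n FP_Nil)
  show "PB S (%x. 1 + (2 * n x + 1) + (1 + n x * (1 + c x)))" by (intro PB_intros PB_nat n c)
  show "sz ((g x ^^ i) (n x, [])) \<le> 1 + (2 * n x + 1) + (1 + n x * (1 + c x))" if "x \<in> S" "i \<le> n x" for x i
  proof -
   have "sz (map (f x) [n x - i..<n x]) \<le> 1 + length [n x - i..<n x] * (1 + c x)"
    using c(2)[OF that(1)] that by (intro sz_map_le) (auto simp: sz_nat)
   also have "\<dots> \<le> 1 + n x * (1 + c x)" using that mult_le_mono1[of i "n x" "1 + c x"] by simp
   finally show ?thesis using that by (simp add: g sz_Pair sz_nat)
  qed
 qed (auto simp: g)
 from FP_snd[OF this] show ?thesis by (simp add: g)
qed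

subsection \<open>Rationals\<close>

definition nu :: "rat => int" where "nu r = fst (quotient_of r)"
definition de :: "rat => int" where "de r = snd (quotient_of r)"

lemma de_pos: "0 < de r"
 by (simp add: de_def quotient_of_denom_pos')

lemma nu_de: "r = of_int (nu r) / of_int (de r)"
 using quotient_of_div[of r "nu r" "de r"] by (simp add: nu_def de_def)

lemma rat_mult_de: "of_int (de r) * r = of_int (nu r)"
 using nu_de[of r] de_pos[of r] by (simp add: field_simps)

lemma sz_rat: "sz r = 1 + int_size (nu r) + int_size (de r)"
 by (simp add: sz_def enc_rat_def nu_def de_def enc_prod_def enc_int_def)

lemma FP_nu: assumes "FP S r" shows "FP S (%x. nu (r x))"
proof -
 have "FP S (%x. quotient_of (r x))" using assms by (rule FP_enc_cong) (simp add: enc_rat_def)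
 from FP_fst[OF this] show ?thesis by (simp add: nu_def)
qed

lemma FP_de: assumes "FP S r" shows "FP S (%x. de (r x))"
proof -
 have "FP S (%x. quotient_of (r x))" using assms by (rule FP_enc_cong) (simp add: enc_rat_def)
 from FP_snd[OF this] show ?thesis by (simp add: de_def)
qed

definition euclid :: "int \<times> int => int \<times> int" where
 "euclid z = (if snd z = 0 then z else (snd z, fst z mod snd z))"

lemma euclid_gcd: "gcd (fst (euclid z)) (snd (euclid z)) = gcd (fst z) (snd z)"
 using gcd_red_int[of "fst z" "snd z"] by (simp add: euclid_def)

text \<open>Once the first component is the larger one, the remainder is at most half of it, so a
  step halves the product of both components. The very first step may merely exchange them, hence
  the exponent \<open>k - 1\<close>.\<close>

lemma euclid_iter:
 assumes "0 \<le> a" "0 \<le> b" "z = (euclid ^^ k) (a, b)"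
 shows "gcd (fst z) (snd z) = gcd a b \<and> 0 \<le> fst z \<and> 0 \<le> snd z \<and> fst z \<le> max a b \<and> snd z \<le> max a b \<and>
  (0 < k --> (snd z \<le> fst z \<or> snd z = 0) \<and> fst z * snd z * 2 ^ (k - 1) \<le> a * b)"
 using assms(3)
proof (induction k arbitrary: z)
 case 0
 thus ?case using assms by auto
next
 case (Suc k)
 define y where "y = (euclid ^^ k) (a, b)"
 have z: "z = euclid y" using Suc.prems by (simp add: y_def)
 note IH = Suc.IH[OF y_def]
 obtain u v where y: "y = (u, v)" by fastforce
 show ?case
 proof (cases "v = 0")
  case True
  hence "z = y" using z y by (simp add: euclid_def)
  moreover have "0 \<le> a * b" using assms by simp
  ultimately show ?thesis using IH y True by simp
 next
  case False
  hence v: "0 < v" using IH y by auto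
  have zz: "z = (v, u mod v)" using z y False by (simp add: euclid_def)
  have m: "0 \<le> u mod v" "u mod v < v" using v by (simp_all only: pos_mod_sign pos_mod_bound)
  have "v * (u mod v) * 2 ^ k \<le> a * b"
  proof (cases k)
   case 0
   hence "u = a" "v = b" using y y_def by auto
   thus ?thesis using 0 assms v
    using mult_right_mono[OF zmod_le_nonneg_dividend[of u v], of v] by (simp add: mult.commute)
  next
   case (Suc j)
   hence uv: "v \<le> u" "u * v * 2 ^ j \<le> a * b" using IH y v by auto
   have "u = v * (u div v) + u mod v" by (simp only: mult_div_mod_eq)
   moreover have "1 \<le> u div v" using uv v by (simp add: pos_imp_zdiv_pos_iff int_one_le_iff_zero_less)
   hence "v * 1 \<le> v * (u div v)" using v by (intro mult_left_mono) auto
   ultimately have "2 * (u mod v) \<le> u" using m by linarith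
   hence "v * (2 * (u mod v)) * 2 ^ j \<le> v * u * 2 ^ j" using v by (intro mult_right_mono mult_left_mono) auto
   thus ?thesis using uv Suc by (simp add: mult_ac)
  qed
  moreover have "gcd v (u mod v) = gcd a b" using IH euclid_gcd[of y] z zz by (metis fst_conv snd_conv)
  moreover have "v \<le> max a b" using IH y by simp
  moreover have "u mod v \<le> max a b" "u mod v \<le> v" "0 \<le> v" using m calculation by auto
  ultimately show ?thesis
   unfolding zz fst_conv snd_conv diff_Suc_1 using m by blast
 qed
qed

lemma FP_gcd: assumes "FP S a" "FP S b" shows "FP S (%x. gcd (a x) (b x) :: int)"
proof -
 \<comment> \<open>One step for the possible exchange and one per bit of the product: the product is
   then below 1, which forces the second component to be 0.\<close>
 let ?n = "%x. Suc (floorlog 2 (nat (\<bar>a x\<bar> * \<bar>b x\<bar>)))"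
 have "FP S (%x. (euclid ^^ ?n x) (\<bar>a x\<bar>, \<bar>b x\<bar>))"
 proof (rule FP_iter[where T=UNIV and B="%x. 1 + 2 * (sz (a x) + sz (b x))"])
  show "FP UNIV (%z::'a \<times> int \<times> int. euclid (snd z))"
   unfolding euclid_def by (intro FP_If FP_Pair FP_int_eq FP_int_mod FP_fst FP_snd FP_id FP_const)
  show "PB S (%x. 1 + 2 * (sz (a x) + sz (b x)))" by (intro PB_intros FP_sz assms)
  show "FP S (%x. (\<bar>a x\<bar>, \<bar>b x\<bar>))" by (intro FP_Pair FP_int_abs assms)
  show "FP S ?n" by (intro FP_Suc FP_bits FP_int_mult FP_int_abs assms)
  show "sz ((euclid ^^ i) (\<bar>a x\<bar>, \<bar>b x\<bar>)) \<le> 1 + 2 * (sz (a x) + sz (b x))" for x i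
  proof -
   define z where "z = (euclid ^^ i) (\<bar>a x\<bar>, \<bar>b x\<bar>)"
   note e = euclid_iter[of "\<bar>a x\<bar>" "\<bar>b x\<bar>" z i, OF _ _ z_def]
   have m: "int_size (max \<bar>a x\<bar> \<bar>b x\<bar>) \<le> int_size (a x) + int_size (b x)"
    by (auto simp: max_def int_size_def)
   have "int_size (fst z) \<le> int_size (max \<bar>a x\<bar> \<bar>b x\<bar>)" "int_size (snd z) \<le> int_size (max \<bar>a x\<bar> \<bar>b x\<bar>)"
    using e by (auto intro!: int_size_mono)
   hence "sz z \<le> 1 + 2 * (sz (a x) + sz (b x))"
    using m sz_Pair[of "fst z" "snd z"] by (simp add: sz_int)
   thus ?thesis by (simp add: z_def)
  qed
 qed auto
 from FP_fst[OF this] show ?thesis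
 proof (rule FP_cong)
  fix x
  define z where "z = (euclid ^^ ?n x) (\<bar>a x\<bar>, \<bar>b x\<bar>)"
  note e = euclid_iter[of "\<bar>a x\<bar>" "\<bar>b x\<bar>" z "?n x", OF _ _ z_def]
  define k where "k = floorlog 2 (nat (\<bar>a x\<bar> * \<bar>b x\<bar>))"
  have "nat (\<bar>a x\<bar> * \<bar>b x\<bar>) < 2 ^ k" unfolding k_def by (rule floorlog_leD) simp_all
  hence "int (nat (\<bar>a x\<bar> * \<bar>b x\<bar>)) < int (2 ^ k)" by (simp only: of_nat_less_iff)
  hence "\<bar>a x\<bar> * \<bar>b x\<bar> < 2 ^ k" by simp
  moreover have "fst z * snd z * 2 ^ k \<le> \<bar>a x\<bar> * \<bar>b x\<bar>" using e by (simp add: k_def)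
  ultimately have lt: "fst z * snd z * 2 ^ k < 1 * 2 ^ k" by linarith
  have "snd z = 0"
  proof (rule ccontr)
   assume "snd z \<noteq> 0"
   hence "1 \<le> snd z" "1 \<le> fst z" using e by auto
   hence "1 * 1 \<le> fst z * snd z" by (intro mult_mono) auto
   hence "1 * 2 ^ k \<le> fst z * snd z * 2 ^ k" by (intro mult_right_mono) auto
   thus False using lt by simp
  qed
  moreover have "gcd (fst z) (snd z) = gcd (a x) (b x)" "0 \<le> fst z" using e by auto
  ultimately have "fst z = gcd (a x) (b x)" by simp
  thus "gcd (a x) (b x) = fst ((euclid ^^ ?n x) (\<bar>a x\<bar>, \<bar>b x\<bar>))" by (simp add: z_def)
 qed
qed

text \<open>Keeping rationals in lowest terms is what requires Euclid's algorithm. In return the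
  size of a rational depends on its value only, and can be bounded without regard to how it was
  computed.\<close>

lemma FP_Fract: assumes "FP S a" "FP S b" shows "FP S (%x. Rat.Fract (a x) (b x))"
proof -
 have "FP S (%x. Rat.normalize (a x, b x))"
  unfolding Rat.normalize_def Let_def
  by (intro FP_If FP_Pair FP_int_less FP_int_eq FP_int_div FP_int_uminus FP_gcd FP_fst FP_snd FP_const assms)
 thus ?thesis by (rule FP_enc_cong) (simp add: enc_rat_def quotient_of_Fract)
qed

lemma FP_of_int: "FP S a ==> FP S (%x. of_int (a x) :: rat)"
 unfolding Fract_of_int_eq[symmetric] by (intro FP_Fract FP_const)

lemma rat_add_Fract: "r + s = Rat.Fract (nu r * de s + nu s * de r) (de r * de s)"
proof -
 define a b c d where abcd: "a = nu r" "b = de r" "c = nu s" "d = de s"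
 have "r = of_int a / of_int b" "s = of_int c / of_int d" "b \<noteq> 0" "d \<noteq> 0"
  unfolding abcd using nu_de de_pos by (auto simp: order.strict_iff_order)
 hence "r + s = Rat.Fract (a * d + c * b) (b * d)"
  by (simp add: Fract_of_int_quotient add_frac_eq)
 thus ?thesis by (simp add: abcd)
qed

lemma rat_mult_Fract: "r * s = Rat.Fract (nu r * nu s) (de r * de s)"
proof -
 define a b c d where abcd: "a = nu r" "b = de r" "c = nu s" "d = de s"
 have "r = of_int a / of_int b" "s = of_int c / of_int d"
  unfolding abcd using nu_de by auto
 hence "r * s = Rat.Fract (a * c) (b * d)" by (simp add: Fract_of_int_quotient)
 thus ?thesis by (simp add: abcd)
qed

lemma rat_divide_Fract: "r / s = Rat.Fract (nu r * de s) (de r * nu s)"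
proof -
 define a b c d where abcd: "a = nu r" "b = de r" "c = nu s" "d = de s"
 have "r = of_int a / of_int b" "s = of_int c / of_int d"
  unfolding abcd using nu_de by auto
 hence "r / s = Rat.Fract (a * d) (b * c)" by (simp add: Fract_of_int_quotient)
 thus ?thesis by (simp add: abcd)
qed

lemma FP_rat_add: "FP S r ==> FP S s ==> FP S (%x. r x + s x :: rat)"
 unfolding rat_add_Fract by (intro FP_Fract FP_int_add FP_int_mult FP_nu FP_de)

lemma FP_rat_mult: "FP S r ==> FP S s ==> FP S (%x. r x * s x :: rat)"
 unfolding rat_mult_Fract by (intro FP_Fract FP_int_mult FP_nu FP_de)

lemma FP_rat_divide: "FP S r ==> FP S s ==> FP S (%x. r x / s x :: rat)"
 unfolding rat_divide_Fract by (intro FP_Fract FP_int_mult FP_nu FP_de)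

lemma FP_rat_uminus: assumes "FP S r" shows "FP S (%x. - r x :: rat)"
proof -
 have "FP S (%x. (- 1) * r x)" by (intro FP_rat_mult FP_const assms)
 thus ?thesis by (simp only: mult_minus1)
qed

lemma FP_rat_diff: assumes "FP S r" "FP S s" shows "FP S (%x. r x - s x :: rat)"
 unfolding diff_conv_add_uminus by (intro FP_rat_add FP_rat_uminus assms)

lemma FP_rat_less: assumes "FP S r" "FP S s" shows "FP S (%x. r x < (s x :: rat))"
proof -
 have "FP S (%x. nu (r x) * de (s x) < nu (s x) * de (r x))"
  by (intro FP_int_less FP_int_mult FP_nu FP_de assms)
 thus ?thesis by (rule FP_cong) (simp add: rat_less_code nu_def de_def mult.commute split: prod.split)
qed

lemma FP_rat_le: "FP S r ==> FP S s ==> FP S (%x. r x \<le> (s x :: rat))"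
 unfolding not_less[symmetric] by (intro FP_not FP_rat_less)

lemma FP_rat_abs: "FP S r ==> FP S (%x. \<bar>r x\<bar> :: rat)"
 unfolding abs_if by (intro FP_If FP_rat_less FP_const FP_rat_uminus)

lemma FP_floor: fixes r :: "_ => rat" assumes "FP S r" shows "FP S (%x. \<lfloor>r x\<rfloor>)"
proof -
 have "FP S (%x. nu (r x) div de (r x))" by (intro FP_int_div FP_nu FP_de assms)
 thus ?thesis by (rule FP_cong) (simp add: rat_floor_code nu_def de_def split: prod.split)
qed

lemma FP_round: fixes r :: "_ => rat" shows "FP S r ==> FP S (%x. round (r x))"
 unfolding round_def by (intro FP_floor FP_rat_add FP_const)

text \<open>The reduced denominator divides every integer \<open>D\<close> that clears the
  denominator, and the numerator is the denominator times the value. All size bounds for rationals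
  below go through this lemma.\<close>

lemma sz_rat_le:
 fixes r :: rat
 assumes D: "0 < D" "of_int D * r \<in> \<int>" "D \<le> 2 ^ a" and r: "\<bar>r\<bar> \<le> 2 ^ b"
 shows "sz r \<le> 2 * a + b + 5"
proof -
 from D(2) obtain k where k: "of_int D * r = of_int k" by (rule Ints_cases)
 hence "r = Rat.Fract k D" using D(1) by (simp add: Fract_of_int_quotient k[symmetric])
 hence "de r = D div gcd k D" using D(1) by (simp add: de_def quotient_of_Fract Rat.normalize_def Let_def)
 hence "de r \<le> D" using abs_div_le[of D "gcd k D"] D(1) by simp
 hence d: "de r \<le> 2 ^ a" using D by simp
 have "\<bar>of_int (nu r)\<bar> = of_int (de r) * \<bar>r\<bar>" unfolding rat_mult_de[of r, symmetric] using de_pos[of r] by (simp add: abs_mult)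
 also have "\<dots> \<le> 2 ^ a * 2 ^ b"
 proof (rule mult_mono[OF _ r])
  have "of_int (de r) \<le> (of_int (2 ^ a) :: rat)" using d by (simp only: of_int_le_iff)
  thus "of_int (de r) \<le> (2 ^ a :: rat)" by simp
 qed simp_all
 finally have "of_int \<bar>nu r\<bar> \<le> (of_int (2 ^ (a + b)) :: rat)" by (simp add: power_add)
 hence "\<bar>nu r\<bar> \<le> 2 ^ (a + b)" by (simp only: of_int_le_iff)
 hence "int_size (nu r) \<le> a + b + 2" by (rule int_size_le_pow)
 moreover have "int_size (de r) \<le> a + 2" using d de_pos[of r] by (intro int_size_le_pow) simp
 ultimately show ?thesis by (simp add: sz_rat)
qed

lemma de_le: "de r \<le> 2 ^ sz r"
proof -
 have "de r < 2 ^ int_size (de r)" using abs_less_int_size[of "de r"] by simp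
 also have "\<dots> \<le> 2 ^ sz r" by (rule power_increasing) (auto simp: sz_rat)
 finally show ?thesis by simp
qed

lemma abs_rat_le: fixes r :: rat shows "\<bar>r\<bar> \<le> 2 ^ sz r"
proof -
 have "\<bar>r\<bar> = of_int \<bar>nu r\<bar> / of_int (de r)" using de_pos[of r] by (subst nu_de[of r]) (simp add: abs_divide)
 also have "\<dots> \<le> of_int \<bar>nu r\<bar> / 1" using de_pos[of r] by (intro divide_left_mono) (auto simp: int_one_le_iff_zero_less)
 also have "\<dots> \<le> of_int (2 ^ int_size (nu r))"
  using abs_less_int_size[of "nu r"] unfolding div_by_1 of_int_le_iff by (rule less_imp_le)
 also have "\<dots> = 2 ^ int_size (nu r)" by simp
 also have "\<dots> \<le> 2 ^ sz r" by (rule power_increasing) (auto simp: sz_rat)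
 finally show ?thesis .
qed

lemma of_nat_le_pow2: "of_nat n \<le> (2::'a::linordered_idom) ^ n"
proof -
 have "n \<le> 2 ^ n" using less_exp[of n] by simp
 hence "of_nat n \<le> (of_nat (2 ^ n) :: 'a)" by (simp only: of_nat_le_iff)
 thus ?thesis by simp
qed

lemma prod_de_clear: fixes f :: "nat => rat" assumes "l < n" shows "of_int (\<Prod>l<n. de (f l)) * f l \<in> \<int>"
proof -
 have "(\<Prod>l<n. de (f l)) = de (f l) * (\<Prod>i\<in>{..<n} - {l}. de (f i))"
  using prod.remove[of "{..<n}" l "%l. de (f l)"] assms by simp
 hence "of_int (\<Prod>l<n. de (f l)) * f l = of_int (\<Prod>i\<in>{..<n} - {l}. de (f i)) * (of_int (de (f l)) * f l)"
  by (simp only: of_int_mult mult_ac)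
 thus ?thesis unfolding rat_mult_de by (simp only:) (intro Ints_mult Ints_of_int)
qed

lemma prod_de_le: assumes "\<And>l. l < n ==> sz (f l) \<le> s" shows "0 < (\<Prod>l<n. de (f l))" "(\<Prod>l<n. de (f l)) \<le> 2 ^ (n * s)"
proof -
 show "0 < (\<Prod>l<n. de (f l))" by (rule prod_pos) (simp add: de_pos)
 have "(\<Prod>l<n. de (f l)) \<le> (\<Prod>l<n. 2 ^ s)"
 proof (rule prod_mono)
  fix l assume "l \<in> {..<n}"
  hence "(2::int) ^ sz (f l) \<le> 2 ^ s" using assms by (intro power_increasing) auto
  thus "0 \<le> de (f l) \<and> de (f l) \<le> 2 ^ s" using de_le[of "f l"] de_pos[of "f l"] by linarith
 qed
 also have "\<dots> = 2 ^ (n * s)" by (simp add: power_mult[symmetric] mult.commute)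
 finally show "(\<Prod>l<n. de (f l)) \<le> 2 ^ (n * s)" .
qed

lemma FP_sum:
 fixes f :: "'x::enc => nat => rat"
 assumes f: "FP {z. fst z \<in> S \<and> snd z < n (fst z)} (%z. f (fst z) (snd z))" and n: "FP S n"
 shows "FP S (%x. \<Sum>i<n x. f x i)"
proof -
 let ?T = "{z. fst z \<in> S \<and> snd z < n (fst z)}"
 define g where "g x z = (Suc (fst z), snd z + f x (fst z))" for x z
 have g: "(g x ^^ i) (0, 0) = (i, \<Sum>j<i. f x j)" for x i
  by (induction i) (auto simp: g_def)
 let ?U = "{(x, z). x \<in> S \<and> fst z < n x}"
 have "FP ?U (%w. f (fst w) (fst (snd w)))"
 proof -
  have "FP ?U (%w. (fst w, fst (snd w)))" by (intro FP_Pair FP_fst FP_snd FP_id)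
  hence "FP ?U (%w. f (fst (fst w, fst (snd w))) (snd (fst w, fst (snd w))))"
   by (rule FP_compose[OF f]) auto
  thus ?thesis by simp
 qed
 hence gFP: "FP ?U (%z. g (fst z) (snd z))"
  unfolding g_def by (intro FP_Pair FP_Suc FP_rat_add FP_fst FP_snd FP_id)
 have Bn: "PB S (%x. 2 * n x + 1)" by (intro PB_intros PB_nat n)
 obtain c where c: "PB S c" "\<And>x y. x \<in> S ==> (x, y) \<in> ?T ==> sz y \<le> 2 * n x + 1 ==> sz (f (fst (x, y)) (snd (x, y))) \<le> c x"
  by (rule PB_uniform[OF FP_sz[OF f] Bn]) (rule that)
 have "FP S (%x. (g x ^^ n x) (0, 0))"
 proof (rule FP_iter[OF gFP n, where B="%x. 1 + (2 * n x + 1) + (2 * (c x * n x) + (n x + c x) + 5)"])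
  show "FP S (%x. (0, 0))" by (intro FP_const)
  show "PB S (%x. 1 + (2 * n x + 1) + (2 * (c x * n x) + (n x + c x) + 5))" by (intro PB_intros PB_nat n c)
  show "sz ((g x ^^ i) (0, 0)) \<le> 1 + (2 * n x + 1) + (2 * (c x * n x) + (n x + c x) + 5)" if x: "x \<in> S" and i: "i \<le> n x" for x i
  proof -
   have fc: "sz (f x j) \<le> c x" if "j < i" for j using c(2)[OF x, of j] x i that by (simp add: sz_nat)
   \<comment> \<open>The product of the denominators clears every partial sum, and its bit length is
     linear in the number of summands.\<close>
   define D where "D = (\<Prod>j<i. de (f x j))"
   have "sz (\<Sum>j<i. f x j) \<le> 2 * (c x * n x) + (n x + c x) + 5"
   proof (rule sz_rat_le[of D])
    show "0 < D" "D \<le> 2 ^ (c x * n x)"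
    proof -
     show "0 < D" unfolding D_def by (rule prod_de_le(1)) (use fc in auto)
     have "D \<le> 2 ^ (i * c x)" unfolding D_def by (rule prod_de_le(2)) (use fc in auto)
     also have "\<dots> \<le> 2 ^ (c x * n x)" using i by (intro power_increasing) (auto simp: mult.commute)
     finally show "D \<le> 2 ^ (c x * n x)" .
    qed
    show "of_int D * (\<Sum>j<i. f x j) \<in> \<int>"
     unfolding sum_distrib_left D_def by (rule Ints_sum, rule prod_de_clear) simp
    have "\<bar>\<Sum>j<i. f x j\<bar> \<le> (\<Sum>j<i. 2 ^ c x)"
    proof (rule order.trans[OF sum_abs sum_mono])
     fix j assume j: "j \<in> {..<i}"
     have "\<bar>f x j\<bar> \<le> 2 ^ sz (f x j)" by (rule abs_rat_le)
     also have "\<dots> \<le> 2 ^ c x" using fc j by (intro power_increasing) auto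
     finally show "\<bar>f x j\<bar> \<le> 2 ^ c x" .
    qed
    also have "\<dots> = of_nat i * 2 ^ c x" by simp
    also have "\<dots> \<le> 2 ^ n x * 2 ^ c x"
    proof (rule mult_right_mono)
     have "(of_nat i :: rat) \<le> of_nat (n x)" using i by simp
     also have "\<dots> \<le> 2 ^ n x" by (rule of_nat_le_pow2)
     finally show "(of_nat i :: rat) \<le> 2 ^ n x" .
    qed simp
    finally show "\<bar>\<Sum>j<i. f x j\<bar> \<le> 2 ^ (n x + c x)" by (simp add: power_add)
   qed
   thus ?thesis using i by (simp add: g sz_Pair sz_nat)
  qed
 qed (auto simp: g)
 from FP_snd[OF this] show ?thesis by (simp add: g)
qed

lemma FP_prod:
 fixes f :: "'x::enc => nat => int"
 assumes f: "FP {z. fst z \<in> S \<and> snd z < n (fst z)} (%z. f (fst z) (snd z))" and n: "FP S n"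
 shows "FP S (%x. \<Prod>i<n x. f x i)"
proof -
 let ?T = "{z. fst z \<in> S \<and> snd z < n (fst z)}"
 define g where "g x z = (Suc (fst z), snd z * f x (fst z))" for x z
 have g: "(g x ^^ i) (0, 1) = (i, \<Prod>j<i. f x j)" for x i
  by (induction i) (auto simp: g_def)
 let ?U = "{(x, z). x \<in> S \<and> fst z < n x}"
 have "FP ?U (%w. f (fst w) (fst (snd w)))"
 proof -
  have "FP ?U (%w. (fst w, fst (snd w)))" by (intro FP_Pair FP_fst FP_snd FP_id)
  hence "FP ?U (%w. f (fst (fst w, fst (snd w))) (snd (fst w, fst (snd w))))"
   by (rule FP_compose[OF f]) auto
  thus ?thesis by simp
 qed
 hence gFP: "FP ?U (%z. g (fst z) (snd z))"
  unfolding g_def by (intro FP_Pair FP_Suc FP_int_mult FP_fst FP_snd FP_id)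
 have Bn: "PB S (%x. 2 * n x + 1)" by (intro PB_intros PB_nat n)
 obtain c where c: "PB S c" "\<And>x y. x \<in> S ==> (x, y) \<in> ?T ==> sz y \<le> 2 * n x + 1 ==> sz (f (fst (x, y)) (snd (x, y))) \<le> c x"
  by (rule PB_uniform[OF FP_sz[OF f] Bn]) (rule that)
 have "FP S (%x. (g x ^^ n x) (0, 1))"
 proof (rule FP_iter[OF gFP n, where B="%x. 1 + (2 * n x + 1) + (n x * c x + 3)"])
  show "FP S (%x. (0, 1))" by (intro FP_const)
  show "PB S (%x. 1 + (2 * n x + 1) + (n x * c x + 3))" by (intro PB_intros PB_nat n c)
  show "sz ((g x ^^ i) (0, 1)) \<le> 1 + (2 * n x + 1) + (n x * c x + 3)" if x: "x \<in> S" and i: "i \<le> n x" for x i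
  proof -
   have "sz (f x j) \<le> c x" if "j < i" for j using c(2)[OF x, of j] x i that by (simp add: sz_nat)
   hence "int_size (\<Prod>j<i. f x j) \<le> i * c x + 3"
   proof (induction i)
    case (Suc i)
    have "int_size (\<Prod>j<Suc i. f x j) \<le> int_size (\<Prod>j<i. f x j) + int_size (f x i)"
     by (simp add: int_size_mult)
    moreover have "int_size (\<Prod>j<i. f x j) \<le> i * c x + 3" using Suc.prems by (intro Suc.IH) auto
    moreover have "int_size (f x i) \<le> c x" using Suc.prems[of i] by (simp add: sz_int)
    ultimately show ?case by simp
   qed (use int_size_le_nat[of 1] in simp)
   also have "\<dots> \<le> n x * c x + 3" using i by simp
   finally show ?thesis using i by (simp add: g sz_Pair sz_nat sz_int)
  qed
 qed (auto simp: g)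
 from FP_snd[OF this] show ?thesis by (simp add: g)
qed

section \<open>Gram-Schmidt orthogonalisation\<close>

definition dt :: "nat => (nat => 'a::comm_ring_1) => (nat => 'a) => 'a" where
 "dt n x y = (\<Sum>i<n. x i * y i)"

definition bil :: "nat => (nat => nat => 'a::comm_ring_1) => (nat => 'a) => (nat => 'a) => 'a" where
 "bil n A x y = (\<Sum>i<n. \<Sum>j<n. x i * A i j * y j)"

lemma dt_cong: "(\<And>i. i < n ==> x i = x' i) ==> (\<And>i. i < n ==> y i = y' i) ==> dt n x y = dt n x' y'"
 unfolding dt_def by (intro sum.cong) auto

lemma bil_cong:
 "(\<And>i j. i < n ==> j < n ==> A i j = A' i j) ==> (\<And>i. i < n ==> x i = x' i) ==>
  (\<And>i. i < n ==> y i = y' i) ==> bil n A x y = bil n A' x' y'"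
 unfolding bil_def by (intro sum.cong) auto

lemma dt_commute: "dt n x y = dt n y x"
 by (simp add: dt_def mult.commute)

lemma dt_add: "dt n x (%i. y i + z i) = dt n x y + dt n x z"
 by (simp add: dt_def algebra_simps sum.distrib)

lemma dt_diff: "dt n x (%i. y i - z i) = dt n x y - dt n x z"
 by (simp add: dt_def algebra_simps sum_subtractf)

lemma dt_scale: "dt n x (%i. c * y i) = c * dt n x y"
 by (simp add: dt_def sum_distrib_left mult_ac)

lemma dt_sum: "dt n x (%i. \<Sum>k\<in>K. f k i) = (\<Sum>k\<in>K. dt n x (f k))"
 unfolding dt_def sum_distrib_left by (rule sum.swap)

lemma dt_sum_left: "dt n (%i. \<Sum>k\<in>K. f k i) x = (\<Sum>k\<in>K. dt n (f k) x)"
 unfolding dt_def sum_distrib_right by (rule sum.swap)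

lemma bil_dt: "bil n A x y = dt n x (%i. \<Sum>j<n. A i j * y j)"
 by (simp add: bil_def dt_def sum_distrib_left mult_ac)

lemma bil_dt': "bil n A x y = dt n (%j. \<Sum>i<n. x i * A i j) y"
 unfolding bil_def dt_def sum_distrib_right by (rule sum.swap)

lemma bil_add_right: "bil n A x (%i. y i + z i) = bil n A x y + bil n A x z"
 by (simp add: bil_dt' dt_add)

lemma bil_diff_right: "bil n A x (%i. y i - z i) = bil n A x y - bil n A x z"
 by (simp add: bil_dt' dt_diff)

lemma bil_scale_right: "bil n A x (%i. c * y i) = c * bil n A x y"
 by (simp add: bil_dt' dt_scale)

lemma bil_sum_right: "bil n A x (%i. \<Sum>k\<in>K. f k i) = (\<Sum>k\<in>K. bil n A x (f k))"
 by (simp add: bil_dt' dt_sum)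

definition symm :: "nat => (nat => nat => 'a) => bool" where
 "symm n A \<longleftrightarrow> (\<forall>i<n. \<forall>j<n. A i j = A j i)"

lemma bil_sym: assumes "symm n A" shows "bil n A x y = bil n A y x"
proof -
 have "bil n A x y = (\<Sum>i<n. \<Sum>j<n. x i * A j i * y j)"
  unfolding bil_def using assms by (intro sum.cong) (auto simp: symm_def)
 also have "\<dots> = bil n A y x" unfolding bil_def by (subst sum.swap) (simp add: mult_ac)
 finally show ?thesis .
qed

lemma bil_add_left: "bil n A (%i. y i + z i) x = bil n A y x + bil n A z x"
 by (simp add: bil_dt dt_commute[of n _ "%i. \<Sum>j<n. A i j * x j"] dt_add)

lemma bil_diff_left: "bil n A (%i. y i - z i) x = bil n A y x - bil n A z x"
 by (simp add: bil_dt dt_commute[of n _ "%i. \<Sum>j<n. A i j * x j"] dt_diff)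

lemma bil_scale_left: "bil n A (%i. c * y i) x = c * bil n A y x"
 by (simp add: bil_dt dt_commute[of n _ "%i. \<Sum>j<n. A i j * x j"] dt_scale)

lemma bil_sum_left: "bil n A (%i. \<Sum>k\<in>K. f k i) x = (\<Sum>k\<in>K. bil n A (f k) x)"
 unfolding bil_dt by (rule dt_sum_left)

lemmas bil_linear = bil_add_right bil_diff_right bil_scale_right bil_sum_right
 bil_add_left bil_diff_left bil_scale_left bil_sum_left

text \<open>The algebra behind the exchange of two basis vectors: \<open>p\<close> and
  \<open>q\<close> are the squared norms of two orthogonal vectors, \<open>m\<close> is the
  coefficient between the basis vectors, and both sides are projections onto the same plane with
  denominators cleared.\<close>

lemma swap_identity:
 "p * q * (v + m * u) * (y + m * x) + (q * u - m * p * v) * (q * x - m * p * y)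
   = (u * x * q + v * y * p) * (q + m * m * p)" for m :: "'a::comm_ring_1"
 by (simp add: algebra_simps)

context
 fixes n :: nat and A :: "nat => nat => 'a::field"
begin

text \<open>The form may be indefinite, as this procedure is also the test whether H + l Q is
  definite. Positivity is replaced by the assumption that the norms divided by do not
  vanish.\<close>

function gs :: "(nat => nat => 'a) => nat => nat => 'a" where
 "gs w k = (%l. w k l - (\<Sum>j<k. bil n A (gs w j) (w k) / bil n A (gs w j) (gs w j) * gs w j l))"
 by auto
termination by (relation "measure snd") auto

declare gs.simps [simp del]

definition gq :: "(nat => nat => 'a) => nat => 'a" where
 "gq w k = bil n A (gs w k) (gs w k)"

definition gmu :: "(nat => nat => 'a) => nat => nat => 'a" where
 "gmu w i k = (if k < i then bil n A (gs w k) (w i) / gq w k else if k = i then 1 else 0)"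

lemma gs_eq: "gs w k l = w k l - (\<Sum>j<k. gmu w k j * gs w j l)"
 by (subst gs.simps) (simp add: gmu_def gq_def)

lemma gs_cong: "(\<And>j. j \<le> k ==> w j = w' j) ==> gs w k = gs w' k"
proof (induction k rule: less_induct)
 case (less k)
 hence "gs w j = gs w' j" if "j < k" for j using that by simp
 thus ?case using less.prems by (subst (1 2) gs.simps) (auto intro!: ext sum.cong)
qed

lemma gs_expand: "k < K ==> w k l = (\<Sum>j<K. gmu w k j * gs w j l)"
proof -
 assume k: "k < K"
 have "(\<Sum>j<K. gmu w k j * gs w j l) = (\<Sum>j<Suc k. gmu w k j * gs w j l)"
  by (rule sum.mono_neutral_right) (use k in \<open>auto simp: gmu_def\<close>)
 also have "\<dots> = w k l" using gs_eq[of w k l] by (simp add: gmu_def)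
 finally show ?thesis by simp
qed

lemma gs_expand': "k < K ==> w k = (%l. \<Sum>j<K. gmu w k j * gs w j l)"
 by (rule ext) (rule gs_expand)

context
 fixes w :: "nat => nat => 'a" and K :: nat
 assumes sym: "symm n A" and q: "\<And>j. j < K ==> gq w j \<noteq> 0"
begin

lemma gs_orth_less: "j \<le> K ==> i < j ==> bil n A (gs w i) (gs w j) = 0"
proof (induction j arbitrary: i rule: less_induct)
 case (less j)
 have IH: "bil n A (gs w i) (gs w l) = (if l = i then gq w i else 0)" if "l < j" for l
 proof (cases "l < i")
  case True
  thus ?thesis using less.IH[of i l] less.prems by (simp add: bil_sym[OF sym, of "gs w i"])
 next
  case False
  thus ?thesis using less.IH[of l i] less.prems that by (auto simp: gq_def)
 qed
 have "gs w j = (%l. w j l - (\<Sum>k<j. gmu w j k * gs w k l))" by (rule ext) (rule gs_eq)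
 hence "bil n A (gs w i) (gs w j) = bil n A (gs w i) (w j) - (\<Sum>k<j. gmu w j k * bil n A (gs w i) (gs w k))"
  by (simp add: bil_linear)
 also have "(\<Sum>k<j. gmu w j k * bil n A (gs w i) (gs w k)) = (\<Sum>k<j. if k = i then gmu w j i * gq w i else 0)"
  by (rule sum.cong) (auto simp: IH)
 also have "\<dots> = bil n A (gs w i) (w j)" using less.prems q[of i] by (simp add: gmu_def)
 finally show ?case by simp
qed

lemma gs_orth: "i < K ==> j < K ==> bil n A (gs w i) (gs w j) = (if i = j then gq w i else 0)"
 using gs_orth_less[of j i] gs_orth_less[of i j] bil_sym[OF sym, of "gs w i" "gs w j"]
 by (cases i j rule: linorder_cases) (auto simp: gq_def)

lemma gs_orth': "i < K ==> j \<le> K ==> i \<noteq> j ==> bil n A (gs w i) (gs w j) = 0"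
 using gs_orth_less[of j i] gs_orth_less[of i j] bil_sym[OF sym, of "gs w i" "gs w j"]
 by (cases i j rule: linorder_cases) auto

lemma bil_w_gs: "i < K ==> j < K ==> bil n A (w i) (gs w j) = gmu w i j * gq w j"
proof -
 assume ij: "i < K" "j < K"
 have "bil n A (w i) (gs w j) = (\<Sum>k<K. gmu w i k * bil n A (gs w k) (gs w j))"
  by (subst gs_expand'[OF ij(1)]) (simp add: bil_linear)
 also have "\<dots> = (\<Sum>k<K. if k = j then gmu w i j * gq w j else 0)"
  using ij by (intro sum.cong) (auto simp: gs_orth)
 finally show ?thesis using ij by simp
qed

lemma bil_w_w: "i < K ==> j < K ==> bil n A (w i) (w j) = (\<Sum>k<K. gmu w i k * gq w k * gmu w j k)"
proof -
 assume ij: "i < K" "j < K"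
 have "bil n A (w i) (w j) = (\<Sum>k<K. gmu w j k * bil n A (w i) (gs w k))"
  by (subst gs_expand'[OF ij(2)]) (simp add: bil_linear)
 also have "\<dots> = (\<Sum>k<K. gmu w i k * gq w k * gmu w j k)"
  using ij by (intro sum.cong) (auto simp: bil_w_gs)
 finally show ?thesis .
qed

text \<open>The part of \<open>x\<close> orthogonal to the first \<open>k\<close> orthogonalised
  vectors. As it is linear in \<open>x\<close>, changes of the basis become calculations with this
  map.\<close>

definition gproj :: "nat => (nat => 'a) => nat => 'a" where
 "gproj k x l = x l - (\<Sum>j<k. bil n A (gs w j) x / gq w j * gs w j l)"

lemma gproj_w: "gproj k (w k) = gs w k"
proof
 fix l
 show "gproj k (w k) l = gs w k l"
  unfolding gs_eq[of w k l] gproj_def by (intro arg_cong2[where f=minus] sum.cong) (auto simp: gmu_def)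
qed

lemma gproj_lower: assumes "j < k" "k \<le> K" shows "gproj k (w j) l = 0"
proof -
 have "(\<Sum>i<k. bil n A (gs w i) (w j) / gq w i * gs w i l) = (\<Sum>i<k. gmu w j i * gs w i l)"
 proof (rule sum.cong)
  fix i assume "i \<in> {..<k}"
  hence "bil n A (gs w i) (w j) = gmu w j i * gq w i" "gq w i \<noteq> 0"
   using bil_w_gs[of j i] bil_sym[OF sym, of "gs w i" "w j"] assms q by auto
  thus "bil n A (gs w i) (w j) / gq w i * gs w i l = gmu w j i * gs w i l" by simp
 qed simp
 also have "\<dots> = w j l" using gs_expand[of j k w l] assms by simp
 finally show ?thesis by (simp add: gproj_def)
qed

lemma gproj_add: "gproj k (%l. x l + y l) l = gproj k x l + gproj k y l"
 by (simp add: gproj_def bil_linear add_divide_distrib distrib_right sum.distrib)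

lemma gproj_scale: "gproj k (%l. c * x l) l = c * gproj k x l"
 by (simp only: gproj_def bil_scale_right times_divide_eq_right[symmetric] mult.assoc
   sum_distrib_left[symmetric] right_diff_distrib[symmetric])

lemma gproj_sum: "gproj k (%l. \<Sum>i\<in>F. f i l) l = (\<Sum>i\<in>F. gproj k (f i) l)"
proof (induction F rule: infinite_finite_induct)
 case (insert i F)
 thus ?case using gproj_add[of k "f i" "%l. \<Sum>i\<in>F. f i l" l] by simp
qed (simp_all add: gproj_def bil_def)

text \<open>\<open>gproj k\<close> annihilates the earlier vectors, so adding multiples of them to a
  basis vector does not move its orthogonalised vector.\<close>

lemma gs_size_reduce:
 assumes w': "\<And>k l. k < K ==> w' k l = w k l + (\<Sum>j<k. t k j * w j l)"
 shows "k < K ==> gs w' k = gs w k"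
proof (induction k rule: less_induct)
 case (less k)
 hence IH: "gs w' j = gs w j" if "j < k" for j using that by simp
 show ?case
 proof
  fix l
  have "gs w' k l = gproj k (w' k) l"
   by (subst gs.simps) (auto simp: gproj_def gq_def IH intro!: sum.cong)
  also have "w' k = (%l. w k l + (\<Sum>j<k. t k j * w j l))" by (rule ext) (rule w'[OF less.prems])
  also have "gproj k (%l. w k l + (\<Sum>j<k. t k j * w j l)) l
    = gproj k (w k) l + (\<Sum>j<k. t k j * gproj k (w j) l)"
   by (simp add: gproj_add gproj_sum gproj_scale)
  also have "\<dots> = gs w k l" using less.prems by (simp add: gproj_w gproj_lower)
  finally show "gs w' k l = gs w k l" .
 qed
qed

text \<open>The exchange formulas of lattice reduction. The two new orthogonal vectors span the same
  plane as the old ones, so the projection onto this plane, and with it every later vector, is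
  unchanged.\<close>

lemma gs_swap:
 fixes i :: nat
 assumes i: "Suc i < K"
 defines "w' \<equiv> w(i := w (Suc i), Suc i := w i)" and "\<mu> \<equiv> gmu w (Suc i) i"
 assumes q': "gq w (Suc i) + \<mu> * \<mu> * gq w i \<noteq> 0"
 shows "k < i ==> gs w' k = gs w k"
  and "gs w' i = (%l. gs w (Suc i) l + \<mu> * gs w i l)"
  and "gq w' i = gq w (Suc i) + \<mu> * \<mu> * gq w i"
  and "gq w' (Suc i) = gq w i * gq w (Suc i) / (gq w (Suc i) + \<mu> * \<mu> * gq w i)"
  and "Suc i < k ==> k < K ==> gs w' k = gs w k"
proof -
 define a b qa qb q where ab: "a = gs w i" "b = gs w (Suc i)" "qa = gq w i" "qb = gq w (Suc i)"
  "q = qb + \<mu> * \<mu> * qa"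
 have q0: "qa \<noteq> 0" "qb \<noteq> 0" "q \<noteq> 0" using i q' q by (auto simp: ab)
 have baa: "bil n A a a = qa" "bil n A b b = qb" "bil n A a b = 0" "bil n A b a = 0"
  using gs_orth[of i "Suc i"] gs_orth[of "Suc i" i] i by (auto simp: ab gq_def)
 show low: "gs w' k = gs w k" if "k < i" for k
  using that by (intro gs_cong) (auto simp: w'_def)
 have w'S: "w' (Suc i) = w i" "w' i = w (Suc i)" by (auto simp: w'_def)
 have lowsum: "(\<Sum>j<i. bil n A (gs w' j) x / bil n A (gs w' j) (gs w' j) * gs w' j l) =
   (\<Sum>j<i. bil n A (gs w j) x / gq w j * gs w j l)" for x l
  by (rule sum.cong) (auto simp: low gq_def)
 have P_eq: "x l - (\<Sum>j<i. bil n A (gs w j) x / gq w j * gs w j l) = gproj i x l" for x l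
  by (simp add: gproj_def)
 have P_Suc: "gproj i (w (Suc i)) l = b l + \<mu> * a l" for l
 proof -
  have "gs w (Suc i) l = gproj i (w (Suc i)) l - \<mu> * a l"
   by (subst gs_eq) (simp add: gproj_def gmu_def ab \<mu>_def)
  thus ?thesis by (simp add: ab)
 qed
 show a': "gs w' i = (%l. gs w (Suc i) l + \<mu> * gs w i l)"
 proof
  fix l
  have "gs w' i l = gproj i (w (Suc i)) l"
   by (subst gs.simps) (simp only: lowsum P_eq w'S)
  thus "gs w' i l = gs w (Suc i) l + \<mu> * gs w i l" by (simp add: P_Suc ab)
 qed
 have a'': "gs w' i = (%l. b l + \<mu> * a l)" using a' by (simp add: ab)
 have a''l: "gs w' i l = b l + \<mu> * a l" for l by (simp add: a'')
 have q1: "bil n A (gs w' i) (gs w' i) = q"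
  by (simp add: a'' bil_linear baa ab(5) algebra_simps)
 show "gq w' i = gq w (Suc i) + \<mu> * \<mu> * gq w i" using q1 by (simp add: gq_def ab)
 have wi: "bil n A (gs w' i) (w i) = \<mu> * qa"
 proof -
  have "bil n A a (w i) = qa" "bil n A b (w i) = 0"
   using bil_w_gs[of i i] bil_w_gs[of i "Suc i"] i bil_sym[OF sym, of "w i"] by (auto simp: gmu_def ab)
  thus ?thesis by (simp add: a'' bil_linear)
 qed
 have b': "gs w' (Suc i) = (%l. (qb / q) * a l + (- (\<mu> * qa / q)) * b l)"
 proof
  fix l
  have "gs w' (Suc i) l = w i l - ((\<Sum>j<i. bil n A (gs w' j) (w i) / bil n A (gs w' j) (gs w' j) * gs w' j l)
    + bil n A (gs w' i) (w i) / bil n A (gs w' i) (gs w' i) * gs w' i l)"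
   by (subst gs.simps) (simp only: w'S sum.lessThan_Suc)
  also have "\<dots> = w i l - (\<Sum>j<i. bil n A (gs w j) (w i) / gq w j * gs w j l)
    - \<mu> * qa / q * (b l + \<mu> * a l)"
   by (simp only: lowsum q1 wi a''l diff_diff_eq)
  also have "\<dots> = gproj i (w i) l - \<mu> * qa / q * (b l + \<mu> * a l)" by (simp only: P_eq)
  also have "gproj i (w i) l = a l" using gproj_w by (simp add: ab)
  also have "a l - \<mu> * qa / q * (b l + \<mu> * a l) = (qb / q) * a l + (- (\<mu> * qa / q)) * b l"
  proof -
   have "a l = ((qb + \<mu> * \<mu> * qa) / q) * a l" using q0 by (simp add: ab(5))
   also have "\<dots> = (qb / q) * a l + (\<mu> * \<mu> * qa / q) * a l"
    by (simp only: add_divide_distrib distrib_right)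
   finally have 1: "a l = (qb / q) * a l + (\<mu> * \<mu> * qa / q) * a l" .
   have 2: "\<mu> * qa / q * (b l + \<mu> * a l) = (\<mu> * \<mu> * qa / q) * a l + (\<mu> * qa / q) * b l"
    by (simp add: algebra_simps)
   have 3: "x = y + z ==> u = z + c * v ==> x - u = y + (- c) * v" for x y z u c v :: 'a by simp
   show ?thesis by (rule 3[OF 1 2])
  qed
  finally show "gs w' (Suc i) l = (qb / q) * a l + (- (\<mu> * qa / q)) * b l" .
 qed
 have q2: "bil n A (gs w' (Suc i)) (gs w' (Suc i)) = qa * qb / q"
 proof -
  have "bil n A (gs w' (Suc i)) (gs w' (Suc i)) = (qb / q) * (qb / q) * qa + (\<mu> * qa / q) * (\<mu> * qa / q) * qb"
  proof -
   define c d where cd: "c = qb / q" "d = - (\<mu> * qa / q)"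
   have "bil n A (gs w' (Suc i)) (gs w' (Suc i)) = c * c * qa + d * d * qb"
    unfolding b' cd[symmetric] by (simp only: bil_linear baa) (simp add: mult.assoc)
   thus ?thesis by (simp add: cd)
  qed
  also have "\<dots> = qa * qb * (qb + \<mu> * \<mu> * qa) / (q * q)"
  proof -
   have "(qb / q) * (qb / q) * qa = qa * qb * qb / (q * q)"
    "(\<mu> * qa / q) * (\<mu> * qa / q) * qb = qa * qb * (\<mu> * \<mu> * qa) / (q * q)" by (simp_all add: mult_ac)
   thus ?thesis by (simp only: add_divide_distrib[symmetric] distrib_left)
  qed
  also have "\<dots> = qa * qb / q" using q0 by (simp only: ab(5)[symmetric]) simp
  finally show ?thesis .
 qed
 show "gq w' (Suc i) = gq w i * gq w (Suc i) / (gq w (Suc i) + \<mu> * \<mu> * gq w i)"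
  using q2 by (simp add: gq_def ab)
 \<comment> \<open>Coordinate \<open>l\<close> of the projection of \<open>x\<close> onto the plane
   of the two exchanged vectors, once in the new and once in the old orthogonal basis.\<close>
 have two: "bil n A (gs w' i) x / q * gs w' i l + bil n A (gs w' (Suc i)) x / (qa * qb / q) * gs w' (Suc i) l
   = bil n A a x / qa * a l + bil n A b x / qb * b l" for x l
 proof -
  define u v where uv: "u = bil n A a x" "v = bil n A b x"
  have "bil n A (gs w' i) x = v + \<mu> * u" by (simp add: a'' bil_linear uv)
  moreover have "bil n A (gs w' (Suc i)) x = (qb * u - \<mu> * qa * v) / q"
  proof -
   define c d where cd: "c = qb / q" "d = - (\<mu> * qa / q)"
   have "bil n A (gs w' (Suc i)) x = c * u + d * v"
    unfolding b' cd[symmetric] by (simp only: bil_linear uv)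
   thus ?thesis by (simp add: cd diff_divide_distrib)
  qed
  moreover have "(v + \<mu> * u) / q * (b l + \<mu> * a l) + (qb * u - \<mu> * qa * v) / q / (qa * qb / q) * ((qb / q) * a l + (- (\<mu> * qa / q)) * b l)
    = u / qa * a l + v / qb * b l"
  proof -
   have "(qb * u - \<mu> * qa * v) / q / (qa * qb / q) * ((qb / q) * a l + (- (\<mu> * qa / q)) * b l)
     = (qb * u - \<mu> * qa * v) * (qb * a l - \<mu> * qa * b l) / (qa * qb * q)"
   proof -
    have "(qb * u - \<mu> * qa * v) / q / (qa * qb / q) = (qb * u - \<mu> * qa * v) / (qa * qb)"
     using q0 by simp
    moreover have "(qb / q) * a l + (- (\<mu> * qa / q)) * b l = (qb * a l - \<mu> * qa * b l) / q"
     by (simp add: diff_divide_distrib)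
    ultimately show ?thesis by (simp only: times_divide_times_eq)
   qed
   moreover have "(v + \<mu> * u) / q * (b l + \<mu> * a l) = qa * qb * (v + \<mu> * u) * (b l + \<mu> * a l) / (qa * qb * q)"
    using q0 by simp
   moreover have "u / qa * a l + v / qb * b l = (u * a l * qb + v * b l * qa) * q / (qa * qb * q)"
    using q0 by (simp add: add_divide_distrib)
   moreover have "qa * qb * (v + \<mu> * u) * (b l + \<mu> * a l) + (qb * u - \<mu> * qa * v) * (qb * a l - \<mu> * qa * b l)
     = (u * a l * qb + v * b l * qa) * q"
    unfolding ab(5) by (rule swap_identity)
   ultimately show ?thesis by (simp only: add_divide_distrib[symmetric])
  qed
  ultimately show ?thesis by (simp add: uv a'' b')
 qed
 show "gs w' k = gs w k" if "Suc i < k" "k < K" for k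
  using that
 proof (induction k rule: less_induct)
  case (less k)
  show ?case
  proof
   fix l
   let ?f = "%w' j. bil n A (gs w' j) (w k) / bil n A (gs w' j) (gs w' j) * gs w' j l"
   have split: "(\<Sum>j<k. g j) = (\<Sum>j<i. g j) + (g i + g (Suc i)) + (\<Sum>j\<in>{Suc (Suc i)..<k}. g j)" for g :: "nat => 'a"
   proof -
    have "(\<Sum>j<k. g j) = (\<Sum>j<Suc (Suc i). g j) + (\<Sum>j\<in>{Suc (Suc i)..<k}. g j)"
     using less.prems by (subst sum.union_disjoint[symmetric]) (auto intro!: sum.cong)
    thus ?thesis by simp
   qed
   have "(\<Sum>j<k. ?f w' j) = (\<Sum>j<k. ?f w j)"
   proof -
    have e1: "(\<Sum>j<i. ?f w' j) = (\<Sum>j<i. ?f w j)" by (rule sum.cong) (auto simp: low)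
    have e2: "(\<Sum>j\<in>{Suc (Suc i)..<k}. ?f w' j) = (\<Sum>j\<in>{Suc (Suc i)..<k}. ?f w j)"
     using less.IH less.prems by (intro sum.cong) auto
    have e3: "?f w' i + ?f w' (Suc i) = ?f w i + ?f w (Suc i)"
     using two[of "w k" l] unfolding q1 q2 unfolding ab gq_def .
    show ?thesis unfolding split e1 e2 e3 by (rule refl)
   qed
   moreover have "w' k = w k" using less.prems by (simp add: w'_def)
   moreover have "gs u k l = u k l - (\<Sum>j<k. bil n A (gs u j) (u k) / bil n A (gs u j) (gs u j) * gs u j l)" for u
    by (subst gs.simps) (rule refl)
   ultimately show "gs w' k l = gs w k l" by (simp only:)
  qed
 qed
qed

end

end

subsection \<open>Size of the orthogonalised vectors\<close>

lemma det_Ints: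
 assumes "G \<in> carrier_mat k k" "\<And>i j. i < k ==> j < k ==> G $$ (i, j) \<in> \<int>"
 shows "det G \<in> (\<int> :: rat set)"
 unfolding det_def'[OF assms(1)]
proof (intro Ints_sum Ints_mult Ints_prod)
 fix p i assume "p \<in> {p. p permutes {0..<k}}" "i \<in> {0..<k}"
 thus "G $$ (i, p i) \<in> \<int>" using permutes_in_image[of p "{0..<k}" i] by (intro assms(2)) auto
qed (auto simp: sign_def)

lemma abs_det_le:
 assumes "G \<in> carrier_mat k k" "\<And>i j. i < k ==> j < k ==> \<bar>G $$ (i, j)\<bar> \<le> (2::rat) ^ g"
 shows "\<bar>det G\<bar> \<le> 2 ^ (k * k + g * k)"
proof -
 let ?P = "{p. p permutes {0..<k}}"
 have "\<bar>det G\<bar> \<le> (\<Sum>p\<in>?P. (2 ^ g) ^ k)"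
  unfolding det_def'[OF assms(1)]
 proof (rule order.trans[OF sum_abs sum_mono])
  fix p assume p: "p \<in> ?P"
  have "\<bar>signof p * (\<Prod>i = 0..<k. G $$ (i, p i))\<bar> = (\<Prod>i = 0..<k. \<bar>G $$ (i, p i)\<bar>)"
   by (simp add: abs_mult abs_prod sign_def)
  also have "\<dots> \<le> (\<Prod>i = 0..<k. 2 ^ g)"
   using p permutes_in_image[of p "{0..<k}"] by (intro prod_mono) (auto intro!: assms(2))
  finally show "\<bar>signof p * (\<Prod>i = 0..<k. G $$ (i, p i))\<bar> \<le> (2 ^ g) ^ k" by simp
 qed
 also have "\<dots> = of_nat (fact k) * 2 ^ (g * k)" by (simp add: card_permutations power_mult)
 also have "\<dots> \<le> 2 ^ (k * k) * 2 ^ (g * k)"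
 proof (rule mult_right_mono)
  have "(fact k :: nat) \<le> k ^ k" using fact_le_power[of k, where 'a=nat] by simp
  also have "\<dots> \<le> (2 ^ k) ^ k" by (rule power_mono) (use less_exp[of k] in auto)
  finally have "fact k \<le> (2::nat) ^ (k * k)" by (simp add: power_mult)
  hence "of_nat (fact k) \<le> (of_nat (2 ^ (k * k)) :: rat)" by (simp only: of_nat_le_iff)
  thus "of_nat (fact k) \<le> (2 ^ (k * k) :: rat)" by simp
 qed simp
 finally show ?thesis by (simp add: power_add)
qed

text \<open>Here the coefficients refer to the original vectors, not to the orthogonalised ones as
  in \<open>gs_eq\<close>. Only these solve a linear system with the Gram matrix, to which Cramer's
  rule applies.\<close>

lemma gs_span: "\<exists>x. \<forall>l. gs n A w k l = w k l - (\<Sum>j<k. x j * w j l)"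
proof (induction k rule: less_induct)
 case (less k)
 then obtain X where X: "\<And>j l. j < k ==> gs n A w j l = w j l - (\<Sum>i<j. X j i * w i l)" by metis
 define m where "m = gmu n A w k"
 show ?case
 proof (intro exI allI)
  fix l
  have "gs n A w k l = w k l - (\<Sum>j<k. m j * gs n A w j l)" unfolding m_def by (rule gs_eq)
  also have "(\<Sum>j<k. m j * gs n A w j l) = (\<Sum>j<k. m j * w j l - (\<Sum>i<k. (if i < j then m j * X j i * w i l else 0)))"
  proof (rule sum.cong)
   fix j assume "j \<in> {..<k}"
   hence j: "j < k" by simp
   have "(\<Sum>i<k. (if i < j then m j * X j i * w i l else 0)) = (\<Sum>i<j. m j * X j i * w i l)"
    using j by (subst sum.inter_filter[symmetric]) (auto intro!: sum.cong)
   thus "m j * gs n A w j l = m j * w j l - (\<Sum>i<k. (if i < j then m j * X j i * w i l else 0))"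
    using X[OF j] by (simp add: right_diff_distrib sum_distrib_left mult.assoc)
  qed simp
  also have "\<dots> = (\<Sum>j<k. m j * w j l) - (\<Sum>i<k. \<Sum>j<k. (if i < j then m j * X j i * w i l else 0))"
   by (simp only: sum_subtractf) (subst (2) sum.swap, rule refl)
  also have "\<dots> = (\<Sum>i<k. (m i - (\<Sum>j<k. if i < j then m j * X j i else 0)) * w i l)"
   by (simp add: sum_subtractf[symmetric] left_diff_distrib sum_distrib_right if_distrib[of "%x. x * _"] cong: if_cong)
  finally show "gs n A w k l = w k l - (\<Sum>i<k. (m i - (\<Sum>j<k. if i < j then m j * X j i else 0)) * w i l)" .
 qed
qed

text \<open>The Gram matrix is the product of \<open>L\<close>, a diagonal matrix and the transpose
  of \<open>L\<close>, where \<open>L\<close> consists of the coefficients \<open>gmu\<close> and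
  has unit diagonal. The factor \<open>D\<close> serves to make the matrix integral.\<close>

lemma gram_det:
 fixes A :: "nat => nat => 'a::field" and D :: 'a
 assumes sym: "symm n A" and q: "\<And>j. j < k ==> gq n A w j \<noteq> 0"
 defines "G \<equiv> mat k k (%(i, j). D * bil n A (w i) (w j))"
 shows "det G = (\<Prod>j<k. D * gq n A w j)"
proof -
 let ?M = "gmu n A w" and ?q = "gq n A w"
 define L where "L = mat k k (%(i, j). ?M i j)"
 define U where "U = mat k k (%(i, j). D * ?q i * ?M j i)"
 have "G = L * U"
 proof (rule eq_matI)
  fix i j assume "i < dim_row (L * U)" "j < dim_col (L * U)"
  hence ij: "i < k" "j < k" by (auto simp: L_def U_def)
  have "(L * U) $$ (i, j) = (\<Sum>l<k. ?M i l * (D * ?q l * ?M j l))"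
   using ij by (simp add: L_def U_def scalar_prod_def atLeast0LessThan)
  also have "\<dots> = D * (\<Sum>l<k. ?M i l * ?q l * ?M j l)" by (simp add: sum_distrib_left mult_ac)
  also have "\<dots> = G $$ (i, j)" using ij by (simp add: G_def bil_w_w[OF sym q ij])
  finally show "G $$ (i, j) = (L * U) $$ (i, j)" by simp
 qed (auto simp: G_def L_def U_def)
 moreover have "det L = 1"
  by (subst det_lower_triangular[of k]) (auto simp: L_def gmu_def prod_list_diag_prod)
 moreover have "det U = (\<Prod>j<k. D * ?q j)"
  by (subst det_upper_triangular[of _ k])
   (auto simp: U_def gmu_def prod_list_diag_prod atLeast0LessThan upper_triangular_def)
 moreover have "L \<in> carrier_mat k k" "U \<in> carrier_mat k k" by (auto simp: L_def U_def)
 ultimately show ?thesis by (simp add: det_mult)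
qed

lemma bil_w_gs_zero:
 assumes sym: "symm n A" and q: "\<And>j. j < k ==> gq n A w j \<noteq> 0" and i: "i < k"
 shows "bil n A (w i) (gs n A w k) = 0"
proof -
 have "bil n A (w i) (gs n A w k) = (\<Sum>j<k. gmu n A w i j * bil n A (gs n A w j) (gs n A w k))"
  by (subst gs_expand'[OF i]) (simp add: bil_linear)
 also have "\<dots> = 0" using gs_orth'[OF sym q] by (intro sum.neutral) auto
 finally show ?thesis .
qed

lemma abs_bil_le:
 fixes A :: "nat => nat => rat"
 assumes "\<And>i j. i < n ==> j < n ==> \<bar>A i j\<bar> \<le> 2 ^ a" "\<And>i. i < n ==> \<bar>x i\<bar> \<le> 2 ^ b" "\<And>i. i < n ==> \<bar>y i\<bar> \<le> 2 ^ c"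
 shows "\<bar>bil n A x y\<bar> \<le> 2 ^ (a + b + c + 2 * n)"
proof -
 have "\<bar>bil n A x y\<bar> \<le> (\<Sum>i<n. \<Sum>j<n. 2 ^ (a + b + c))"
  unfolding bil_def
 proof (rule order.trans[OF sum_abs sum_mono], rule order.trans[OF sum_abs sum_mono])
  fix i j assume ij: "i \<in> {..<n}" "j \<in> {..<n}"
  have "\<bar>x i\<bar> * \<bar>A i j\<bar> * \<bar>y j\<bar> \<le> 2 ^ b * 2 ^ a * 2 ^ c" using ij assms by (intro mult_mono) auto
  thus "\<bar>x i * A i j * y j\<bar> \<le> 2 ^ (a + b + c)" by (simp add: abs_mult power_add mult_ac)
 qed
 also have "\<dots> = of_nat n * of_nat n * 2 ^ (a + b + c)" by simp
 also have "\<dots> \<le> 2 ^ n * 2 ^ n * 2 ^ (a + b + c)"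
  using of_nat_le_pow2[of n, where 'a=rat] by (intro mult_right_mono mult_mono) auto
 also have "\<dots> = 2 ^ (a + b + c + 2 * n)" by (simp add: power_add mult_2)
 finally show ?thesis .
qed

lemma bil_Ints:
 fixes A :: "nat => nat => rat"
 assumes "\<And>i j. i < n ==> j < n ==> D * A i j \<in> \<int>" "\<And>i. i < n ==> x i \<in> \<int>" "\<And>i. i < n ==> y i \<in> \<int>"
 shows "D * bil n A x y \<in> \<int>"
proof -
 have "D * bil n A x y = (\<Sum>i<n. \<Sum>j<n. x i * (D * A i j) * y j)"
  by (simp add: bil_def sum_distrib_left mult_ac)
 also have "\<dots> \<in> \<int>" by (intro Ints_sum Ints_mult[OF Ints_mult] assms) auto
 finally show ?thesis .
qed

text \<open>Orthogonality to the first \<open>k\<close> vectors is a linear system for the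
  coefficients of \<open>gs_span\<close>, with the integral Gram matrix \<open>G\<close>. By
  Cramer's rule \<open>det G\<close> clears their denominators and the numerators are determinants
  too; both are bounded by the expansion over permutations.\<close>

lemma gs_size:
 fixes A :: "nat => nat => rat" and D :: int
 assumes sym: "symm n A" and D: "0 < D" "D \<le> 2 ^ a"
  and A: "\<And>i j. i < n ==> j < n ==> of_int D * A i j \<in> \<int>" "\<And>i j. i < n ==> j < n ==> \<bar>A i j\<bar> \<le> 2 ^ a"
  and w: "\<And>j i. j \<le> k ==> i < n ==> w j i \<in> \<int>" "\<And>j i. j \<le> k ==> i < n ==> \<bar>w j i\<bar> \<le> 2 ^ b"
  and q: "\<And>j. j < k ==> 0 < gq n A w j" and l: "l < n"
 shows "sz (gs n A w k l) \<le> 4 * (k * k + (2 * a + 2 * b + 2 * n) * k) + b + k + 6"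
proof -
 define g where "g = 2 * a + 2 * b + 2 * n"
 define d where "d = k * k + g * k"
 define G where "G = mat k k (%(i, j). of_int D * bil n A (w i) (w j))"
 have Gc: "G \<in> carrier_mat k k" by (simp add: G_def)
 obtain x where x: "\<And>l. gs n A w k l = w k l - (\<Sum>j<k. x j * w j l)" using gs_span by blast
 have Db: "of_int D \<le> (2 ^ a :: rat)"
 proof -
  have "of_int D \<le> (of_int (2 ^ a) :: rat)" using D(2) by (simp only: of_int_le_iff)
  thus ?thesis by simp
 qed
 have entry: "\<bar>of_int D * bil n A (w i) (w j)\<bar> \<le> 2 ^ g" "of_int D * bil n A (w i) (w j) \<in> \<int>" if "i \<le> k" "j \<le> k" for i j
 proof -
  have "\<bar>of_int D\<bar> * \<bar>bil n A (w i) (w j)\<bar> \<le> 2 ^ a * 2 ^ (a + b + b + 2 * n)"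
   using D Db abs_bil_le[of n A a "w i" b "w j" b] A w that by (intro mult_mono) auto
  also have "\<dots> = 2 ^ g" unfolding power_add[symmetric] g_def by (simp add: mult_2)
  finally show "\<bar>of_int D * bil n A (w i) (w j)\<bar> \<le> 2 ^ g" by (simp add: abs_mult)
  show "of_int D * bil n A (w i) (w j) \<in> \<int>" using A w that by (intro bil_Ints) auto
 qed
 have q0: "\<And>j. j < k ==> gq n A w j \<noteq> 0" using q by force
 have "det G = (\<Prod>j<k. of_int D * gq n A w j)" unfolding G_def by (rule gram_det[OF sym q0])
 hence det_pos: "0 < det G" using D q by (auto intro!: prod_pos)
 have det_int: "det G \<in> \<int>" by (rule det_Ints[OF Gc]) (use entry in \<open>auto simp: G_def\<close>)
 then obtain E where E: "det G = of_int E" by (rule Ints_cases)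
 have "\<bar>det G\<bar> \<le> 2 ^ d" unfolding d_def by (rule abs_det_le[OF Gc]) (use entry in \<open>auto simp: G_def\<close>)
 hence "of_int E \<le> (of_int (2 ^ d) :: rat)" using E det_pos by simp
 hence Ed: "E \<le> 2 ^ d" by (simp only: of_int_le_iff)
 have E1: "0 < E" using det_pos E by simp
 \<comment> \<open>A positive integer is at least 1, so dividing by the determinant in Cramer's rule
   does not increase the coefficients.\<close>
 hence E1': "1 \<le> det G" using E by simp
 have Gx: "G *\<^sub>v vec k x = vec k (%i. of_int D * bil n A (w i) (w k))"
 proof (rule eq_vecI)
  fix i assume "i < dim_vec (vec k (%i. of_int D * bil n A (w i) (w k)))"
  hence i: "i < k" by simp
  have "gs n A w k = (%l. w k l - (\<Sum>j<k. x j * w j l))" using x by (intro ext)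
  hence "0 = bil n A (w i) (w k) - (\<Sum>j<k. x j * bil n A (w i) (w j))"
   using bil_w_gs_zero[OF sym q0 i] by (simp add: bil_linear)
  hence "bil n A (w i) (w k) = (\<Sum>j<k. bil n A (w i) (w j) * x j)" by (simp add: mult.commute)
  thus "(G *\<^sub>v vec k x) $ i = vec k (%i. of_int D * bil n A (w i) (w k)) $ i"
   using i by (simp add: G_def scalar_prod_def atLeast0LessThan sum_distrib_left mult.assoc)
 qed (simp add: G_def)
 have xj: "x j * det G \<in> \<int>" "\<bar>x j\<bar> \<le> 2 ^ d" if "j < k" for j
 proof -
  define R where "R = replace_col G (G *\<^sub>v vec k x) j"
  have R: "det R = x j * det G"
   unfolding R_def using that by (subst cramer_lemma_mat[OF Gc]) auto
  have Rc: "R \<in> carrier_mat k k" by (simp add: R_def replace_col_def G_def)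
  have Re: "R $$ (i, i') \<in> \<int>" "\<bar>R $$ (i, i')\<bar> \<le> 2 ^ g" if "i < k" "i' < k" for i i'
   using that entry[of i k] entry[of i i'] by (auto simp: R_def replace_col_def G_def Gx[unfolded G_def])
  show "x j * det G \<in> \<int>" using det_Ints[OF Rc Re(1)] R by simp
  have "\<bar>det R\<bar> \<le> 2 ^ d" unfolding d_def by (rule abs_det_le[OF Rc Re(2)])
  moreover have "\<bar>x j\<bar> * 1 \<le> \<bar>x j\<bar> * \<bar>det G\<bar>" using E1' by (intro mult_left_mono) auto
  ultimately show "\<bar>x j\<bar> \<le> 2 ^ d" using R by (simp add: abs_mult)
 qed
 have "sz (gs n A w k l) \<le> 2 * d + (k + d + b + 1) + 5"
 proof (rule sz_rat_le[OF E1 _ Ed])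
  have "of_int E * gs n A w k l = of_int E * w k l - (\<Sum>j<k. (x j * det G) * w j l)"
   by (simp add: x E[symmetric] right_diff_distrib sum_distrib_left mult_ac)
  also have "\<dots> \<in> \<int>"
   by (intro Ints_diff Ints_sum; rule Ints_mult[OF xj(1) w(1)] Ints_mult[OF Ints_of_int w(1)]) (use l in auto)
  finally show "of_int E * gs n A w k l \<in> \<int>" .
  have "\<bar>gs n A w k l\<bar> \<le> \<bar>w k l\<bar> + \<bar>\<Sum>j<k. x j * w j l\<bar>" unfolding x by (rule abs_triangle_ineq4)
  also have "\<dots> \<le> 2 ^ b + (\<Sum>j<k. 2 ^ d * 2 ^ b)"
  proof (intro add_mono order.trans[OF sum_abs sum_mono])
   show "\<bar>w k l\<bar> \<le> 2 ^ b" using w l by simp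
   fix j assume "j \<in> {..<k}"
   thus "\<bar>x j * w j l\<bar> \<le> 2 ^ d * 2 ^ b" unfolding abs_mult using xj w l by (intro mult_mono) auto
  qed
  also have "\<dots> = 2 ^ b + of_nat k * (2 ^ d * 2 ^ b)" by simp
  also have "\<dots> \<le> 1 * (1 * 2 ^ b) + 2 ^ k * (2 ^ d * 2 ^ b)"
   using of_nat_le_pow2[of k, where 'a=rat] by (intro add_mono mult_right_mono) auto
  also have "\<dots> \<le> 2 ^ k * (2 ^ d * 2 ^ b) + 2 ^ k * (2 ^ d * 2 ^ b)"
   by (intro add_mono mult_mono) auto
  also have "\<dots> = 2 ^ (k + d + b + 1)" by (simp add: power_add)
  finally show "\<bar>gs n A w k l\<bar> \<le> 2 ^ (k + d + b + 1)" .
 qed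
 hence "sz (gs n A w k l) \<le> 4 * d + b + k + 6" by linarith
 thus ?thesis unfolding d_def g_def .
qed

section \<open>The orthogonalisation procedure\<close>

definition tab :: "nat => (nat => 'a) => 'a list" where
 "tab n f = map f [0..<n]"

abbreviation vx :: "rat list => nat => rat" where "vx \<equiv> elt 0"

definition mx :: "rmat => nat => nat => rat" where
 "mx A i = vx (elt [] A i)"

lemma length_tab [simp]: "length (tab n f) = n"
 by (simp add: tab_def)

lemma nth_tab [simp]: "i < n ==> tab n f ! i = f i"
 by (simp add: tab_def)

lemma elt_tab [simp]: "elt d (tab n f) i = (if i < n then f i else d)"
 by (simp add: elt_def)

lemma mx_tab: "mx (tab n f) i = (if i < n then vx (f i) else (%_. 0))"
 by (auto simp: mx_def elt_def)

lemma mx_nth: "i < length A ==> mx A i = vx (A ! i)"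
 by (simp add: mx_def elt_def)

text \<open>Orthogonalises \<open>ws\<close> with respect to the form \<open>A\<close>, stopping after the first vector of nonpositive norm.\<close>

definition gcoef where
 "gcoef n A vs w i = bil n (mx A) (mx vs i) (vx w) / bil n (mx A) (mx vs i) (mx vs i)"

definition gnext where
 "gnext n A vs w = tab n (%l. vx w l - (\<Sum>i<length vs. gcoef n A vs w i * mx vs i l))"

definition posall where
 "posall n A vs \<longleftrightarrow> vs = [] \<or> 0 < bil n (mx A) (mx vs (length vs - Suc 0)) (mx vs (length vs - Suc 0))"

definition gstep where
 "gstep n A vs w = (if posall n A vs then vs @ [gnext n A vs w] else vs)"

definition gso where
 "gso n A ws = foldl (gstep n A) [] ws"

text \<open>All vectors but the last have positive norm, which is what the size bound for the last
  one requires. If the run stopped early, the last vector is a direction of nonpositive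
  norm.\<close>

definition gso_inv where
 "gso_inv n A ws k vs \<longleftrightarrow> length vs \<le> k \<and>
   (\<forall>i<length vs. length (vs ! i) = n \<and> (\<forall>l<n. mx vs i l = gs n (mx A) (mx ws) i l)) \<and>
   (\<forall>i. Suc i < length vs --> 0 < gq n (mx A) (mx ws) i) \<and>
   (length vs = k \<or> vs \<noteq> [] \<and> \<not> 0 < gq n (mx A) (mx ws) (length vs - Suc 0))"

lemma gso_inv_bil:
 assumes "gso_inv n A ws k vs" "i < length vs"
 shows "bil n (mx A) (mx vs i) x = bil n (mx A) (gs n (mx A) (mx ws) i) x"
  "bil n (mx A) (mx vs i) (mx vs i) = gq n (mx A) (mx ws) i"
 using assms unfolding gq_def by (auto simp: gso_inv_def intro!: bil_cong)

lemma gso_inv_foldl: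
 assumes "k \<le> length ws"
 shows "gso_inv n A ws k (foldl (gstep n A) [] (take k ws))"
 using assms
proof (induction k)
 case 0
 thus ?case by (simp add: gso_inv_def)
next
 case (Suc k)
 define vs where "vs = foldl (gstep n A) [] (take k ws)"
 have inv: "gso_inv n A ws k vs" using Suc by (simp add: vs_def)
 have step: "foldl (gstep n A) [] (take (Suc k) ws) = gstep n A vs (ws ! k)"
  using Suc.prems by (simp add: take_Suc_conv_app_nth vs_def)
 have pos: "posall n A vs \<longleftrightarrow> vs = [] \<or> 0 < gq n (mx A) (mx ws) (length vs - Suc 0)"
  using gso_inv_bil(2)[OF inv, of "length vs - Suc 0"] by (cases vs) (auto simp: posall_def)
 show ?case
 proof (cases "posall n A vs")
  case False
  hence "gstep n A vs (ws ! k) = vs" by (simp add: gstep_def)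
  moreover have "vs \<noteq> []" "\<not> 0 < gq n (mx A) (mx ws) (length vs - Suc 0)" using False pos by auto
  ultimately show ?thesis using inv unfolding step by (auto simp: gso_inv_def)
 next
  case True
  hence len: "length vs = k" using inv pos by (auto simp: gso_inv_def)
  define v where "v = gnext n A vs (ws ! k)"
  have v: "vx v l = gs n (mx A) (mx ws) k l" if "l < n" for l
  proof -
   have "vx v l = vx (ws ! k) l - (\<Sum>i<k. bil n (mx A) (mx vs i) (mx ws k) / gq n (mx A) (mx ws) i * mx vs i l)"
    using that Suc.prems gso_inv_bil(2)[OF inv] by (auto simp: v_def gnext_def gcoef_def len mx_nth intro!: sum.cong)
   also have "\<dots> = mx ws k l - (\<Sum>i<k. gmu n (mx A) (mx ws) k i * gs n (mx A) (mx ws) i l)"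
    using that inv Suc.prems gso_inv_bil(1)[OF inv]
    by (auto simp: gmu_def len mx_nth gso_inv_def intro!: sum.cong)
   finally show ?thesis using gs_eq[of n "mx A" "mx ws" k l] by simp
  qed
  have old: "mx (vs @ [v]) i = mx vs i" if "i < k" for i
   using that len by (simp add: mx_nth nth_append)
  have new: "mx (vs @ [v]) k = vx v" using len by (simp add: mx_nth nth_append)
  have "gso_inv n A ws (Suc k) (vs @ [v])"
   unfolding gso_inv_def
  proof (intro conjI allI impI)
   fix i assume i: "i < length (vs @ [v])"
   show "length ((vs @ [v]) ! i) = n"
    using i inv len by (cases "i = k") (auto simp: gso_inv_def nth_append v_def gnext_def)
   fix l assume "l < n"
   thus "mx (vs @ [v]) i l = gs n (mx A) (mx ws) i l"
    using i inv len old new v by (cases "i = k") (auto simp: gso_inv_def)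
  next
   fix i assume "Suc i < length (vs @ [v])"
   thus "0 < gq n (mx A) (mx ws) i"
   proof (cases "Suc i = k")
    case True
    hence "vs \<noteq> []" "length vs - Suc 0 = i" using len by auto
    thus ?thesis using \<open>posall n A vs\<close> pos by metis
   next
    case False
    thus ?thesis using \<open>Suc i < length (vs @ [v])\<close> inv len by (simp add: gso_inv_def)
   qed
  qed (use len in auto)
  moreover have "gstep n A vs (ws ! k) = vs @ [v]" using True by (simp add: gstep_def v_def)
  ultimately show ?thesis unfolding step by simp
 qed
qed

lemma gso_inv_gso: "gso_inv n A ws (length ws) (gso n A ws)"
 using gso_inv_foldl[of "length ws" ws n A] by (simp add: gso_def)

lemma posall_gso:
 assumes "posall n A (gso n A ws)"
 shows "length (gso n A ws) = length ws" "\<And>i. i < length ws ==> 0 < gq n (mx A) (mx ws) i"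
proof -
 define vs where "vs = gso n A ws"
 have inv: "gso_inv n A ws (length ws) vs" using gso_inv_gso by (simp add: vs_def)
 have pos: "vs = [] \<or> 0 < gq n (mx A) (mx ws) (length vs - Suc 0)"
  using assms gso_inv_bil(2)[OF inv, of "length vs - Suc 0"] by (cases vs) (auto simp: posall_def vs_def)
 show len: "length (gso n A ws) = length ws" using inv pos by (auto simp: gso_inv_def vs_def)
 show "0 < gq n (mx A) (mx ws) i" if "i < length ws" for i
  using inv pos that len unfolding vs_def[symmetric]
 proof (cases "Suc i = length ws")
  case True
  hence "vs \<noteq> []" "length vs - Suc 0 = i" using len by (auto simp: vs_def)
  thus ?thesis using pos by metis
 next
  case False
  thus ?thesis using inv that len by (simp add: gso_inv_def vs_def)
 qed
qed

lemma gso_posall: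
 assumes "\<And>i. i < length ws ==> 0 < gq n (mx A) (mx ws) i"
 shows "posall n A (gso n A ws)"
proof -
 define vs where "vs = gso n A ws"
 have inv: "gso_inv n A ws (length ws) vs" using gso_inv_gso by (simp add: vs_def)
 show ?thesis
  unfolding vs_def[symmetric]
 proof (cases "vs = []")
  case False
  hence "length vs - Suc 0 < length vs" "length vs - Suc 0 < length ws"
   using inv by (cases vs; auto simp: gso_inv_def)+
  thus "posall n A vs"
   using gso_inv_bil(2)[OF inv, of "length vs - Suc 0"] assms[of "length vs - Suc 0"] by (simp add: posall_def)
 qed (simp add: posall_def)
qed

lemma gso_nth:
 assumes "i < length (gso n A ws)" "l < n"
 shows "mx (gso n A ws) i l = gs n (mx A) (mx ws) i l"
 using gso_inv_gso[of n A ws] assms by (auto simp: gso_inv_def)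

lemma gso_bil:
 assumes "i < length (gso n A ws)"
 shows "bil n (mx A) (mx (gso n A ws) i) x = bil n (mx A) (gs n (mx A) (mx ws) i) x"
  "bil n (mx A) (mx (gso n A ws) i) (mx (gso n A ws) i) = gq n (mx A) (mx ws) i"
 using gso_inv_bil[OF gso_inv_gso assms] by auto

definition units :: "nat => nat => rmat" where
 "units p n = tab p (%i. tab n (%j. if i = j then 1 else 0))"

lemma mx_units: "mx (units p n) i j = (if i < p \<and> j < n \<and> i = j then 1 else 0)"
 by (simp add: units_def mx_tab)

lemma length_units [simp]: "length (units p n) = p"
 by (simp add: units_def)

lemma dt_units: "i < p ==> i < n ==> dt n (mx (units p n) i) x = x i"
 unfolding dt_def mx_units by (subst sum.mono_neutral_right[of _ "{i}"]) auto

lemma bil_units: "i < p ==> i < n ==> bil n A (mx (units p n) i) x = (\<Sum>j<n. A i j * x j)"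
 by (simp add: bil_dt dt_units)

lemma gs_units: "k \<le> l ==> l < n ==> k < p ==> gs n A (mx (units p n)) k l = (if l = k then 1 else 0)"
proof -
 assume kl: "k \<le> l" "l < n" "k < p"
 obtain x where "\<And>l. gs n A (mx (units p n)) k l = mx (units p n) k l - (\<Sum>j<k. x j * mx (units p n) j l)"
  using gs_span by blast
 thus ?thesis using kl by (simp add: mx_units)
qed

text \<open>For an orthogonal basis \<open>v_k\<close> with squared norms \<open>q_k\<close>, the
  inverse of the form is the sum of \<open>v_k v_k^T / q_k\<close>. So the orthogonalisation that
  tests definiteness also inverts the matrix.\<close>

definition minv where
 "minv n A vs = tab n (%i. tab n (%j. \<Sum>k<length vs. mx vs k i * mx vs k j / bil n (mx A) (mx vs k) (mx vs k)))"

lemma symm_minv: "symm n (mx (minv n A vs))"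
 by (auto simp: symm_def minv_def mx_tab mult.commute)

lemma minv_correct:
 assumes sym: "symm n (mx A)" and vs: "vs = gso n A (units n n)" "posall n A vs" and il: "i < n" "l < n"
 shows "(\<Sum>j<n. mx A i j * mx (minv n A vs) j l) = (if i = l then 1 else 0)"
proof -
 let ?w = "mx (units n n)" and ?A = "mx A"
 have len: "length vs = n" and q: "\<And>i. i < n ==> 0 < gq n ?A ?w i"
  using posall_gso[of n A "units n n"] vs by auto
 have q0: "\<And>i. i < n ==> gq n ?A ?w i \<noteq> 0" using q by force
 note nth = gso_nth[of _ n A "units n n", folded vs(1), unfolded len]
  and bl = gso_bil(2)[of _ n A "units n n", folded vs(1), unfolded len]
 have "(\<Sum>j<n. ?A i j * mx (minv n A vs) j l) = (\<Sum>j<n. ?A i j * (\<Sum>k<n. gs n ?A ?w k j * gs n ?A ?w k l / gq n ?A ?w k))"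
  using il by (intro sum.cong) (auto simp: minv_def mx_tab len nth bl)
 also have "\<dots> = (\<Sum>k<n. (\<Sum>j<n. ?A i j * gs n ?A ?w k j) / gq n ?A ?w k * gs n ?A ?w k l)"
  by (simp add: sum_distrib_left sum_distrib_right sum_divide_distrib mult_ac) (rule sum.swap)
 also have "\<dots> = (\<Sum>k<n. gmu n ?A ?w i k * gs n ?A ?w k l)"
 proof (rule sum.cong)
  fix k assume k: "k \<in> {..<n}"
  have "(\<Sum>j<n. ?A i j * gs n ?A ?w k j) = gmu n ?A ?w i k * gq n ?A ?w k"
   using bil_w_gs[OF sym q0, of n i k] il k by (simp add: bil_units)
  thus "(\<Sum>j<n. ?A i j * gs n ?A ?w k j) / gq n ?A ?w k * gs n ?A ?w k l = gmu n ?A ?w i k * gs n ?A ?w k l"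
   using q0[of k] k by simp
 qed simp
 also have "\<dots> = ?w i l" using gs_expand[of i n ?w l n ?A] il by simp
 finally show ?thesis using il by (simp add: mx_units)
qed

lemma bil_of_rat: "bil n (%i j. of_rat (A i j)) (%i. of_rat (x i)) (%i. of_rat (y i)) = (of_rat (bil n A x y) :: real)"
 by (simp add: bil_def of_rat_sum of_rat_mult)

lemma dt_of_rat: "dt n (%i. of_rat (x i)) (%i. of_rat (y i)) = (of_rat (dt n x y) :: real)"
 by (simp add: dt_def of_rat_sum of_rat_mult)

text \<open>At the unit vectors \<open>bil_w_w\<close> writes the form as a sum of squares of linear
  forms with weights \<open>gq\<close>. The decomposition is rational, hence it also holds for real
  vectors.\<close>

lemma psd_of_gso:
 assumes sym: "symm n (mx A)" and vs: "posall n A (gso n A (units n n))"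
 shows "0 \<le> bil n (%i j. of_rat (mx A i j)) z (z :: nat => real)"
proof -
 let ?w = "mx (units n n)" and ?A = "mx A"
 have q: "\<And>i. i < n ==> 0 < gq n ?A ?w i"
  using posall_gso[OF vs] by auto
 have q0: "\<And>i. i < n ==> gq n ?A ?w i \<noteq> 0" using q by force
 have A: "of_rat (?A i j) = (\<Sum>k<n. of_rat (gmu n ?A ?w i k) * of_rat (gq n ?A ?w k) * (of_rat (gmu n ?A ?w j k) :: real))" if "i < n" "j < n" for i j
 proof -
  have "?A i j = (\<Sum>k<n. ?A i k * ?w j k)"
   using that by (subst sum.mono_neutral_right[of _ "{j}"]) (auto simp: mx_units)
  also have "\<dots> = bil n ?A (?w i) (?w j)" using that by (simp add: bil_units)
  also have "\<dots> = (\<Sum>k<n. gmu n ?A ?w i k * gq n ?A ?w k * gmu n ?A ?w j k)"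
   by (rule bil_w_w[OF sym q0 that])
  finally show ?thesis by (simp add: of_rat_sum of_rat_mult)
 qed
 have "bil n (%i j. of_rat (?A i j)) z z
   = (\<Sum>i<n. \<Sum>j<n. \<Sum>k<n. of_rat (gq n ?A ?w k) * ((z i * of_rat (gmu n ?A ?w i k)) * (z j * of_rat (gmu n ?A ?w j k))))"
  unfolding bil_def by (intro sum.cong) (auto simp: A sum_distrib_left sum_distrib_right mult_ac)
 also have "\<dots> = (\<Sum>k<n. \<Sum>i<n. \<Sum>j<n. of_rat (gq n ?A ?w k) * ((z i * of_rat (gmu n ?A ?w i k)) * (z j * of_rat (gmu n ?A ?w j k))))"
  by (subst (2) sum.swap) (subst sum.swap, rule refl)
 also have "\<dots> = (\<Sum>k<n. of_rat (gq n ?A ?w k) * (\<Sum>i<n. z i * of_rat (gmu n ?A ?w i k))\<^sup>2)"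
  unfolding power2_eq_square sum_product unfolding sum_distrib_left by (rule refl)
 also have "0 \<le> \<dots>" using q by (intro sum_nonneg mult_nonneg_nonneg) (auto simp: less_imp_le)
 finally show ?thesis by simp
qed

text \<open>The orthogonalisation stops at a vector of nonpositive norm. It is not zero: it arises
  from a unit vector by subtracting combinations of earlier ones, so the coordinate with its own
  index is 1.\<close>

lemma not_posall_witness:
 assumes "\<not> posall n A (gso n A (units n n))"
 defines "v \<equiv> mx (gso n A (units n n)) (length (gso n A (units n n)) - Suc 0)"
 shows "bil n (mx A) v v \<le> 0" "\<exists>i<n. v i \<noteq> 0"
proof -
 let ?vs = "gso n A (units n n)"
 define k where "k = length ?vs - Suc 0"
 have ne: "?vs \<noteq> []" using assms by (auto simp: posall_def)
 show "bil n (mx A) v v \<le> 0" using assms by (auto simp: posall_def v_def)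
 have "length ?vs \<le> n" using gso_inv_gso[of n A "units n n"] by (auto simp: gso_inv_def)
 hence k: "k < length ?vs" "k < n" using ne by (cases ?vs; auto simp: k_def)+
 hence "v k = 1" using gso_nth[OF k] gs_units[of k k n n "mx A"] by (simp add: v_def k_def)
 thus "\<exists>i<n. v i \<noteq> 0" using k by auto
qed

subsection \<open>Complexity of the orthogonalisation\<close>

lemma FP_lift: "FP S f ==> FP {z. fst z \<in> S \<and> Q z} (%z. f (fst z))"
 by (rule FP_compose[OF _ FP_fst[OF FP_id]]) auto

lemma FP_lift2: "FP {z. fst z \<in> S \<and> Q z} (%z. f (fst z) (snd z)) ==>
  FP {w. fst w \<in> {z. fst z \<in> S \<and> Q z} \<and> R w} (%w. f (fst (fst w)) (snd (fst w)))"
 by (rule FP_lift)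

lemma FP_tabI: "FP S n ==> FP {z. fst z \<in> S \<and> snd z < n (fst z)} (%z. f (fst z) (snd z)) ==> FP S (%x. tab (n x) (f x))"
 unfolding tab_def by (rule FP_tab)

lemma FP_mx: "FP S A ==> FP S i ==> FP S j ==> FP S (%x. mx (A x) (i x) (j x))"
 unfolding mx_def by (intro FP_elt)

lemma FP_bil:
 fixes A :: "'s::enc => nat => nat => rat"
 assumes n: "FP S n"
  and A: "FP {z. fst z \<in> {z. fst z \<in> S \<and> snd z < n (fst z)} \<and> snd z < n (fst (fst z))} (%z. A (fst (fst z)) (snd (fst z)) (snd z))"
  and x: "FP {z. fst z \<in> S \<and> snd z < n (fst z)} (%z. x (fst z) (snd z))"
  and y: "FP {z. fst z \<in> S \<and> snd z < n (fst z)} (%z. y (fst z) (snd z))"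
 shows "FP S (%s. bil (n s) (A s) (x s) (y s))"
 unfolding bil_def
proof (intro FP_sum n FP_rat_mult)
 let ?T = "{z. fst z \<in> S \<and> snd z < n (fst z)}"
 show "FP ?T (%z. n (fst z))" by (rule FP_lift[OF n])
 show "FP {z. fst z \<in> ?T \<and> snd z < n (fst (fst z))} (%z. x (fst (fst z)) (snd (fst z)))"
  by (rule FP_lift2[OF x])
 have "FP {z. fst z \<in> ?T \<and> snd z < n (fst (fst z))} (%z. (fst (fst z), snd z))"
  by (intro FP_Pair FP_fst FP_snd FP_id)
 hence "FP {z. fst z \<in> ?T \<and> snd z < n (fst (fst z))} (%z. y (fst (fst (fst z), snd z)) (snd (fst (fst z), snd z)))"
  by (rule FP_compose[OF y]) auto
 thus "FP {z. fst z \<in> ?T \<and> snd z < n (fst (fst z))} (%z. y (fst (fst z)) (snd z))" by simp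
qed (rule A)

lemma FP_dt:
 assumes "FP S n" "FP {z. fst z \<in> S \<and> snd z < n (fst z)} (%z. x (fst z) (snd z) :: rat)"
  "FP {z. fst z \<in> S \<and> snd z < n (fst z)} (%z. y (fst z) (snd z))"
 shows "FP S (%s. dt (n s) (x s) (y s))"
 unfolding dt_def by (intro FP_sum FP_rat_mult assms)

lemma FP_bil_mx:
 assumes "FP S n" "FP S A" "FP {z. fst z \<in> S \<and> snd z < n (fst z)} (%z. x (fst z) (snd z))"
  "FP {z. fst z \<in> S \<and> snd z < n (fst z)} (%z. y (fst z) (snd z))"
 shows "FP S (%s. bil (n s) (mx (A s)) (x s) (y s))"
 by (rule FP_bil[OF assms(1) _ assms(3,4)]) (intro FP_mx FP_compose[OF assms(2)] FP_fst FP_snd FP_id; auto)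

lemma FP_row: assumes "FP S A" "FP S i" shows "FP {z. fst z \<in> S \<and> Q z} (%z. mx (A (fst z)) (i (fst z)) (snd z))"
 by (intro FP_mx FP_lift assms FP_snd FP_id)

lemma FP_vec: assumes "FP S v" shows "FP {z. fst z \<in> S \<and> Q z} (%z. elt d (v (fst z)) (snd z))"
 by (intro FP_elt FP_lift assms FP_snd FP_id)

lemma FP_posall: assumes "FP S n" "FP S A" "FP S vs" shows "FP S (%x. posall (n x) (A x) (vs x))"
 unfolding posall_def
 by (intro FP_disj FP_null FP_rat_less FP_const FP_bil_mx FP_row FP_pred FP_length assms)

lemma FP_gcoef:
 assumes "FP S n" "FP S A" "FP S vs" "FP S w" "FP S i"
 shows "FP S (%x. gcoef (n x) (A x) (vs x) (w x) (i x))"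
 unfolding gcoef_def by (intro FP_rat_divide FP_bil_mx FP_row FP_vec assms)

lemma FP_gnext:
 assumes "FP S n" "FP S A" "FP S vs" "FP S w"
 shows "FP S (%x. gnext (n x) (A x) (vs x) (w x))"
 unfolding gnext_def
 by (intro FP_tabI FP_rat_diff FP_elt FP_sum FP_rat_mult FP_length FP_gcoef FP_mx
   assms(1,2,3,4)[THEN FP_compose] FP_fst FP_snd FP_id; auto)

lemma FP_gstep:
 assumes "FP S n" "FP S A" "FP S vs" "FP S w"
 shows "FP S (%x. gstep (n x) (A x) (vs x) (w x))"
 unfolding gstep_def by (intro FP_If FP_posall FP_append FP_Cons FP_Nil FP_gnext assms)

lemma FP_units: "FP S p ==> FP S n ==> FP S (%x. units (p x) (n x))"
 unfolding units_def
 by (intro FP_tabI FP_If FP_nat_eq FP_const FP_fst FP_snd FP_id FP_lift)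

lemma FP_minv:
 assumes "FP S n" "FP S A" "FP S vs"
 shows "FP S (%x. minv (n x) (A x) (vs x))"
proof -
 have 1: "FP S (%x. bil (n x) (mx (A x)) (mx (vs x) (k x)) (mx (vs x) (k x)))"
  if "FP S n" "FP S A" "FP S vs" "FP S k" for S :: "'z::enc set" and n A vs k
  by (intro FP_bil_mx FP_row that)
 show ?thesis unfolding minv_def
  by (intro FP_tabI FP_sum FP_rat_mult FP_rat_divide FP_length 1 FP_mx
   assms(1,2,3)[THEN FP_compose] FP_fst FP_snd FP_id; auto)
qed

lemma sz_elt: "sz (elt d l i) \<le> sz l + sz d"
 using sz_mem[of "l ! i" l] by (auto simp: elt_def)

lemma sz_mx: "sz (mx A i j) \<le> sz A + 5"
proof -
 have "sz (0::rat) = 4" by (simp add: sz_rat nu_def de_def int_size_def floorlog_def)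
 moreover have "sz ([]::rat list) = 1" by (simp add: sz_Nil)
 ultimately show ?thesis
  using sz_elt[of "0::rat" "elt [] A i" j] sz_elt[of "[]" A i] by (simp add: mx_def)
qed

text \<open>The plain product instead of a least common multiple: it also has polynomially many
  bits.\<close>

definition mden where
 "mden n A = (\<Prod>i<n. \<Prod>j<n. de (mx A i j))"

lemma mden_pos: "0 < mden n A"
 unfolding mden_def by (intro prod_pos) (auto simp: de_pos)

lemma mden_Ints: "i < n ==> j < n ==> of_int (mden n A) * mx A i j \<in> \<int>"
proof -
 assume ij: "i < n" "j < n"
 have "mden n A = (\<Prod>j<n. de (mx A i j)) * (\<Prod>i\<in>{..<n} - {i}. \<Prod>j<n. de (mx A i j))"
  unfolding mden_def using ij by (subst prod.remove[of _ i]) auto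
 hence "of_int (mden n A) * mx A i j =
   of_int (\<Prod>i\<in>{..<n} - {i}. \<Prod>j<n. de (mx A i j)) * (of_int (\<Prod>j<n. de (mx A i j)) * mx A i j)"
  by (simp only: of_int_mult mult_ac)
 thus ?thesis by (simp only:) (rule Ints_mult[OF Ints_of_int prod_de_clear[OF ij(2)]])
qed

lemma mden_le: "mden n A \<le> 2 ^ (n * n * (sz A + 5))"
proof -
 have "mden n A \<le> (\<Prod>i<n. \<Prod>j<n. 2 ^ (sz A + 5))"
  unfolding mden_def
 proof (intro prod_mono conjI prod_nonneg)
  fix i j
  have "de (mx A i j) \<le> 2 ^ sz (mx A i j)" by (rule de_le)
  also have "\<dots> \<le> 2 ^ (sz A + 5)" using sz_mx by (intro power_increasing) auto
  finally show "de (mx A i j) \<le> 2 ^ (sz A + 5)" .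
 qed (use de_pos in \<open>auto simp: less_imp_le\<close>)
 also have "\<dots> = 2 ^ (n * n * (sz A + 5))" by (simp add: power_mult[symmetric] mult_ac)
 finally show ?thesis .
qed

lemma FP_mden: assumes "FP S n" "FP S A" shows "FP S (%x. mden (n x) (A x))"
 unfolding mden_def
 by (intro FP_prod FP_de FP_mx assms(1,2)[THEN FP_compose] FP_fst FP_snd FP_id; auto)

lemma abs_mx_le: "\<bar>mx A i j\<bar> \<le> 2 ^ (sz A + 5)"
proof -
 have "\<bar>mx A i j\<bar> \<le> 2 ^ sz (mx A i j)" by (rule abs_rat_le)
 also have "\<dots> \<le> 2 ^ (sz A + 5)" using sz_mx by (intro power_increasing) auto
 finally show ?thesis .
qed

text \<open>\<open>gs_size\<close> applies to every vector in the list because those before it have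
  positive norm. This is where it pays that the run stops at the first nonpositive one.\<close>

lemma FP_gso:
 assumes n: "FP S n" and A: "FP S A" and ws: "FP S ws"
  and sym: "\<And>x. x \<in> S ==> symm (n x) (mx (A x))"
  and int: "\<And>x i j. x \<in> S ==> mx (ws x) i j \<in> \<int>"
 shows "FP S (%x. gso (n x) (A x) (ws x))"
 unfolding gso_def
proof (rule FP_foldl[where T="S \<times> UNIV"])
 show "FP (S \<times> UNIV) (%z. gstep (n (fst z)) (A (fst z)) (fst (snd z)) (snd (snd z)))"
  by (intro FP_gstep FP_compose[OF n] FP_compose[OF A] FP_fst FP_snd FP_id) auto
 define a where "a x = n x * n x * (sz (A x) + 5) + (sz (A x) + 5)" for x
 define b where "b x = sz (ws x) + 5" for x
 define m where "m x = length (ws x)" for x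
 define c where "c x = 4 * (m x * m x + (2 * a x + 2 * b x + 2 * n x) * m x) + b x + m x + 6" for x
 have m: "PB S m" unfolding m_def by (rule PB_nat[OF FP_length[OF ws]])
 have n': "PB S n" by (rule PB_nat[OF n])
 have "PB S c" unfolding c_def a_def b_def by (intro PB_add PB_mult PB_const n' m FP_sz[OF A] FP_sz[OF ws])
 thus "PB S (%x. 1 + m x * (1 + (1 + n x * (1 + c x))))" by (intro PB_add PB_mult PB_const n' m)
 fix x i assume x: "x \<in> S" and i: "i \<le> length (ws x)"
 define vs where "vs = foldl (gstep (n x) (A x)) [] (take i (ws x))"
 have inv: "gso_inv (n x) (A x) (ws x) i vs" unfolding vs_def by (rule gso_inv_foldl[OF i])
 have entry: "sz (mx vs k l) \<le> c x" if k: "k < length vs" and l: "l < n x" for k l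
 proof -
  have kp: "\<And>j. j < k ==> 0 < gq (n x) (mx (A x)) (mx (ws x)) j" and km: "k \<le> m x"
   using inv k i by (auto simp: gso_inv_def m_def)
  have "sz (gs (n x) (mx (A x)) (mx (ws x)) k l)
    \<le> 4 * (k * k + (2 * a x + 2 * b x + 2 * n x) * k) + b x + k + 6"
  proof (rule gs_size[OF sym[OF x] mden_pos[of "n x" "A x"] _ mden_Ints _ _ _ kp l])
   have "mden (n x) (A x) \<le> 2 ^ (n x * n x * (sz (A x) + 5))" by (rule mden_le)
   also have "\<dots> \<le> 2 ^ a x" by (rule power_increasing) (auto simp: a_def)
   finally show "mden (n x) (A x) \<le> 2 ^ a x" .
   have "(2::rat) ^ (sz (A x) + 5) \<le> 2 ^ a x" by (rule power_increasing) (auto simp: a_def)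
   thus "\<bar>mx (A x) i j\<bar> \<le> 2 ^ a x" for i j by (rule order.trans[OF abs_mx_le])
   show "\<bar>mx (ws x) i j\<bar> \<le> 2 ^ b x" for i j using abs_mx_le by (simp add: b_def)
   show "mx (ws x) i j \<in> \<int>" for i j using int[OF x] .
  qed auto
  also have "\<dots> \<le> c x" unfolding c_def using km
   by (intro add_le_mono mult_le_mono le_refl) auto
  finally show ?thesis using inv k l by (simp add: gso_inv_def)
 qed
 have "sz v \<le> 1 + n x * (1 + c x)" if "v \<in> set vs" for v
 proof -
  from that obtain k where k: "k < length vs" "v = vs ! k" by (metis in_set_conv_nth)
  have len: "length v = n x" using inv k by (auto simp: gso_inv_def)
  have "sz (map (%y. y) v) \<le> 1 + length v * (1 + c x)"
  proof (rule sz_map_le)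
   fix y assume "y \<in> set v"
   then obtain l where "l < n x" "y = v ! l" using len by (metis in_set_conv_nth)
   thus "sz y \<le> c x" using entry[OF k(1), of l] k len by (simp add: mx_nth elt_def)
  qed
  thus ?thesis using len by simp
 qed
 hence "sz (map (%y. y) vs) \<le> 1 + length vs * (1 + (1 + n x * (1 + c x)))" by (rule sz_map_le)
 also have "\<dots> \<le> 1 + m x * (1 + (1 + n x * (1 + c x)))"
  using inv i by (intro add_le_mono mult_le_mono1 le_refl) (auto simp: gso_inv_def m_def)
 finally show "sz (foldl (gstep (n x) (A x)) [] (take i (ws x))) \<le> 1 + m x * (1 + (1 + n x * (1 + c x)))"
  by (simp add: vs_def)
qed (auto intro: ws FP_Nil)

section \<open>Minimising a quadratic function over an ellipsoid\<close>

definition qf :: "nat => (nat => nat => real) => (nat => real) => (nat => real) => real" where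
 "qf n H b x = bil n H x x + dt n b x"

context
 fixes n :: nat and Q :: "nat => nat => real"
 assumes sym: "symm n Q" and psd: "\<And>x. 0 \<le> bil n Q x x"
begin

definition nm :: "(nat => real) => real" where "nm x = sqrt (bil n Q x x)"

lemma nm_nonneg: "0 \<le> nm x"
 by (simp add: nm_def psd)

lemma nm_square: "nm x * nm x = bil n Q x x"
 by (simp add: nm_def psd)

lemma nm_cauchy: "\<bar>bil n Q x y\<bar> \<le> nm x * nm y"
proof -
 define a b c where abc: "a = bil n Q x x" "b = bil n Q x y" "c = bil n Q y y"
 have yx: "bil n Q y x = b" using bil_sym[OF sym] by (simp add: abc)
 have *: "0 \<le> s * s * a - 2 * (s * t * b) + t * t * c" for s t
  using psd[of "%i. s * x i - t * y i"] by (simp add: bil_linear yx flip: abc) (simp add: algebra_simps)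
 have "b * b \<le> a * c"
 proof (cases "c = 0")
  case True
  have "0 \<le> a" using psd by (simp add: abc)
  have "b = 0"
  proof (rule ccontr)
   assume b: "b \<noteq> 0"
   \<comment> \<open>For these \<open>s\<close> and \<open>t\<close> the nonnegative expression
     equals \<open>- a - 2\<close>.\<close>
   have "0 \<le> a - 2 * (((a + 1) / b) * b)" using *[of 1 "(a + 1) / b"] True by simp
   thus False using b \<open>0 \<le> a\<close> by simp
  qed
  thus ?thesis using True by simp
 next
  case False
  hence c: "0 < c" using psd[of y] by (simp add: abc)
  have "0 \<le> c * (a * c - b * b)" using *[of c b] by (simp add: algebra_simps)
  thus ?thesis using c by (simp add: zero_le_mult_iff)
 qed
 hence "b\<^sup>2 \<le> (nm x * nm y)\<^sup>2"
  using nm_square[of x] nm_square[of y] by (simp add: power2_eq_square abc mult_ac)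
   (metis mult.assoc mult.left_commute)
 thus ?thesis using nm_nonneg by (simp add: abs_le_square_iff[symmetric] abc abs_mult)
qed

lemma nm_add: "nm (%i. x i + y i) \<le> nm x + nm y"
proof -
 have "bil n Q (%i. x i + y i) (%i. x i + y i) = nm x * nm x + 2 * bil n Q x y + nm y * nm y"
  using bil_sym[OF sym, of y x] by (simp add: bil_linear nm_square)
 also have "\<dots> \<le> nm x * nm x + 2 * (nm x * nm y) + nm y * nm y" using nm_cauchy[of x y] by simp
 also have "\<dots> = (nm x + nm y)\<^sup>2" by (simp add: power2_eq_square algebra_simps)
 finally show ?thesis unfolding nm_def[of "%i. x i + y i"] using nm_nonneg[of x] nm_nonneg[of y]
  by (simp add: real_le_lsqrt)
qed

lemma nm_scale: "nm (%i. c * x i) = \<bar>c\<bar> * nm x"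
proof -
 have "bil n Q (%i. c * x i) (%i. c * x i) = c\<^sup>2 * bil n Q x x"
  by (simp add: bil_linear power2_eq_square mult.assoc)
 thus ?thesis unfolding nm_def by (simp add: real_sqrt_mult)
qed

lemma nm_diff: "nm (%i. x i - y i) \<le> nm x + nm y"
 using nm_add[of x "%i. - 1 * y i"] nm_scale[of "- 1" y] by simp

lemma nm_le_1: "nm x \<le> 1 \<longleftrightarrow> bil n Q x x \<le> 1"
 by (simp add: nm_def)

lemma nm_cong: "(\<And>i. i < n ==> x i = y i) ==> nm x = nm y"
 unfolding nm_def by (intro arg_cong[where f=sqrt] bil_cong) auto

text \<open>Weak duality: \<open>y\<close> minimises the Lagrangian with multiplier \<open>l\<close>.\<close>

lemma lagrange:
 fixes H :: "nat => nat => real"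
 assumes symH: "symm n H" and l: "0 \<le> l"
 defines "A \<equiv> %i j. H i j + l * Q i j"
 assumes A: "\<And>z. 0 \<le> bil n A z z" and y: "\<And>i. i < n ==> (\<Sum>j<n. A i j * y j) = - b i / 2"
  and u: "bil n Q u u \<le> 1"
 shows "qf n H b w \<le> qf n H b u + bil n A (%i. w i - y i) (%i. w i - y i) + l * (1 - bil n Q w w)"
proof -
 have symA: "symm n A" using symH sym by (simp add: symm_def A_def)
 have Ay: "bil n A x y = - dt n b x / 2" for x
 proof -
  have "bil n A x y = dt n x (%i. - b i / 2)" unfolding bil_dt by (rule dt_cong) (simp_all add: y)
  also have "\<dots> = dt n x (%i. (- 1 / 2) * b i)" by (rule dt_cong) simp_all
  also have "\<dots> = - dt n b x / 2" unfolding dt_scale by (simp add: dt_commute)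
  finally show ?thesis .
 qed
 have AHQ: "bil n A x x = bil n H x x + l * bil n Q x x" for x
  by (simp add: A_def bil_def algebra_simps sum.distrib sum_distrib_left)
 have L: "bil n A x x + dt n b x = bil n A (%i. x i - y i) (%i. x i - y i) + (bil n A y y + dt n b y)" for x
  using bil_sym[OF symA, of y x] Ay[of x] Ay[of y] by (simp add: bil_linear)
 have "qf n H b u = bil n A u u + dt n b u - l * bil n Q u u" by (simp add: qf_def AHQ)
 also have "\<dots> \<ge> (bil n A y y + dt n b y) - l"
  using A[of "%i. u i - y i"] L[of u] mult_left_mono[OF u l] by simp
 finally have "bil n A y y + dt n b y \<le> qf n H b u + l" by simp
 moreover have "qf n H b w = bil n A (%i. w i - y i) (%i. w i - y i) + (bil n A y y + dt n b y) - l * bil n Q w w"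
  using L[of w] by (simp add: qf_def AHQ)
 ultimately show ?thesis by (simp add: algebra_simps)
qed

end

subsection \<open>Bisection\<close>

definition bstep :: "(rat => bool) => rat \<times> rat => rat \<times> rat" where
 "bstep R z = (if R ((fst z + snd z) / 2) then (fst z, (fst z + snd z) / 2) else ((fst z + snd z) / 2, snd z))"

definition bisect :: "(rat => bool) => rat => rat => nat => rat \<times> rat" where
 "bisect R lo hi N = (bstep R ^^ N) (lo, hi)"

text \<open>Only the end points enter, so no monotonicity of \<open>good\<close> in the multiplier
  has to be proved: any close pair of a bad and a good multiplier will do.\<close>

lemma bisect_spec:
 assumes "\<not> R lo" "R hi" "lo \<le> hi"
 shows "\<not> R (fst (bisect R lo hi N))" "R (snd (bisect R lo hi N))"
  "snd (bisect R lo hi N) - fst (bisect R lo hi N) = (hi - lo) / 2 ^ N"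
  "lo \<le> fst (bisect R lo hi N)" "snd (bisect R lo hi N) \<le> hi"
proof -
 have "\<not> R (fst z) \<and> R (snd z) \<and> snd z - fst z = (hi - lo) / 2 ^ N \<and> lo \<le> fst z \<and> snd z \<le> hi \<and> fst z \<le> snd z"
  if "z = bisect R lo hi N" for z
  using that
 proof (induction N arbitrary: z)
  case 0
  thus ?case using assms by (simp add: bisect_def)
 next
  case (Suc N)
  define y where "y = bisect R lo hi N"
  have z: "z = bstep R y" using Suc.prems by (simp add: bisect_def y_def)
  note IH = Suc.IH[OF y_def]
  hence e: "snd y - fst y = (hi - lo) / 2 ^ N" by simp
  have "(hi - lo) / 2 ^ Suc N = (snd y - fst y) / 2" unfolding e by simp
  thus ?case using IH unfolding z bstep_def by (auto simp: field_simps)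
 qed
 from this[OF refl] show "\<not> R (fst (bisect R lo hi N))" "R (snd (bisect R lo hi N))"
  "snd (bisect R lo hi N) - fst (bisect R lo hi N) = (hi - lo) / 2 ^ N"
  "lo \<le> fst (bisect R lo hi N)" "snd (bisect R lo hi N) \<le> hi" by auto
qed

text \<open>Each midpoint costs one more factor 2 in the common denominator and stays between the
  end points.\<close>

lemma bisect_size:
 fixes lo hi :: rat
 assumes "D * lo \<in> \<int>" "D * hi \<in> \<int>" "\<bar>lo\<bar> \<le> B" "\<bar>hi\<bar> \<le> B" "z = bisect R lo hi N"
 shows "D * 2 ^ N * fst z \<in> \<int> \<and> D * 2 ^ N * snd z \<in> \<int> \<and> \<bar>fst z\<bar> \<le> B \<and> \<bar>snd z\<bar> \<le> B"
 using assms(5)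
proof (induction N arbitrary: z)
 case 0
 thus ?case using assms by (simp add: bisect_def)
next
 case (Suc N)
 define y where "y = bisect R lo hi N"
 have z: "z = bstep R y" using Suc.prems by (simp add: bisect_def y_def)
 note IH = Suc.IH[OF y_def]
 have dbl: "D * 2 ^ Suc N * x \<in> \<int>" if "D * 2 ^ N * x \<in> \<int>" for x
 proof -
  have "D * 2 ^ Suc N * x = 2 * (D * 2 ^ N * x)" by simp
  moreover have "2 * (D * 2 ^ N * x) \<in> \<int>" using Ints_mult[OF _ that, of 2] by simp
  ultimately show ?thesis by (simp only:)
 qed
 have "D * 2 ^ Suc N * ((fst y + snd y) / 2) = D * 2 ^ N * fst y + D * 2 ^ N * snd y"
  by (simp add: algebra_simps)
 moreover have "D * 2 ^ N * fst y + D * 2 ^ N * snd y \<in> \<int>" using IH by (intro Ints_add) auto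
 ultimately have mid: "D * 2 ^ Suc N * ((fst y + snd y) / 2) \<in> \<int>" by (simp only:)
 have "\<bar>(fst y + snd y) / 2\<bar> \<le> B" using IH by (simp add: abs_le_iff)
 thus ?case using mid dbl IH unfolding z bstep_def by (auto simp del: power_Suc)
qed

lemma FP_bisect:
 assumes R: "FP (S \<times> UNIV) (%z. R (fst z) (snd z))" and lo: "FP S lo" and hi: "FP S hi" and N: "FP S N"
 shows "FP S (%x. bisect (R x) (lo x) (hi x) (N x))"
 unfolding bisect_def
proof (rule FP_iter[where T="S \<times> UNIV"])
 have mid: "FP (S \<times> UNIV) (%z::_ \<times> rat \<times> rat. (fst (snd z) + snd (snd z)) / 2)"
  by (intro FP_rat_divide FP_rat_add FP_fst FP_snd FP_id FP_const)
 have "FP (S \<times> UNIV) (%z::_ \<times> rat \<times> rat. (fst z, (fst (snd z) + snd (snd z)) / 2))"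
  by (intro FP_Pair mid FP_fst FP_id)
 hence "FP (S \<times> UNIV) (%z. R (fst (fst z, (fst (snd z) + snd (snd z)) / 2)) (snd (fst z, (fst (snd z) + snd (snd z)) / 2)))"
  by (rule FP_compose[OF R]) auto
 thus "FP (S \<times> UNIV) (%z. bstep (R (fst z)) (snd z))"
  unfolding bstep_def fst_conv snd_conv by (intro FP_If FP_Pair mid FP_fst FP_snd FP_id)
 define c where "c x = 2 * (sz (lo x) + sz (hi x) + N x) + (sz (lo x) + sz (hi x)) + 5" for x
 have "PB S c" unfolding c_def by (intro PB_add PB_mult PB_const FP_sz[OF lo] FP_sz[OF hi] PB_nat[OF N])
 thus "PB S (%x. 1 + 2 * c x)" by (intro PB_add PB_mult PB_const)
 fix x i assume x: "x \<in> S" and i: "i \<le> N x"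
 define z where "z = bisect (R x) (lo x) (hi x) i"
 define D where "D = de (lo x) * de (hi x)"
 define B :: rat where "B = 2 ^ (sz (lo x) + sz (hi x))"
 have pw: "(2::rat) ^ sz (lo x) \<le> B" "(2::rat) ^ sz (hi x) \<le> B"
  unfolding B_def by (rule power_increasing; simp)+
 have "of_int D * lo x = of_int (de (hi x)) * (of_int (de (lo x)) * lo x)"
  "of_int D * hi x = of_int (de (lo x)) * (of_int (de (hi x)) * hi x)" by (simp_all add: D_def)
 hence "of_int D * lo x \<in> \<int>" "of_int D * hi x \<in> \<int>" unfolding rat_mult_de by simp_all
 hence s: "of_int D * 2 ^ i * fst z \<in> \<int> \<and> of_int D * 2 ^ i * snd z \<in> \<int> \<and> \<bar>fst z\<bar> \<le> B \<and> \<bar>snd z\<bar> \<le> B"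
  using abs_rat_le[of "lo x"] abs_rat_le[of "hi x"] pw by (intro bisect_size[OF _ _ _ _ z_def]) auto
 have "D \<le> 2 ^ sz (lo x) * 2 ^ sz (hi x)"
  unfolding D_def using de_pos[of "lo x"] de_pos[of "hi x"] by (intro mult_mono de_le) auto
 hence "D * 2 ^ i \<le> 2 ^ (sz (lo x) + sz (hi x)) * 2 ^ N x"
  using i by (intro mult_mono power_increasing) (auto simp: power_add)
 hence Dle: "D * 2 ^ i \<le> 2 ^ (sz (lo x) + sz (hi x) + N x)" by (simp add: power_add)
 have D0: "0 < D * 2 ^ i" unfolding D_def using de_pos[of "lo x"] de_pos[of "hi x"] by simp
 have "sz (fst z) \<le> c x" "sz (snd z) \<le> c x"
  using s sz_rat_le[OF D0 _ Dle, of "fst z" "sz (lo x) + sz (hi x)"]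
   sz_rat_le[OF D0 _ Dle, of "snd z" "sz (lo x) + sz (hi x)"] by (simp_all add: c_def B_def)
 thus "sz ((bstep (R x) ^^ i) (lo x, hi x)) \<le> 1 + 2 * c x"
  using sz_Pair[of "fst z" "snd z"] by (simp add: z_def bisect_def)
qed (auto intro: FP_Pair lo hi N)

definition nbits :: "rat => nat" where
 "nbits x = floorlog 2 (nat (\<lfloor>x\<rfloor> + 1))"

lemma le_nbits: "x \<le> 2 ^ nbits x"
proof -
 have "nat (\<lfloor>x\<rfloor> + 1) < 2 ^ nbits x" unfolding nbits_def by (rule floorlog_leD) simp_all
 hence "int (nat (\<lfloor>x\<rfloor> + 1)) < int (2 ^ nbits x)" by (simp only: of_nat_less_iff)
 hence "int (nat (\<lfloor>x\<rfloor> + 1)) \<le> 2 ^ nbits x" by simp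
 hence "\<lfloor>x\<rfloor> + 1 \<le> 2 ^ nbits x" using int_nat_eq[of "\<lfloor>x\<rfloor> + 1"] by linarith
 hence "of_int (\<lfloor>x\<rfloor> + 1) \<le> (of_int (2 ^ nbits x) :: rat)" by (simp only: of_int_le_iff)
 moreover have "x \<le> of_int (\<lfloor>x\<rfloor> + 1)" by linarith
 ultimately show ?thesis by simp
qed

lemma FP_nbits: "FP S x ==> FP S (%s. nbits (x s))"
 unfolding nbits_def by (intro FP_bits FP_int_add FP_floor FP_const)

subsection \<open>The trust region procedure\<close>

text \<open>
 \<open>ylam l\<close> is the minimiser \<open>-(H + l Q)\<^sup>-\<^sup>1 b / 2\<close> of the Lagrangian with multiplier \<open>l\<close>; the multiplier is
 good if \<open>H + l Q\<close> is positive definite and this minimiser lies in the ellipsoid. Bisection leaves a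
 bad \<open>lo\<close> close to a good \<open>hi\<close>.
\<close>

definition alam where
 "alam n H Q l = tab n (%i. tab n (%j. mx H i j + l * mx Q i j))"

definition glam where
 "glam n H Q l = gso n (alam n H Q l) (units n n)"

definition ylam where
 "ylam n H b Q l = tab n (%i. \<Sum>j<n. mx (minv n (alam n H Q l) (glam n H Q l)) i j * (- vx b j / 2))"

definition pdlam where
 "pdlam n H Q l = posall n (alam n H Q l) (glam n H Q l)"

definition qnorm where
 "qnorm n Q x = bil n (mx Q) (vx x) (vx x)"

definition good where
 "good n H b Q l \<longleftrightarrow> pdlam n H Q l \<and> qnorm n Q (ylam n H b Q l) \<le> 1"

text \<open>A multiplier that is certainly good. With \<open>R\<close> the inverse of
  \<open>Q\<close>, Cauchy-Schwarz bounds the coordinates of a vector by its Q-norm and the diagonal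
  of \<open>R\<close>, so the sums of absolute entries times 1 plus the trace of \<open>R\<close>
  bound both parts of the objective on the ellipsoid.\<close>

definition lmax where
 "lmax n H b R = 1 + ((\<Sum>i<n. \<Sum>j<n. \<bar>mx H i j\<bar>) + (\<Sum>i<n. \<bar>vx b i\<bar>)) * (1 + (\<Sum>i<n. mx R i i))"

definition seg where
 "seg n y z t = tab n (%i. vx y i + t * (vx z i - vx y i))"

text \<open>For a direction of length \<open>r\<close> the step has length \<open>r + 4 / r\<close>,
  which is at least 4. So it leaves the ellipsoid from any point inside, and no square root is
  needed to scale it.\<close>

definition ray where
 "ray n Q y v = tab n (%i. vx y i + (1 + 4 / qnorm n Q v) * vx v i)"

text \<open>
 A point outside the ellipsoid: the minimiser for \<open>lo\<close>, or else a long step along a direction of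
 nonpositive curvature of \<open>H + lo Q\<close>. The segment from the minimiser for \<open>hi\<close> to it meets the boundary
 in an approximate minimiser.
\<close>

definition outer where
 "outer n H b Q lo hi = (if pdlam n H Q lo then ylam n H b Q lo else
   ray n Q (ylam n H b Q hi) (elt [] (glam n H Q lo) (length (glam n H Q lo) - Suc 0)))"

text \<open>After these halvings the last subinterval, as a piece of the segment, has length at most
  \<open>1 / c\<close>. One plus the squared length stands for the length of the segment, which may
  be irrational.\<close>

definition clip where
 "clip n Q y z c = seg n y z (fst (bisect (%t. 1 < qnorm n Q (seg n y z t)) 0 1
   (nbits (c * (1 + qnorm n Q (tab n (%i. vx z i - vx y i)))))))"

text \<open>The 12 makes the gap between the multipliers at most \<open>e / 12\<close>: the
  quadratic error is at most six times the gap and may use up half of \<open>e\<close>.\<close>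

definition lbracket where
 "lbracket n H b Q R e = bisect (good n H b Q) 0 (lmax n H b R) (nbits (12 * lmax n H b R / e))"

text \<open>With \<open>4 * hi / e\<close> as the last argument, the bound 2 in
  \<open>clip_spec\<close> becomes \<open>e / 2\<close> for the slackness term, the other half of
  the tolerance.\<close>

definition trs2 where
 "trs2 n H b Q e z = clip n Q (ylam n H b Q (snd z)) (outer n H b Q (fst z) (snd z)) (4 * snd z / e)"

definition trs where
 "trs n H b Q R e = (if good n H b Q 0 then ylam n H b Q 0 else trs2 n H b Q e (lbracket n H b Q R e))"

lemma FP_alam: assumes "FP S n" "FP S H" "FP S Q" "FP S l" shows "FP S (%x. alam (n x) (H x) (Q x) (l x))"
 unfolding alam_def
 by (intro FP_tabI FP_rat_add FP_rat_mult FP_mx assms(1,2,3,4)[THEN FP_compose] FP_fst FP_snd FP_id; auto)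

lemma symm_alam: "symm n (mx H) ==> symm n (mx Q) ==> symm n (mx (alam n H Q l))"
 by (auto simp: symm_def alam_def mx_tab)

lemma FP_glam:
 assumes "FP S n" "FP S H" "FP S Q" "FP S l" "\<And>x. x \<in> S ==> symm (n x) (mx (H x))" "\<And>x. x \<in> S ==> symm (n x) (mx (Q x))"
 shows "FP S (%x. glam (n x) (H x) (Q x) (l x))"
 unfolding glam_def
proof (rule FP_gso)
 show "FP S (%x. units (n x) (n x))" by (intro FP_units assms)
qed (auto intro: FP_alam assms symm_alam simp: mx_units)

lemma FP_ylam:
 assumes "FP S n" "FP S H" "FP S b" "FP S Q" "FP S l" "\<And>x. x \<in> S ==> symm (n x) (mx (H x))" "\<And>x. x \<in> S ==> symm (n x) (mx (Q x))"
 shows "FP S (%x. ylam (n x) (H x) (b x) (Q x) (l x))"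
proof -
 have m: "FP S (%x. minv (n x) (alam (n x) (H x) (Q x) (l x)) (glam (n x) (H x) (Q x) (l x)))"
  by (intro FP_minv FP_alam FP_glam assms)
 show ?thesis unfolding ylam_def
  by (intro FP_tabI FP_sum FP_rat_mult FP_rat_divide FP_rat_uminus FP_mx FP_elt FP_const FP_compose[OF m]
   assms(1,3)[THEN FP_compose] FP_fst FP_snd FP_id; auto)
qed

lemma FP_pdlam:
 assumes "FP S n" "FP S H" "FP S Q" "FP S l" "\<And>x. x \<in> S ==> symm (n x) (mx (H x))" "\<And>x. x \<in> S ==> symm (n x) (mx (Q x))"
 shows "FP S (%x. pdlam (n x) (H x) (Q x) (l x))"
 unfolding pdlam_def by (intro FP_posall FP_alam FP_glam assms)

lemma FP_qnorm: "FP S n ==> FP S Q ==> FP S v ==> FP S (%x. qnorm (n x) (Q x) (v x))"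
 unfolding qnorm_def by (intro FP_bil_mx FP_vec)

lemma FP_good:
 assumes "FP S n" "FP S H" "FP S b" "FP S Q" "FP S l" "\<And>x. x \<in> S ==> symm (n x) (mx (H x))" "\<And>x. x \<in> S ==> symm (n x) (mx (Q x))"
 shows "FP S (%x. good (n x) (H x) (b x) (Q x) (l x))"
 unfolding good_def by (intro FP_conj FP_pdlam FP_rat_le FP_qnorm FP_ylam FP_const assms)

lemma FP_lmax: assumes "FP S n" "FP S H" "FP S b" "FP S R" shows "FP S (%x. lmax (n x) (H x) (b x) (R x))"
 unfolding lmax_def
 by (intro FP_rat_add FP_rat_mult FP_sum FP_rat_abs FP_mx FP_elt FP_const assms(1,2,3,4)[THEN FP_compose] FP_fst FP_snd FP_id; auto)

lemma FP_seg: assumes "FP S n" "FP S y" "FP S z" "FP S t" shows "FP S (%x. seg (n x) (y x) (z x) (t x))"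
 unfolding seg_def
 by (intro FP_tabI FP_rat_add FP_rat_mult FP_rat_diff FP_elt assms(1,2,3,4)[THEN FP_compose] FP_fst FP_snd FP_id; auto)

lemma FP_ray: assumes "FP S n" "FP S Q" "FP S y" "FP S v" shows "FP S (%x. ray (n x) (Q x) (y x) (v x))"
 unfolding ray_def
 by (intro FP_tabI FP_rat_add FP_rat_mult FP_rat_divide FP_elt FP_qnorm FP_const assms(1,2,3,4)[THEN FP_compose] FP_fst FP_snd FP_id; auto)

lemma FP_outer:
 assumes "FP S n" "FP S H" "FP S b" "FP S Q" "FP S lo" "FP S hi" "\<And>x. x \<in> S ==> symm (n x) (mx (H x))" "\<And>x. x \<in> S ==> symm (n x) (mx (Q x))"
 shows "FP S (%x. outer (n x) (H x) (b x) (Q x) (lo x) (hi x))"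
 unfolding outer_def
 by (intro FP_If FP_pdlam FP_ylam FP_ray FP_elt FP_glam FP_pred FP_length assms)

lemma FP_clip: assumes "FP S n" "FP S Q" "FP S y" "FP S z" "FP S c" shows "FP S (%x. clip (n x) (Q x) (y x) (z x) (c x))"
proof -
 have d: "FP S (%x. tab (n x) (%i. vx (z x) i - vx (y x) i))"
  by (intro FP_tabI FP_rat_diff FP_elt assms(1,3,4)[THEN FP_compose] FP_fst FP_snd FP_id; auto)
 have R: "FP (S \<times> UNIV) (%w. 1 < qnorm (n (fst w)) (Q (fst w)) (seg (n (fst w)) (y (fst w)) (z (fst w)) (snd w)))"
  by (intro FP_rat_less FP_qnorm FP_seg FP_const assms(1,2,3,4)[THEN FP_compose] FP_fst FP_snd FP_id; auto)
 show ?thesis unfolding clip_def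
  by (intro FP_seg assms FP_fst FP_bisect R FP_const FP_nbits FP_rat_mult FP_rat_add FP_qnorm d)
qed

lemma FP_lbracket:
 assumes "FP S n" "FP S H" "FP S b" "FP S Q" "FP S R" "FP S e" "\<And>x. x \<in> S ==> symm (n x) (mx (H x))" "\<And>x. x \<in> S ==> symm (n x) (mx (Q x))"
 shows "FP S (%x. lbracket (n x) (H x) (b x) (Q x) (R x) (e x))"
proof -
 have g: "FP (S \<times> UNIV) (%w. good (n (fst w)) (H (fst w)) (b (fst w)) (Q (fst w)) (snd w))"
  by (intro FP_good assms(1,2,3,4)[THEN FP_compose] FP_fst FP_snd FP_id) (auto simp: assms)
 show ?thesis unfolding lbracket_def
  by (intro FP_bisect g FP_const FP_lmax FP_nbits FP_rat_divide FP_rat_mult assms)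
qed

lemma FP_trs2:
 assumes "FP S n" "FP S H" "FP S b" "FP S Q" "FP S e" "FP S z" "\<And>x. x \<in> S ==> symm (n x) (mx (H x))" "\<And>x. x \<in> S ==> symm (n x) (mx (Q x))"
 shows "FP S (%x. trs2 (n x) (H x) (b x) (Q x) (e x) (z x))"
 unfolding trs2_def by (intro FP_clip FP_ylam FP_outer FP_rat_divide FP_rat_mult FP_const FP_fst FP_snd assms)

lemma FP_trs:
 assumes "FP S n" "FP S H" "FP S b" "FP S Q" "FP S R" "FP S e" "\<And>x. x \<in> S ==> symm (n x) (mx (H x))" "\<And>x. x \<in> S ==> symm (n x) (mx (Q x))"
 shows "FP S (%x. trs (n x) (H x) (b x) (Q x) (R x) (e x))"
 unfolding trs_def by (intro FP_If FP_good FP_ylam FP_trs2 FP_lbracket FP_const assms)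

subsection \<open>Correctness of the trust region procedure\<close>

definition rx :: "rat list => nat => real" where "rx v i = of_rat (vx v i)"
definition rm :: "rmat => nat => nat => real" where "rm A i j = of_rat (mx A i j)"

lemma bil_rm: "bil n (rm A) (rx x) (rx y) = of_rat (bil n (mx A) (vx x) (vx y))"
 unfolding rm_def rx_def by (rule bil_of_rat)

lemma symm_rm: "symm n (mx A) ==> symm n (rm A)"
 by (simp add: symm_def rm_def)

lemma rx_tab: "i < n ==> rx (tab n f) i = of_rat (f i)"
 by (simp add: rx_def)

lemma scale_identity: "t * t * (D * (x * x + x)) = D * ((t * x) * (t * x) + t * (t * x))" for D :: real
 by (simp add: algebra_simps)

lemma scale_bound: "x \<le> D * (2 * 2 + 1 * 2) ==> D * 12 \<le> e ==> x \<le> e / 2" for D :: real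
 by simp

lemma of_rat_bil_zero_imp:
 assumes pos: "\<And>z. \<exists>i<n. z i \<noteq> 0 ==> 0 < bil n (rm Q) z z" and v: "\<exists>i<n. vx v i \<noteq> 0"
 shows "0 < qnorm n Q v"
proof -
 have "0 < bil n (rm Q) (rx v) (rx v)" by (rule pos) (use v in \<open>auto simp: rx_def\<close>)
 thus ?thesis by (simp add: bil_rm qnorm_def)
qed

context
 fixes n :: nat and H Q R :: "rmat" and b :: "rat list"
 assumes symH: "symm n (mx H)" and symQ: "symm n (mx Q)"
  and posQ: "\<And>z. \<exists>i<n. z i \<noteq> 0 ==> 0 < bil n (rm Q) z z"
  and R: "R = minv n Q (gso n Q (units n n))"
begin

lemma psdQ: "0 \<le> bil n (rm Q) z z"
proof (cases "\<exists>i<n. z i \<noteq> 0")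
 case False
 hence "bil n (rm Q) z z = 0" by (simp add: bil_def)
 thus ?thesis by simp
qed (use posQ in \<open>auto intro: less_imp_le\<close>)

lemma symQ': "symm n (rm Q)"
 by (rule symm_rm[OF symQ])

abbreviation "N \<equiv> nm n (rm Q)"

lemma posall_Q: "posall n Q (gso n Q (units n n))"
proof (rule ccontr)
 assume a: "\<not> ?thesis"
 define v where "v = elt [] (gso n Q (units n n)) (length (gso n Q (units n n)) - Suc 0)"
 have "vx v = mx (gso n Q (units n n)) (length (gso n Q (units n n)) - Suc 0)" by (simp add: v_def mx_def)
 hence "bil n (mx Q) (vx v) (vx v) \<le> 0" "\<exists>i<n. vx v i \<noteq> 0" using not_posall_witness[OF a] by auto
 thus False using of_rat_bil_zero_imp[OF posQ, of v] by (simp add: qnorm_def)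
qed

lemma Q_R: "i < n ==> l < n ==> (\<Sum>j<n. rm Q i j * rm R j l) = (if i = l then 1 else 0)"
 using arg_cong[OF minv_correct[OF symQ refl posall_Q, of i l], of "of_rat :: rat => real"] R
 by (simp add: rm_def of_rat_sum of_rat_mult split: if_splits)

lemma symR: "symm n (mx R)"
 unfolding R by (rule symm_minv)

lemma bil_Q_R: assumes "l < n" shows "bil n (rm Q) z (%j. rm R j l) = z l"
proof -
 have "bil n (rm Q) z (%j. rm R j l) = (\<Sum>i<n. z i * (if i = l then 1 else 0))"
  unfolding bil_dt dt_def by (rule sum.cong) (simp_all add: Q_R assms)
 also have "\<dots> = z l" using assms by (subst sum.mono_neutral_right[of _ "{l}"]) auto
 finally show ?thesis .
qed

lemma R_diag_nonneg: "l < n ==> 0 \<le> rm R l l"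
 using psdQ[of "%j. rm R j l"] bil_Q_R[of l "%j. rm R j l"] by simp

text \<open>Cauchy-Schwarz with column \<open>l\<close> of the inverse: its product with
  \<open>z\<close> is the coordinate itself, and its squared norm is the diagonal entry.\<close>

lemma coord_bound: assumes "l < n" shows "\<bar>z l\<bar> \<le> N z * sqrt (rm R l l)"
proof -
 have "\<bar>bil n (rm Q) z (%j. rm R j l)\<bar> \<le> N z * N (%j. rm R j l)"
  by (rule nm_cauchy[OF symQ' psdQ])
 thus ?thesis using assms
  by (simp add: bil_Q_R nm_def[OF symQ' psdQ])
qed

abbreviation "rtr \<equiv> 1 + (\<Sum>i<n. rm R i i)"

lemma coord_bound': assumes "l < n" "l' < n" shows "\<bar>z l\<bar> * \<bar>z' l'\<bar> \<le> rtr * (N z * N z')"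
proof -
 have r: "rm R l l \<le> rtr" if "l < n" for l
  using member_le_sum[of l "{..<n}" "%i. rm R i i"] R_diag_nonneg that by auto
 have n0: "0 \<le> N z" "0 \<le> N z'" by (rule nm_nonneg[OF symQ' psdQ])+
 have "\<bar>z l\<bar> * \<bar>z' l'\<bar> \<le> (N z * sqrt rtr) * (N z' * sqrt rtr)"
 proof (rule mult_mono)
  show "\<bar>z l\<bar> \<le> N z * sqrt rtr"
   using coord_bound[OF assms(1), of z] mult_left_mono[OF real_sqrt_le_mono[OF r[OF assms(1)]] n0(1)] by linarith
  show "\<bar>z' l'\<bar> \<le> N z' * sqrt rtr"
   using coord_bound[OF assms(2), of z'] mult_left_mono[OF real_sqrt_le_mono[OF r[OF assms(2)]] n0(2)] by linarith
  show "0 \<le> N z * sqrt rtr" using n0 R_diag_nonneg by (auto intro!: mult_nonneg_nonneg add_nonneg_nonneg sum_nonneg)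
 qed simp
 also have "\<dots> = (sqrt rtr * sqrt rtr) * (N z * N z')" by (simp only: mult_ac)
 also have "sqrt rtr * sqrt rtr = rtr"
 proof -
  have "0 \<le> rtr" using R_diag_nonneg by (auto intro!: add_nonneg_nonneg sum_nonneg)
  thus ?thesis by (rule real_sqrt_mult_self[THEN trans, OF abs_of_nonneg])
 qed
 finally show ?thesis .
qed

lemma coord_bound1: assumes "l < n" shows "\<bar>z l\<bar> \<le> rtr * N z"
proof -
 have r: "0 \<le> (\<Sum>i<n. rm R i i)" using R_diag_nonneg by (intro sum_nonneg) auto
 have "sqrt (rm R l l) \<le> sqrt (rtr * rtr)"
 proof (rule real_sqrt_le_mono)
  have "rm R l l \<le> rtr" using member_le_sum[of l "{..<n}" "%i. rm R i i"] R_diag_nonneg assms by auto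
  also have "rtr * 1 \<le> rtr * rtr" using r by (intro mult_left_mono) auto
  finally show "rm R l l \<le> rtr * rtr" by simp
 qed
 hence "sqrt (rm R l l) \<le> rtr" using r by simp
 hence "N z * sqrt (rm R l l) \<le> N z * rtr" by (intro mult_left_mono nm_nonneg[OF symQ' psdQ])
 thus ?thesis using coord_bound[OF assms, of z] by (simp add: mult.commute)
qed

abbreviation "Lm \<equiv> of_rat (lmax n H b R) :: real"

lemma Lm_eq: "Lm = 1 + ((\<Sum>i<n. \<Sum>j<n. \<bar>rm H i j\<bar>) + (\<Sum>i<n. \<bar>rx b i\<bar>)) * rtr"
 unfolding lmax_def rm_def rx_def of_rat_add of_rat_mult of_rat_sum abs_of_rat by simp

lemma H_bound: "\<bar>bil n (rm H) z z'\<bar> \<le> (\<Sum>i<n. \<Sum>j<n. \<bar>rm H i j\<bar>) * rtr * (N z * N z')"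
proof -
 have "\<bar>bil n (rm H) z z'\<bar> \<le> (\<Sum>i<n. \<Sum>j<n. \<bar>rm H i j\<bar> * (rtr * (N z * N z')))"
  unfolding bil_def
 proof (rule order.trans[OF sum_abs sum_mono], rule order.trans[OF sum_abs sum_mono])
  fix i j assume "i \<in> {..<n}" "j \<in> {..<n}"
  hence "\<bar>rm H i j\<bar> * (\<bar>z i\<bar> * \<bar>z' j\<bar>) \<le> \<bar>rm H i j\<bar> * (rtr * (N z * N z'))"
   by (intro mult_left_mono coord_bound') auto
  thus "\<bar>z i * rm H i j * z' j\<bar> \<le> \<bar>rm H i j\<bar> * (rtr * (N z * N z'))" by (simp add: abs_mult mult_ac)
 qed
 thus ?thesis by (simp only: sum_distrib_right[symmetric] mult.assoc)
qed

lemma b_bound: "\<bar>dt n (rx b) z\<bar> \<le> (\<Sum>i<n. \<bar>rx b i\<bar>) * rtr * N z"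
proof -
 have "\<bar>dt n (rx b) z\<bar> \<le> (\<Sum>i<n. \<bar>rx b i\<bar> * (rtr * N z))"
  unfolding dt_def
 proof (rule order.trans[OF sum_abs sum_mono])
  fix i assume "i \<in> {..<n}"
  hence "\<bar>rx b i\<bar> * \<bar>z i\<bar> \<le> \<bar>rx b i\<bar> * (rtr * N z)" by (intro mult_left_mono coord_bound1) auto
  thus "\<bar>rx b i * z i\<bar> \<le> \<bar>rx b i\<bar> * (rtr * N z)" by (simp add: abs_mult)
 qed
 thus ?thesis by (simp only: sum_distrib_right[symmetric] mult.assoc)
qed

lemma rm_alam: "i < n ==> j < n ==> rm (alam n H Q l) i j = rm H i j + of_rat l * rm Q i j"
 by (simp add: rm_def alam_def mx_tab of_rat_add of_rat_mult)

lemma bil_alam: "bil n (rm (alam n H Q l)) z z' = bil n (rm H) z z' + of_rat l * bil n (rm Q) z z'"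
proof -
 have "bil n (rm (alam n H Q l)) z z' = bil n (%i j. rm H i j + of_rat l * rm Q i j) z z'"
  by (rule bil_cong) (auto simp: rm_alam)
 thus ?thesis by (simp add: bil_def algebra_simps sum.distrib sum_distrib_left)
qed

lemma psd_alam: "pdlam n H Q l ==> 0 \<le> bil n (rm (alam n H Q l)) z z"
 unfolding rm_def pdlam_def glam_def by (rule psd_of_gso[OF symm_alam[OF symH symQ]])

lemma ylam_eq:
 assumes "pdlam n H Q l" "i < n"
 shows "(\<Sum>j<n. (rm H i j + of_rat l * rm Q i j) * rx (ylam n H b Q l) j) = - rx b i / 2"
proof -
 let ?A = "alam n H Q l" and ?I = "minv n (alam n H Q l) (glam n H Q l)"
 have "(\<Sum>j<n. mx ?A i j * vx (ylam n H b Q l) j) = (\<Sum>j<n. \<Sum>k<n. mx ?A i j * mx ?I j k * (- vx b k / 2))"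
  by (rule sum.cong) (auto simp: ylam_def sum_distrib_left mult.assoc)
 also have "\<dots> = (\<Sum>k<n. (\<Sum>j<n. mx ?A i j * mx ?I j k) * (- vx b k / 2))"
  by (subst sum.swap) (simp only: sum_distrib_right)
 also have "\<dots> = (\<Sum>k<n. (if i = k then 1 else 0) * (- vx b k / 2))"
  using assms minv_correct[OF symm_alam[OF symH symQ] glam_def] by (intro sum.cong) (auto simp: pdlam_def)
 also have "\<dots> = - vx b i / 2" using assms by (subst sum.mono_neutral_right[of _ "{i}"]) auto
 finally have "(of_rat (\<Sum>j<n. mx ?A i j * vx (ylam n H b Q l) j) :: real) = of_rat (- vx b i / 2)" by simp
 hence "(\<Sum>j<n. rm ?A i j * rx (ylam n H b Q l) j) = - rx b i / 2"
  by (simp add: of_rat_sum of_rat_mult rm_def rx_def of_rat_divide of_rat_minus)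
 moreover have "(\<Sum>j<n. rm ?A i j * rx (ylam n H b Q l) j) = (\<Sum>j<n. (rm H i j + of_rat l * rm Q i j) * rx (ylam n H b Q l) j)"
  by (rule sum.cong) (auto simp: rm_alam assms)
 ultimately show ?thesis by simp
qed

lemma bil_ylam:
 assumes "pdlam n H Q l"
 shows "bil n (rm (alam n H Q l)) z (rx (ylam n H b Q l)) = - dt n (rx b) z / 2"
proof -
 have "bil n (rm (alam n H Q l)) z (rx (ylam n H b Q l)) = dt n z (%i. (- 1 / 2) * rx b i)"
  unfolding bil_dt
 proof (rule dt_cong)
  fix i assume i: "i < n"
  have "(\<Sum>j<n. rm (alam n H Q l) i j * rx (ylam n H b Q l) j) = (\<Sum>j<n. (rm H i j + of_rat l * rm Q i j) * rx (ylam n H b Q l) j)"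
   by (rule sum.cong) (auto simp: rm_alam i)
  thus "(\<Sum>j<n. rm (alam n H Q l) i j * rx (ylam n H b Q l) j) = (- 1 / 2) * rx b i"
   using ylam_eq[OF assms i] by simp
 qed simp
 thus ?thesis unfolding dt_scale by (simp add: dt_commute)
qed

lemma qnorm_N: "N (rx v) * N (rx v) = of_rat (qnorm n Q v)"
 by (simp add: nm_square[OF symQ' psdQ] bil_rm qnorm_def)

lemma qnorm_le_1: "qnorm n Q v \<le> 1 \<longleftrightarrow> N (rx v) \<le> 1"
 by (simp add: nm_le_1[OF symQ' psdQ] bil_rm qnorm_def)

text \<open>At this multiplier H + l Q dominates \<open>(1 + s) Q\<close>, where \<open>s\<close>
  bounds the linear term on the unit ball. This gives definiteness, and multiplying the equation of
  the minimiser \<open>y\<close> by \<open>y\<close> yields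
  \<open>(1 + s) * (N y * N y) \<le> s * N y\<close>, so \<open>y\<close> lies in the ball.\<close>

lemma good_lmax: "good n H b Q (lmax n H b R)"
proof -
 let ?l = "lmax n H b R" and ?A = "alam n H Q (lmax n H b R)"
 define sH sb where sh: "sH = (\<Sum>i<n. \<Sum>j<n. \<bar>rm H i j\<bar>)" "sb = (\<Sum>i<n. \<bar>rx b i\<bar>)"
 have tr: "1 \<le> rtr" using R_diag_nonneg by (auto intro: sum_nonneg)
 have s0: "0 \<le> sH" "0 \<le> sb" by (auto simp: sh sum_nonneg)
 have Lm: "Lm = 1 + sH * rtr + sb * rtr" by (simp add: Lm_eq sh distrib_right)
 have A: "(1 + sb * rtr) * bil n (rm Q) z z \<le> bil n (rm ?A) z z" for z
  using H_bound[of z z] unfolding bil_alam Lm by (simp add: nm_square[OF symQ' psdQ] sh algebra_simps abs_le_iff)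
 have pd: "pdlam n H Q ?l"
 proof (rule ccontr)
  assume a: "\<not> ?thesis"
  let ?vs = "glam n H Q ?l"
  define v where "v = elt [] ?vs (length ?vs - Suc 0)"
  have "vx v = mx ?vs (length ?vs - Suc 0)" by (simp add: v_def mx_def)
  hence v: "bil n (mx ?A) (vx v) (vx v) \<le> 0" "\<exists>i<n. vx v i \<noteq> 0"
   using not_posall_witness[of n ?A] a by (auto simp: pdlam_def glam_def)
  have "0 < bil n (rm Q) (rx v) (rx v)" by (rule posQ) (use v in \<open>auto simp: rx_def\<close>)
  hence "0 < (1 + sb * rtr) * bil n (rm Q) (rx v) (rx v)"
   using s0 tr by (intro mult_pos_pos add_pos_nonneg mult_nonneg_nonneg) auto
  also have "\<dots> \<le> bil n (rm ?A) (rx v) (rx v)" by (rule A)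
  finally show False using v by (simp add: bil_rm)
 qed
 define y where "y = rx (ylam n H b Q ?l)"
 have "(1 + sb * rtr) * (N y * N y) \<le> - dt n (rx b) y / 2"
  using A[of y] bil_ylam[OF pd, of y] by (simp add: y_def nm_square[OF symQ' psdQ])
 also have "\<dots> \<le> sb * rtr * N y" using b_bound[of y] unfolding sh by (simp add: abs_le_iff)
 finally have "(1 + sb * rtr) * (N y * N y) \<le> (sb * rtr) * N y" .
 moreover have "(sb * rtr) * N y \<le> (1 + sb * rtr) * N y"
  by (intro mult_right_mono nm_nonneg[OF symQ' psdQ]) simp
 ultimately have "(1 + sb * rtr) * (N y * N y) \<le> (1 + sb * rtr) * N y" by simp
 moreover have "0 < 1 + sb * rtr" using s0 tr by (intro add_pos_nonneg mult_nonneg_nonneg) auto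
 ultimately have "N y * N y \<le> N y" by (simp add: mult_le_cancel_left_pos)
 hence "N y \<le> 1" using nm_nonneg[OF symQ' psdQ, of y] by (cases "N y = 0") auto
 thus ?thesis using pd by (simp add: good_def qnorm_le_1 y_def)
qed

abbreviation "g \<equiv> qf n (rm H) (rx b)"

lemma lagrange_pdlam:
 assumes "pdlam n H Q l" "0 \<le> l" "N u \<le> 1"
 shows "g w \<le> g u + bil n (rm (alam n H Q l)) (%i. w i - rx (ylam n H b Q l) i) (%i. w i - rx (ylam n H b Q l) i)
   + of_rat l * (1 - bil n (rm Q) w w)"
proof -
 have e: "bil n (%i j. rm H i j + of_rat l * rm Q i j) z z' = bil n (rm (alam n H Q l)) z z'" for z z'
  by (rule bil_cong) (auto simp: rm_alam)
 have "g w \<le> g u + bil n (%i j. rm H i j + of_rat l * rm Q i j) (%i. w i - rx (ylam n H b Q l) i) (%i. w i - rx (ylam n H b Q l) i)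
   + of_rat l * (1 - bil n (rm Q) w w)"
 proof (rule lagrange[OF symQ' psdQ symm_rm[OF symH]])
  show "0 \<le> bil n (%i j. rm H i j + of_rat l * rm Q i j) z z" for z
   unfolding e by (rule psd_alam[OF assms(1)])
 qed (use assms ylam_eq[OF assms(1)] nm_le_1[OF symQ' psdQ] in auto)
 thus ?thesis by (simp only: e)
qed

text \<open>If both matrices are definite, subtracting the two stationarity equations shows that the
  matrix for \<open>hi\<close> maps \<open>d\<close> to \<open>(hi - lo) Q z\<close>. Otherwise the
  form for \<open>lo\<close> is nonpositive along the ray and only \<open>(hi - lo) Q\<close>
  remains. In both cases the excess of the Lagrangian is proportional to the gap.\<close>

lemma outer_spec:
 assumes lo: "\<not> good n H b Q lo" and hi: "good n H b Q hi" and le: "lo \<le> hi"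
 defines "y \<equiv> rx (ylam n H b Q hi)" and "z \<equiv> rx (outer n H b Q lo hi)"
 defines "d \<equiv> %i. z i - y i"
 shows "1 < N z" "bil n (rm (alam n H Q hi)) d d \<le> of_rat (hi - lo) * (N d * N d + N d)"
proof -
 have Ny: "N y \<le> 1" using hi by (simp add: good_def qnorm_le_1 y_def)
 have pdhi: "pdlam n H Q hi" using hi by (simp add: good_def)
 have d0: "0 \<le> N d" by (rule nm_nonneg[OF symQ' psdQ])
 have del: "0 \<le> (of_rat (hi - lo) :: real)" using le by simp
 have Ahi: "bil n (rm (alam n H Q hi)) x x' = bil n (rm (alam n H Q lo)) x x' + of_rat (hi - lo) * bil n (rm Q) x x'" for x x'
  by (simp add: bil_alam of_rat_diff algebra_simps)
 have "1 < N z \<and> bil n (rm (alam n H Q hi)) d d \<le> of_rat (hi - lo) * (N d * N d + N d)"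
 proof (cases "pdlam n H Q lo")
  case True
  hence z: "z = rx (ylam n H b Q lo)" by (simp add: z_def outer_def)
  have "1 < N z" using lo True by (simp add: good_def qnorm_le_1 z)
  have zd: "N z \<le> N d + 1"
   using nm_add[OF symQ' psdQ, of d y] Ny by (simp add: d_def)
  have "bil n (rm (alam n H Q hi)) d d = bil n (rm (alam n H Q hi)) d z - bil n (rm (alam n H Q hi)) d y"
   unfolding d_def by (simp add: bil_linear)
  also have "\<dots> = of_rat (hi - lo) * bil n (rm Q) d z"
   using bil_ylam[OF pdhi, of d] bil_ylam[OF True, of d] unfolding Ahi[of d z] by (simp add: z y_def)
  also have "\<dots> \<le> of_rat (hi - lo) * (N d * N z)"
   using nm_cauchy[OF symQ' psdQ, of d z] del by (intro mult_left_mono) auto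
  also have "\<dots> \<le> of_rat (hi - lo) * (N d * (N d + 1))"
   using zd d0 del by (intro mult_left_mono) auto
  finally show ?thesis using \<open>1 < N z\<close> by (simp add: distrib_left)
 next
  case False
  let ?vs = "glam n H Q lo"
  define v where "v = elt [] ?vs (length ?vs - Suc 0)"
  have "vx v = mx ?vs (length ?vs - Suc 0)" by (simp add: v_def mx_def)
  hence v: "bil n (mx (alam n H Q lo)) (vx v) (vx v) \<le> 0" "\<exists>i<n. vx v i \<noteq> 0"
   using not_posall_witness[of n "alam n H Q lo"] False by (auto simp: pdlam_def glam_def)
  define s where "s = qnorm n Q v"
  have s: "0 < s" unfolding s_def by (rule of_rat_bil_zero_imp[OF posQ v(2)])
  define T :: real where "T = of_rat (1 + 4 / s)"
  have z: "z i = y i + T * rx v i" if "i < n" for i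
   using that False by (simp add: z_def outer_def ray_def rx_tab y_def T_def s_def v_def rx_def of_rat_add of_rat_mult)
  have d: "d i = T * rx v i" if "i < n" for i using z[OF that] by (simp add: d_def)
  have NT: "N d = \<bar>T\<bar> * N (rx v)"
   using nm_cong[OF symQ' psdQ, of d "%i. T * rx v i"] d nm_scale[OF symQ' psdQ, of T "rx v"] by simp
  have T1: "1 \<le> T" using s by (simp add: T_def of_rat_add)
  have "bil n (rm (alam n H Q lo)) d d = bil n (rm (alam n H Q lo)) (%i. T * rx v i) (%i. T * rx v i)"
   by (rule bil_cong) (auto simp: d)
  also have "\<dots> = T * T * of_rat (bil n (mx (alam n H Q lo)) (vx v) (vx v))" by (simp add: bil_linear bil_rm)
  also have "\<dots> \<le> 0" using v T1 by (intro mult_nonneg_nonpos) auto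
  finally have "bil n (rm (alam n H Q hi)) d d \<le> of_rat (hi - lo) * (N d * N d)"
   unfolding Ahi by (simp add: nm_square[OF symQ' psdQ])
  also have "\<dots> \<le> of_rat (hi - lo) * (N d * N d + N d)" using d0 del by (intro mult_left_mono) auto
  finally have 1: "bil n (rm (alam n H Q hi)) d d \<le> of_rat (hi - lo) * (N d * N d + N d)" .
  define r where "r = N (rx v)"
  have r: "r * r = of_rat s" unfolding r_def qnorm_N s_def ..
  have "r \<noteq> 0" using r s by auto
  hence r0: "0 < r" using nm_nonneg[OF symQ' psdQ, of "rx v"] by (simp add: r_def)
  have "T * r = r + 4 / r"
  proof -
   have "T = 1 + 4 / (r * r)" by (simp add: T_def of_rat_add of_rat_divide r)
   hence "T * r = (1 + 4 / (r * r)) * r" by (simp only:)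
   also have "\<dots> = r + 4 / r" using r0 by (simp add: distrib_right)
   finally show ?thesis .
  qed
  moreover have "4 \<le> r + 4 / r"
  proof -
   have "0 \<le> (r - 2) * (r - 2) / r" using r0 by simp
   also have "\<dots> = r + 4 / r - 4" using r0 by (simp add: field_simps)
   finally show ?thesis by simp
  qed
  ultimately have "4 \<le> N d" using NT T1 by (simp add: r_def)
  moreover have "N d \<le> N z + N y" unfolding d_def by (rule nm_diff[OF symQ' psdQ])
  ultimately show ?thesis using 1 Ny by simp
 qed
 thus "1 < N z" "bil n (rm (alam n H Q hi)) d d \<le> of_rat (hi - lo) * (N d * N d + N d)" by auto
qed

text \<open>The right end of the bracket lies outside the ellipsoid, so the norm of \<open>w\<close>
  misses 1 by less than one subinterval of the segment, and \<open>1 - N w * N w\<close> is at most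
  twice that.\<close>

lemma clip_spec:
 assumes y: "qnorm n Q y \<le> 1" and z: "1 < qnorm n Q z" and c: "0 \<le> c"
 defines "d \<equiv> %i. rx z i - rx y i" and "w \<equiv> rx (clip n Q y z c)"
 shows "\<exists>t. 0 \<le> t \<and> t \<le> 1 \<and> (\<forall>i<n. w i = rx y i + t * d i)" "N w \<le> 1"
  "of_rat c * (1 - bil n (rm Q) w w) \<le> 2"
proof -
 let ?P = "%t. 1 < qnorm n Q (seg n y z t)"
 define D where "D = tab n (%i. vx z i - vx y i)"
 define m where "m = nbits (c * (1 + qnorm n Q D))"
 define tt where "tt = bisect ?P 0 1 m"
 define t where "t = fst tt"
 define t' where "t' = snd tt"
 have q0: "qnorm n Q (seg n y z 0) = qnorm n Q y" "qnorm n Q (seg n y z 1) = qnorm n Q z"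
  unfolding qnorm_def by (rule bil_cong; simp add: seg_def)+
 have P01: "\<not> ?P 0" "?P 1" using q0 y z by auto
 have "(0::rat) \<le> 1" by simp
 note bs = bisect_spec[of ?P 0 1 m, OF P01 this, folded tt_def]
 have t: "0 \<le> t" "t \<le> 1" "t' - t = 1 / 2 ^ m"
 proof -
  show t0: "0 \<le> t" "t' - t = 1 / 2 ^ m" using bs(3,4) by (simp_all add: t_def t'_def)
  have "0 \<le> t' - t" unfolding t0(2) by simp
  thus "t \<le> 1" using bs(5) by (simp add: t'_def)
 qed
 have seg: "rx (seg n y z s) i = rx y i + of_rat s * d i" if "i < n" for i s
  using that by (simp add: seg_def rx_tab d_def rx_def of_rat_add of_rat_mult of_rat_diff)
 have w: "w = rx (seg n y z t)" by (simp add: w_def clip_def t_def tt_def m_def D_def)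
 show "\<exists>t. 0 \<le> t \<and> t \<le> 1 \<and> (\<forall>i<n. w i = rx y i + t * d i)"
  using t seg by (intro exI[of _ "of_rat t"]) (auto simp: w)
 show w1: "N w \<le> 1" using bs(1) by (simp add: w qnorm_le_1[symmetric] t_def not_less)
 define w' where "w' = rx (seg n y z t')"
 have w'1: "1 < N w'" using bs(2) qnorm_le_1[of "seg n y z t'"] by (simp add: w'_def t'_def)
 have Nd: "N d * N d = of_rat (qnorm n Q D)"
 proof -
  have "N d = N (rx D)" by (rule nm_cong[OF symQ' psdQ]) (simp add: D_def d_def rx_tab rx_def of_rat_diff)
  thus ?thesis by (simp add: qnorm_N)
 qed
 have d0: "0 \<le> N d" by (rule nm_nonneg[OF symQ' psdQ])
 have "N w' = N (%i. w i + of_rat (t' - t) * d i)"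
  by (rule nm_cong[OF symQ' psdQ]) (simp add: w'_def w seg of_rat_diff algebra_simps)
 also have "\<dots> \<le> N w + of_rat (t' - t) * N d"
  using nm_add[OF symQ' psdQ, of w "%i. of_rat (t' - t) * d i"] nm_scale[OF symQ' psdQ, of "of_rat (t' - t)" d] t
  by simp
 finally have 1: "1 - N w < N d / 2 ^ m" using w'1 t by (simp add: of_rat_divide of_rat_power)
 have w0: "0 \<le> N w" by (rule nm_nonneg[OF symQ' psdQ])
 have "1 - bil n (rm Q) w w = (1 - N w) * (1 + N w)" by (simp add: nm_square[OF symQ' psdQ, symmetric] algebra_simps)
 also have "\<dots> \<le> (N d / 2 ^ m) * 2" using 1 w0 w1 by (intro mult_mono) auto
 finally have 2: "1 - bil n (rm Q) w w \<le> 2 * (N d / 2 ^ m)" by (simp only: mult.commute)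
 have "N d \<le> 1 + N d * N d"
 proof (cases "N d \<le> 1")
  case False
  hence "N d * 1 \<le> N d * N d" by (intro mult_left_mono) auto
  thus ?thesis by simp
 next
  case True
  have "0 \<le> N d * N d" using d0 by simp
  thus ?thesis using True by linarith
 qed
 hence "of_rat c * N d \<le> of_rat c * (1 + N d * N d)" using c by (intro mult_left_mono) auto
 also have "\<dots> = of_rat (c * (1 + qnorm n Q D))" by (simp add: Nd of_rat_mult of_rat_add)
 also have "\<dots> \<le> of_rat (2 ^ m)" unfolding m_def of_rat_less_eq by (rule le_nbits)
 finally have "of_rat c * N d \<le> 2 ^ m" by (simp add: of_rat_power)
 hence 3: "of_rat c * (N d / 2 ^ m) \<le> 1" by (simp add: divide_le_eq)
 have "of_rat c * (1 - bil n (rm Q) w w) \<le> of_rat c * (2 * (N d / 2 ^ m))"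
  using 2 c by (intro mult_left_mono) auto
 also have "\<dots> = 2 * (of_rat c * (N d / 2 ^ m))" by (simp only: mult.left_commute)
 finally show "of_rat c * (1 - bil n (rm Q) w w) \<le> 2" using 3 by linarith
qed

text \<open>The outer point may be far away, but \<open>w\<close> and \<open>y\<close> both lie in
  the ball, so \<open>t * N d \<le> 2\<close>. Multiplied by \<open>t * t\<close>, the bound of
  \<open>outer_spec\<close> is therefore at most six times the gap, whatever the distance.\<close>

lemma trs_spec:
 assumes e: "0 < e"
 defines "w \<equiv> rx (trs n H b Q R e)"
 shows "N w \<le> 1" "N u \<le> 1 ==> g w \<le> g u + of_rat e"
proof -
 have "N w \<le> 1 \<and> (N u \<le> 1 --> g w \<le> g u + of_rat e)"
 proof (cases "good n H b Q 0")
  case True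
  hence w: "w = rx (ylam n H b Q 0)" by (simp add: w_def trs_def)
  have pd: "pdlam n H Q 0" using True by (simp add: good_def)
  have "g w \<le> g u + of_rat e" if "N u \<le> 1"
  proof -
   have "g w \<le> g u" using lagrange_pdlam[OF pd _ that, of w] by (simp add: w bil_def)
   moreover have "(0::real) \<le> of_rat e" using e by simp
   ultimately show ?thesis by linarith
  qed
  thus ?thesis using True by (simp add: w good_def qnorm_le_1)
 next
  case False
  define m where "m = nbits (12 * lmax n H b R / e)"
  define lh where "lh = bisect (good n H b Q) 0 (lmax n H b R) m"
  define lo where "lo = fst lh"
  define hi where "hi = snd lh"
  have "0 \<le> Lm" unfolding Lm_eq using R_diag_nonneg
   by (intro add_nonneg_nonneg mult_nonneg_nonneg sum_nonneg) auto
  hence l0: "0 \<le> lmax n H b R" by simp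
  note bs = bisect_spec[of "good n H b Q", OF False good_lmax l0, of m, folded lh_def, folded lo_def hi_def]
  have le: "0 \<le> hi - lo" unfolding bs(3) using l0 by simp
  have hi0: "0 \<le> hi" using bs(4) le by simp
  have small: "of_rat (hi - lo) * 12 \<le> (of_rat e :: real)"
  proof -
   have "12 * lmax n H b R / e \<le> 2 ^ m" unfolding m_def by (rule le_nbits)
   hence "12 * lmax n H b R \<le> 2 ^ m * e" using e by (simp add: divide_le_eq)
   hence "lmax n H b R * 12 / 2 ^ m \<le> e" by (simp add: divide_le_eq mult.commute)
   hence "(hi - lo) * 12 \<le> e" unfolding bs(3) by simp
   hence "(of_rat ((hi - lo) * 12) :: real) \<le> of_rat e" by (simp only: of_rat_less_eq)
   thus ?thesis by (simp only: of_rat_mult of_rat_numeral_eq)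
  qed
  define y where "y = ylam n H b Q hi"
  define z where "z = outer n H b Q lo hi"
  define d where "d = (%i. rx z i - rx y i)"
  have "lo \<le> hi" using le by simp
  note os' = outer_spec[OF bs(1,2) this, folded y_def z_def]
  have os: "1 < N (rx z)" "bil n (rm (alam n H Q hi)) d d \<le> of_rat (hi - lo) * (N d * N d + N d)"
   unfolding d_def by (rule os')+
  have y1: "qnorm n Q y \<le> 1" and pd: "pdlam n H Q hi" using bs(2) by (simp_all add: good_def y_def)
  have z1: "1 < qnorm n Q z" using os(1) unfolding not_le[symmetric] qnorm_le_1 .
  have c0: "0 \<le> 4 * hi / e" using hi0 e by simp
  have w: "w = rx (clip n Q y z (4 * hi / e))"
   unfolding w_def trs_def trs2_def lbracket_def y_def z_def lo_def hi_def lh_def m_def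
   by (simp only: False if_False)
  note cs = clip_spec[OF y1 z1 c0, folded w]
  from cs(1) obtain t where t': "0 \<le> t \<and> t \<le> 1 \<and> (\<forall>i<n. w i = rx y i + t * (rx z i - rx y i))" ..
  hence t: "0 \<le> t" "t \<le> 1" "\<And>i. i < n ==> w i = rx y i + t * d i" by (simp_all add: d_def)
  have d0: "0 \<le> N d" by (rule nm_nonneg[OF symQ' psdQ])
  have td: "t * N d \<le> 2"
  proof -
   have "t * N d = N (%i. t * d i)" using nm_scale[OF symQ' psdQ, of t d] t by simp
   also have "\<dots> = N (%i. w i - rx y i)" by (rule nm_cong[OF symQ' psdQ]) (simp add: t)
   also have "\<dots> \<le> N w + N (rx y)" by (rule nm_diff[OF symQ' psdQ])
   also have "\<dots> \<le> 2" using cs(2) y1 by (simp add: qnorm_le_1)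
   finally show ?thesis .
  qed
  have "bil n (rm (alam n H Q hi)) (%i. w i - rx y i) (%i. w i - rx y i) = t * t * bil n (rm (alam n H Q hi)) d d"
  proof -
   have "bil n (rm (alam n H Q hi)) (%i. w i - rx y i) (%i. w i - rx y i) = bil n (rm (alam n H Q hi)) (%i. t * d i) (%i. t * d i)"
    by (rule bil_cong) (auto simp: t)
   thus ?thesis by (simp add: bil_linear)
  qed
  also have "\<dots> \<le> t * t * (of_rat (hi - lo) * (N d * N d + N d))" using os(2) t by (intro mult_left_mono) auto
  also have "\<dots> = of_rat (hi - lo) * ((t * N d) * (t * N d) + t * (t * N d))" by (rule scale_identity)
  also have "\<dots> \<le> of_rat (hi - lo) * (2 * 2 + 1 * 2)"
  proof (rule mult_left_mono)
   have tN: "0 \<le> t * N d" using t d0 by simp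
   have "(t * N d) * (t * N d) \<le> 2 * 2" by (rule mult_mono[OF td td _ tN]) simp
   moreover have "t * (t * N d) \<le> 1 * 2" by (rule mult_mono[OF t(2) td _ tN]) simp
   ultimately show "(t * N d) * (t * N d) + t * (t * N d) \<le> 2 * 2 + 1 * 2" by (rule add_mono)
  qed (use le in simp)
  finally have 1: "bil n (rm (alam n H Q hi)) (%i. w i - rx y i) (%i. w i - rx y i) \<le> of_rat e / 2"
   by (rule scale_bound[OF _ small])
  have "of_rat (4 * hi / e) * (1 - bil n (rm Q) w w) \<le> 2" by (rule cs(3))
  also have "of_rat (4 * hi / e) = 4 * of_rat hi / (of_rat e :: real)" by (simp add: of_rat_mult of_rat_divide)
  finally have "4 * (of_rat hi * (1 - bil n (rm Q) w w)) / of_rat e \<le> 2" by simp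
  moreover have "(0::real) < of_rat e" using e by simp
  ultimately have "4 * (of_rat hi * (1 - bil n (rm Q) w w)) \<le> 2 * of_rat e" by (simp only: pos_divide_le_eq)
  hence 2: "of_rat hi * (1 - bil n (rm Q) w w) \<le> of_rat e / 2" by linarith
  have "g w \<le> g u + of_rat e" if "N u \<le> 1"
   using lagrange_pdlam[OF pd hi0 that, of w] 1 2 by (simp add: y_def)
  thus ?thesis using cs(2) by simp
 qed
 thus "N w \<le> 1" "N u \<le> 1 ==> g w \<le> g u + of_rat e" by auto
qed

end

section \<open>Lattice basis reduction\<close>

text \<open>The orthogonalisation coefficients of all rows, as a unit lower triangular
  matrix.\<close>

definition mum where
 "mum n R vs W = tab (length W) (%k. tab (length W) (%j.
   if j < k then gcoef n R vs (elt [] W k) j else if j = k then 1 else 0))"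

text \<open>
 \<open>tcoef M k\<close> is the integer vector \<open>t\<^sub>0, \<dots>, t\<^sub>k = 1\<close>, computed from the back, whose combination of
 the first \<open>k + 1\<close> rows is reduced.
\<close>

definition tnext where
 "tnext M acc j = of_int (- round (\<Sum>i<length acc. vx acc i * mx M (Suc (j + i)) j)) # acc"

definition tcoef where
 "tcoef M k = foldl (tnext M) [1] (rev [0..<k])"

definition srow where
 "srow n W t = tab n (%l. \<Sum>i<length t. vx t i * mx W i l)"

text \<open>All rows are reduced at once from the coefficients of the old basis. Every new row is an
  integer combination of old rows, so no intermediate bases arise whose size would have to be
  controlled.\<close>

definition sred where
 "sred n W M = tab (length W) (%k. srow n W (tcoef M k))"

text \<open>The norms are compared directly, a simplification of the condition of Lovasz. With
  coefficients of at most 1/2 in absolute value this still makes every exchange halve a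
  norm.\<close>

definition viol where
 "viol n R vs i \<longleftrightarrow> 4 * bil n (mx R) (mx vs (Suc i)) (mx vs (Suc i)) < bil n (mx R) (mx vs i) (mx vs i)"

text \<open>A violating index is smaller than \<open>length vs - 1\<close>, so
  \<open>length vs\<close> can signal that there is none.\<close>

definition fviol where
 "fviol n R vs = foldl (%r i. if viol n R vs i then i else r) (length vs) [0..<length vs - Suc 0]"

definition rswap :: "rmat => nat => rmat" where
 "rswap W i = tab (length W) (%k. elt [] W (if k = i then Suc i else if k = Suc i then i else k))"

definition lstep2 where
 "lstep2 n R W vs = (if fviol n R vs < length vs then rswap (sred n W (mum n R vs W)) (fviol n R vs)
   else sred n W (mum n R vs W))"

definition lstep where
 "lstep n R W = lstep2 n R W (gso n R W)"

text \<open>The potential of a basis halves with every swap and never drops below 1.\<close>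

definition lfuel where
 "lfuel n p R = nbits (of_int (mden n R) * (1 + (\<Sum>i<n. mx R i i))) * (p * p) + 1"

definition lll where
 "lll n p R = (lstep n R ^^ lfuel n p R) (units p n)"

lemma fviol_spec:
 "(fviol n R vs = length vs \<and> (\<forall>i. Suc i < length vs --> \<not> viol n R vs i)) \<or>
  (Suc (fviol n R vs) < length vs \<and> viol n R vs (fviol n R vs))"
proof -
 have "let r = foldl (%r i. if viol n R vs i then i else r) (length vs) [0..<m] in
   (r = length vs \<and> (\<forall>i<m. \<not> viol n R vs i)) \<or> (r < m \<and> viol n R vs r)" for m
  by (induction m) (auto simp: Let_def less_Suc_eq)
 from this[of "length vs - Suc 0"] show ?thesis unfolding fviol_def Let_def by (auto simp: less_diff_conv)
qed

definition rowsum where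
 "rowsum M acc b j = (\<Sum>i<length acc. vx acc i * mx M (b + i) j)"

lemma elt_Cons: "elt d (x # xs) 0 = x" "elt d (x # xs) (Suc i) = elt d xs i"
 by (simp_all add: elt_def)

lemma rowsum_Cons: "rowsum M (t # acc) b j = t * mx M b j + rowsum M acc (Suc b) j"
 by (simp add: rowsum_def sum.lessThan_Suc_shift elt_Cons del: sum.lessThan_Suc)

text \<open>As \<open>M\<close> is lower triangular, the coefficient chosen at \<open>j\<close> does
  not disturb the columns above \<open>j\<close> that are already within 1/2. Each choice enlarges
  the bound by \<open>2 ^ (m + p + 1)\<close>: \<open>2 ^ p\<close> for the number of summands,
  \<open>2 ^ m\<close> for the entries and 2 for the rounding.\<close>

lemma tcoef_inv:
 assumes M: "\<And>i j. i < j ==> mx M i j = 0" "\<And>i. i < p ==> mx M i i = 1"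
  and B: "\<And>i j. \<bar>mx M i j\<bar> \<le> 2 ^ m" and k: "k < p"
 shows "s \<le> k ==> acc = foldl (tnext M) [1] (take s (rev [0..<k])) ==>
   length acc = Suc s \<and> vx acc s = 1 \<and> (\<forall>i. vx acc i \<in> \<int>) \<and> (\<forall>i. \<bar>vx acc i\<bar> \<le> 2 ^ (s * (m + p + 1))) \<and>
   (\<forall>j. k - s \<le> j \<and> j < k --> \<bar>rowsum M acc (k - s) j\<bar> \<le> 1 / 2)"
proof (induction s arbitrary: acc)
 case 0
 thus ?case by (auto simp: elt_def)
next
 case (Suc s)
 define a where "a = foldl (tnext M) [1] (take s (rev [0..<k]))"
 have IH: "length a = Suc s" "vx a s = 1" "\<And>i. vx a i \<in> \<int>" "\<And>i. \<bar>vx a i\<bar> \<le> 2 ^ (s * (m + p + 1))"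
   "\<And>j. k - s \<le> j ==> j < k ==> \<bar>rowsum M a (k - s) j\<bar> \<le> 1 / 2"
  using Suc.IH[OF _ a_def] Suc.prems by auto
 define j where "j = k - Suc s"
 have j: "Suc j = k - s" "j < k" using Suc.prems by (auto simp: j_def)
 have "rev [0..<k] ! s = j" using Suc.prems by (simp add: rev_nth j_def)
 hence acc: "acc = tnext M a j"
  using Suc.prems by (simp add: take_Suc_conv_app_nth a_def)
 define y where "y = rowsum M a (Suc j) j"
 define t where "t = (of_int (- round y) :: rat)"
 have acc': "acc = t # a" by (simp add: acc tnext_def t_def y_def rowsum_def)
 have y: "\<bar>y\<bar> \<le> 2 ^ (s * (m + p + 1)) * 2 ^ (p + m)"
 proof -
  have "\<bar>y\<bar> \<le> (\<Sum>i<length a. 2 ^ (s * (m + p + 1)) * 2 ^ m)"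
   unfolding y_def rowsum_def
   by (rule order.trans[OF sum_abs sum_mono]) (use IH(4) B in \<open>auto simp: abs_mult intro!: mult_mono\<close>)
  also have "\<dots> = of_nat (Suc s) * (2 ^ (s * (m + p + 1)) * 2 ^ m)" by (simp add: IH)
  also have "\<dots> \<le> 2 ^ p * (2 ^ (s * (m + p + 1)) * 2 ^ m)"
  proof (rule mult_right_mono)
   have "of_nat (Suc s) \<le> (of_nat p :: rat)" using Suc.prems k by (simp only: of_nat_le_iff)
   also have "\<dots> \<le> 2 ^ p" by (rule of_nat_le_pow2)
   finally show "of_nat (Suc s) \<le> (2 ^ p :: rat)" .
  qed simp
  finally show ?thesis by (simp add: power_add mult_ac)
 qed
 have "\<bar>t\<bar> \<le> \<bar>y\<bar> + 1"
  using of_int_round_abs_le[of y] abs_triangle_ineq[of "of_int (round y) - y" y] unfolding t_def by simp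
 also have "\<dots> \<le> 2 ^ (s * (m + p + 1)) * 2 ^ (p + m) + 2 ^ (s * (m + p + 1)) * 2 ^ (p + m)"
 proof (rule add_mono[OF y])
  have "(1::rat) * 1 \<le> 2 ^ (s * (m + p + 1)) * 2 ^ (p + m)" by (intro mult_mono) auto
  thus "(1::rat) \<le> 2 ^ (s * (m + p + 1)) * 2 ^ (p + m)" by simp
 qed
 also have "\<dots> = 2 ^ (Suc s * (m + p + 1))" by (simp add: power_add)
 finally have tb: "\<bar>t\<bar> \<le> 2 ^ (Suc s * (m + p + 1))" .
 have ab: "\<bar>vx acc i\<bar> \<le> 2 ^ (Suc s * (m + p + 1))" for i
 proof (cases i)
  case 0
  thus ?thesis using tb by (simp add: acc' elt_Cons)
 next
  case (Suc i')
  have "\<bar>vx a i'\<bar> \<le> 2 ^ (s * (m + p + 1))" by (rule IH)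
  also have "\<dots> \<le> 2 ^ (Suc s * (m + p + 1))" by (rule power_increasing) auto
  finally show ?thesis using Suc by (simp add: acc' elt_Cons)
 qed
 have int: "vx acc i \<in> \<int>" for i using IH(3) by (cases i) (auto simp: acc' elt_Cons t_def)
 have small: "\<bar>rowsum M acc j j'\<bar> \<le> 1 / 2" if "j \<le> j'" "j' < k" for j'
 proof (cases "j' = j")
  case True
  hence "rowsum M acc j j' = y - of_int (round y)"
   using M(2)[of j] j k by (simp add: acc' rowsum_Cons y_def t_def)
  thus ?thesis using of_int_round_abs_le[of y] by (simp add: abs_minus_commute)
 next
  case False
  hence "mx M j j' = 0" using that by (intro M(1)) simp
  hence "rowsum M acc j j' = rowsum M a (k - s) j'" by (simp add: acc' rowsum_Cons j)
  thus ?thesis using IH(5)[of j'] that False j by simp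
 qed
 show ?case using IH int ab small by (auto simp: acc' elt_Cons j_def)
qed

lemma tcoef_spec:
 assumes "\<And>i j. i < j ==> mx M i j = 0" "\<And>i. i < p ==> mx M i i = 1"
  and "\<And>i j. \<bar>mx M i j\<bar> \<le> 2 ^ m" and k: "k < p"
 shows "length (tcoef M k) = Suc k" "vx (tcoef M k) k = 1" "vx (tcoef M k) i \<in> \<int>"
  "j < k ==> \<bar>\<Sum>i<Suc k. vx (tcoef M k) i * mx M i j\<bar> \<le> 1 / 2"
 using tcoef_inv[OF assms, of k "tcoef M k"] by (auto simp: tcoef_def rowsum_def)

lemma mx_mum: "k < length W ==> j < length W ==>
  mx (mum n R vs W) k j = (if j < k then gcoef n R vs (elt [] W k) j else if j = k then 1 else 0)"
 by (simp add: mum_def mx_tab)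

lemma mx_mum_upper: "i < j ==> mx (mum n R vs W) i j = 0"
 by (auto simp: mum_def mx_tab elt_def)

lemma abs_mx_le': "\<exists>m. \<forall>i j. \<bar>mx M i j\<bar> \<le> 2 ^ m"
 using abs_mx_le by blast

definition trR where "trR n R = (\<Sum>i<n. mx R i i)"

context
 fixes n p :: nat and R :: "rmat"
 assumes pn: "p \<le> n" and symR: "symm n (mx R)"
  and posR: "\<And>v. \<exists>i<n. v i \<noteq> 0 ==> 0 < bil n (mx R) v v"
begin

abbreviation "Gs W \<equiv> gs n (mx R) (mx W)"
abbreviation "Gq W \<equiv> gq n (mx R) (mx W)"
abbreviation "Gm W \<equiv> gmu n (mx R) (mx W)"

text \<open>That the rows generate \<open>Z^p\<close> is expressed dually: integral products with
  all rows imply integral coordinates. Rounding needs it in this form, and it passes from basis to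
  basis without unimodular matrices. The bounds by the trace keep all bases small.\<close>

definition linv where
 "linv W \<longleftrightarrow> length W = p \<and> (\<forall>k l. mx W k l \<in> \<int>) \<and> (\<forall>k l. p \<le> l --> mx W k l = 0) \<and>
   (\<forall>x::nat => real. (\<forall>k<p. dt n (rm W k) x \<in> \<int>) --> (\<forall>i<p. x i \<in> \<int>)) \<and>
   (\<forall>k<p. 0 < Gq W k \<and> Gq W k \<le> trR n R \<and> bil n (mx R) (mx W k) (mx W k) \<le> of_nat p * trR n R)"

lemma psdR: "0 \<le> bil n (mx R) v v"
proof (cases "\<exists>i<n. v i \<noteq> 0")
 case False
 hence "bil n (mx R) v v = 0" by (simp add: bil_def)
 thus ?thesis by simp
qed (use posR in \<open>auto intro: less_imp_le\<close>)

lemma diag_le_trR: "i < n ==> mx R i i \<le> trR n R" and diag_nonneg: "i < n ==> 0 \<le> mx R i i"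
proof -
 have d: "0 \<le> mx R i i" if "i < n" for i
 proof -
  have "bil n (mx R) (mx (units n n) i) (mx (units n n) i) = (\<Sum>j<n. mx R i j * mx (units n n) i j)"
   using that by (simp add: bil_units)
  also have "\<dots> = mx R i i" using that by (subst sum.mono_neutral_right[of _ "{i}"]) (auto simp: mx_units)
  finally show ?thesis using psdR[of "mx (units n n) i"] by simp
 qed
 thus "i < n ==> 0 \<le> mx R i i" by blast
 show "i < n ==> mx R i i \<le> trR n R" unfolding trR_def using d by (intro member_le_sum) auto
qed

lemma linv_units: "linv (units p n)"
proof -
 have pos: "0 < Gq (units p n) k" if "k < p" for k
  unfolding gq_def using that pn gs_units[of k k n p "mx R"] by (intro posR exI[of _ k]) auto
 have diag: "bil n (mx R) (mx (units p n) k) (mx (units p n) k) = mx R k k" if "k < p" for k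
 proof -
  have "bil n (mx R) (mx (units p n) k) (mx (units p n) k) = (\<Sum>j<n. mx R k j * mx (units p n) k j)"
   using that pn by (simp add: bil_units)
  also have "\<dots> = mx R k k" using that pn by (subst sum.mono_neutral_right[of _ "{k}"]) (auto simp: mx_units)
  finally show ?thesis .
 qed
 have q0: "Gq (units p n) k \<noteq> 0" if "k < p" for k using pos[OF that] by simp
 have le: "Gq (units p n) k \<le> trR n R" if k: "k < p" for k
 proof -
  \<comment> \<open>The squared norm of the unit vector is a sum of nonnegative terms, one of which
    is the orthogonalised norm.\<close>
  have "Gm (units p n) k k * Gq (units p n) k * Gm (units p n) k k \<le> (\<Sum>j<p. Gm (units p n) k j * Gq (units p n) j * Gm (units p n) k j)"
  proof (rule member_le_sum)
   fix j assume "j \<in> {..<p} - {k}"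
   hence "0 \<le> Gq (units p n) j" using pos[of j] by simp
   hence "0 \<le> Gq (units p n) j * (Gm (units p n) k j * Gm (units p n) k j)" by simp
   thus "0 \<le> Gm (units p n) k j * Gq (units p n) j * Gm (units p n) k j" by (simp add: mult_ac)
  qed (use k in auto)
  also have "\<dots> = mx R k k" using bil_w_w[OF symR q0 k k] diag[OF k] by simp
  also have "\<dots> \<le> trR n R" using k pn by (intro diag_le_trR) simp
  finally show ?thesis by (simp add: gmu_def)
 qed
 have le2: "bil n (mx R) (mx (units p n) k) (mx (units p n) k) \<le> of_nat p * trR n R" if k: "k < p" for k
 proof -
  have "mx R k k \<le> 1 * trR n R" using diag_le_trR[of k] k pn by simp
  also have "\<dots> \<le> of_nat p * trR n R"
   using k diag_nonneg by (intro mult_right_mono) (auto simp: trR_def intro!: sum_nonneg)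
  finally show ?thesis using diag[OF k] by simp
 qed
 have uni: "x i \<in> \<int>" if "\<forall>k<p. dt n (rm (units p n) k) x \<in> \<int>" "i < p" for x :: "nat => real" and i
 proof -
  have "dt n (rm (units p n) i) x = (\<Sum>j\<in>{i}. rm (units p n) i j * x j)"
   unfolding dt_def using that pn by (intro sum.mono_neutral_right) (auto simp: rm_def mx_units)
  hence "dt n (rm (units p n) i) x = x i" using that pn by (simp add: rm_def mx_units)
  thus ?thesis using that by metis
 qed
 show ?thesis unfolding linv_def using pos le le2 uni by (auto simp: mx_units)
qed

lemma linv_pos: "linv W ==> k < p ==> 0 < Gq W k"
 by (simp add: linv_def)

lemma linv_uni: "linv W ==> (\<And>k. k < p ==> dt n (rm W k) (x :: nat => real) \<in> \<int>) ==> i < p ==> x i \<in> \<int>"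
 unfolding linv_def by blast

lemma linvD:
 assumes "linv W"
 shows "length W = p" "mx W k l \<in> \<int>" "p \<le> l ==> mx W k l = 0" "k < p ==> Gq W k \<le> trR n R"
  "k < p ==> bil n (mx R) (mx W k) (mx W k) \<le> of_nat p * trR n R"
 using assms by (simp_all add: linv_def)

lemma linvI:
 assumes "length W = p" "\<And>k l. mx W k l \<in> \<int>" "\<And>k l. p \<le> l ==> mx W k l = 0"
  "\<And>(x::nat => real) i. \<forall>k<p. dt n (rm W k) x \<in> \<int> ==> i < p ==> x i \<in> \<int>"
  "\<And>k. k < p ==> 0 < Gq W k \<and> Gq W k \<le> trR n R"
  "\<And>k. k < p ==> bil n (mx R) (mx W k) (mx W k) \<le> of_nat p * trR n R"
 shows "linv W"
 unfolding linv_def using assms by blast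

lemma linv_gso:
 assumes "linv W"
 shows "posall n R (gso n R W)" "length (gso n R W) = p"
proof -
 show "posall n R (gso n R W)" by (rule gso_posall) (use assms in \<open>auto simp: linv_def\<close>)
 from posall_gso(1)[OF this] show "length (gso n R W) = p" using assms by (simp add: linv_def)
qed

lemma linv_gcoef:
 assumes W: "linv W" and "j < k" "k < p"
 shows "gcoef n R (gso n R W) (elt [] W k) j = Gm W k j"
 using assms gso_bil[of j n R W] linv_gso[OF W] by (simp add: gcoef_def gmu_def mx_def)

lemma linv_mum:
 assumes W: "linv W" and "j < p" "k < p"
 shows "mx (mum n R (gso n R W) W) k j = Gm W k j"
 using assms linv_gcoef[OF W] by (simp add: mx_mum linv_def gmu_def)

context
 fixes W W' :: "rmat"
 assumes W: "linv W" and W'_def: "W' = sred n W (mum n R (gso n R W) W)"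
begin

lemma sred_length: "length W' = p"
 using W by (simp add: W'_def sred_def linv_def)

lemma sred_row:
 "\<exists>t. (\<forall>k i. k < p --> t k i \<in> (\<int> :: rat set)) \<and>
   (\<forall>k l. k < p --> mx W' k l = mx W k l + (\<Sum>j<k. t k j * mx W j l)) \<and>
   (\<forall>k j. j < k --> k < p --> \<bar>Gm W k j + (\<Sum>i<k. t k i * Gm W i j)\<bar> \<le> 1 / 2)"
proof -
 define M where "M = mum n R (gso n R W) W"
 obtain m where m: "\<And>i j. \<bar>mx M i j\<bar> \<le> 2 ^ m" using abs_mx_le' by blast
 have M1: "mx M i i = 1" if "i < p" for i using that W by (simp add: M_def mx_mum linv_def)
 have M0: "mx M i j = 0" if "i < j" for i j using mx_mum_upper[OF that] by (simp add: M_def)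
 have ts: "length (tcoef M k) = Suc k" "vx (tcoef M k) k = 1" "vx (tcoef M k) i \<in> \<int>" if "k < p" for k i
  by (rule tcoef_spec[where p=p and m=m]; use M0 M1 m that in blast)+
 have ts4: "\<bar>\<Sum>i<Suc k. vx (tcoef M k) i * mx M i j\<bar> \<le> 1 / 2" if "k < p" "j < k" for k j
  by (rule tcoef_spec(4)[where p=p and m=m]) (use M0 M1 m that in auto)
 show ?thesis
 proof (rule exI[of _ "%k. vx (tcoef M k)"], intro conjI allI impI)
  fix k i assume k: "k < p"
  show "vx (tcoef M k) i \<in> \<int>" by (rule ts(3)[OF k])
 next
  fix k l assume k: "k < p"
  have l0: "mx W i l = 0" if "n \<le> l" for i using that W pn by (auto simp: linv_def)
  have "mx W' k l = (\<Sum>i<Suc k. vx (tcoef M k) i * mx W i l)"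
   using k W ts(1)[OF k] l0 by (auto simp: W'_def sred_def srow_def mx_tab linv_def M_def[symmetric])
  thus "mx W' k l = mx W k l + (\<Sum>j<k. vx (tcoef M k) j * mx W j l)"
   using ts(2)[OF k] by simp
 next
  fix k j assume jk: "j < k" "k < p"
  have "(\<Sum>i<Suc k. vx (tcoef M k) i * mx M i j) = (\<Sum>i<Suc k. vx (tcoef M k) i * Gm W i j)"
   using jk linv_mum[OF W] by (intro sum.cong) (auto simp: M_def)
  thus "\<bar>Gm W k j + (\<Sum>i<k. vx (tcoef M k) i * Gm W i j)\<bar> \<le> 1 / 2"
   using ts4[OF jk(2) jk(1)] ts(2)[OF jk(2)] by (simp add: add.commute)
 qed
qed

lemma sred_gs: "k < p ==> Gs W' k = Gs W k"
proof -
 from sred_row obtain t where "\<forall>k i. k < p --> t k i \<in> (\<int> :: rat set)"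
  "\<forall>k l. k < p --> mx W' k l = mx W k l + (\<Sum>j<k. t k j * mx W j l)"
  "\<forall>k j. j < k --> k < p --> \<bar>Gm W k j + (\<Sum>i<k. t k i * Gm W i j)\<bar> \<le> 1 / 2"
  by (elim exE conjE)
 note t = this[rule_format]
 have q: "Gq W j \<noteq> 0" if "j < p" for j using linv_pos[OF W that] by simp
 show "k < p ==> Gs W' k = Gs W k" using gs_size_reduce[OF symR q t(2)] by simp
qed

lemma sred_gq: "k < p ==> Gq W' k = Gq W k"
 unfolding gq_def by (simp add: sred_gs)

lemma sred_gmu: "j < k ==> k < p ==> \<bar>Gm W' k j\<bar> \<le> 1 / 2"
proof -
 assume jk: "j < k" "k < p"
 from sred_row obtain t where "\<forall>k i. k < p --> t k i \<in> (\<int> :: rat set)"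
  "\<forall>k l. k < p --> mx W' k l = mx W k l + (\<Sum>j<k. t k j * mx W j l)"
  "\<forall>k j. j < k --> k < p --> \<bar>Gm W k j + (\<Sum>i<k. t k i * Gm W i j)\<bar> \<le> 1 / 2"
  by (elim exE conjE)
 note t = this[rule_format]
 have q: "Gq W j \<noteq> 0" if "j < p" for j using linv_pos[OF W that] by simp
 have b: "bil n (mx R) (Gs W j) (mx W i) = Gm W i j * Gq W j" if "i < p" for i
  using bil_w_gs[OF symR q that, of j] jk bil_sym[OF symR, of "Gs W j"] by simp
 have "mx W' k = (%l. mx W k l + (\<Sum>j<k. t k j * mx W j l))" by (rule ext) (rule t(2)[OF jk(2)])
 hence "bil n (mx R) (Gs W j) (mx W' k) = Gm W k j * Gq W j + (\<Sum>i<k. t k i * (Gm W i j * Gq W j))"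
  using jk by (simp add: bil_linear b)
 also have "\<dots> = (Gm W k j + (\<Sum>i<k. t k i * Gm W i j)) * Gq W j"
  by (simp add: distrib_right sum_distrib_right mult.assoc)
 finally have "Gm W' k j = Gm W k j + (\<Sum>i<k. t k i * Gm W i j)"
  using jk q[of j] by (simp add: gmu_def[of n "mx R" "mx W'"] sred_gs sred_gq)
 thus ?thesis using t(3)[OF jk] by simp
qed

lemma linv_sred: "linv W'"
proof -
 from sred_row obtain t where "\<forall>k i. k < p --> t k i \<in> (\<int> :: rat set)"
  "\<forall>k l. k < p --> mx W' k l = mx W k l + (\<Sum>j<k. t k j * mx W j l)"
  "\<forall>k j. j < k --> k < p --> \<bar>Gm W k j + (\<Sum>i<k. t k i * Gm W i j)\<bar> \<le> 1 / 2"
  by (elim exE conjE)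
 note t = this[rule_format]
 have beyond: "mx W' k l = 0" if "p \<le> k" for k l
  using that sred_length by (simp add: mx_def elt_def)
 have Wi: "\<And>k l. mx W k l \<in> \<int>" "\<And>k l. p \<le> l ==> mx W k l = 0" by (rule linvD[OF W], erule linvD[OF W])
 have int: "mx W' k l \<in> \<int>" for k l
 proof (cases "k < p")
  case True
  show ?thesis unfolding t(2)[OF True] by (intro Ints_add Ints_sum Ints_mult t(1)[OF True] Wi)
 qed (simp add: beyond)
 have zero: "mx W' k l = 0" if "p \<le> l" for k l
  using t(2)[of k l] Wi(2)[OF that] beyond[of k l] by (cases "k < p") auto
 have uni: "x i \<in> \<int>" if x: "\<forall>k<p. dt n (rm W' k) x \<in> \<int>" and "i < p" for x :: "nat => real" and i
 proof -
  \<comment> \<open>The change of basis is unit lower triangular with integer entries, so the old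
    products are recovered by forward substitution.\<close>
  have "dt n (rm W k) x \<in> \<int>" if "k < p" for k
   using that
  proof (induction k rule: less_induct)
   case (less k)
   have IH: "dt n (rm W j) x \<in> \<int>" if "j < k" for j
    by (rule less.IH) (use that less.prems in auto)
   have "dt n (rm W' k) x = dt n (%l. rm W k l + (\<Sum>j<k. of_rat (t k j) * rm W j l)) x"
    by (rule dt_cong) (simp_all add: rm_def t(2)[OF less.prems] of_rat_add of_rat_sum of_rat_mult)
   also have "\<dots> = dt n (rm W k) x + (\<Sum>j<k. of_rat (t k j) * dt n (rm W j) x)"
    by (simp add: dt_commute[of n _ x] dt_add dt_sum dt_scale)
   finally have e: "dt n (rm W k) x = dt n (rm W' k) x - (\<Sum>j<k. of_rat (t k j) * dt n (rm W j) x)" by simp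
   have "of_rat (t k j) * dt n (rm W j) x \<in> \<int>" if "j \<in> {..<k}" for j
   proof (rule Ints_mult)
    show "(of_rat (t k j) :: real) \<in> \<int>" using t(1)[OF less.prems, of j] by (auto elim!: Ints_cases)
    show "dt n (rm W j) x \<in> \<int>" using IH[of j] that by simp
   qed
   hence "(\<Sum>j<k. of_rat (t k j) * dt n (rm W j) x) \<in> \<int>" by (rule Ints_sum)
   moreover have "dt n (rm W' k) x \<in> \<int>" using x less.prems by blast
   ultimately show ?case unfolding e by (intro Ints_diff)
  qed
  thus ?thesis using that(2) by (rule linv_uni[OF W])
 qed
 have q: "Gq W' j \<noteq> 0" if "j < p" for j using linv_pos[OF W that] sred_gq[OF that] by simp
 \<comment> \<open>After the reduction all coefficients are at most 1 in absolute value, so the norm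
   is at most a sum of \<open>p\<close> orthogonalised norms, each bounded by the trace.\<close>
 have norm: "bil n (mx R) (mx W' k) (mx W' k) \<le> of_nat p * trR n R" if k: "k < p" for k
 proof -
  have "bil n (mx R) (mx W' k) (mx W' k) = (\<Sum>j<p. Gm W' k j * Gq W' j * Gm W' k j)"
   by (rule bil_w_w[OF symR q k k])
  also have "\<dots> \<le> (\<Sum>j<p. trR n R)"
  proof (rule sum_mono)
   fix j assume j: "j \<in> {..<p}"
   have "\<bar>Gm W' k j\<bar> \<le> 1"
   proof (cases "j < k")
    case True
    thus ?thesis using sred_gmu[OF True k] by linarith
   qed (auto simp: gmu_def)
   hence "\<bar>Gm W' k j\<bar> * \<bar>Gm W' k j\<bar> \<le> 1 * 1" by (intro mult_mono) auto
   hence "Gm W' k j * Gm W' k j \<le> 1" by simp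
   hence "Gm W' k j * Gm W' k j * Gq W' j \<le> 1 * Gq W' j"
    using linv_pos[OF W, of j] sred_gq[of j] j by (intro mult_right_mono) auto
   also have "\<dots> \<le> trR n R" using W j sred_gq[of j] by (simp add: linv_def)
   finally show "Gm W' k j * Gq W' j * Gm W' k j \<le> trR n R" by (simp add: mult_ac)
  qed
  finally show ?thesis by simp
 qed
 show ?thesis
 proof (rule linvI)
  fix k assume "k < p"
  thus "0 < Gq W' k \<and> Gq W' k \<le> trR n R" using W sred_gq[of k] by (simp add: linv_def)
 qed (use sred_length int zero uni norm in blast)+
qed

lemma mx_rswap: assumes "Suc i < p" shows "mx (rswap W' i) = (mx W')(i := mx W' (Suc i), Suc i := mx W' i)"
proof
 fix k
 show "mx (rswap W' i) k = ((mx W')(i := mx W' (Suc i), Suc i := mx W' i)) k"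
 proof (cases "k < p")
  case True
  thus ?thesis using sred_length by (auto simp: rswap_def mx_tab mx_def)
 next
  case False
  thus ?thesis using assms sred_length by (auto simp: rswap_def mx_tab) (auto simp: mx_def elt_def)
 qed
qed

text \<open>The new norm at \<open>i\<close> is that of \<open>Suc i\<close> plus
  \<open>mu * mu\<close> times that of \<open>i\<close>. The violation bounds the first summand by a
  quarter of the old norm, \<open>\<bar>mu\<bar> \<le> 1 / 2\<close> the second. The larger of the
  two norms does not increase, so the trace bound survives.\<close>

lemma rswap_spec:
 assumes i: "Suc i < p" and v: "4 * Gq W (Suc i) < Gq W i"
 defines "V \<equiv> rswap W' i"
 shows "linv V" "2 * Gq V i \<le> Gq W i" "Gq V i * Gq V (Suc i) = Gq W i * Gq W (Suc i)"
  "k < p ==> k \<noteq> i ==> k \<noteq> Suc i ==> Gq V k = Gq W k"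
proof -
 define mu where "mu = Gm W' (Suc i) i"
 have q: "Gq W' j \<noteq> 0" if "j < p" for j using linv_pos[OF linv_sred that] by simp
 have qp: "0 < Gq W i" "0 < Gq W (Suc i)" using linv_pos[OF W] i by auto
 have mu: "mu * mu \<le> 1 / 4"
 proof -
  have "\<bar>mu\<bar> * \<bar>mu\<bar> \<le> 1 / 2 * (1 / 2)"
   using sred_gmu[of i "Suc i"] i unfolding mu_def by (intro mult_mono) auto
  thus ?thesis by simp
 qed
 define q' where "q' = Gq W (Suc i) + mu * mu * Gq W i"
 have q'0: "0 < q'" using qp unfolding q'_def by (intro add_pos_nonneg) auto
 have nz: "Gq W' (Suc i) + Gm W' (Suc i) i * Gm W' (Suc i) i * Gq W' i \<noteq> 0"
  using q'0 i by (simp add: sred_gq q'_def mu_def)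
 note sw = gs_swap[OF symR q i nz, folded mx_rswap[OF i], folded V_def]
 have Vi: "Gq V i = q'" using sw(3) i by (simp add: sred_gq q'_def mu_def)
 have VSi: "Gq V (Suc i) = Gq W i * Gq W (Suc i) / q'"
  using sw(4) i by (simp add: sred_gq q'_def mu_def)
 show other: "Gq V k = Gq W k" if "k < p" "k \<noteq> i" "k \<noteq> Suc i" for k
 proof -
  have "Gs V k = Gs W' k" using sw(1)[of k] sw(5)[of k] that by (cases "k < i") auto
  thus ?thesis using sred_gs[OF that(1)] by (simp add: gq_def)
 qed
 have "mu * mu * Gq W i \<le> 1 / 4 * Gq W i" using mu qp by (intro mult_right_mono) auto
 hence half: "2 * q' \<le> Gq W i" using v by (simp add: q'_def)
 thus "2 * Gq V i \<le> Gq W i" by (simp add: Vi)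
 show "Gq V i * Gq V (Suc i) = Gq W i * Gq W (Suc i)" using q'0 by (simp add: Vi VSi)
 have Wb: "Gq W k \<le> trR n R" if "k < p" for k using W that by (simp add: linv_def)
 have qV: "0 < Gq V k \<and> Gq V k \<le> trR n R" if k: "k < p" for k
 proof -
  consider "k = i" | "k = Suc i" | "k \<noteq> i \<and> k \<noteq> Suc i" by blast
  thus ?thesis
  proof cases
   case 1
   thus ?thesis using q'0 half Wb[of i] qp i by (simp add: Vi)
  next
   case 2
   have "Gq W (Suc i) \<le> q'" using qp by (simp add: q'_def)
   hence "Gq W i * Gq W (Suc i) \<le> Gq W i * q'" using qp by (intro mult_left_mono) auto
   hence "Gq V (Suc i) \<le> Gq W i" using q'0 by (simp add: VSi divide_le_eq)
   thus ?thesis using 2 Wb[of i] i qp q'0 by (simp add: VSi)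
  next
   case 3
   thus ?thesis using other[OF k] linv_pos[OF W k] Wb[OF k] by simp
  qed
 qed
 note inv' = linv_sred
 have rows: "\<exists>k'<p. mx V k = mx W' k'" if "k < p" for k
  using that i unfolding V_def mx_rswap[OF i] by (intro exI[of _ "if k = i then Suc i else if k = Suc i then i else k"]) auto
 have rows': "\<exists>k'. mx V k = mx W' k'" for k
  unfolding V_def mx_rswap[OF i] by (intro exI[of _ "if k = i then Suc i else if k = Suc i then i else k"]) auto
 have former: "\<exists>k'<p. mx W' k = mx V k'" if "k < p" for k
  using that i unfolding V_def mx_rswap[OF i] by (intro exI[of _ "if k = i then Suc i else if k = Suc i then i else k"]) auto
 have uni: "x j \<in> \<int>" if x: "\<forall>k<p. dt n (rm V k) x \<in> \<int>" and "j < p" for x :: "nat => real" and j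
 proof -
  have "dt n (rm W' k) x \<in> \<int>" if k: "k < p" for k
  proof -
   obtain k' where k': "k' < p" "mx W' k = mx V k'" using former[OF k] by blast
   hence "rm W' k = rm V k'" by (simp add: rm_def fun_eq_iff)
   thus ?thesis using x k' by simp
  qed
  thus ?thesis using that(2) by (rule linv_uni[OF inv'])
 qed
 have inv1: "mx W' k l \<in> \<int>" "p \<le> l ==> mx W' k l = 0" for k l using inv' by (auto simp: linv_def)
 have inv2: "bil n (mx R) (mx W' k) (mx W' k) \<le> of_nat p * trR n R" if "k < p" for k using inv' that by (simp add: linv_def)
 show "linv V"
 proof (rule linvI)
  show "length V = p" using sred_length by (simp add: V_def rswap_def)
  show "mx V k l \<in> \<int>" for k l using rows'[of k] inv1 by metis
  show "p \<le> l ==> mx V k l = 0" for k l using rows'[of k] inv1 by metis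
  show "bil n (mx R) (mx V k) (mx V k) \<le> of_nat p * trR n R" if "k < p" for k using rows[OF that] inv2 by metis
  show "0 < Gq V k \<and> Gq V k \<le> trR n R" if "k < p" for k by (rule qV[OF that])
 qed (rule uni)
qed

end

definition reduced where
 "reduced W \<longleftrightarrow> (\<forall>i. Suc i < p --> Gq W i \<le> 4 * Gq W (Suc i))"

text \<open>The product of all leading Gram determinants of the basis, scaled by
  \<open>mden n R\<close> so that they are integers.\<close>

definition pot where
 "pot W = (\<Prod>k<Suc p. \<Prod>j<k. of_int (mden n R) * Gq W j)"

text \<open>An exchange at \<open>i\<close> changes only the determinant of the first
  \<open>i + 1\<close> rows: smaller ones do not see it, and larger ones contain both norms, whose
  product is kept. Reducedness must persist because the number of steps is fixed beforehand and may
  exceed what is needed.\<close>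

lemma lstep_spec:
 assumes W: "linv W"
 shows "linv (lstep n R W)" "reduced W ==> reduced (lstep n R W)"
  "\<not> reduced W ==> 2 * pot (lstep n R W) \<le> pot W"
proof -
 let ?vs = "gso n R W"
 define W' where "W' = sred n W (mum n R ?vs W)"
 have len: "length ?vs = p" by (rule linv_gso(2)[OF W])
 have v: "viol n R ?vs i \<longleftrightarrow> 4 * Gq W (Suc i) < Gq W i" if "Suc i < p" for i
  using that gso_bil(2)[of i n R W] gso_bil(2)[of "Suc i" n R W] len by (simp add: viol_def)
 have red_iff: "reduced W \<longleftrightarrow> (\<forall>i. Suc i < p --> \<not> viol n R ?vs i)" by (simp add: reduced_def v not_less)
 have fv: "fviol n R ?vs = p \<and> reduced W \<or> Suc (fviol n R ?vs) < p \<and> viol n R ?vs (fviol n R ?vs)"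
  using fviol_spec[of n R ?vs] unfolding len red_iff .
 have step: "lstep n R W = (if fviol n R ?vs < p then rswap W' (fviol n R ?vs) else W')"
  by (simp add: lstep_def lstep2_def len W'_def)
 show "linv (lstep n R W)"
 proof (cases "Suc (fviol n R ?vs) < p \<and> viol n R ?vs (fviol n R ?vs)")
  case True
  hence "linv (rswap W' (fviol n R ?vs))" using v[of "fviol n R ?vs"] by (intro rswap_spec(1)[OF W W'_def]) simp_all
  thus ?thesis using True by (simp add: step)
 next
  case False
  hence "fviol n R ?vs = p" using fv by argo
  thus ?thesis using linv_sred[OF W W'_def] by (simp add: step)
 qed
 show "reduced (lstep n R W)" if r: "reduced W"
 proof -
  have "\<not> fviol n R ?vs < p"
  proof
   assume "fviol n R ?vs < p"
   hence "Suc (fviol n R ?vs) < p" "viol n R ?vs (fviol n R ?vs)" using fv by auto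
   thus False using r red_iff by blast
  qed
  hence "lstep n R W = W'" by (simp add: step)
  thus ?thesis using r by (simp add: reduced_def sred_gq[OF W W'_def])
 qed
 show "2 * pot (lstep n R W) \<le> pot W" if r: "\<not> reduced W"
 proof -
  define i where "i = fviol n R ?vs"
  have i: "Suc i < p" "viol n R ?vs i" using fv r by (simp_all add: i_def)
  define V where "V = rswap W' i"
  have st: "lstep n R W = V" using i by (simp add: step V_def i_def)
  have v4: "4 * Gq W (Suc i) < Gq W i" using v i by simp
  note rs = rswap_spec[OF W W'_def i(1) v4, folded V_def]
  define m :: rat where "m = of_int (mden n R)"
  have m: "0 < m" unfolding m_def using mden_pos[of n R] by simp
  have pV: "0 < m * Gq V j" if "j < p" for j using m linv_pos[OF rs(1) that] by simp
  have pW: "0 < m * Gq W j" if "j < p" for j using m linv_pos[OF W that] by simp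
  let ?D = "%W k. \<Prod>j<k. m * Gq W j"
  have D_eq: "?D V k = ?D W k" if "k \<le> p" "k \<noteq> Suc i" for k
  proof (cases "k \<le> i")
   case True
   thus ?thesis using that i by (intro prod.cong refl) (simp add: rs(4))
  next
   case False
   hence k: "Suc (Suc i) \<le> k" using that by simp
   have split: "?D U k = ?D U i * ((m * Gq U i) * (m * Gq U (Suc i))) * (\<Prod>j\<in>{Suc (Suc i)..<k}. m * Gq U j)" for U
   proof -
    have u: "{..<k} = {..<Suc (Suc i)} \<union> {Suc (Suc i)..<k}" using k by auto
    have "?D U k = ?D U (Suc (Suc i)) * (\<Prod>j\<in>{Suc (Suc i)..<k}. m * Gq U j)"
     unfolding u by (rule prod.union_disjoint) auto
    moreover have "?D U (Suc (Suc i)) = ?D U i * ((m * Gq U i) * (m * Gq U (Suc i)))"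
     by (simp only: prod.lessThan_Suc mult.assoc)
    ultimately show ?thesis by (simp only:)
   qed
   have "?D V i = ?D W i" using i by (intro prod.cong refl) (simp add: rs(4))
   moreover have "(\<Prod>j\<in>{Suc (Suc i)..<k}. m * Gq V j) = (\<Prod>j\<in>{Suc (Suc i)..<k}. m * Gq W j)"
    using that by (intro prod.cong refl) (simp add: rs(4))
   moreover have "(m * Gq V i) * (m * Gq V (Suc i)) = (m * Gq W i) * (m * Gq W (Suc i))"
   proof -
    have "(m * Gq U i) * (m * Gq U (Suc i)) = m * m * (Gq U i * Gq U (Suc i))" for U by (simp only: mult_ac)
    thus ?thesis by (simp only: rs(3))
   qed
   ultimately show ?thesis by (simp only: split)
  qed
  have Dpos: "0 < ?D V k" "0 < ?D W k" if "k \<le> p" for k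
   by (rule prod_pos, rule pV pW, use that in simp)+
  have D_half: "2 * ?D V (Suc i) \<le> ?D W (Suc i)"
  proof -
   have "?D V i = ?D W i" by (rule D_eq) (use i in auto)
   moreover have "?D W i * (m * (2 * Gq V i)) \<le> ?D W i * (m * Gq W i)"
    using rs(2) m Dpos(2)[of i] i by (intro mult_left_mono) auto
   moreover have "2 * ?D V (Suc i) = ?D V i * (m * (2 * Gq V i))" "?D W (Suc i) = ?D W i * (m * Gq W i)"
    by (simp_all only: prod.lessThan_Suc mult_ac)
   ultimately show ?thesis by (simp only:)
  qed
  have split: "pot U = ?D U (Suc i) * (\<Prod>k\<in>{..<Suc p} - {Suc i}. ?D U k)" for U
   unfolding pot_def m_def[symmetric] by (rule prod.remove) (use i in auto)
  have rest: "(\<Prod>k\<in>{..<Suc p} - {Suc i}. ?D V k) = (\<Prod>k\<in>{..<Suc p} - {Suc i}. ?D W k)"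
   by (rule prod.cong[OF refl], rule D_eq) auto
  have "0 < (\<Prod>k\<in>{..<Suc p} - {Suc i}. ?D W k)" by (rule prod_pos, rule Dpos) auto
  hence "(2 * ?D V (Suc i)) * (\<Prod>k\<in>{..<Suc p} - {Suc i}. ?D W k) \<le> ?D W (Suc i) * (\<Prod>k\<in>{..<Suc p} - {Suc i}. ?D W k)"
   using D_half by (intro mult_right_mono) auto
  thus ?thesis unfolding st split rest by (simp only: mult.assoc)
 qed
qed

text \<open>Every factor is the determinant of an integral matrix and positive, hence at least
  1.\<close>

lemma pot_ge_1:
 assumes W: "linv W"
 shows "1 \<le> pot W"
proof -
 define m :: rat where "m = of_int (mden n R)"
 have m: "0 < m" unfolding m_def using mden_pos[of n R] by simp
 have "1 \<le> (\<Prod>j<k. m * Gq W j)" if k: "k \<le> p" for k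
 proof -
  have q: "Gq W j \<noteq> 0" if "j < k" for j using linv_pos[OF W, of j] that k by simp
  have d: "det (mat k k (%(i, j). m * bil n (mx R) (mx W i) (mx W j))) = (\<Prod>j<k. m * Gq W j)"
   by (rule gram_det[OF symR q])
  have "det (mat k k (%(i, j). m * bil n (mx R) (mx W i) (mx W j))) \<in> \<int>"
   by (rule det_Ints[of _ k]) (use W in \<open>auto simp: m_def linv_def intro!: bil_Ints mden_Ints\<close>)
  hence int: "(\<Prod>j<k. m * Gq W j) \<in> \<int>" unfolding d .
  have "0 < (\<Prod>j<k. m * Gq W j)" using m linv_pos[OF W] k by (intro prod_pos) auto
  thus ?thesis using int by (auto elim!: Ints_cases)
 qed
 thus ?thesis unfolding pot_def m_def[symmetric] by (rule prod_ge_1) simp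
qed

lemma pot_units: "pot (units p n) < 2 ^ lfuel n p R"
proof -
 define m :: rat where "m = of_int (mden n R)"
 have m: "0 < m" unfolding m_def using mden_pos[of n R] by simp
 define a where "a = nbits (m * (1 + trR n R))"
 have W: "linv (units p n)" by (rule linv_units)
 have q: "0 \<le> m * Gq (units p n) j \<and> m * Gq (units p n) j \<le> 2 ^ a" if "j < p" for j
 proof -
  have "m * Gq (units p n) j \<le> m * (1 + trR n R)"
   using W that m by (intro mult_left_mono) (auto simp: linv_def intro: add_increasing)
  also have "\<dots> \<le> 2 ^ a" unfolding a_def by (rule le_nbits)
  finally show ?thesis using m linv_pos[OF W that] by simp
 qed
 have "pot (units p n) = (\<Prod>k<p. \<Prod>j<Suc k. m * Gq (units p n) j)"
  unfolding pot_def m_def[symmetric] by (subst prod.lessThan_Suc_shift) (simp del: prod.lessThan_Suc)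
 also have "\<dots> \<le> (\<Prod>k<p. (2 ^ a) ^ p)"
 proof (rule prod_mono, rule conjI)
  fix k assume k: "k \<in> {..<p}"
  show "0 \<le> (\<Prod>j<Suc k. m * Gq (units p n) j)" using q k by (intro prod_nonneg) auto
  have "(\<Prod>j<Suc k. m * Gq (units p n) j) \<le> (\<Prod>j<Suc k. 2 ^ a)"
   using q k by (intro prod_mono) auto
  also have "\<dots> = (2 ^ a) ^ Suc k" by simp
  also have "\<dots> \<le> (2 ^ a) ^ p" using k by (intro power_increasing) auto
  finally show "(\<Prod>j<Suc k. m * Gq (units p n) j) \<le> (2 ^ a) ^ p" .
 qed
 also have "\<dots> = 2 ^ (a * (p * p))" by (simp add: power_mult)
 also have "\<dots> < 2 ^ (a * (p * p) + 1)" by (rule power_strict_increasing) auto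
 finally show ?thesis by (simp add: lfuel_def a_def m_def trR_def)
qed

lemma lll_iter: "linv ((lstep n R ^^ k) (units p n)) \<and>
  (reduced ((lstep n R ^^ k) (units p n)) \<or> 2 ^ k * pot ((lstep n R ^^ k) (units p n)) \<le> pot (units p n))"
proof (induction k)
 case 0
 thus ?case using linv_units by simp
next
 case (Suc k)
 let ?W = "(lstep n R ^^ k) (units p n)"
 note ls = lstep_spec[of ?W]
 show ?case
 proof (cases "reduced ?W")
  case True
  thus ?thesis using Suc ls by simp
 next
  case False
  hence "2 ^ k * (2 * pot (lstep n R ?W)) \<le> 2 ^ k * pot ?W" using Suc ls by (intro mult_left_mono) auto
  moreover have "2 ^ k * pot ?W \<le> pot (units p n)" using Suc False by blast
  ultimately have "2 ^ k * (2 * pot (lstep n R ?W)) \<le> pot (units p n)" by (rule order.trans)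
  thus ?thesis using Suc ls(1) by (simp add: mult.assoc mult.left_commute)
 qed
qed

lemma lll_spec: "linv (lll n p R)" "reduced (lll n p R)"
proof -
 note it = lll_iter[of "lfuel n p R", folded lll_def]
 thus "linv (lll n p R)" by simp
 show "reduced (lll n p R)"
 proof (rule ccontr)
  assume "\<not> reduced (lll n p R)"
  hence "2 ^ lfuel n p R * pot (lll n p R) \<le> pot (units p n)" using it by simp
  moreover have "2 ^ lfuel n p R * 1 \<le> 2 ^ lfuel n p R * pot (lll n p R)"
   using pot_ge_1 it by (intro mult_left_mono) auto
  ultimately show False using pot_units by simp
 qed
qed

end

subsection \<open>Lattice reduction takes polynomial time\<close>

lemma FP_upt: "FP S k ==> FP S (%x. [0..<k x])"
 using FP_tabI[of S k "%_ i. i", OF _ FP_snd[OF FP_id]] by (simp add: tab_def)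

lemma FP_tnext:
 assumes "FP S M" "FP S acc" "FP S j"
 shows "FP S (%x. tnext (M x) (acc x) (j x))"
 unfolding tnext_def
 by (intro FP_Cons FP_of_int FP_int_uminus FP_round FP_sum FP_rat_mult FP_mx FP_elt FP_Suc FP_nat_add FP_length assms
  assms(1,2,3)[THEN FP_compose] FP_fst FP_snd FP_id; auto)

lemma FP_tcoef:
 assumes M: "FP S M" and k: "FP S k"
  and M0: "\<And>x i j. x \<in> S ==> i < j ==> mx (M x) i j = 0"
  and M1: "\<And>x i. x \<in> S ==> i < length (M x) ==> mx (M x) i i = 1"
  and kM: "\<And>x. x \<in> S ==> k x < length (M x)"
 shows "FP S (%x. tcoef (M x) (k x))"
 unfolding tcoef_def
proof (rule FP_foldl[where T = "S \<times> UNIV"])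
 show "FP (S \<times> UNIV) (%z. tnext (M (fst z)) (fst (snd z)) (snd (snd z)))"
  by (intro FP_tnext FP_compose[OF M] FP_fst FP_snd FP_id; auto)
 show "FP S (%x. rev [0..<k x])" "FP S (%x. [1::rat])"
  by (intro FP_rev FP_upt FP_const k)+
 define B where "B x = 1 + (sz (k x) + 1) * (1 + (sz (k x) * (sz (M x) + 5 + sz (M x) + 1) + 5))" for x
 show "PB S B" unfolding B_def by (intro PB_add PB_mult PB_const FP_sz[OF k] FP_sz[OF M])
 fix x i assume x: "x \<in> S"
 show "i < length (rev [0..<k x]) ==> (x, foldl (tnext (M x)) [1] (take i (rev [0..<k x])), rev [0..<k x] ! i) \<in> S \<times> UNIV"
  using x by simp
 assume "i \<le> length (rev [0..<k x])"
 hence i: "i \<le> k x" by simp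
 define acc where "acc = foldl (tnext (M x)) [1] (take i (rev [0..<k x]))"
 have inv: "length acc = Suc i" "\<And>l. vx acc l \<in> \<int>" "\<And>l. \<bar>vx acc l\<bar> \<le> 2 ^ (i * (sz (M x) + 5 + length (M x) + 1))"
 proof -
  have "length acc = Suc i \<and> vx acc i = 1 \<and> (\<forall>l. vx acc l \<in> \<int>) \<and> (\<forall>l. \<bar>vx acc l\<bar> \<le> 2 ^ (i * (sz (M x) + 5 + length (M x) + 1))) \<and>
    (\<forall>j. k x - i \<le> j \<and> j < k x --> \<bar>rowsum (M x) acc (k x - i) j\<bar> \<le> 1 / 2)"
   by (rule tcoef_inv[OF M0[OF x] M1[OF x] abs_mx_le kM[OF x] i acc_def])
  thus "length acc = Suc i" "\<And>l. vx acc l \<in> \<int>" "\<And>l. \<bar>vx acc l\<bar> \<le> 2 ^ (i * (sz (M x) + 5 + length (M x) + 1))"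
   by simp_all
 qed
 have le: "i * (sz (M x) + 5 + length (M x) + 1) \<le> sz (k x) * (sz (M x) + 5 + sz (M x) + 1)"
 proof (rule mult_le_mono)
  show "i \<le> sz (k x)" unfolding sz_nat using i by linarith
  show "sz (M x) + 5 + length (M x) + 1 \<le> sz (M x) + 5 + sz (M x) + 1"
   using length_le_sz[of "M x"] by simp
 qed
 have "sz y \<le> sz (k x) * (sz (M x) + 5 + sz (M x) + 1) + 5" if "y \<in> set acc" for y
 proof -
  from that obtain l where l: "l < length acc" "acc ! l = y" unfolding in_set_conv_nth by (elim exE conjE)
  hence y: "y = vx acc l" by (simp only: elt_def if_True)
  have "sz (vx acc l) \<le> 2 * 0 + i * (sz (M x) + 5 + length (M x) + 1) + 5"
  proof (rule sz_rat_le[OF _ _ _ inv(3)])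
   show "of_int 1 * vx acc l \<in> \<int>" using inv(2) by simp
  qed simp_all
  also have "\<dots> \<le> sz (k x) * (sz (M x) + 5 + sz (M x) + 1) + 5" using le by (simp only: mult_0_right add_0 add_le_cancel_right)
  finally show ?thesis unfolding y .
 qed
 from sz_map_le[of acc "%y. y", OF this]
 have "sz acc \<le> 1 + Suc i * (1 + (sz (k x) * (sz (M x) + 5 + sz (M x) + 1) + 5))" by (simp only: list.map_ident inv)
 also have "\<dots> \<le> B x" unfolding B_def using i by (intro add_left_mono mult_right_mono) (auto simp: sz_nat)
 finally show "sz (foldl (tnext (M x)) [1] (take i (rev [0..<k x]))) \<le> B x" by (simp only: acc_def)
qed

lemma FP_mum:
 assumes "FP S n" "FP S R" "FP S vs" "FP S W"
 shows "FP S (%x. mum (n x) (R x) (vs x) (W x))"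
 unfolding mum_def
 by (intro FP_tabI FP_If FP_nat_less FP_nat_eq FP_gcoef FP_elt FP_length FP_const assms
  assms(1,2,3,4)[THEN FP_compose] FP_fst FP_snd FP_id; auto)

lemma FP_srow:
 assumes "FP S n" "FP S W" "FP S t"
 shows "FP S (%x. srow (n x) (W x) (t x))"
 unfolding srow_def
 by (intro FP_tabI FP_sum FP_rat_mult FP_mx FP_elt FP_length assms
  assms(2,3)[THEN FP_compose] FP_fst FP_snd FP_id; auto)

lemma FP_sred:
 assumes "FP S n" "FP S R" "FP S vs" "FP S W"
 shows "FP S (%x. sred (n x) (W x) (mum (n x) (R x) (vs x) (W x)))"
 unfolding sred_def
proof (intro FP_tabI FP_srow FP_length assms)
 let ?T = "{z. fst z \<in> S \<and> snd z < length (W (fst z))}"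
 have l: "length (mum n R vs W) = length W" for n R vs W by (simp add: mum_def)
 show "FP ?T (%z. n (fst z))" "FP ?T (%z. W (fst z))" by (intro FP_lift assms)+
 show "FP ?T (%z. tcoef (mum (n (fst z)) (R (fst z)) (vs (fst z)) (W (fst z))) (snd z))"
  by (intro FP_tcoef FP_mum FP_lift assms FP_snd FP_id) (auto simp: l mx_mum mx_mum_upper)
qed

lemma FP_viol:
 assumes "FP S n" "FP S R" "FP S vs" "FP S i"
 shows "FP S (%x. viol (n x) (R x) (vs x) (i x))"
 unfolding viol_def by (intro FP_rat_less FP_rat_mult FP_const FP_bil_mx FP_row FP_Suc assms)

lemma FP_fviol:
 assumes n: "FP S n" and R: "FP S R" and vs: "FP S vs"
 shows "FP S (%x. fviol (n x) (R x) (vs x))"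
 unfolding fviol_def
proof (rule FP_foldl[where T = "S \<times> UNIV"])
 show "FP (S \<times> UNIV) (%z. if viol (n (fst z)) (R (fst z)) (vs (fst z)) (snd (snd z)) then snd (snd z) else fst (snd z))"
  by (intro FP_If FP_viol FP_compose[OF n] FP_compose[OF R] FP_compose[OF vs] FP_fst FP_snd FP_id; auto)
 show "FP S (%x. [0..<length (vs x) - Suc 0])" "FP S (%x. length (vs x))" by (intro FP_upt FP_pred FP_length vs)+
 show "PB S (%x. sz (length (vs x)))" by (rule FP_sz[OF FP_length[OF vs]])
 fix x i assume x: "x \<in> S"
 let ?f = "%r i. if viol (n x) (R x) (vs x) i then i else r"
 show "i < length [0..<length (vs x) - Suc 0] ==> (x, foldl ?f (length (vs x)) (take i [0..<length (vs x) - Suc 0]), [0..<length (vs x) - Suc 0] ! i) \<in> S \<times> UNIV"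
  using x by simp
 have "foldl ?f a l \<le> a" if "\<forall>j\<in>set l. j \<le> a" for a l
 proof -
  have "foldl ?f c l \<le> a" if "c \<le> a" "\<forall>j\<in>set l. j \<le> a" for c using that by (induction l arbitrary: c) auto
  from this[OF le_refl that] show ?thesis .
 qed
 moreover have "\<forall>j\<in>set (take i [0..<length (vs x) - Suc 0]). j \<le> length (vs x)"
  by (auto dest!: in_set_takeD)
 ultimately have "foldl ?f (length (vs x)) (take i [0..<length (vs x) - Suc 0]) \<le> length (vs x)"
  by blast
 thus "sz (foldl ?f (length (vs x)) (take i [0..<length (vs x) - Suc 0])) \<le> sz (length (vs x))"
  by (simp add: sz_nat)
qed

lemma FP_rswap:
 assumes "FP S W" "FP S i"
 shows "FP S (%x. rswap (W x) (i x))"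
 unfolding rswap_def
 by (intro FP_tabI FP_elt FP_If FP_nat_eq FP_Suc FP_length assms
  assms(1,2)[THEN FP_compose] FP_fst FP_snd FP_id; auto)

lemma FP_lstep:
 assumes "FP S n" "FP S R" "FP S W" "\<And>x. x \<in> S ==> symm (n x) (mx (R x))" "\<And>x i j. x \<in> S ==> mx (W x) i j \<in> \<int>"
 shows "FP S (%x. lstep (n x) (R x) (W x))"
 unfolding lstep_def lstep2_def
 by (intro FP_If FP_nat_less FP_rswap FP_sred FP_fviol FP_length FP_gso assms)

lemma FP_lfuel:
 assumes "FP S n" "FP S p" "FP S R"
 shows "FP S (%x. lfuel (n x) (p x) (R x))"
 unfolding lfuel_def
 by (intro FP_nat_add FP_nat_mult FP_nbits FP_rat_mult FP_rat_add FP_of_int FP_mden FP_sum FP_mx FP_const assms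
   FP_compose[OF assms(3)] FP_fst FP_snd FP_id; auto)

text \<open>The entries \<open>mx W\<close> do not determine the lists, which \<open>elt\<close>
  pads with zeros, whereas the size of the encoding depends on the actual lengths.\<close>

definition shaped :: "nat => nat => rmat => bool" where
 "shaped p n W \<longleftrightarrow> length W = p \<and> (\<forall>k<p. length (elt [] W k) = n)"

lemma shaped_sred: "shaped (length W) n (sred n W M)"
 by (simp add: shaped_def sred_def srow_def)

lemma shaped_rswap: "shaped p n W ==> Suc i < p ==> shaped p n (rswap W i)"
 by (simp add: shaped_def rswap_def)

lemma shaped_lstep: "length W = p ==> length (gso n R W) = p ==> shaped p n (lstep n R W)"
 using shaped_sred[of W n] shaped_rswap[of p n] fviol_spec[of n R "gso n R W"]
 by (auto simp: lstep_def lstep2_def)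

lemma sz_shaped:
 assumes "shaped p n W" "\<And>k l. k < p ==> l < n ==> sz (mx W k l) \<le> s"
 shows "sz W \<le> 1 + p * (1 + (1 + n * (1 + s)))"
proof -
 have W: "W = map (%k. map (mx W k) [0..<n]) [0..<p]"
  by (rule nth_equalityI) (use assms(1) in \<open>auto simp: shaped_def elt_def mx_def intro!: nth_equalityI\<close>)
 have "sz (map (mx W k) [0..<n]) \<le> 1 + n * (1 + s)" if "k < p" for k
  using sz_map_le[of "[0..<n]" "mx W k" s] assms(2)[OF that] by auto
 hence "sz (map (%k. map (mx W k) [0..<n]) [0..<p]) \<le> 1 + p * (1 + (1 + n * (1 + s)))"
  using sz_map_le[of "[0..<p]" "%k. map (mx W k) [0..<n]" "1 + n * (1 + s)"] by auto
 thus ?thesis using W by simp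
qed

section \<open>The form Q and its inverse R as dual norms\<close>

definition ap :: "nat => (nat => nat => 'a::comm_ring_1) => (nat => 'a) => nat => 'a" where
 "ap n M v i = (\<Sum>j<n. M i j * v j)"

lemma dt_ap: "dt n x (ap n M v) = bil n M x v"
 by (simp add: bil_dt ap_def[abs_def])

context
 fixes n :: nat and Q R :: "rmat"
 assumes symQ: "symm n (mx Q)"
  and posQ: "\<And>z. \<exists>i<n. z i \<noteq> 0 ==> 0 < bil n (rm Q) z z"
  and R: "R = minv n Q (gso n Q (units n n))"
begin

lemma nmQ: "symm n (rm Q)" "0 \<le> bil n (rm Q) x x"
proof -
 show "symm n (rm Q)" by (rule symQ'[OF symQ symQ posQ R])
 show "0 \<le> bil n (rm Q) x x" by (rule psdQ[OF symQ symQ posQ R])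
qed

lemmas N_simps = nm_def[OF nmQ]

lemma Q_ap: assumes "i < n" shows "(\<Sum>j<n. rm Q i j * ap n (rm R) v j) = v i"
proof -
 have "(\<Sum>j<n. rm Q i j * ap n (rm R) v j) = (\<Sum>l<n. \<Sum>j<n. rm Q i j * rm R j l * v l)"
  unfolding ap_def sum_distrib_left by (subst sum.swap) (simp only: mult.assoc)
 also have "\<dots> = (\<Sum>l<n. (if i = l then 1 else 0) * v l)"
  by (rule sum.cong) (use Q_R[OF symQ symQ posQ R assms] in \<open>auto simp flip: sum_distrib_right\<close>)
 also have "\<dots> = v i" using assms by (subst sum.mono_neutral_right[of _ "{i}"]) auto
 finally show ?thesis .
qed

lemma bil_Q_ap: "bil n (rm Q) x (ap n (rm R) v) = dt n x v"
 unfolding bil_dt by (rule dt_cong) (simp_all add: Q_ap)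

lemma bil_ap_ap: "bil n (rm Q) (ap n (rm R) v) (ap n (rm R) v) = bil n (rm R) v v"
 by (simp add: bil_Q_ap dt_commute[of n "ap n (rm R) v"] dt_ap)

lemma psd_R: "0 \<le> bil n (rm R) v v"
 using nmQ(2)[of "ap n (rm R) v"] by (simp add: bil_ap_ap)

lemma pos_R: assumes "\<exists>i<n. v i \<noteq> 0" shows "0 < bil n (rm R) v v"
proof -
 have "\<exists>i<n. ap n (rm R) v i \<noteq> 0"
 proof (rule ccontr)
  assume "\<not> ?thesis"
  hence "v i = 0" if "i < n" for i using Q_ap[OF that, of v] by simp
  thus False using assms by blast
 qed
 from posQ[OF this] show ?thesis by (simp add: bil_ap_ap)
qed

lemma pos_R_rat: assumes "\<exists>i<n. v i \<noteq> 0" shows "0 < bil n (mx R) v v"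
proof -
 have "0 < bil n (rm R) (%i. of_rat (v i)) (%i. of_rat (v i))" by (rule pos_R) (use assms in auto)
 moreover have "bil n (rm R) (%i. of_rat (v i)) (%i. of_rat (v i)) = of_rat (bil n (mx R) v v)"
  unfolding rm_def by (rule bil_of_rat)
 ultimately show ?thesis by simp
qed

text \<open>Cauchy-Schwarz for \<open>x\<close> and \<open>R v\<close>: the functional
  \<open>v\<close> has dual norm \<open>sqrt (v R v)\<close>. This is half the width of the
  ellipsoid in direction \<open>v\<close>.\<close>

lemma dt_bound: "\<bar>dt n x v\<bar> \<le> nm n (rm Q) x * sqrt (bil n (rm R) v v)"
 using nm_cauchy[OF nmQ, of x "ap n (rm R) v"] unfolding N_simps bil_ap_ap bil_Q_ap[of x v] .

text \<open>Cauchy-Schwarz with a unit vector bounds the square of the entry. The absolute value of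
  an integer is at most its square, so the bound is free of roots.\<close>

lemma entry_bound:
 assumes l: "l < n" and v: "v l \<in> \<int>"
 shows "\<bar>v l\<bar> \<le> mx Q l l * bil n (mx R) v v"
proof -
 define e where "e = (%i. if i = l then 1 else 0 :: real)"
 define v' where "v' = (%i. of_rat (v i) :: real)"
 have "dt n e v' = v' l" unfolding dt_def using l by (subst sum.mono_neutral_right[of _ "{l}"]) (auto simp: e_def)
 moreover have "bil n (rm Q) e e = rm Q l l"
 proof -
  have "bil n (rm Q) e e = (\<Sum>i\<in>{l}. \<Sum>j\<in>{l}. e i * rm Q i j * e j)" unfolding bil_def
   using l by (intro sum.mono_neutral_cong_right) (auto simp: e_def intro!: sum.mono_neutral_cong_right)
  thus ?thesis by (simp add: e_def)
 qed
 ultimately have "\<bar>v' l\<bar> \<le> sqrt (rm Q l l) * sqrt (bil n (rm R) v' v')"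
  using dt_bound[of e v'] by (simp add: N_simps)
 hence "\<bar>v' l\<bar> * \<bar>v' l\<bar> \<le> (sqrt (rm Q l l) * sqrt (bil n (rm R) v' v')) * (sqrt (rm Q l l) * sqrt (bil n (rm R) v' v'))"
  by (intro mult_mono) auto
 also have "\<dots> = (sqrt (rm Q l l) * sqrt (rm Q l l)) * (sqrt (bil n (rm R) v' v') * sqrt (bil n (rm R) v' v'))"
  by (simp only: mult_ac)
 also have "\<dots> = rm Q l l * bil n (rm R) v' v'"
 proof -
  have "0 \<le> rm Q l l" using nmQ(2)[of e] \<open>bil n (rm Q) e e = rm Q l l\<close> by simp
  thus ?thesis using psd_R[of v'] by (simp only: real_sqrt_mult_self abs_of_nonneg)
 qed
 also have "bil n (rm R) v' v' = of_rat (bil n (mx R) v v)" unfolding rm_def v'_def by (rule bil_of_rat)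
 finally have *: "of_rat (\<bar>v l\<bar> * \<bar>v l\<bar>) \<le> (of_rat (mx Q l l * bil n (mx R) v v) :: real)"
  unfolding v'_def rm_def of_rat_mult abs_of_rat .
 obtain a where a: "v l = of_int a" using v by (rule Ints_cases)
 have "\<bar>v l\<bar> \<le> \<bar>v l\<bar> * \<bar>v l\<bar>"
 proof (cases "a = 0")
  case False
  hence "\<bar>a\<bar> * 1 \<le> \<bar>a\<bar> * \<bar>a\<bar>" by (intro mult_left_mono) auto
  hence "(of_int (\<bar>a\<bar> * 1) :: rat) \<le> of_int (\<bar>a\<bar> * \<bar>a\<bar>)" by (simp only: of_int_le_iff)
  thus ?thesis by (simp add: a)
 qed (simp add: a)
 also have "\<dots> \<le> mx Q l l * bil n (mx R) v v" using * by (simp only: of_rat_less_eq)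
 finally show ?thesis .
qed

text \<open>The number of iterations does not enter: the invariant alone keeps the entries small,
  through the trace bound on the norms and \<open>entry_bound\<close>.\<close>

lemma sz_linv:
 assumes pn: "p \<le> n" and W: "linv n p R W" "shaped p n W"
 shows "sz W \<le> 1 + sz p * (1 + (1 + sz n * (1 + (sz Q + sz R + sz p + sz n + 20))))"
proof -
 have symR: "symm n (mx R)" by (rule symR[OF symQ symQ posQ R])
 have dpos: "0 \<le> mx R i i" if "i < n" for i by (rule diag_nonneg[OF pn symR pos_R_rat that])
 have "sz (mx W k l) \<le> sz Q + sz R + sz p + sz n + 20" if k: "k < p" and l: "l < n" for k l
 proof -
  have lD: "length W = p" "mx W k l \<in> \<int>" "bil n (mx R) (mx W k) (mx W k) \<le> of_nat p * trR n R"
   using linvD[OF pn symR pos_R_rat W(1)] k by auto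
  have int: "mx W k l \<in> \<int>" by (rule lD)
  have tr: "0 \<le> trR n R" "trR n R \<le> 2 ^ n * 2 ^ (sz R + 5)"
  proof -
   show "0 \<le> trR n R" unfolding trR_def by (intro sum_nonneg) (use dpos in auto)
   have "trR n R \<le> (\<Sum>i<n. 2 ^ (sz R + 5))" unfolding trR_def
    by (rule sum_mono) (use abs_mx_le[of R] abs_le_D1 in blast)
   also have "\<dots> = of_nat n * 2 ^ (sz R + 5)" by simp
   also have "\<dots> \<le> 2 ^ n * 2 ^ (sz R + 5)" by (intro mult_right_mono of_nat_le_pow2) auto
   finally show "trR n R \<le> 2 ^ n * 2 ^ (sz R + 5)" .
  qed
  have b0: "0 \<le> bil n (mx R) (mx W k) (mx W k)" by (rule psdR[OF pn symR pos_R_rat])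
  have "\<bar>mx W k l\<bar> \<le> mx Q l l * bil n (mx R) (mx W k) (mx W k)" by (rule entry_bound[OF l]) (rule int)
  also have "\<dots> \<le> 2 ^ (sz Q + 5) * (2 ^ p * (2 ^ n * 2 ^ (sz R + 5)))"
  proof (rule mult_mono[OF _ _ _ b0])
   show "mx Q l l \<le> 2 ^ (sz Q + 5)" using abs_mx_le[of Q l l] by (rule abs_le_D1)
   have "bil n (mx R) (mx W k) (mx W k) \<le> of_nat p * trR n R" by (rule lD)
   also have "\<dots> \<le> 2 ^ p * (2 ^ n * 2 ^ (sz R + 5))" using tr by (intro mult_mono of_nat_le_pow2) auto
   finally show "bil n (mx R) (mx W k) (mx W k) \<le> 2 ^ p * (2 ^ n * 2 ^ (sz R + 5))" .
  qed simp
  also have "\<dots> = 2 ^ (sz Q + 5 + (p + (n + (sz R + 5))))" by (simp only: power_add)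
  finally have "sz (mx W k l) \<le> 2 * 0 + (sz Q + 5 + (p + (n + (sz R + 5)))) + 5"
   using int by (intro sz_rat_le[of 1]) auto
  thus ?thesis by (simp add: sz_nat)
 qed
 from sz_shaped[OF W(2) this] have "sz W \<le> 1 + p * (1 + (1 + n * (1 + (sz Q + sz R + sz p + sz n + 20))))" .
 also have "\<dots> \<le> 1 + sz p * (1 + (1 + sz n * (1 + (sz Q + sz R + sz p + sz n + 20))))"
  by (intro add_left_mono mult_mono) (auto simp: sz_nat)
 finally show ?thesis .
qed

lemma lll_shaped: assumes pn: "p \<le> n" shows "shaped p n ((lstep n R ^^ k) (units p n))"
proof (cases k)
 case 0
 thus ?thesis by (simp add: shaped_def units_def)
next
 case (Suc k')
 have symR: "symm n (mx R)" by (rule symR[OF symQ symQ posQ R])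
 have "linv n p R ((lstep n R ^^ k') (units p n))" using lll_iter[OF pn symR pos_R_rat] by blast
 thus ?thesis using Suc linv_gso(2)[OF pn symR pos_R_rat] linvD(1)[OF pn symR pos_R_rat]
  by (auto intro!: shaped_lstep)
qed

lemma lll_linv: assumes pn: "p \<le> n" shows "linv n p R ((lstep n R ^^ k) (units p n))"
 using lll_iter[OF pn symR[OF symQ symQ posQ R] pos_R_rat] by blast

end

lemma FP_lll:
 assumes n: "FP S n" and p: "FP S p" and Q: "FP S Q" and R: "FP S R"
  and sym: "\<And>x. x \<in> S ==> symm (n x) (mx (Q x))"
  and pos: "\<And>x z. x \<in> S ==> \<exists>i<n x. z i \<noteq> 0 ==> 0 < bil (n x) (rm (Q x)) z z"
  and R_eq: "\<And>x. x \<in> S ==> R x = minv (n x) (Q x) (gso (n x) (Q x) (units (n x) (n x)))"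
  and pn: "\<And>x. x \<in> S ==> p x \<le> n x"
 shows "FP S (%x. lll (n x) (p x) (R x))"
 unfolding lll_def
proof (rule FP_iter[where T = "{z. fst z \<in> S \<and> (\<forall>i j. mx (snd z) i j \<in> \<int>)}"])
 let ?T = "{z. fst z \<in> S \<and> (\<forall>i j. mx (snd z) i j \<in> \<int>)}"
 show "FP ?T (%z. lstep (n (fst z)) (R (fst z)) (snd z))"
 proof (intro FP_lstep FP_lift FP_snd FP_id n R)
  fix z assume "z \<in> ?T"
  thus "symm (n (fst z)) (mx (R (fst z)))" using R_eq[of "fst z"] by (simp add: symm_minv)
 qed auto
 show "FP S (%x. lfuel (n x) (p x) (R x))" "FP S (%x. units (p x) (n x))" by (intro FP_lfuel FP_units n p R)+
 define B where "B x = 1 + sz (p x) * (1 + (1 + sz (n x) * (1 + (sz (Q x) + sz (R x) + sz (p x) + sz (n x) + 20))))" for x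
 show "PB S B" unfolding B_def by (intro PB_add PB_mult PB_const FP_sz[OF n] FP_sz[OF p] FP_sz[OF Q] FP_sz[OF R])
 fix x i assume x: "x \<in> S"
 have W: "linv (n x) (p x) (R x) ((lstep (n x) (R x) ^^ i) (units (p x) (n x)))"
  by (rule lll_linv[OF sym[OF x] pos[OF x] R_eq[OF x] pn[OF x]])
 have sh: "shaped (p x) (n x) ((lstep (n x) (R x) ^^ i) (units (p x) (n x)))"
  by (rule lll_shaped[OF sym[OF x] pos[OF x] R_eq[OF x] pn[OF x]])
 show "(x, (lstep (n x) (R x) ^^ i) (units (p x) (n x))) \<in> ?T"
  using x linvD(2)[OF pn[OF x] symR[OF sym[OF x] sym[OF x] pos[OF x] R_eq[OF x]] pos_R_rat[OF sym[OF x] pos[OF x] R_eq[OF x]] W] by simp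
 show "sz ((lstep (n x) (R x) ^^ i) (units (p x) (n x))) \<le> B x"
  unfolding B_def by (rule sz_linv[OF sym[OF x] pos[OF x] R_eq[OF x] pn[OF x] W sh])
qed

section \<open>Rounding and the approximation guarantee\<close>

subsection \<open>A quadratic function on the unit ball\<close>

context
 fixes n :: nat and Q H :: "nat => nat => real" and b :: "nat => real" and m M :: real
 assumes symQ: "symm n Q" and posQ: "\<And>x. \<exists>i<n. x i \<noteq> 0 ==> 0 < bil n Q x x"
  and symH: "symm n H" and mM: "\<And>u. nm n Q u \<le> 1 ==> m \<le> qf n H b u \<and> qf n H b u \<le> M"
begin

lemma ball_psd: "0 \<le> bil n Q x x"
proof (cases "\<exists>i<n. x i \<noteq> 0")
 case False
 hence "bil n Q x x = 0" by (simp add: bil_def)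
 thus ?thesis by simp
qed (use posQ in \<open>auto intro: less_imp_le\<close>)

text \<open>If the norm is 0, division yields 0; such a vector vanishes below \<open>n\<close>, so
  scaling back is right in this case too.\<close>

definition normed :: "(nat => real) => nat => real" where "normed x i = x i / nm n Q x"

lemma nm_normed: "nm n Q (normed x) \<le> 1"
proof -
 have "nm n Q (normed x) = nm n Q (%i. (1 / nm n Q x) * x i)"
  by (rule nm_cong[OF symQ ball_psd]) (simp add: normed_def)
 also have "\<dots> = \<bar>1 / nm n Q x\<bar> * nm n Q x" by (rule nm_scale[OF symQ ball_psd])
 also have "\<dots> \<le> 1" using nm_nonneg[OF symQ ball_psd, of x] by (cases "nm n Q x = 0") auto
 finally show ?thesis .
qed

lemma normed_scale: assumes "i < n" shows "nm n Q x * normed x i = x i"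
proof (cases "nm n Q x = 0")
 case True
 have "x i = 0"
 proof (rule ccontr)
  assume "x i \<noteq> 0"
  hence "0 < bil n Q x x" using assms by (intro posQ) blast
  thus False using True nm_square[OF symQ ball_psd, of x] by simp
 qed
 thus ?thesis using True by simp
qed (simp add: normed_def)

lemma bil_normed: "bil n A x y = nm n Q x * nm n Q y * bil n A (normed x) (normed y)"
proof -
 have "bil n A x y = bil n A (%i. nm n Q x * normed x i) (%i. nm n Q y * normed y i)"
  by (rule bil_cong) (simp_all only: normed_scale)
 thus ?thesis by (simp add: bil_scale_left bil_scale_right)
qed

lemma dt_normed: "dt n a x = nm n Q x * dt n a (normed x)"
proof -
 have "dt n a x = dt n a (%i. nm n Q x * normed x i)"
  by (rule dt_cong) (simp_all only: normed_scale)
 thus ?thesis by (simp only: dt_scale)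
qed

lemma range_nonneg: "m \<le> 0" "0 \<le> M"
proof -
 have "nm n Q (%_. 0) \<le> 1" by (simp add: nm_le_1[OF symQ ball_psd] bil_def)
 from mM[OF this] have "m \<le> 0 \<and> 0 \<le> M" by (simp add: qf_def bil_def dt_def)
 thus "m \<le> 0" "0 \<le> M" by simp_all
qed

lemma qf_minus: "qf n H b (%i. - 1 * x i) = bil n H x x - dt n b x" "nm n Q (%i. - 1 * x i) = nm n Q x"
 unfolding qf_def bil_scale_left bil_scale_right dt_scale nm_scale[OF symQ ball_psd] by simp_all

text \<open>The values at \<open>x\<close> and \<open>- x\<close> separate the even part, their
  mean, from the odd part, half their difference. The value 0 at the centre gives
  \<open>m \<le> 0 \<le> M\<close>.\<close>

lemma ball_bounds:
 assumes "nm n Q x \<le> 1"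
 shows "\<bar>bil n H x x\<bar> \<le> M - m" "\<bar>dt n b x\<bar> \<le> (M - m) / 2"
proof -
 have 1: "m \<le> bil n H x x + dt n b x" "bil n H x x + dt n b x \<le> M" using mM[OF assms] by (simp_all add: qf_def)
 have 2: "m \<le> bil n H x x - dt n b x" "bil n H x x - dt n b x \<le> M"
  using mM[of "%i. - 1 * x i", unfolded qf_minus, OF assms] by simp_all
 show "\<bar>bil n H x x\<bar> \<le> M - m" "\<bar>dt n b x\<bar> \<le> (M - m) / 2" using 1 2 range_nonneg unfolding abs_le_iff by (simp_all add: field_simps)
qed

lemma dt_le: "\<bar>dt n b x\<bar> \<le> (M - m) / 2 * nm n Q x"
proof -
 have "\<bar>dt n b x\<bar> = nm n Q x * \<bar>dt n b (normed x)\<bar>"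
  by (subst dt_normed) (simp add: abs_mult nm_nonneg[OF symQ ball_psd])
 also have "\<dots> \<le> nm n Q x * ((M - m) / 2)"
  by (intro mult_left_mono ball_bounds nm_normed nm_nonneg[OF symQ ball_psd])
 finally show ?thesis by (simp only: mult.commute)
qed

text \<open>Polarisation for normalised vectors: four times the form is the difference of the
  quadratic form at \<open>x + y\<close> and \<open>x - y\<close>. By the parallelogram law the
  squared norms of these two add up to at most 4, so no constant is lost.\<close>

lemma bil_le: "\<bar>bil n H x y\<bar> \<le> (M - m) * (nm n Q x * nm n Q y)"
proof -
 have sq: "\<bar>bil n H z z\<bar> \<le> (M - m) * bil n Q z z" for z
 proof -
  have "\<bar>bil n H z z\<bar> = bil n Q z z * \<bar>bil n H (normed z) (normed z)\<bar>"
   unfolding bil_normed[of H z z] nm_square[OF symQ ball_psd] abs_mult abs_of_nonneg[OF ball_psd] ..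
  also have "\<dots> \<le> bil n Q z z * (M - m)"
   by (intro mult_left_mono ball_bounds nm_normed ball_psd)
  finally show ?thesis by (simp only: mult.commute)
 qed
 have unit: "\<bar>bil n H x y\<bar> \<le> M - m" if "nm n Q x \<le> 1" "nm n Q y \<le> 1" for x y
 proof -
  let ?p = "%i. x i + y i" and ?d = "%i. x i - y i"
  have 4: "4 * bil n H x y = bil n H ?p ?p - bil n H ?d ?d"
   using bil_sym[OF symH, of y x] by (simp add: bil_linear)
  have par: "bil n Q ?p ?p + bil n Q ?d ?d = 2 * bil n Q x x + 2 * bil n Q y y"
   by (simp add: bil_linear)
  have "\<bar>bil n H ?p ?p\<bar> + \<bar>bil n H ?d ?d\<bar> \<le> (M - m) * (bil n Q ?p ?p + bil n Q ?d ?d)"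
   using sq[of ?p] sq[of ?d] by (simp only: distrib_left)
  also have "\<dots> \<le> (M - m) * 4"
   unfolding par using that range_nonneg by (intro mult_left_mono) (simp_all add: nm_le_1[OF symQ ball_psd])
  finally have "\<bar>bil n H ?p ?p\<bar> + \<bar>bil n H ?d ?d\<bar> \<le> (M - m) * 4" .
  thus ?thesis using 4 unfolding abs_le_iff by (simp add: algebra_simps) linarith
 qed
 have "\<bar>bil n H x y\<bar> = nm n Q x * nm n Q y * \<bar>bil n H (normed x) (normed y)\<bar>"
  by (subst bil_normed) (simp add: abs_mult nm_nonneg[OF symQ ball_psd])
 also have "\<dots> \<le> nm n Q x * nm n Q y * (M - m)"
  by (intro mult_left_mono unit nm_normed mult_nonneg_nonneg nm_nonneg[OF symQ ball_psd])
 finally show ?thesis by (simp only: mult.commute)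
qed

text \<open>The difference is the form at \<open>u - v\<close> and \<open>u + v\<close> plus the
  linear term at \<open>u - v\<close>. As \<open>u + v\<close> has norm at most 2, the constant is 2
  + 1/2.\<close>

lemma qf_lipschitz:
 assumes u: "nm n Q u \<le> 1" and v: "nm n Q v \<le> 1"
 shows "\<bar>qf n H b u - qf n H b v\<bar> \<le> 5 / 2 * ((M - m) * nm n Q (%i. u i - v i))"
proof -
 let ?d = "%i. u i - v i" and ?p = "%i. u i + v i"
 have p: "nm n Q ?p \<le> 2" using nm_add[OF symQ ball_psd, of u v] u v by simp
 have "qf n H b u - qf n H b v = bil n H ?d ?p + dt n b ?d"
  using bil_sym[OF symH, of u v] by (simp add: qf_def bil_linear dt_diff)
 also have "\<bar>\<dots>\<bar> \<le> \<bar>bil n H ?d ?p\<bar> + \<bar>dt n b ?d\<bar>" by (rule abs_triangle_ineq)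
 also have "\<dots> \<le> (M - m) * (nm n Q ?d * 2) + (M - m) / 2 * nm n Q ?d"
 proof (rule add_mono[OF _ dt_le])
  have "\<bar>bil n H ?d ?p\<bar> \<le> (M - m) * (nm n Q ?d * nm n Q ?p)" by (rule bil_le)
  also have "\<dots> \<le> (M - m) * (nm n Q ?d * 2)"
   using p range_nonneg by (intro mult_left_mono nm_nonneg[OF symQ ball_psd]) simp_all
  finally show "\<bar>bil n H ?d ?p\<bar> \<le> (M - m) * (nm n Q ?d * 2)" .
 qed
 finally show ?thesis by simp
qed

end

text \<open>Points of the ball at distance \<open>2 * t\<close> differ by at most
  \<open>5 * (D * t)\<close> in value. So \<open>x\<close> is \<open>6 * (D * t)\<close> above the
  minimum, 5 from rounding and 1 from \<open>w\<close>, while the range on \<open>S\<close> loses at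
  most 10 such units, 5 at each end. The 16 is 10 + 6: as \<open>16 * t \<le> 1\<close>, the range
  keeps at least \<open>3 / 8 * D\<close>, and \<open>6 * t = 16 * t * (3 / 8)\<close>.\<close>

lemma approx_on_net:
 fixes n :: nat and Q H :: "nat => nat => real" and b :: "nat => real"
 assumes symQ: "symm n Q" and posQ: "\<And>x. \<exists>i<n. x i \<noteq> 0 ==> 0 < bil n Q x x" and symH: "symm n H"
 defines "U \<equiv> {u. nm n Q u \<le> 1}" and g_def: "\<phi> \<equiv> qf n H b"
 assumes bdd: "bdd_above (\<phi> ` U)" "bdd_below (\<phi> ` U)"
 defines "D \<equiv> (SUP u\<in>U. \<phi> u) - (INF u\<in>U. \<phi> u)"
 assumes S: "S \<subseteq> U" and t: "0 \<le> t" "16 * t \<le> \<epsilon>" "16 * t \<le> 1"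
  and net: "\<And>y. y \<in> U ==> \<exists>v\<in>S. nm n Q (%i. v i - y i) \<le> 2 * t"
  and x: "x \<in> S" and w: "w \<in> U" and xw: "nm n Q (%i. x i - w i) \<le> 2 * t"
  and wmin: "\<And>u. u \<in> U ==> \<phi> w \<le> \<phi> u + e" and e: "0 < D ==> e \<le> D * t"
 shows "\<phi> x - (INF u\<in>S. \<phi> u) \<le> \<epsilon> * ((SUP u\<in>S. \<phi> u) - (INF u\<in>S. \<phi> u))"
proof -
 define M m where "M = (SUP u\<in>U. \<phi> u)" and "m = (INF u\<in>U. \<phi> u)"
 have D: "D = M - m" by (simp add: D_def M_def m_def)
 have mM: "m \<le> \<phi> u \<and> \<phi> u \<le> M" if "u \<in> U" for u
  unfolding M_def m_def using that bdd by (auto intro: cINF_lower cSUP_upper)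
 have bddS: "bdd_above (\<phi> ` S)" "bdd_below (\<phi> ` S)"
  using bdd_above_mono[OF bdd(1) image_mono[OF S]] bdd_below_mono[OF bdd(2) image_mono[OF S]] by simp_all
 have SU: "(INF u\<in>S. \<phi> u) \<le> \<phi> v" "\<phi> v \<le> (SUP u\<in>S. \<phi> u)" if "v \<in> S" for v
  using that bddS by (auto intro: cINF_lower cSUP_upper)
 have D0: "0 \<le> D" using mM[OF w] by (simp add: D)
 have lip: "\<bar>\<phi> u - \<phi> v\<bar> \<le> 5 * (D * t)" if "u \<in> U" "v \<in> U" "nm n Q (%i. u i - v i) \<le> 2 * t" for u v
 proof -
  have "\<bar>\<phi> u - \<phi> v\<bar> \<le> 5 / 2 * ((M - m) * nm n Q (%i. u i - v i))"
   unfolding g_def by (rule qf_lipschitz[OF symQ posQ symH]) (use that mM in \<open>auto simp: U_def g_def\<close>)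
  also have "\<dots> \<le> 5 / 2 * (D * (2 * t))" unfolding D[symmetric] by (intro mult_left_mono that D0) simp
  finally show ?thesis by simp
 qed
 have infS: "m \<le> (INF u\<in>S. \<phi> u)" using x S mM by (intro cINF_greatest) auto
 have supS': "M \<le> (SUP u\<in>S. \<phi> u) + 5 * (D * t)" unfolding M_def
 proof (rule cSUP_least)
  fix u assume u: "u \<in> U"
  obtain v where v: "v \<in> S" "nm n Q (%i. v i - u i) \<le> 2 * t" using net[OF u] by (elim bexE)
  have "\<bar>\<phi> v - \<phi> u\<bar> \<le> 5 * (D * t)" by (rule lip) (use v u S in auto)
  thus "\<phi> u \<le> (SUP u\<in>S. \<phi> u) + 5 * (D * t)" using SU(2)[OF v(1)] by linarith
 qed (use w in auto)
 have infS': "(INF u\<in>S. \<phi> u) - 5 * (D * t) \<le> m" unfolding m_def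
 proof (rule cINF_greatest)
  fix u assume u: "u \<in> U"
  obtain v where v: "v \<in> S" "nm n Q (%i. v i - u i) \<le> 2 * t" using net[OF u] by (elim bexE)
  have "\<bar>\<phi> v - \<phi> u\<bar> \<le> 5 * (D * t)" by (rule lip) (use v u S in auto)
  thus "(INF u\<in>S. \<phi> u) - 5 * (D * t) \<le> \<phi> u" using SU(1)[OF v(1)] by linarith
 qed (use w in auto)
 have e': "\<phi> x - m \<le> 6 * (D * t)"
 proof (cases "D = 0")
  \<comment> \<open>For a constant objective there is no positive range to compare the tolerance
    \<open>e\<close> with, but all values agree.\<close>
  case True
  hence "\<phi> x = m" using mM[of x] x S by (auto simp: D)
  thus ?thesis using True by simp
 next
  case False
  have "\<phi> w - e \<le> m" unfolding m_def
   by (rule cINF_greatest) (use w wmin in \<open>auto simp: le_diff_eq diff_le_eq\<close>)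
  moreover have "\<bar>\<phi> x - \<phi> w\<bar> \<le> 5 * (D * t)" by (rule lip) (use x w xw S in auto)
  moreover have "e \<le> D * t" using e D0 False by simp
  ultimately show ?thesis by linarith
 qed
 have "D * (10 * t) \<le> D * (10 / 16)" using t D0 by (intro mult_left_mono) auto
 hence width: "3 / 8 * D \<le> (SUP u\<in>S. \<phi> u) - (INF u\<in>S. \<phi> u)" using supS' infS' by (simp add: D)
 have "\<phi> x - (INF u\<in>S. \<phi> u) \<le> 6 * (D * t)" using e' infS by linarith
 also have "\<dots> = (16 * t) * (3 / 8 * D)" by simp
 also have "\<dots> \<le> \<epsilon> * (3 / 8 * D)" using t D0 by (intro mult_right_mono) auto
 also have "\<dots> \<le> \<epsilon> * ((SUP u\<in>S. \<phi> u) - (INF u\<in>S. \<phi> u))" using t width by (intro mult_left_mono) auto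
 finally show ?thesis .
qed

subsection \<open>Rounding along the orthogonal directions\<close>

primrec rnd :: "nat => (nat => nat => real) => (nat => nat => real) => (nat => real) => nat => nat => real" where
 "rnd n w G y 0 = y"
| "rnd n w G y (Suc k) = (%l. rnd n w G y k l + (of_int (round (dt n (w k) (rnd n w G y k))) - dt n (w k) (rnd n w G y k)) * G k l)"

lemma dt_rnd_Suc: "dt n a (rnd n w G y (Suc k)) =
  dt n a (rnd n w G y k) + (of_int (round (dt n (w k) (rnd n w G y k))) - dt n (w k) (rnd n w G y k)) * dt n a (G k)"
 by (simp add: dt_add dt_scale)

text \<open>Step \<open>m\<close> moves the product with row \<open>m\<close> to its rounded value,
  and the later directions have product 0 with this row.\<close>

lemma rnd_int:
 assumes 1: "\<And>k. k < p ==> dt n (w k) (G k) = 1" and 0: "\<And>k j. k < j ==> j < p ==> dt n (w k) (G j) = 0"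
 shows "m \<le> p ==> k < m ==> dt n (w k) (rnd n w G y m) \<in> \<int>"
proof (induction m)
 case (Suc m)
 show ?case
 proof (cases "k = m")
  case True
  thus ?thesis using 1[of m] Suc.prems unfolding dt_rnd_Suc by simp
 next
  case False
  thus ?thesis using 0[of k m] Suc unfolding dt_rnd_Suc by simp
 qed
qed simp

text \<open>Rounding moves by at most half of each direction, and by orthogonality the squared
  lengths add up. The second conjunct keeps the induction going.\<close>

lemma rnd_norm:
 assumes sym: "symm n Q" and 0: "\<And>i j. i < p ==> j < p ==> i \<noteq> j ==> bil n Q (G i) (G j) = 0"
  and r: "\<And>i. i < p ==> 0 \<le> bil n Q (G i) (G i)"
 shows "m \<le> p ==> z = (%l. rnd n w G y m l - y l) ==>
  bil n Q z z \<le> (\<Sum>i<m. bil n Q (G i) (G i) / 4) \<and> (\<forall>j. m \<le> j --> j < p --> bil n Q z (G j) = 0)"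
proof (induction m arbitrary: z)
 case 0
 thus ?case by (simp add: bil_def)
next
 case (Suc m)
 define x where "x = (%l. rnd n w G y m l - y l)"
 have IH: "bil n Q x x \<le> (\<Sum>i<m. bil n Q (G i) (G i) / 4)" "\<And>j. m \<le> j ==> j < p ==> bil n Q x (G j) = 0"
  using Suc.IH[OF _ x_def] Suc.prems(1) by auto
 define s where "s = of_int (round (dt n (w m) (rnd n w G y m))) - dt n (w m) (rnd n w G y m)"
 have z: "z = (%l. x l + s * G m l)" using Suc.prems(2) by (simp add: x_def s_def fun_eq_iff)
 have xm: "bil n Q x (G m) = 0" using IH(2)[of m] Suc.prems by simp
 have "\<bar>s\<bar> \<le> 1 / 2" unfolding s_def using of_int_round_abs_le by blast
 hence "\<bar>s\<bar> * \<bar>s\<bar> \<le> 1 / 2 * (1 / 2)" by (intro mult_mono) auto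
 hence ss: "s * s \<le> 1 / 4" by simp
 have "bil n Q z z = bil n Q x x + s * s * bil n Q (G m) (G m)"
  using xm bil_sym[OF sym, of "G m" x] by (simp add: z bil_linear)
 also have "\<dots> \<le> (\<Sum>i<m. bil n Q (G i) (G i) / 4) + 1 / 4 * bil n Q (G m) (G m)"
  using ss r[of m] Suc.prems by (intro add_mono IH mult_right_mono) auto
 finally have 1: "bil n Q z z \<le> (\<Sum>i<Suc m. bil n Q (G i) (G i) / 4)" by simp
 have "bil n Q z (G j) = 0" if "Suc m \<le> j" "j < p" for j
 proof -
  have "bil n Q x (G j) = 0" "bil n Q (G m) (G j) = 0" using IH(2)[of j] 0[of m j] that by auto
  thus ?thesis by (simp add: z bil_linear)
 qed
 with 1 show ?case by blast
qed

subsection \<open>The algorithm\<close>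

definition rstep where
 "rstep n W G x k = tab n (%l. vx x l + (of_int (round (dt n (mx W k) (vx x))) - dt n (mx W k) (vx x)) * mx G k l)"

definition rlist where
 "rlist n W G k y = foldl (rstep n W G) y [0..<k]"

text \<open>
 Adding multiples of \<open>gmat k\<close> changes the product with row \<open>k\<close> but not those with the rows before it,
 so \<open>rlist\<close> makes the products with all rows integral one after the other. Every step has squared
 length at most the corresponding summand of \<open>tau\<close>.
\<close>

definition gmat where
 "gmat n p R vs = tab p (%k. tab n (%l. (\<Sum>j<n. mx R l j * mx vs k j) / bil n (mx R) (mx vs k) (mx vs k)))"

definition tau where
 "tau n p R vs = (\<Sum>j<p. 1 / (4 * bil n (mx R) (mx vs j) (mx vs j)))"

definition bvec where
 "bvec n H h c = tab n (%i. 2 * (\<Sum>j<n. mx H i j * vx c j) + vx h i)"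

text \<open>Clearing denominators bounds the range of a nonconstant objective away from 0.\<close>

definition tol where
 "tol n H b Q e = e / (16 * (of_int (mden (Suc n) (b # H)) * (1 + (\<Sum>i<n. mx Q i i))))"

text \<open>The factor \<open>1 - e / 16\<close> leaves room for rounding without leaving the ellipsoid.\<close>

definition shrink where
 "shrink n c e w = tab n (%l. vx c l + (1 - e / 16) * vx w l)"

text \<open>Taking the right end of the bracket yields an upper bound of the root; the number of
  halvings leaves a bracket of length at most 1.\<close>

definition usqrt :: "rat => rat" where
 "usqrt q = snd (bisect (%t. q \<le> t * t) 0 (1 + q) (nbits (1 + q)))"

definition interleave where
 "interleave x = foldl (%acc r. acc @ [nu r, de r]) [] x"

definition dirout where
 "dirout n w r = 1 # (tab n (%l. \<lfloor>vx w l\<rfloor>) @ [nu r, de r])"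

definition solve3 where
 "solve3 n p H b Q R c e W vs = (if 256 * tau n p R vs \<le> e * e
   then 0 # interleave (rlist n W (gmat n p R vs) p (shrink n c e (trs n H b Q R (tol n H b Q e))))
   else dirout n (elt [] W 0) (dt n (mx W 0) (vx c) - usqrt (bil n (mx R) (mx W 0) (mx W 0))))"

definition solve2 where
 "solve2 n p H b Q R c e W = solve3 n p H b Q R c e W (gso n R W)"

definition solve1 where
 "solve1 n p H b Q R c e = solve2 n p H b Q R c e (lll n p R)"

definition solve where
 "solve n p H h Q c e = solve1 n p H (bvec n H h c) Q (minv n Q (gso n Q (units n n))) c e"

lemma length_rlist: "length y = n ==> length (rlist n W G k y) = n"
 unfolding rlist_def by (induction k) (auto simp: rstep_def)

lemma interleave_snoc: "interleave (x @ [r]) = interleave x @ [nu r, de r]"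
 by (simp add: interleave_def)

lemma length_interleave: "length (interleave x) = 2 * length x"
 by (induction x rule: rev_induct) (simp_all add: interleave_snoc, simp add: interleave_def)

lemma nth_interleave: "i < length x ==> interleave x ! (2 * i) = nu (x ! i) \<and> interleave x ! (2 * i + 1) = de (x ! i)"
proof (induction x rule: rev_induct)
 case (snoc r x)
 show ?case
 proof (cases "i < length x")
  case True
  thus ?thesis using snoc.IH by (simp add: interleave_snoc nth_append length_interleave)
 next
  case False
  hence "i = length x" using snoc.prems by simp
  thus ?thesis by (simp add: interleave_snoc nth_append length_interleave)
 qed
qed simp

lemma round_of_rat: "round (of_rat x :: real) = round x"
proof -
 have "\<lfloor>of_rat y :: real\<rfloor> = \<lfloor>y\<rfloor>" for y
 proof (rule floor_unique)
  have "(of_rat (of_int \<lfloor>y\<rfloor>) :: real) \<le> of_rat y" by (simp only: of_rat_less_eq of_int_floor_le)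
  thus "of_int \<lfloor>y\<rfloor> \<le> (of_rat y :: real)" by simp
  have "(of_rat y :: real) < of_rat (of_int \<lfloor>y\<rfloor> + 1)" by (simp only: of_rat_less) linarith
  thus "of_rat y < (of_int \<lfloor>y\<rfloor> + 1 :: real)" by (simp add: of_rat_add)
 qed
 from this[of "x + 1 / 2"] show ?thesis by (simp add: round_def of_rat_add of_rat_divide)
qed

lemma rx_rlist: "l < n ==> rx (rlist n W G k y) l = rnd n (rm W) (rm G) (rx y) k l"
proof (induction k arbitrary: l)
 case 0
 thus ?case by (simp add: rlist_def)
next
 case (Suc k)
 define x where "x = rlist n W G k y"
 have x: "rlist n W G (Suc k) y = rstep n W G x k" by (simp add: rlist_def x_def)
 have "dt n (rm W k) (rnd n (rm W) (rm G) (rx y) k) = dt n (rm W k) (rx x)"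
  by (rule dt_cong) (simp_all add: Suc.IH x_def)
 also have "\<dots> = of_rat (dt n (mx W k) (vx x))" unfolding rm_def rx_def by (rule dt_of_rat)
 finally have t: "dt n (rm W k) (rnd n (rm W) (rm G) (rx y) k) = of_rat (dt n (mx W k) (vx x))" .
 have "rx (rstep n W G x k) l = rx x l + (of_int (round (dt n (mx W k) (vx x))) - of_rat (dt n (mx W k) (vx x))) * rm G k l"
  using Suc.prems by (simp add: rstep_def rx_tab rx_def rm_def of_rat_add of_rat_mult of_rat_diff)
 also have "rx x l = rnd n (rm W) (rm G) (rx y) k l" unfolding x_def by (rule Suc.IH[OF Suc.prems])
 finally show ?case unfolding x by (simp add: t round_of_rat)
qed

context
 fixes n p :: nat and Q R W :: "rmat"
 assumes symQ: "symm n (mx Q)"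
  and posQ: "\<And>z. \<exists>i<n. z i \<noteq> 0 ==> 0 < bil n (rm Q) z z"
  and R: "R = minv n Q (gso n Q (units n n))"
  and pn: "p \<le> n" and W: "linv n p R W"
begin

lemma Rfacts: "symm n (mx R)" "symm n (rm Q)" "0 \<le> bil n (rm Q) x x" "\<exists>i<n. v i \<noteq> 0 ==> 0 < bil n (mx R) v v"
proof -
 show "symm n (mx R)" unfolding R by (rule symm_minv)
 show "symm n (rm Q)" by (rule symm_rm[OF symQ])
 show "0 \<le> bil n (rm Q) x x" by (rule psdQ[OF symQ symQ posQ R])
 show "\<exists>i<n. v i \<noteq> 0 ==> 0 < bil n (mx R) v v" by (rule pos_R_rat[OF symQ posQ R])
qed

abbreviation "gvs \<equiv> gso n R W"
abbreviation "gqs \<equiv> gq n (mx R) (mx W)"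

lemma qs_pos: "k < p ==> 0 < gqs k"
 by (rule linv_pos[OF pn Rfacts(1) Rfacts(4) W])

lemma len_vs: "length gvs = p"
 by (rule linv_gso(2)[OF pn Rfacts(1) Rfacts(4) W])

lemma bil_vs: "k < p ==> bil n (mx R) (mx gvs k) x = bil n (mx R) (gs n (mx R) (mx W) k) x"
  "k < p ==> bil n (mx R) (mx gvs k) (mx gvs k) = gqs k"
 using gso_bil[of k n R W] by (simp_all add: len_vs)

lemma rm_G: "k < p ==> l < n ==> rm (gmat n p R gvs) k l = (1 / of_rat (gqs k)) * ap n (rm R) (rm gvs k) l"
 by (simp add: gmat_def rm_def mx_tab bil_vs(2) ap_def of_rat_divide of_rat_sum of_rat_mult)

lemma bil_rm_vs: "i < p ==> j < p ==> bil n (rm R) (rm gvs i) (rm gvs j) = (if i = j then of_rat (gqs i) else 0)"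
proof -
 assume ij: "i < p" "j < p"
 have "bil n (rm R) (rm gvs i) (rm gvs j) = of_rat (bil n (mx R) (mx gvs i) (mx gvs j))"
  unfolding rm_def by (rule bil_of_rat)
 also have "bil n (mx R) (mx gvs i) (mx gvs j) = bil n (mx R) (gs n (mx R) (mx W) i) (gs n (mx R) (mx W) j)"
  using bil_vs(1)[OF ij(1)] bil_vs(1)[OF ij(2)] bil_sym[OF Rfacts(1)] by metis
 also have "\<dots> = (if i = j then gqs i else 0)"
 proof (cases "i = j")
  case False
  have q: "gqs k \<noteq> 0" if "k < p" for k using qs_pos[OF that] by simp
  show ?thesis using gs_orth[OF Rfacts(1) q ij] False by simp
 qed (simp add: gq_def)
 finally show ?thesis by simp
qed

text \<open>Direction \<open>k\<close> is \<open>R v_k / q_k\<close>. As \<open>Q\<close> cancels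
  one factor \<open>R\<close>, orthogonality of the \<open>v_k\<close> for \<open>R\<close> becomes
  orthogonality of the directions for \<open>Q\<close>, with squared norms
  \<open>1 / q_k\<close>.\<close>

lemma bil_G: assumes "i < p" "j < p"
 shows "bil n (rm Q) (rm (gmat n p R gvs) i) (rm (gmat n p R gvs) j) = (if i = j then 1 / of_rat (gqs i) else 0)"
proof -
 have "bil n (rm Q) (rm (gmat n p R gvs) i) (rm (gmat n p R gvs) j) =
   bil n (rm Q) (%l. (1 / of_rat (gqs i)) * ap n (rm R) (rm gvs i) l) (%l. (1 / of_rat (gqs j)) * ap n (rm R) (rm gvs j) l)"
  by (rule bil_cong) (simp_all only: rm_G assms)
 also have "\<dots> = (1 / of_rat (gqs i)) * ((1 / of_rat (gqs j)) * bil n (rm R) (rm gvs i) (rm gvs j))"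
 proof -
  have "bil n (rm Q) (ap n (rm R) (rm gvs i)) (ap n (rm R) (rm gvs j)) = dt n (ap n (rm R) (rm gvs i)) (rm gvs j)"
   by (rule bil_Q_ap[OF symQ posQ R])
  also have "\<dots> = bil n (rm R) (rm gvs j) (rm gvs i)" unfolding dt_commute[of n "ap n (rm R) (rm gvs i)"] dt_ap ..
  also have "\<dots> = bil n (rm R) (rm gvs i) (rm gvs j)" by (rule bil_sym[OF symm_rm[OF Rfacts(1)]])
  finally show ?thesis unfolding bil_scale_left bil_scale_right by (simp only:)
 qed
 also have "\<dots> = (if i = j then 1 / of_rat (gqs i) else 0)"
  using bil_rm_vs[OF assms] qs_pos[OF assms(1)] by simp
 finally show ?thesis .
qed

text \<open>The products of rows and directions are the orthogonalisation coefficients: 1 on the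
  diagonal and 0 above it, the triangular shape that rounding one row after the other
  requires.\<close>

lemma dt_G: assumes "k < p" "j < p"
 shows "dt n (rm W k) (rm (gmat n p R gvs) j) = of_rat (gmu n (mx R) (mx W) k j)"
proof -
 have "dt n (rm W k) (rm (gmat n p R gvs) j) = dt n (rm W k) (%l. (1 / of_rat (gqs j)) * ap n (rm R) (rm gvs j) l)"
  by (rule dt_cong) (simp_all only: rm_G assms)
 also have "\<dots> = (1 / of_rat (gqs j)) * bil n (rm R) (rm W k) (rm gvs j)" unfolding dt_scale dt_ap ..
 also have "bil n (rm R) (rm W k) (rm gvs j) = of_rat (bil n (mx R) (mx W k) (mx gvs j))"
  unfolding rm_def by (rule bil_of_rat)
 also have "bil n (mx R) (mx W k) (mx gvs j) = bil n (mx R) (mx W k) (gs n (mx R) (mx W) j)"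
  using bil_vs(1)[OF assms(2)] bil_sym[OF Rfacts(1)] by metis
 also have "\<dots> = gmu n (mx R) (mx W) k j * gqs j"
 proof (rule bil_w_gs[OF Rfacts(1) _ assms])
  show "gqs k \<noteq> 0" if "k < p" for k using qs_pos[OF that] by simp
 qed
 finally show ?thesis using qs_pos[OF assms(2)] by (simp add: of_rat_mult)
qed

lemma of_rat_tau: "of_rat (tau n p R gvs) = (\<Sum>j<p. 1 / (4 * of_rat (gqs j)) :: real)"
 unfolding tau_def of_rat_sum by (rule sum.cong) (simp_all add: bil_vs(2) of_rat_divide of_rat_mult)

lemma rnd_spec:
 fixes y :: "nat => real"
 defines "x \<equiv> rnd n (rm W) (rm (gmat n p R gvs)) y p"
 shows "i < p ==> x i \<in> \<int>" "bil n (rm Q) (%l. x l - y l) (%l. x l - y l) \<le> of_rat (tau n p R gvs)"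
proof -
 have int: "dt n (rm W k) x \<in> \<int>" if "k < p" for k
  unfolding x_def by (rule rnd_int[where p = p]) (use that in \<open>auto simp: dt_G gmu_def\<close>)
 show "x i \<in> \<int>" if "i < p"
 proof (rule linv_uni[OF pn Rfacts(1) _ W _ that])
  show "0 < bil n (mx R) v v" if "\<exists>i<n. v i \<noteq> 0" for v by (rule Rfacts(4)[OF that])
 qed (rule int)
 have "bil n (rm Q) (%l. x l - y l) (%l. x l - y l) \<le> (\<Sum>j<p. bil n (rm Q) (rm (gmat n p R gvs) j) (rm (gmat n p R gvs) j) / 4) \<and>
   (\<forall>j. p \<le> j --> j < p --> bil n (rm Q) (%l. x l - y l) (rm (gmat n p R gvs) j) = 0)"
  unfolding x_def
 proof (rule rnd_norm[where p = p and m = p, OF Rfacts(2) _ _ le_refl refl])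
  show "bil n (rm Q) (rm (gmat n p R gvs) i) (rm (gmat n p R gvs) j) = 0" if "i < p" "j < p" "i \<noteq> j" for i j
   using that bil_G by simp
  show "0 \<le> bil n (rm Q) (rm (gmat n p R gvs) i) (rm (gmat n p R gvs) i)" for i by (rule Rfacts(3))
 qed
 hence "bil n (rm Q) (%l. x l - y l) (%l. x l - y l) \<le> (\<Sum>j<p. bil n (rm Q) (rm (gmat n p R gvs) j) (rm (gmat n p R gvs) j) / 4)"
  by (rule conjunct1)
 also have "\<dots> = of_rat (tau n p R gvs)" unfolding of_rat_tau by (rule sum.cong) (simp_all add: bil_G)
 finally show "bil n (rm Q) (%l. x l - y l) (%l. x l - y l) \<le> of_rat (tau n p R gvs)" .
qed

end

subsection \<open>Correctness of the algorithm\<close>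

lemma usqrt_spec:
 assumes q: "0 < q"
 shows "sqrt (of_rat q) \<le> of_rat (usqrt q)" "of_rat (usqrt q) \<le> sqrt (of_rat q) + 1"
proof -
 define lo where "lo = fst (bisect (%t. q \<le> t * t) 0 (1 + q) (nbits (1 + q)))"
 have hi: "q \<le> (1 + q) * (1 + q)" using q by (simp add: algebra_simps)
 note bs = bisect_spec[of "%t. q \<le> t * t" 0 "1 + q" "nbits (1 + q)", folded lo_def usqrt_def]
 have b: "\<not> q \<le> lo * lo" "q \<le> usqrt q * usqrt q" "usqrt q - lo = (1 + q - 0) / 2 ^ nbits (1 + q)" "0 \<le> lo"
  using bs q hi by simp_all
 have "(1 + q) / 2 ^ nbits (1 + q) \<le> 1" using le_nbits[of "1 + q"] by simp
 hence d: "usqrt q \<le> lo + 1" using b(3) unfolding diff_0_right by linarith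
 have "lo \<le> usqrt q" using b(3) q by (simp add: diff_eq_eq)
 hence s0: "0 \<le> usqrt q" using b(4) by simp
 have "(of_rat q :: real) \<le> of_rat (usqrt q * usqrt q)" using b(2) by (simp only: of_rat_less_eq)
 thus "sqrt (of_rat q) \<le> of_rat (usqrt q)"
  by (intro real_le_lsqrt) (use s0 in \<open>simp_all add: of_rat_mult power2_eq_square\<close>)
 have "lo * lo \<le> q" using b(1) by simp
 hence "(of_rat (lo * lo) :: real) \<le> of_rat q" by (simp only: of_rat_less_eq)
 hence "of_rat lo \<le> sqrt (of_rat q)"
  by (intro real_le_rsqrt) (simp add: of_rat_mult power2_eq_square)
 moreover have "(of_rat (usqrt q) :: real) \<le> of_rat (lo + 1)" using d by (simp only: of_rat_less_eq)
 ultimately show "of_rat (usqrt q) \<le> sqrt (of_rat q) + 1" by (simp add: of_rat_add)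
qed

text \<open>The loss of the reduction against the square of the claimed factor. From
  \<open>p = 3\<close> on \<open>2 * p \<le> p * (p + 1) div 2\<close>, so the new summand
  \<open>4 ^ p\<close> is at most the new power of 2, which the growth of \<open>p * p\<close>
  absorbs; the cases before that are computed.\<close>

lemma geometric_width: "(\<Sum>j<p. 4 ^ j) \<le> (p * p) * 2 ^ (p * (p - 1) div 2)"
proof (induction p)
 case (Suc p)
 consider "p = 0" | "p = 1" | "p = 2" | "3 \<le> p" by linarith
 thus ?case
 proof cases
  case 4
  hence "p * 4 \<le> p * (p + 1)" by (intro mult_le_mono2) simp
  hence "p * 4 div 2 \<le> p * (p + 1) div 2" by (rule div_le_mono)
  hence "2 * p \<le> p * (p + 1) div 2" by simp
  hence "(2::nat) ^ (2 * p) \<le> 2 ^ (p * (p + 1) div 2)" by (intro power_increasing) auto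
  hence a: "(4::nat) ^ p \<le> 2 ^ (p * (p + 1) div 2)" by (simp add: power_mult)
  have "(2::nat) ^ (p * (p - 1) div 2) \<le> 2 ^ (p * (p + 1) div 2)"
   by (intro power_increasing div_le_mono mult_le_mono) auto
  hence c: "(p * p) * 2 ^ (p * (p - 1) div 2) \<le> (p * p) * 2 ^ (p * (p + 1) div 2)" by (rule mult_le_mono2)
  have "(\<Sum>j<Suc p. 4 ^ j) \<le> (p * p) * 2 ^ (p * (p + 1) div 2) + 2 ^ (p * (p + 1) div 2)"
   unfolding sum.lessThan_Suc by (rule add_mono[OF order.trans[OF Suc.IH c] a])
  also have "\<dots> = (p * p + 1) * 2 ^ (p * (p + 1) div 2)" by (simp only: distrib_right mult_1_left)
  also have "\<dots> \<le> (Suc p * Suc p) * 2 ^ (p * (p + 1) div 2)" by (rule mult_le_mono1) simp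
  finally show ?thesis by (simp only: mult.commute Suc_eq_plus1 diff_Suc_1 add_diff_cancel_right')
 next
  case 3
  have "(\<Sum>j<Suc 2. 4 ^ j) = (21::nat)" by (simp add: numeral_2_eq_2)
  thus ?thesis unfolding 3 by simp
 qed simp_all
qed simp

definition lwidth :: "nat => real" where
 "lwidth p = real p * 2 powr (real p * (real p - 1) / 4)"

lemma sqrt_geometric_width:
 assumes "0 < p"
 shows "sqrt (\<Sum>j<p. 4 ^ j) \<le> lwidth p" "1 \<le> lwidth p"
proof -
 have e: "real (p * (p - 1) div 2) = real p * (real p - 1) / 2"
 proof -
  have "even (p * (p - 1))" by (cases p) auto
  then obtain k where k: "p * (p - 1) = 2 * k" by (rule evenE)
  have "real p * (real p - 1) = real (p * (p - 1))" using assms(1) by (simp add: of_nat_diff)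
  thus ?thesis unfolding k by simp
 qed
 have "(\<Sum>j<p. 4 ^ j :: real) = real (\<Sum>j<p. 4 ^ j)" by simp
 also have "\<dots> \<le> real ((p * p) * 2 ^ (p * (p - 1) div 2))" by (simp only: of_nat_le_iff geometric_width)
 also have "\<dots> = real p * real p * 2 powr (real p * (real p - 1) / 2)"
  unfolding e[symmetric] by (simp add: powr_realpow)
 also have "2 powr (real p * (real p - 1) / 2) = 2 powr (real p * (real p - 1) / 4) * 2 powr (real p * (real p - 1) / 4)"
  unfolding powr_add[symmetric] by simp
 finally have "(\<Sum>j<p. 4 ^ j :: real) \<le> (lwidth p)\<^sup>2" unfolding lwidth_def power2_eq_square by (simp only: mult_ac)
 thus "sqrt (\<Sum>j<p. 4 ^ j) \<le> lwidth p" by (intro real_le_lsqrt) (simp_all add: lwidth_def)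
 have "2 powr 0 \<le> 2 powr (real p * (real p - 1) / 4)" using assms(1) by (intro powr_mono) auto
 hence "1 * 1 \<le> real p * 2 powr (real p * (real p - 1) / 4)" using assms(1) by (intro mult_mono) auto
 thus "1 \<le> lwidth p" by (simp add: lwidth_def)
qed

context
 fixes n p :: nat and H Q R W :: "rmat" and b c :: "rat list" and e :: rat and \<epsilon> :: real
 assumes symH: "symm n (mx H)" and symQ: "symm n (mx Q)"
  and posQ: "\<And>z. \<exists>i<n. z i \<noteq> 0 ==> 0 < bil n (rm Q) z z"
  and R: "R = minv n Q (gso n Q (units n n))"
  and pn: "p \<le> n" and W: "linv n p R W" "reduced n p R W"
  and e: "0 < e" "of_rat e \<le> \<epsilon>" "\<epsilon> \<le> 1" "\<epsilon> \<le> 9 / 8 * of_rat e"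
begin

abbreviation "NQ \<equiv> nm n (rm Q)"
abbreviation "obj \<equiv> qf n (rm H) (rx b)"

definition ball :: "(nat => real) set" where "ball = {u. NQ u \<le> 1}"
text \<open>Points are described relative to the centre \<open>c\<close>, so the integrality
  conditions are shifted by it.\<close>

definition feas :: "(nat => real) set" where "feas = {u \<in> ball. \<forall>i<p. u i + rx c i \<in> \<int>}"

lemma sQ: "symm n (rm Q)" by (rule symm_rm[OF symQ])
lemma sH: "symm n (rm H)" by (rule symm_rm[OF symH])
lemma pQ: "0 \<le> bil n (rm Q) x x" by (rule psdQ[OF symQ symQ posQ R])

lemma obj_bounded: "\<exists>B. \<forall>u\<in>ball. \<bar>obj u\<bar> \<le> B"
proof -
 define A where "A = (\<Sum>i<n. \<Sum>j<n. \<bar>rm H i j\<bar>) * (1 + (\<Sum>i<n. rm R i i))"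
 define B where "B = (\<Sum>i<n. \<bar>rx b i\<bar>) * (1 + (\<Sum>i<n. rm R i i))"
 have tr: "0 \<le> 1 + (\<Sum>i<n. rm R i i)"
  using R_diag_nonneg[OF symH symQ posQ R] by (intro add_nonneg_nonneg sum_nonneg) auto
 have AB: "0 \<le> A" "0 \<le> B" unfolding A_def B_def using tr by (intro mult_nonneg_nonneg sum_nonneg; simp)+
 have "\<bar>obj u\<bar> \<le> A * (1 * 1) + B * 1" if "u \<in> ball" for u
 proof -
  have u: "NQ u \<le> 1" "0 \<le> NQ u" using that nm_nonneg[OF sQ pQ] by (auto simp: ball_def)
  have "\<bar>bil n (rm H) u u\<bar> \<le> A * (NQ u * NQ u)" unfolding A_def by (rule H_bound[OF symH symQ posQ R])
  also have "\<dots> \<le> A * (1 * 1)" using u AB by (intro mult_left_mono mult_mono) auto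
  finally have 1: "\<bar>bil n (rm H) u u\<bar> \<le> A * (1 * 1)" .
  have "\<bar>dt n (rx b) u\<bar> \<le> B * NQ u" unfolding B_def by (rule b_bound[OF symH symQ posQ R])
  also have "\<dots> \<le> B * 1" using u AB by (intro mult_left_mono) auto
  finally show ?thesis using 1 unfolding qf_def by linarith
 qed
 thus ?thesis by blast
qed

lemma obj_bdd: "bdd_above (obj ` ball)" "bdd_below (obj ` ball)"
proof -
 obtain B where B: "\<forall>u\<in>ball. \<bar>obj u\<bar> \<le> B" using obj_bounded by (elim exE)
 show "bdd_above (obj ` ball)" by (rule bdd_aboveI2[where M = B]) (use B in \<open>auto simp: abs_le_iff\<close>)
 show "bdd_below (obj ` ball)" by (rule bdd_belowI2[where m = "- B"]) (use B in \<open>auto simp: abs_le_iff\<close>)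
qed

definition objrange :: real where "objrange = (SUP u\<in>ball. obj u) - (INF u\<in>ball. obj u)"

abbreviation "dn \<equiv> mden (Suc n) (b # H)"
abbreviation "qt \<equiv> 1 + (\<Sum>i<n. mx Q i i)"

lemma clear_H: "i < n ==> j < n ==> of_int dn * mx H i j \<in> \<int>"
 using mden_Ints[of "Suc i" "Suc n" j "b # H"] by (simp add: mx_def elt_Cons)

lemma clear_b: "i < n ==> of_int dn * vx b i \<in> \<int>"
 using mden_Ints[of 0 "Suc n" i "b # H"] by (simp add: mx_def elt_Cons)

definition unitv :: "nat => nat => real" where "unitv i j = (if i = j then 1 else 0)"

lemma bil_unitv: "i < n ==> j < n ==> bil n A (unitv i) (unitv j) = A i j"
proof -
 assume ij: "i < n" "j < n"
 have "bil n A (unitv i) (unitv j) = (\<Sum>k\<in>{i}. \<Sum>l\<in>{j}. unitv i k * A k l * unitv j l)"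
  unfolding bil_def using ij
  by (intro sum.mono_neutral_cong_right) (auto simp: unitv_def intro!: sum.mono_neutral_cong_right)
 thus ?thesis by (simp add: unitv_def)
qed

lemma dt_unitv: "i < n ==> dt n a (unitv i) = a i"
 unfolding dt_def by (subst sum.mono_neutral_right[of _ "{i}"]) (auto simp: unitv_def)

lemma diag_Q: "i < n ==> 0 \<le> rm Q i i"
 using pQ[of "unitv i"] by (simp add: bil_unitv)

lemma q_ge: "1 \<le> (of_rat qt :: real)" "i < n ==> rm Q i i \<le> of_rat qt"
proof -
 have qt: "(of_rat qt :: real) = 1 + (\<Sum>i<n. rm Q i i)" by (simp add: of_rat_add of_rat_sum rm_def)
 have "0 \<le> (\<Sum>i<n. rm Q i i)" by (rule sum_nonneg) (simp add: diag_Q)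
 thus "1 \<le> (of_rat qt :: real)" by (simp add: qt)
 show "rm Q i i \<le> of_rat qt" if "i < n"
  using member_le_sum[of i "{..<n}" "%i. rm Q i i"] that diag_Q by (simp add: qt)
qed

lemma NQ_unitv: assumes "i < n" shows "NQ (unitv i) \<le> sqrt (of_rat qt)"
 unfolding nm_def[OF sQ pQ] bil_unitv[OF assms assms] by (rule real_sqrt_le_mono, rule q_ge(2)[OF assms])

lemma ball_range: "u \<in> ball ==> (INF u\<in>ball. obj u) \<le> obj u \<and> obj u \<le> (SUP u\<in>ball. obj u)"
 by (intro conjI cINF_lower cSUP_upper obj_bdd)

lemma zero_ball: "(%_. 0) \<in> ball"
 by (simp add: ball_def nm_le_1[OF sQ pQ] bil_def)

lemma D_nonneg: "0 \<le> objrange"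
 using ball_range[OF zero_ball] by (simp add: objrange_def)

text \<open>\<open>bil_le\<close> and \<open>dt_le\<close> at unit vectors, whose squared norms are
  diagonal entries of \<open>Q\<close> and thus at most \<open>qt\<close>.\<close>

lemma coeff_le:
 assumes i: "i < n" and j: "j < n"
 shows "\<bar>rm H i j\<bar> \<le> objrange * of_rat qt" "\<bar>rx b i\<bar> \<le> objrange * of_rat qt"
proof -
 have mM: "(INF u\<in>ball. obj u) \<le> obj u \<and> obj u \<le> (SUP u\<in>ball. obj u)" if "NQ u \<le> 1" for u
  by (rule ball_range) (simp add: ball_def that)
 have qq: "sqrt (of_rat qt) * sqrt (of_rat qt) = of_rat qt" by (rule real_sqrt_mult_self[THEN trans, OF abs_of_nonneg]) (use q_ge(1) in linarith)
 have "\<bar>rm H i j\<bar> \<le> objrange * (NQ (unitv i) * NQ (unitv j))"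
  using bil_le[OF sQ posQ sH mM, of "unitv i" "unitv j"] i j by (simp add: bil_unitv objrange_def)
 also have "\<dots> \<le> objrange * (sqrt (of_rat qt) * sqrt (of_rat qt))"
  by (intro mult_left_mono mult_mono NQ_unitv i j D_nonneg nm_nonneg[OF sQ pQ] real_sqrt_ge_zero) (use q_ge(1) in linarith)
 finally show "\<bar>rm H i j\<bar> \<le> objrange * of_rat qt" unfolding qq .
 have "\<bar>rx b i\<bar> \<le> objrange / 2 * NQ (unitv i)"
  using dt_le[OF sQ posQ sH mM, of "unitv i"] i by (simp add: dt_unitv objrange_def)
 also have "\<dots> \<le> objrange * of_rat qt"
 proof (rule mult_mono)
  define r :: real where "r = sqrt (of_rat qt)"
  have "1 \<le> r" unfolding r_def using q_ge(1) by (rule real_sqrt_ge_one)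
  hence "r * 1 \<le> r * r" by (intro mult_left_mono) auto
  thus "NQ (unitv i) \<le> of_rat qt" using NQ_unitv[OF i] qq unfolding r_def[symmetric] by linarith
 qed (use D_nonneg nm_nonneg[OF sQ pQ] in auto)
 finally show "\<bar>rx b i\<bar> \<le> objrange * of_rat qt" .
qed

lemma int_ge_1:
 assumes r: "of_int k * r \<in> \<int>" "r \<noteq> 0" and k: "0 < k"
 shows "1 \<le> of_int k * \<bar>of_rat r :: real\<bar>"
proof -
 obtain a where a: "of_int k * r = of_int a" using r(1) by (rule Ints_cases)
 have "a \<noteq> 0" using a r(2) k by auto
 hence "(1::rat) \<le> \<bar>of_int a\<bar>" by (simp add: of_int_abs[symmetric] del: of_int_abs)
 also have "\<bar>of_int a\<bar> = of_int k * \<bar>r\<bar>" unfolding a[symmetric] abs_mult using k by simp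
 finally have "(of_rat 1 :: real) \<le> of_rat (of_int k * \<bar>r\<bar>)" by (simp only: of_rat_less_eq)
 thus ?thesis by (simp add: of_rat_mult)
qed

text \<open>For a smaller range, \<open>coeff_le\<close> would put every coefficient below
  \<open>1 / dn\<close> in absolute value. It would then be zero, as \<open>dn\<close> clears its
  denominator, and the objective constant. Hence an absolute tolerance of polynomial size can stand
  for a relative one.\<close>

lemma D_lower: assumes "0 < objrange" shows "1 \<le> of_int dn * (objrange * of_rat qt)"
proof (rule ccontr)
 assume small: "\<not> ?thesis"
 have dn: "0 < dn" by (rule mden_pos)
 have mul: "of_int dn * x \<le> of_int dn * (objrange * of_rat qt)" if "x \<le> objrange * of_rat qt" for x :: real
  using that dn by (intro mult_left_mono) auto
 have H0: "rm H i j = 0" if "i < n" "j < n" for i j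
 proof (rule ccontr)
  assume "rm H i j \<noteq> 0"
  hence "1 \<le> of_int dn * \<bar>rm H i j\<bar>" unfolding rm_def using that by (intro int_ge_1 clear_H dn) auto
  also have "\<dots> \<le> of_int dn * (objrange * of_rat qt)" by (rule mul[OF coeff_le(1)[OF that]])
  finally show False using small by simp
 qed
 have b0: "rx b i = 0" if "i < n" for i
 proof (rule ccontr)
  assume "rx b i \<noteq> 0"
  hence "1 \<le> of_int dn * \<bar>rx b i\<bar>" unfolding rx_def using that by (intro int_ge_1 clear_b dn) auto
  also have "\<dots> \<le> of_int dn * (objrange * of_rat qt)" by (rule mul[OF coeff_le(2)[OF that that]])
  finally show False using small by simp
 qed
 have "obj u = 0" for u by (simp add: qf_def bil_def dt_def H0 b0)
 hence "obj ` ball = {0}" using zero_ball by auto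
 hence "(SUP u\<in>ball. obj u) = 0" "(INF u\<in>ball. obj u) = 0" by simp_all
 thus False using assms by (simp add: objrange_def)
qed

definition tr :: real where "tr = of_rat e / 16"

lemma tr: "0 < tr" "16 * tr \<le> \<epsilon>" "16 * tr \<le> 1"
proof -
 have "0 < (of_rat e :: real)" using e(1) by simp
 thus "0 < tr" "16 * tr \<le> \<epsilon>" "16 * tr \<le> 1" unfolding tr_def using e(2,3) by linarith+
qed

abbreviation "gv \<equiv> gso n R W"
abbreviation "gr \<equiv> gmat n p R gv"

text \<open>Shrinking by \<open>tr\<close> makes room for a rounding error of \<open>tr\<close>, so
  the rounded point stays in the ball, and the two displacements add up to \<open>2 * tr\<close>.
  The lemma serves for the approximate minimiser and, to show that the feasible points form a net,
  for every point of the ball.\<close>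

lemma near:
 assumes t: "256 * tau n p R gv \<le> e * e" and y: "y \<in> ball"
  and z: "\<And>l. l < n ==> z l = rx c l + (1 - tr) * y l"
  and x: "\<And>l. l < n ==> x l = rnd n (rm W) (rm gr) z p l"
 defines "v \<equiv> %l. x l - rx c l"
 shows "v \<in> feas" "NQ (%l. v l - y l) \<le> 2 * tr"
proof -
 have y1: "NQ y \<le> 1" using y by (simp add: ball_def)
 have y0: "0 \<le> NQ y" by (rule nm_nonneg[OF sQ pQ])
 have "(of_rat (256 * tau n p R gv) :: real) \<le> of_rat (e * e)" using t by (simp only: of_rat_less_eq)
 hence tau: "of_rat (tau n p R gv) \<le> tr\<^sup>2" by (simp add: tr_def of_rat_mult power2_eq_square)
 define d where "d = (%l. rnd n (rm W) (rm gr) z p l - z l)"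
 have "bil n (rm Q) d d \<le> of_rat (tau n p R gv)" unfolding d_def by (rule rnd_spec(2)[OF symQ posQ R pn W(1)])
 hence dn: "NQ d \<le> tr" unfolding nm_def[OF sQ pQ] using tau tr by (intro real_le_lsqrt) auto
 have sc: "NQ (%l. k * y l) \<le> \<bar>k\<bar>" for k
 proof -
  have "\<bar>k\<bar> * NQ y \<le> \<bar>k\<bar> * 1" by (intro mult_left_mono y1) simp
  thus ?thesis unfolding nm_scale[OF sQ pQ] by simp
 qed
 have "NQ v = NQ (%l. d l + (1 - tr) * y l)"
  by (rule nm_cong[OF sQ pQ]) (simp add: v_def d_def x z)
 also have "\<dots> \<le> NQ d + NQ (%l. (1 - tr) * y l)" by (rule nm_add[OF sQ pQ])
 also have "\<dots> \<le> tr + (1 - tr)" using dn sc[of "1 - tr"] tr by linarith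
 finally have vb: "v \<in> ball" by (simp add: ball_def)
 have "v i + rx c i \<in> \<int>" if "i < p" for i
 proof -
  have "rnd n (rm W) (rm gr) z p i \<in> \<int>" by (rule rnd_spec(1)[OF symQ posQ R pn W(1) that])
  thus ?thesis using x[of i] that pn by (simp add: v_def)
 qed
 with vb show "v \<in> feas" by (simp add: feas_def)
 have "NQ (%l. v l - y l) = NQ (%l. d l + (- tr) * y l)"
  by (rule nm_cong[OF sQ pQ]) (simp add: v_def d_def x z algebra_simps)
 also have "\<dots> \<le> NQ d + NQ (%l. (- tr) * y l)" by (rule nm_add[OF sQ pQ])
 also have "\<dots> \<le> tr + tr" using dn sc[of "- tr"] tr by linarith
 finally show "NQ (%l. v l - y l) \<le> 2 * tr" by simp
qed

lemma solve_point:
 assumes t: "256 * tau n p R gv \<le> e * e"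
 defines "x \<equiv> rlist n W gr p (shrink n c e (trs n H b Q R (tol n H b Q e)))"
 defines "v \<equiv> %l. rx x l - rx c l"
 shows "length x = n" "v \<in> feas"
  "obj v - (INF u\<in>feas. obj u) \<le> \<epsilon> * ((SUP u\<in>feas. obj u) - (INF u\<in>feas. obj u))"
proof -
 define w where "w = rx (trs n H b Q R (tol n H b Q e))"
 define z where "z = rx (shrink n c e (trs n H b Q R (tol n H b Q e)))"
 show "length x = n" unfolding x_def by (rule length_rlist) (simp add: shrink_def)
 have mpos: "0 < dn" by (rule mden_pos)
 have q1: "1 \<le> qt"
 proof -
  have "(of_rat 1 :: real) \<le> of_rat qt" using q_ge(1) by simp
  thus ?thesis by (simp only: of_rat_less_eq)
 qed
 have tol0: "0 < tol n H b Q e" unfolding tol_def using e mpos q1 by (intro divide_pos_pos mult_pos_pos) auto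
 have "of_rat (tol n H b Q e) = tr / (of_int dn * of_rat qt)"
  by (simp add: tol_def tr_def of_rat_divide of_rat_mult)
 hence tolD: "of_rat (tol n H b Q e) \<le> objrange * tr" if "0 < objrange"
 proof -
  assume tl: "of_rat (tol n H b Q e) = tr / (of_int dn * of_rat qt)"
  have mq: "0 < of_int dn * (of_rat qt :: real)" using mpos q_ge(1) by (intro mult_pos_pos) auto
  have "1 * tr \<le> (of_int dn * (objrange * of_rat qt)) * tr" using D_lower[OF that] tr by (intro mult_right_mono) auto
  hence "tr \<le> (objrange * tr) * (of_int dn * of_rat qt)" by (simp only: mult_1_left mult_ac)
  thus ?thesis unfolding tl using mq by (simp only: pos_divide_le_eq)
 qed
 note ts = trs_spec[OF symH symQ posQ R tol0, where b = b, folded w_def]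
 have wb: "w \<in> ball" using ts(1) by (simp add: ball_def)
 have zl: "z l = rx c l + (1 - tr) * w l" if "l < n" for l
  using that by (simp add: z_def shrink_def rx_def w_def tr_def of_rat_add of_rat_mult of_rat_diff of_rat_divide)
 have xl: "rx x l = rnd n (rm W) (rm gr) z p l" if "l < n" for l
  unfolding x_def z_def by (rule rx_rlist[OF that])
 have nr: "v \<in> feas" "NQ (%l. v l - w l) \<le> 2 * tr"
 proof -
  show "v \<in> feas" unfolding v_def by (rule near(1)[OF t wb zl xl])
  show "NQ (%l. v l - w l) \<le> 2 * tr" unfolding v_def by (rule near(2)[OF t wb zl xl])
 qed
 show "v \<in> feas" by (rule nr(1))
 show "obj v - (INF u\<in>feas. obj u) \<le> \<epsilon> * ((SUP u\<in>feas. obj u) - (INF u\<in>feas. obj u))"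
 proof (rule approx_on_net[OF sQ posQ sH, folded ball_def, OF _ obj_bdd _ _ tr(2,3) _ nr(1) wb nr(2)])
  show "\<exists>i<n. z i \<noteq> 0" if "\<exists>i<n. z i \<noteq> 0" for z :: "nat => real" by (rule that)
  show "feas \<subseteq> ball" by (auto simp: feas_def)
  show "0 \<le> tr" using tr(1) by simp
  show "\<exists>v\<in>feas. NQ (%i. v i - y i) \<le> 2 * tr" if "y \<in> ball" for y
   by (rule bexI) (rule near(2)[OF t that refl refl], rule near(1)[OF t that refl refl])
  show "obj w \<le> obj u + of_rat (tol n H b Q e)" if "u \<in> ball" for u
   using that ts(2) by (simp add: ball_def)
  show "of_rat (tol n H b Q e) \<le> ((SUP u\<in>ball. obj u) - (INF u\<in>ball. obj u)) * tr"
   if "0 < (SUP u\<in>ball. obj u) - (INF u\<in>ball. obj u)"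
   using tolD that by (simp add: objrange_def)
 qed
qed

lemma solve_direction:
 assumes t: "\<not> 256 * tau n p R gv \<le> e * e"
 defines "\<rho> \<equiv> dt n (mx W 0) (vx c) - usqrt (bil n (mx R) (mx W 0) (mx W 0))"
 shows "0 < p" "\<exists>i<n. mx W 0 i \<noteq> 0"
  "NQ (%l. x l - rx c l) \<le> 1 ==> of_rat \<rho> \<le> dt n (rm W 0) x \<and>
   dt n (rm W 0) x \<le> of_rat \<rho> + 19 * lwidth p / \<epsilon>"
proof -
 \<comment> \<open>Without integer variables \<open>tau\<close> is an empty sum, and the rounding
   branch is always taken.\<close>
 show p: "0 < p"
 proof (rule ccontr)
  assume "\<not> 0 < p"
  thus False using t e by (simp add: tau_def)
 qed
 define q0 where "q0 = bil n (mx R) (mx W 0) (mx W 0)"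
 have symR: "symm n (mx R)" unfolding R by (rule symm_minv)
 have qp: "0 < gq n (mx R) (mx W) k" if "k < p" for k by (rule qs_pos[OF symQ posQ R pn W(1) that])
 have gs0: "gs n (mx R) (mx W) 0 = mx W 0" by (subst gs.simps) simp
 have q0: "gq n (mx R) (mx W) 0 = q0" by (simp add: gq_def gs0 q0_def)
 have q0p: "0 < q0" using qp[OF p] q0 by simp
 show "\<exists>i<n. mx W 0 i \<noteq> 0"
 proof (rule ccontr)
  assume "\<not> ?thesis"
  hence "q0 = 0" by (simp add: q0_def bil_def)
  thus False using q0p by simp
 qed
 have red: "\<forall>i. Suc i < p --> gq n (mx R) (mx W) i \<le> 4 * gq n (mx R) (mx W) (Suc i)"
  using W(2) by (simp add: reduced_def[OF pn symR pos_R_rat[OF symQ posQ R]])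
 have grow: "q0 \<le> 4 ^ j * gq n (mx R) (mx W) j" if "j < p" for j
  using that
 proof (induction j)
  case (Suc j)
  have "gq n (mx R) (mx W) j \<le> 4 * gq n (mx R) (mx W) (Suc j)"
   using red Suc.prems by blast
  hence "4 ^ j * gq n (mx R) (mx W) j \<le> 4 ^ j * (4 * gq n (mx R) (mx W) (Suc j))" by (rule mult_left_mono) simp
  moreover have "q0 \<le> 4 ^ j * gq n (mx R) (mx W) j" using Suc by simp
  ultimately have "q0 \<le> 4 ^ j * (4 * gq n (mx R) (mx W) (Suc j))" by linarith
  thus ?case by (simp only: power_Suc2 mult.assoc)
 qed (simp add: q0)
 have "tau n p R gv = (\<Sum>j<p. 1 / (4 * gq n (mx R) (mx W) j))"
  unfolding tau_def by (rule sum.cong) (simp_all add: bil_vs(2)[OF symQ posQ R pn W(1)])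
 also have "\<dots> \<le> (\<Sum>j<p. 4 ^ j / (4 * q0))"
 proof (rule sum_mono)
  fix j assume "j \<in> {..<p}"
  hence g: "q0 \<le> 4 ^ j * gq n (mx R) (mx W) j" "0 < gq n (mx R) (mx W) j" using grow qp by auto
  show "1 / (4 * gq n (mx R) (mx W) j) \<le> 4 ^ j / (4 * q0)"
   using g q0p by (simp add: divide_simps mult_ac)
 qed
 also have "\<dots> = (\<Sum>j<p. 4 ^ j) / (4 * q0)" by (simp only: sum_divide_distrib)
 finally have "e * e < 256 * ((\<Sum>j<p. 4 ^ j) / (4 * q0))" using t by simp
 \<comment> \<open>The 64 is 256 divided by the 4 in \<open>tau\<close>; its root is the 8 in the
   bound for \<open>r * e\<close> below.\<close>
 hence "e * e * q0 < 64 * (\<Sum>j<p. 4 ^ j)" using q0p by (simp add: field_simps)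
 hence "(of_rat (e * e * q0) :: real) < of_rat (64 * (\<Sum>j<p. 4 ^ j))" by (simp only: of_rat_less)
 hence E: "of_rat q0 * (of_rat e)\<^sup>2 \<le> 8\<^sup>2 * (\<Sum>j<p. 4 ^ j :: real)"
  by (simp add: of_rat_mult of_rat_sum of_rat_power power2_eq_square mult_ac)
 define r where "r = sqrt (of_rat q0 :: real)"
 define K where "K = lwidth p"
 note K = sqrt_geometric_width[OF p, folded K_def]
 have er: "0 < (of_rat e :: real)" using e by simp
 have "r * of_rat e \<le> 8 * sqrt (\<Sum>j<p. 4 ^ j)"
  using real_sqrt_le_mono[OF E] er by (simp add: real_sqrt_mult r_def)
 also have "\<dots> \<le> 8 * K" using K by simp
 finally have rK: "r * of_rat e \<le> 8 * K" .
 have eps: "0 < \<epsilon>" using er e by linarith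
 have width: "2 * r + 1 \<le> 19 * K / \<epsilon>"
 proof -
  have r0: "0 \<le> r" using q0p by (simp add: r_def)
  have "r * \<epsilon> \<le> r * (9 / 8 * of_rat e)" using e(4) r0 by (rule mult_left_mono)
  hence "r * \<epsilon> \<le> 9 * K" using rK by simp
  moreover have "1 * \<epsilon> \<le> K" using K(2) e(3) by simp
  ultimately have "(2 * r + 1) * \<epsilon> \<le> 19 * K" by (simp add: distrib_right)
  thus ?thesis using eps by (simp only: pos_le_divide_eq)
 qed
 assume x: "NQ (%l. x l - rx c l) \<le> 1"
 have bR: "bil n (rm R) (rm W 0) (rm W 0) = of_rat q0" unfolding rm_def q0_def by (rule bil_of_rat)
 have "\<bar>dt n (%l. x l - rx c l) (rm W 0)\<bar> \<le> NQ (%l. x l - rx c l) * sqrt (bil n (rm R) (rm W 0) (rm W 0))"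
  by (rule dt_bound[OF symQ posQ R])
 also have "\<dots> \<le> 1 * r" unfolding bR r_def[symmetric] using x q0p by (intro mult_right_mono) (auto simp: r_def)
 finally have dev: "\<bar>dt n (rm W 0) x - dt n (rm W 0) (rx c)\<bar> \<le> r"
  unfolding dt_commute[of n "%l. x l - rx c l"] dt_diff by simp
 have "dt n (rm W 0) (rx c) = of_rat (dt n (mx W 0) (vx c))" unfolding rm_def rx_def by (rule dt_of_rat)
 hence rho: "of_rat \<rho> = dt n (rm W 0) (rx c) - of_rat (usqrt q0)"
  by (simp add: \<rho>_def of_rat_diff q0_def)
 show "of_rat \<rho> \<le> dt n (rm W 0) x \<and>
   dt n (rm W 0) x \<le> of_rat \<rho> + 19 * lwidth p / \<epsilon>"
 proof
  show "of_rat \<rho> \<le> dt n (rm W 0) x"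
   using dev usqrt_spec(1)[OF q0p] unfolding rho r_def[symmetric] by linarith
  have "dt n (rm W 0) x \<le> of_rat \<rho> + (2 * r + 1)"
   using dev usqrt_spec(2)[OF q0p] unfolding rho r_def[symmetric] by linarith
  thus "dt n (rm W 0) x \<le> of_rat \<rho> + 19 * lwidth p / \<epsilon>"
   using width unfolding K_def by linarith
 qed
qed

end

subsection \<open>The algorithm takes polynomial time\<close>

lemma FP_gmat:
 assumes "FP S n" "FP S p" "FP S R" "FP S vs"
 shows "FP S (%x. gmat (n x) (p x) (R x) (vs x))"
proof -
 have 1: "FP S' (%x. bil (n x) (mx (A x)) (mx (vs x) (k x)) (mx (vs x) (k x)))"
  if "FP S' n" "FP S' A" "FP S' vs" "FP S' k" for S' :: "'z::enc set" and n A vs k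
  by (intro FP_bil_mx FP_row that)
 show ?thesis unfolding gmat_def
  by (intro FP_tabI FP_rat_divide FP_sum FP_rat_mult 1 FP_mx assms assms(1,2,3,4)[THEN FP_compose]
   FP_fst FP_snd FP_id; auto)
qed

lemma FP_tau:
 assumes "FP S n" "FP S p" "FP S R" "FP S vs"
 shows "FP S (%x. tau (n x) (p x) (R x) (vs x))"
proof -
 have 1: "FP S' (%x. bil (n x) (mx (A x)) (mx (vs x) (k x)) (mx (vs x) (k x)))"
  if "FP S' n" "FP S' A" "FP S' vs" "FP S' k" for S' :: "'z::enc set" and n A vs k
  by (intro FP_bil_mx FP_row that)
 show ?thesis unfolding tau_def
  by (intro FP_sum FP_rat_divide FP_rat_mult 1 FP_const assms assms(1,2,3,4)[THEN FP_compose]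
   FP_fst FP_snd FP_id; auto)
qed

lemma FP_bvec:
 assumes "FP S n" "FP S H" "FP S h" "FP S c"
 shows "FP S (%x. bvec (n x) (H x) (h x) (c x))"
 unfolding bvec_def
 by (intro FP_tabI FP_rat_add FP_rat_mult FP_const FP_sum FP_mx FP_elt assms assms(1,2,3,4)[THEN FP_compose]
   FP_fst FP_snd FP_id; auto)

lemma FP_tol:
 assumes "FP S n" "FP S H" "FP S b" "FP S Q" "FP S e"
 shows "FP S (%x. tol (n x) (H x) (b x) (Q x) (e x))"
 unfolding tol_def
 by (intro FP_rat_divide FP_rat_mult FP_rat_add FP_of_int FP_mden FP_Suc FP_Cons FP_const FP_sum FP_mx assms FP_compose[OF assms(4)]
   FP_fst FP_snd FP_id; auto)

lemma FP_shrink: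
 assumes "FP S n" "FP S c" "FP S e" "FP S w"
 shows "FP S (%x. shrink (n x) (c x) (e x) (w x))"
 unfolding shrink_def
 by (intro FP_tabI FP_rat_add FP_rat_mult FP_rat_diff FP_rat_divide FP_const FP_elt assms assms(2,3,4)[THEN FP_compose]
   FP_fst FP_snd FP_id; auto)

lemma FP_usqrt: assumes q: "FP S q" shows "FP S (%x. usqrt (q x))"
 unfolding usqrt_def
 by (intro FP_snd FP_bisect FP_rat_le FP_rat_mult FP_rat_add FP_nbits FP_const FP_compose[OF q] q FP_fst FP_snd FP_id; auto)

lemma FP_interleave: assumes l: "FP S l" shows "FP S (%x. interleave (l x))"
 unfolding interleave_def
proof (rule FP_foldl[where T = "S \<times> UNIV"])
 show "FP (S \<times> UNIV) (%z. fst (snd z) @ [nu (snd (snd z)), de (snd (snd z))])"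
  by (intro FP_append FP_Cons FP_nu FP_de FP_Nil FP_fst FP_snd FP_id)
 show "FP S (%x. [])" by (rule FP_Nil)
 show "FP S l" by (rule l)
 show "PB S (%x. 1 + 2 * sz (l x) * (1 + sz (l x)))" by (intro PB_add PB_mult PB_const FP_sz[OF l])
 fix x i assume x: "x \<in> S"
 show "(x, foldl (%acc r. acc @ [nu r, de r]) [] (take i (l x)), l x ! i) \<in> S \<times> UNIV" using x by simp
 have "sz (interleave k) \<le> 1 + 2 * length k * (1 + sz (l x))" if "\<forall>r\<in>set k. sz r \<le> sz (l x)" for k
  using that
 proof (induction k rule: rev_induct)
  case Nil
  thus ?case by (simp add: interleave_def sz_Nil)
 next
  case (snoc r k)
  have "sz (nu r) \<le> sz (l x)" "sz (de r) \<le> sz (l x)" using snoc.prems by (auto simp: sz_rat sz_int)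
  thus ?case using snoc sz_append[of "interleave k" "[nu r, de r]"]
   by (simp add: interleave_snoc sz_Cons sz_Nil)
 qed
 moreover have "\<forall>r\<in>set (take i (l x)). sz r \<le> sz (l x)" using sz_mem[of _ "l x"] in_set_takeD by metis
 ultimately have "sz (interleave (take i (l x))) \<le> 1 + 2 * length (take i (l x)) * (1 + sz (l x))" by blast
 also have "\<dots> \<le> 1 + 2 * sz (l x) * (1 + sz (l x))"
 proof -
  have "length (take i (l x)) \<le> sz (l x)" using length_le_sz[of "l x"] by simp
  hence "2 * length (take i (l x)) * (1 + sz (l x)) \<le> 2 * sz (l x) * (1 + sz (l x))" by (intro mult_le_mono) simp_all
  thus ?thesis by simp
 qed
 finally show "sz (foldl (%acc r. acc @ [nu r, de r]) [] (take i (l x))) \<le> 1 + 2 * sz (l x) * (1 + sz (l x))"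
  by (simp only: interleave_def)
qed

lemma FP_dirout:
 assumes "FP S n" "FP S w" "FP S r"
 shows "FP S (%x. dirout (n x) (w x) (r x))"
 unfolding dirout_def
 by (intro FP_Cons FP_append FP_tabI FP_floor FP_elt FP_nu FP_de FP_Nil FP_const assms FP_compose[OF assms(2)]
   FP_fst FP_snd FP_id; auto)

lemma FP_rstep:
 assumes "FP S n" "FP S W" "FP S G" "FP S x" "FP S k"
 shows "FP S (%z. rstep (n z) (W z) (G z) (x z) (k z))"
proof -
 have 1: "FP S' (%z. dt (n z) (mx (W z) (k z)) (vx (x z)))"
  if "FP S' n" "FP S' W" "FP S' k" "FP S' x" for S' :: "'z::enc set" and n W k x
  by (intro FP_dt FP_row FP_vec that)
 show ?thesis unfolding rstep_def
  by (intro FP_tabI FP_rat_add FP_rat_mult FP_rat_diff FP_of_int FP_round 1 FP_mx FP_elt assms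
   assms(1,2,3,4,5)[THEN FP_compose]
   FP_fst FP_snd FP_id; auto)
qed

lemma sz_vx: "sz (vx y l) \<le> sz y + 4"
proof -
 have "sz (0::rat) = 4" by (simp add: sz_rat nu_def de_def int_size_def floorlog_def)
 thus ?thesis using sz_elt[of "0::rat" y l] by simp
qed

text \<open>The rows are integral, so the product \<open>t\<close> has no other denominators than
  the current point. Hence step \<open>k\<close> multiplies the common denominator only by
  \<open>E k\<close>, that of the direction, and sizes add up; rounding changes an entry by at most
  the entry of the direction.\<close>

lemma rlist_size:
 assumes W: "\<And>k l. mx W k l \<in> \<int>" and "l < n" "k \<le> p"
 shows "sz (vx (rlist n W G k y) l) \<le> 2 * (n * (sz y + 4) + p * (n * (sz G + 5))) + (sz y + 4 + p + (sz G + 5)) + 5"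
proof -
 define E where "E j = (\<Prod>l<n. de (mx G j l))" for j
 define D where "D k = (\<Prod>l<n. de (vx y l)) * (\<Prod>j<k. E j)" for k
 have inv: "\<forall>l<n. of_int (D k) * vx (rlist n W G k y) l \<in> \<int> \<and> \<bar>vx (rlist n W G k y) l\<bar> \<le> 2 ^ (sz y + 4) + of_nat k * 2 ^ (sz G + 5)" for k
 proof (induction k)
  case 0
  have "\<bar>vx y l\<bar> \<le> 2 ^ (sz y + 4)" for l
   using abs_rat_le[of "vx y l"] power_increasing[OF sz_vx[of y l], of "2::rat"] by linarith
  thus ?case by (simp add: rlist_def D_def prod_de_clear del: of_int_prod)
 next
  case (Suc k)
  define x where "x = rlist n W G k y"
  have x: "rlist n W G (Suc k) y = rstep n W G x k" by (simp add: rlist_def x_def)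
  define t where "t = dt n (mx W k) (vx x)"
  show ?case
  proof (intro allI impI conjI)
   fix l assume l: "l < n"
   have xl: "vx (rlist n W G (Suc k) y) l = vx x l + (of_int (round t) - t) * mx G k l"
    using l by (simp add: x rstep_def t_def)
   have D: "D (Suc k) = D k * E k" by (simp add: D_def)
   have ix: "of_int (D k) * vx x i \<in> \<int>" if "i < n" for i using Suc.IH that by (simp add: x_def)
   have "of_int (D k) * t = (\<Sum>i<n. mx W k i * (of_int (D k) * vx x i))"
    unfolding t_def dt_def sum_distrib_left by (simp only: mult.left_commute)
   also have "\<dots> \<in> \<int>" by (intro Ints_sum Ints_mult W ix) simp
   finally have it: "of_int (D k) * t \<in> \<int>" .
   have ig: "of_int (E k) * mx G k l \<in> \<int>" unfolding E_def by (rule prod_de_clear[OF l])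
   have "of_int (D (Suc k)) * vx (rlist n W G (Suc k) y) l =
     of_int (E k) * (of_int (D k) * vx x l) + (of_int (D k) * of_int (round t) - of_int (D k) * t) * (of_int (E k) * mx G k l)"
    unfolding D xl of_int_mult by (simp add: algebra_simps)
   also have "\<dots> \<in> \<int>" by (intro Ints_add Ints_mult Ints_diff ix it ig l Ints_of_int)
   finally show "of_int (D (Suc k)) * vx (rlist n W G (Suc k) y) l \<in> \<int>" .
   have "\<bar>of_int (round t) - t\<bar> \<le> 1" using of_int_round_abs_le[of t] by linarith
   hence "\<bar>of_int (round t) - t\<bar> * \<bar>mx G k l\<bar> \<le> 1 * 2 ^ (sz G + 5)"
    using abs_mx_le[of G k l] by (intro mult_mono) auto
   moreover have "\<bar>vx x l\<bar> \<le> 2 ^ (sz y + 4) + of_nat k * 2 ^ (sz G + 5)" using Suc.IH l by (simp add: x_def)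
   moreover have "\<bar>vx x l + (of_int (round t) - t) * mx G k l\<bar> \<le> \<bar>vx x l\<bar> + \<bar>of_int (round t) - t\<bar> * \<bar>mx G k l\<bar>"
    using abs_triangle_ineq[of "vx x l" "(of_int (round t) - t) * mx G k l"] by (simp only: abs_mult)
   moreover have "of_nat (Suc k) * 2 ^ (sz G + 5) = of_nat k * 2 ^ (sz G + 5) + (2 ^ (sz G + 5) :: rat)"
    by (simp only: of_nat_Suc distrib_right mult_1_left add.commute)
   ultimately show "\<bar>vx (rlist n W G (Suc k) y) l\<bar> \<le> 2 ^ (sz y + 4) + of_nat (Suc k) * 2 ^ (sz G + 5)"
    unfolding xl by linarith
  qed
 qed
 have E: "0 < E j" "E j \<le> 2 ^ (n * (sz G + 5))" for j
  unfolding E_def using prod_de_le[of n "mx G j" "sz G + 5"] sz_mx by simp_all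
 have D0: "0 < D k" unfolding D_def by (intro mult_pos_pos prod_pos E de_pos)
 have "D k \<le> 2 ^ (n * (sz y + 4)) * 2 ^ (p * (n * (sz G + 5)))"
 proof -
  have "(\<Prod>j<k. E j) \<le> (\<Prod>j<k. 2 ^ (n * (sz G + 5)))" by (rule prod_mono) (use E in \<open>simp add: less_imp_le\<close>)
  also have "\<dots> = 2 ^ (k * (n * (sz G + 5)))" by (simp add: power_mult[symmetric] mult.commute)
  also have "\<dots> \<le> 2 ^ (p * (n * (sz G + 5)))" using assms by (intro power_increasing mult_le_mono1) auto
  finally have 1: "(\<Prod>j<k. E j) \<le> 2 ^ (p * (n * (sz G + 5)))" .
  have "0 \<le> (\<Prod>j<k. E j)" by (rule prod_nonneg) (use E in \<open>simp add: less_imp_le\<close>)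
  thus ?thesis unfolding D_def
   using prod_de_le[of n "vx y" "sz y + 4"] sz_vx 1 by (intro mult_mono) simp_all
 qed
 hence D1: "D k \<le> 2 ^ (n * (sz y + 4) + p * (n * (sz G + 5)))" by (simp only: power_add)
 have "of_nat k \<le> (2::rat) ^ p"
 proof -
  have "of_nat k \<le> (of_nat p :: rat)" using assms by simp
  also have "\<dots> \<le> 2 ^ p" by (rule of_nat_le_pow2)
  finally show ?thesis .
 qed
 hence k2: "of_nat k * 2 ^ (sz G + 5) \<le> (2::rat) ^ p * 2 ^ (sz G + 5)" by (rule mult_right_mono) simp
 have "\<bar>vx (rlist n W G k y) l\<bar> \<le> 2 ^ (sz y + 4) + 2 ^ (p + (sz G + 5))"
 proof -
  have "\<bar>vx (rlist n W G k y) l\<bar> \<le> 2 ^ (sz y + 4) + of_nat k * 2 ^ (sz G + 5)" using inv[of k] assms(2) by blast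
  thus ?thesis using k2 unfolding power_add[of 2 p] by linarith
 qed
 also have "\<dots> \<le> 2 ^ (sz y + 4 + p + (sz G + 5))"
 proof -
  have two: "(2::rat) \<le> 2 ^ (sz y + 4)" "(2::rat) \<le> 2 ^ (p + (sz G + 5))"
   using self_le_power[of "2::rat" "sz y + 4"] self_le_power[of "2::rat" "p + (sz G + 5)"] by simp_all
  have "x + y \<le> x * y" if "2 \<le> x" "2 \<le> y" for x y :: rat
  proof -
   have "1 * 1 \<le> (x - 1) * (y - 1)" using that by (intro mult_mono) auto
   thus ?thesis by (simp add: algebra_simps)
  qed
  from this[OF two] show ?thesis by (simp only: power_add[symmetric] add.assoc)
 qed
 finally have "\<bar>vx (rlist n W G k y) l\<bar> \<le> 2 ^ (sz y + 4 + p + (sz G + 5))" .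
 thus ?thesis using inv[of k] assms(2) by (intro sz_rat_le[OF D0 _ D1]) simp_all
qed

lemma FP_rlist:
 assumes n: "FP S n" and W: "FP S W" and G: "FP S G" and p: "FP S p" and y: "FP S y"
  and int: "\<And>x k l. x \<in> S ==> mx (W x) k l \<in> \<int>" and len: "\<And>x. x \<in> S ==> length (y x) = n x"
 shows "FP S (%x. rlist (n x) (W x) (G x) (p x) (y x))"
 unfolding rlist_def
proof (rule FP_foldl[where T = "S \<times> UNIV"])
 show "FP (S \<times> UNIV) (%z. rstep (n (fst z)) (W (fst z)) (G (fst z)) (fst (snd z)) (snd (snd z)))"
  by (intro FP_rstep FP_compose[OF n] FP_compose[OF W] FP_compose[OF G] FP_fst FP_snd FP_id; auto)
 show "FP S (%x. [0..<p x])" by (rule FP_upt[OF p])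
 show "FP S y" by (rule y)
 define s where "s x = 2 * (sz (n x) * (sz (y x) + 4) + sz (p x) * (sz (n x) * (sz (G x) + 5))) + (sz (y x) + 4 + sz (p x) + (sz (G x) + 5)) + 5" for x
 have "PB S s" unfolding s_def
  by (intro PB_add PB_mult PB_const FP_sz[OF n] FP_sz[OF p] FP_sz[OF G] FP_sz[OF y])
 thus "PB S (%x. 1 + sz (n x) * (1 + s x))" by (intro PB_add PB_mult PB_const FP_sz[OF n])
 fix x i assume x: "x \<in> S"
 show "(x, foldl (rstep (n x) (W x) (G x)) (y x) (take i [0..<p x]), [0..<p x] ! i) \<in> S \<times> UNIV" using x by simp
 assume "i \<le> length [0..<p x]"
 hence i: "i \<le> p x" by simp
 define r where "r = rlist (n x) (W x) (G x) i (y x)"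
 have r: "foldl (rstep (n x) (W x) (G x)) (y x) (take i [0..<p x]) = r" using i by (simp add: r_def rlist_def take_upt)
 have lr: "length r = n x" unfolding r_def by (rule length_rlist[OF len[OF x]])
 have "sz (vx r l) \<le> s x" if l: "l < n x" for l
 proof -
  have "sz (vx r l) \<le> 2 * (n x * (sz (y x) + 4) + p x * (n x * (sz (G x) + 5))) + (sz (y x) + 4 + p x + (sz (G x) + 5)) + 5"
   unfolding r_def by (rule rlist_size[OF int[OF x] l i])
  also have "\<dots> \<le> s x" unfolding s_def
   by (intro add_le_mono mult_le_mono le_refl) (simp_all add: sz_nat)
  finally show ?thesis .
 qed
 hence "sz a \<le> s x" if "a \<in> set r" for a
  using that lr unfolding in_set_conv_nth by (elim exE conjE) (simp add: elt_def, metis)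
 from sz_map_le[of r "%y. y", OF this]
 have "sz r \<le> 1 + n x * (1 + s x)" by (simp only: list.map_ident lr)
 also have "\<dots> \<le> 1 + sz (n x) * (1 + s x)" by (simp add: sz_nat)
 finally show "sz (foldl (rstep (n x) (W x) (G x)) (y x) (take i [0..<p x])) \<le> 1 + sz (n x) * (1 + s x)" unfolding r .
qed

lemma FP_solve3:
 assumes "FP S n" "FP S p" "FP S H" "FP S b" "FP S Q" "FP S R" "FP S c" "FP S e" "FP S W" "FP S vs"
  and "\<And>x. x \<in> S ==> symm (n x) (mx (H x))" "\<And>x. x \<in> S ==> symm (n x) (mx (Q x))"
  and "\<And>x k l. x \<in> S ==> mx (W x) k l \<in> \<int>"
 shows "FP S (%x. solve3 (n x) (p x) (H x) (b x) (Q x) (R x) (c x) (e x) (W x) (vs x))"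
 unfolding solve3_def
 by (intro FP_If FP_rat_le FP_rat_mult FP_tau FP_Cons FP_interleave FP_rlist FP_gmat FP_shrink FP_trs FP_tol
   FP_dirout FP_elt FP_rat_diff FP_dt FP_row FP_usqrt FP_bil_mx FP_const FP_lift FP_snd FP_id assms)
  (simp_all add: shrink_def)

lemma FP_solve:
 assumes fp: "FP S n" "FP S p" "FP S H" "FP S h" "FP S Q" "FP S c" "FP S e"
  and sym: "\<And>x. x \<in> S ==> symm (n x) (mx (H x))" "\<And>x. x \<in> S ==> symm (n x) (mx (Q x))"
  and pos: "\<And>x z. x \<in> S ==> \<exists>i<n x. z i \<noteq> 0 ==> 0 < bil (n x) (rm (Q x)) z z"
  and pn: "\<And>x. x \<in> S ==> p x \<le> n x"
 shows "FP S (%x. solve (n x) (p x) (H x) (h x) (Q x) (c x) (e x))"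
proof -
 define R where "R x = minv (n x) (Q x) (gso (n x) (Q x) (units (n x) (n x)))" for x
 have R: "FP S R" unfolding R_def
  by (intro FP_minv FP_gso FP_units fp sym) (auto simp: mx_units)
 define W where "W x = lll (n x) (p x) (R x)" for x
 have W: "FP S W" unfolding W_def by (rule FP_lll[OF fp(1,2,5) R sym(2) pos _ pn]) (simp_all add: R_def)
 have int: "mx (W x) k l \<in> \<int>" if x: "x \<in> S" for x k l
  using linvD(2)[OF pn[OF x] symR[OF sym(2)[OF x] sym(2)[OF x] pos[OF x] R_def] pos_R_rat[OF sym(2)[OF x] pos[OF x] R_def],
    OF _ _ _ lll_linv[OF sym(2)[OF x] pos[OF x] R_def pn[OF x], of "lfuel (n x) (p x) (R x)"]]
  unfolding W_def lll_def by simp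
 have sR: "symm (n x) (mx (R x))" for x unfolding R_def by (rule symm_minv)
 have vs: "FP S (%x. gso (n x) (R x) (W x))" by (rule FP_gso[OF fp(1) R W sR int])
 have b: "FP S (%x. bvec (n x) (H x) (h x) (c x))" by (intro FP_bvec fp)
 show ?thesis unfolding solve_def solve1_def solve2_def R_def[symmetric] W_def[symmetric]
  by (rule FP_solve3[OF fp(1-3) b fp(5) R fp(6,7) W vs sym int])
qed

section \<open>From the tape to the heap and back\<close>

primrec writes :: "com => nat set" where
 "writes Skip = {}"
| "writes (Write a e f) = {a}"
| "writes (Seq c d) = writes c \<union> writes d"
| "writes (Cond e c d) = writes c \<union> writes d"
| "writes (While e c) = writes c"

lemma run_writes: "run c m t m' ==> a \<notin> writes c ==> m' a = m a"
 by (induction rule: run.induct) auto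

lemma runs_writes: "runs c m t m' ==> a \<notin> writes c ==> m' a = m a"
 unfolding runs_def using run_writes by blast

lemma pointer_size: "0 \<le> p ==> p < int w ==> int_size p \<le> w"
 using int_size_pointer[of p "w - 1"] by (simp add: of_nat_diff)

lemma runs_setreg:
 assumes "small m w e" "int_size (int d) \<le> w"
 shows "runs (setreg d e) m ((len e + 4) * w) (m(6 := (m 6)(int d := eval m e)))"
 using runs_Write[of m w "Const (int d)" e 6] assms by (simp add: add.commute)

text \<open>The tape is copied from its last entry backwards, because lists grow at the front.
  Register 1 counts the entries left and register 0 points to the list.\<close>

definition load_loop :: com where
 "load_loop = While (reg 1) (Seq (setreg 1 (Minus (reg 1) (Const 1)))
   (Seq (alloc_int 2 (Read 0 (reg 1))) (alloc_pair 0 2 0)))"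

lemma load_loop:
 assumes entries: "\<forall>a\<in>set L. int_size a \<le> w"
 shows "k \<le> length L ==> m 6 1 = int k ==> (\<forall>j<length L. m 0 (int j) = L ! j) ==> rep m (enc (drop k L)) (m 6 0) ==>
  m 7 0 + 2 * int k + 10 < int w ==>
  \<exists>m'. runs load_loop m ((k + 1) * (300 * w)) m' \<and> rep m' (enc L) (m' 6 0) \<and> m' 7 0 = m 7 0 + 2 * int k"
proof (induction k arbitrary: m)
 case 0
 have w: "10 < w" using 0 rep_bounds[OF 0(4)] by simp
 have "eval_cost m (reg 1) \<le> 3 * w"
  using eval_cost_small[of m w "reg 1"] 0 w pointer_size[of 0 w] pointer_size[of 1 w] by simp
 hence "runs load_loop m (1 * (300 * w)) m"
  unfolding load_loop_def using w 0 by (intro runs_mono[OF runs_While_False]) auto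
 thus ?case using 0 by (intro exI[of _ m]) simp
next
 case (Suc k)
 have h0: "0 \<le> m 7 0" using rep_bounds[OF Suc.prems(4)] by simp
 have w: "10 < w" "int k + 10 < int w" using Suc.prems(5) h0 by auto
 have sm: "int_size p \<le> w" if "0 \<le> p" "p \<le> int k + 10" for p by (rule pointer_size) (use that w in auto)
 have cst: "int_size k' \<le> w" if "0 \<le> k'" "k' \<le> 7" for k' by (rule sm) (use that in auto)
 let ?m1 = "m(6 := (m 6)(int 1 := int k))"
 have r1: "runs (setreg 1 (Minus (reg 1) (Const 1))) m (10 * w) ?m1"
  using runs_setreg[of m w "Minus (reg 1) (Const 1)" 1] Suc.prems(2) sm[of 1] sm[of "int k"] sm[of "1 + int k"] by simp
 have "small ?m1 w (Read 0 (reg 1))"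
  using Suc.prems entries sm[of 1] sm[of "int k"] by simp
 from alloc_int[OF this cst, of 2] obtain m2 where m2: "runs (alloc_int 2 (Read 0 (reg 1))) ?m1 ((50 + len (Read 0 (reg 1))) * w) m2"
  "rep m2 (VInt (eval ?m1 (Read 0 (reg 1)))) (m2 6 (int 2))" "extends 2 ?m1 m2" "m2 7 0 = ?m1 7 0 + 1"
  "\<And>r. r \<noteq> 2 ==> m2 6 (int r) = ?m1 6 (int r)"
  using h0 Suc.prems(5) cst[of 2] by auto
 have e2: "rep m2 (enc (L ! k)) (m2 6 (int 2))" using m2(2) Suc.prems by (simp add: enc_int_def)
 have "rep ?m1 (enc (drop (Suc k) L)) (?m1 6 (int 0))" using Suc.prems(4) by (simp add: rep_setreg)
 hence d2: "rep m2 (enc (drop (Suc k) L)) (m2 6 (int 0))"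
  using rep_mono[OF m2(3)] m2(5)[of 0] by simp
 from alloc_pair[OF e2 d2 cst, of 0] obtain m3 where m3: "runs (alloc_pair 0 2 0) m2 (60 * w) m3"
  "rep m3 (VPair (enc (L ! k)) (enc (drop (Suc k) L))) (m3 6 (int 0))" "m3 7 0 = m2 7 0 + 1"
  "\<And>r. r \<noteq> 0 ==> m3 6 (int r) = m2 6 (int r)"
  using m2(4) Suc.prems(5) cst[of 2] cst[of 0] by auto
 have kL: "drop k L = L ! k # drop (Suc k) L" using Suc.prems(1) by (simp add: Cons_nth_drop_Suc)
 have "writes (alloc_int 2 (Read 0 (reg 1))) = {3, 4, 5, 6, 7}" "writes (alloc_pair 0 2 0) = {3, 4, 5, 6, 7}"
  by (auto simp: alloc_int_def alloc_pair_def)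
 hence a0: "m3 0 = m 0" using runs_writes[OF m2(1), of 0] runs_writes[OF m3(1), of 0] by simp
 have "\<exists>m'. runs load_loop m3 ((k + 1) * (300 * w)) m' \<and> rep m' (enc L) (m' 6 0) \<and> m' 7 0 = m3 7 0 + 2 * int k"
 proof (rule Suc.IH)
  show "m3 6 1 = int k" using m3(4)[of 1] m2(5)[of 1] by simp
  show "rep m3 (enc (drop k L)) (m3 6 0)" using m3(2) unfolding kL by simp
  show "m3 7 0 + 2 * int k + 10 < int w" using m3(3) m2(4) Suc.prems(5) by simp
 qed (use Suc.prems a0 in auto)
 then obtain m' where m': "runs load_loop m3 ((k + 1) * (300 * w)) m'" "rep m' (enc L) (m' 6 0)" "m' 7 0 = m3 7 0 + 2 * int k"
  by blast
 have "runs (Seq (setreg 1 (Minus (reg 1) (Const 1))) (Seq (alloc_int 2 (Read 0 (reg 1))) (alloc_pair 0 2 0))) m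
   (1 + 10 * w + (1 + (50 + len (Read 0 (reg 1))) * w + 60 * w)) m3"
  by (rule runs_Seq[OF r1 runs_Seq[OF m2(1) m3(1)]])
 hence body: "runs (Seq (setreg 1 (Minus (reg 1) (Const 1))) (Seq (alloc_int 2 (Read 0 (reg 1))) (alloc_pair 0 2 0))) m (150 * w) m3"
  by (rule runs_mono) (use w in simp)
 have c: "eval_cost m (reg 1) \<le> 3 * w"
  using eval_cost_small[of m w "reg 1"] Suc.prems(2) sm[of 1] sm[of "1 + int k"] by simp
 have "eval m (reg 1) > 0" using Suc.prems(2) by simp
 from runs_While_True[OF this body m'(1)[unfolded load_loop_def], folded load_loop_def]
 have "runs load_loop m ((Suc k + 1) * (300 * w)) m'"
  by (rule runs_mono) (use c w in simp)
 thus ?case using m' m3(3) m2(4) by (intro exI[of _ m']) simp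
qed

text \<open>Digits are read until the number in register 2 reaches 8, that is, until four
  significant bits are known. Truncation then loses at most a factor 9/8, however small \<epsilon>
  is. Register 1 holds the matching power of 2.\<close>

definition digit_loop :: com where
 "digit_loop = While (Minus (Const 8) (reg 2)) (Seq (setreg 3 (Plus (reg 3) (Const 1)))
   (Seq (setreg 2 (Plus (Times (Const 2) (reg 2)) (Read 1 (reg 3)))) (setreg 1 (Times (Const 2) (reg 1)))))"

lemma floor_digit: "\<lfloor>2 ^ Suc i * \<epsilon>\<rfloor> = 2 * \<lfloor>2 ^ i * \<epsilon>\<rfloor> + binary_digit \<epsilon> (Suc i)" for \<epsilon> :: real
proof -
 define y where "y = 2 ^ i * \<epsilon>"
 have "\<lfloor>2 * y\<rfloor> div 2 = \<lfloor>y\<rfloor>"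
 proof -
  have "of_int \<lfloor>y\<rfloor> \<le> y" "y < of_int \<lfloor>y\<rfloor> + 1" by linarith+
  hence "2 * \<lfloor>y\<rfloor> \<le> \<lfloor>2 * y\<rfloor>" "\<lfloor>2 * y\<rfloor> < 2 * \<lfloor>y\<rfloor> + 2" by linarith+
  thus ?thesis by linarith
 qed
 hence "\<lfloor>2 * y\<rfloor> = 2 * \<lfloor>y\<rfloor> + \<lfloor>2 * y\<rfloor> mod 2" using mult_div_mod_eq[of 2 "\<lfloor>2 * y\<rfloor>"] by simp
 thus ?thesis by (simp add: binary_digit_def y_def mult.assoc)
qed

lemma binary_digit_range: "0 \<le> binary_digit \<epsilon> i" "binary_digit \<epsilon> i \<le> 1"
 unfolding binary_digit_def by (simp_all add: zle_diff1_eq[symmetric] del: zle_diff1_eq)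

lemma int_size_pow2: "int_size (2 ^ i) = i + 2"
 by (simp add: int_size_def nat_power_eq floorlog_def)

lemma digit_loop:
 fixes \<epsilon> :: real
 assumes I: "8 \<le> \<lfloor>2 ^ I * \<epsilon>\<rfloor>" and e0: "0 < \<epsilon>" and w: "I + 100 < w"
 shows "i + j = I ==> m 6 3 = int i ==> m 6 2 = \<lfloor>2 ^ i * \<epsilon>\<rfloor> ==> m 6 1 = 2 ^ i ==> \<lfloor>2 ^ i * \<epsilon>\<rfloor> < 16 ==>
  (\<forall>i. m 1 (int i) = binary_digit \<epsilon> i) ==>
  \<exists>m' i'. runs digit_loop m ((j + 1) * (100 * w)) m' \<and> i' \<le> I \<and> 8 \<le> \<lfloor>2 ^ i' * \<epsilon>\<rfloor> \<and> \<lfloor>2 ^ i' * \<epsilon>\<rfloor> < 16 \<and>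
   m' 6 2 = \<lfloor>2 ^ i' * \<epsilon>\<rfloor> \<and> m' 6 1 = 2 ^ i' \<and> m' 6 0 = m 6 0 \<and> (\<forall>a. a \<noteq> 6 --> m' a = m a)"
proof (induction j arbitrary: i m)
 case (0 i m)
 have "i = I" using 0 by simp
 have sm: "int_size p \<le> w" if "0 \<le> p" "p \<le> 100" for p by (rule pointer_size) (use that w in auto)
 have "0 \<le> \<lfloor>2 ^ i * \<epsilon>\<rfloor>" using e0 by simp
 have e1: "int_size p \<le> w" if "\<bar>p\<bar> \<le> 50" for p
  using int_size_le[of p 50] that w by simp
 have c: "eval_cost m (Minus (Const 8) (reg 2)) \<le> 6 * w"
  using eval_cost_small[of m w "Minus (Const 8) (reg 2)"] e1 0(3,5) \<open>0 \<le> \<lfloor>2 ^ i * \<epsilon>\<rfloor>\<close> by simp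
 have "runs digit_loop m (1 * (100 * w)) m"
  unfolding digit_loop_def by (rule runs_mono[OF runs_While_False]) (use 0 I \<open>i = I\<close> c w in auto)
 thus ?case using 0 I \<open>i = I\<close> by (intro exI[of _ m] exI[of _ i]) simp
next
 case (Suc j i m)
 have sm: "int_size p \<le> w" if "0 \<le> p" "p \<le> int I + 100" for p by (rule pointer_size) (use that w in auto)
 have e1: "int_size p \<le> w" if "\<bar>p\<bar> \<le> 50" for p
  using int_size_le[of p 50] that w by simp
 define a where "a = \<lfloor>2 ^ i * \<epsilon>\<rfloor>"
 have a0: "0 \<le> a" "a < 16" using e0 Suc.prems by (simp_all add: a_def)
 have m2: "m 6 2 = a" using Suc.prems by (simp add: a_def)
 have c: "eval_cost m (Minus (Const 8) (reg 2)) \<le> 6 * w"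
  using eval_cost_small[of m w "Minus (Const 8) (reg 2)"] e1 a0 m2 by simp
 show ?case
 proof (cases "8 \<le> a")
  case True
  have "runs digit_loop m ((Suc j + 1) * (100 * w)) m"
   unfolding digit_loop_def by (rule runs_mono[OF runs_While_False]) (use True m2 c w in auto)
  thus ?thesis using Suc.prems True a0 by (intro exI[of _ m] exI[of _ i]) (simp add: a_def)
 next
  case False
  define d where "d = binary_digit \<epsilon> (Suc i)"
  have d: "0 \<le> d" "d \<le> 1" unfolding d_def by (rule binary_digit_range)+
  have dm: "m 1 (1 + int i) = d" using spec[OF Suc.prems(6), of "Suc i"] by (simp add: d_def)
  let ?m1 = "m(6 := (m 6)(int 3 := int i + 1))"
  let ?m2 = "?m1(6 := (?m1 6)(int 2 := 2 * a + d))"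
  let ?m3 = "?m2(6 := (?m2 6)(int 1 := 2 * 2 ^ i))"
  have iI: "int i + 1 \<le> int I" using Suc.prems(1) by simp
  have r1: "runs (setreg 3 (Plus (reg 3) (Const 1))) m (10 * w) ?m1"
   using runs_setreg[of m w "Plus (reg 3) (Const 1)" 3] Suc.prems(2) iI sm[of 1] sm[of 3] sm[of "int i"] sm[of "int i + 1"] by simp
  have r2: "runs (setreg 2 (Plus (Times (Const 2) (reg 2)) (Read 1 (reg 3)))) ?m1 (17 * w) ?m2"
   using runs_setreg[of ?m1 w "Plus (Times (Const 2) (reg 2)) (Read 1 (reg 3))" 2] iI m2 dm a0 d False
    sm[of 2] sm[of 3] sm[of "int i + 1"] e1[of a] e1[of "2 * a"] e1[of d] e1[of "2 * a + d"]
   by (simp add: add.commute)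
  have pw: "int_size (2 ^ i) \<le> w" "int_size (2 * 2 ^ i) \<le> w"
   using int_size_pow2[of i] int_size_pow2[of "Suc i"] iI w by simp_all
  have r3: "runs (setreg 1 (Times (Const 2) (reg 1))) ?m2 (10 * w) ?m3"
   using runs_setreg[of ?m2 w "Times (Const 2) (reg 1)" 1] Suc.prems(4) pw sm[of 1] sm[of 2] by simp
  have body: "runs (Seq (setreg 3 (Plus (reg 3) (Const 1)))
   (Seq (setreg 2 (Plus (Times (Const 2) (reg 2)) (Read 1 (reg 3)))) (setreg 1 (Times (Const 2) (reg 1))))) m (50 * w) ?m3"
   by (rule runs_mono[OF runs_Seq[OF r1 runs_Seq[OF r2 r3]]]) (use w in simp)
  have fl: "\<lfloor>2 ^ Suc i * \<epsilon>\<rfloor> = 2 * a + d" unfolding floor_digit by (simp add: a_def d_def)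
  obtain m' i' where m': "runs digit_loop ?m3 ((j + 1) * (100 * w)) m'" "i' \<le> I" "8 \<le> \<lfloor>2 ^ i' * \<epsilon>\<rfloor>" "\<lfloor>2 ^ i' * \<epsilon>\<rfloor> < 16"
   "m' 6 2 = \<lfloor>2 ^ i' * \<epsilon>\<rfloor>" "m' 6 1 = 2 ^ i'" "m' 6 0 = ?m3 6 0" "\<forall>a. a \<noteq> 6 --> m' a = ?m3 a"
  proof -
   have "\<exists>m' i'. runs digit_loop ?m3 ((j + 1) * (100 * w)) m' \<and> i' \<le> I \<and> 8 \<le> \<lfloor>2 ^ i' * \<epsilon>\<rfloor> \<and> \<lfloor>2 ^ i' * \<epsilon>\<rfloor> < 16 \<and>
    m' 6 2 = \<lfloor>2 ^ i' * \<epsilon>\<rfloor> \<and> m' 6 1 = 2 ^ i' \<and> m' 6 0 = ?m3 6 0 \<and> (\<forall>a. a \<noteq> 6 --> m' a = ?m3 a)"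
   proof (rule Suc.IH[of "Suc i"])
    show "?m3 6 2 = \<lfloor>2 ^ Suc i * \<epsilon>\<rfloor>" unfolding fl by simp
    show "\<lfloor>2 ^ Suc i * \<epsilon>\<rfloor> < 16" unfolding fl using False d by simp
   qed (use Suc.prems in auto)
   thus thesis using that by blast
  qed
  have "eval m (Minus (Const 8) (reg 2)) > 0" using False m2 by simp
  from runs_While_True[OF this body m'(1)[unfolded digit_loop_def], folded digit_loop_def]
  have "runs digit_loop m ((Suc j + 1) * (100 * w)) m'"
   by (rule runs_mono) (use c w in simp)
  thus ?thesis using m'(2-8) by (intro exI[of _ m'] exI[of _ i'] conjI) simp_all
 qed
qed

definition store_loop :: com where
 "store_loop = While (Minus (reg 0) (Read 5 (reg 0))) (Seq (Write 2 (reg 1) (Read 3 (Read 4 (reg 0))))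
   (Seq (setreg 1 (Plus (reg 1) (Const 1))) (setreg 0 (Read 5 (reg 0)))))"

lemma store_loop:
 fixes l :: "int list"
 assumes w: "10 < w"
 shows "rep m (enc l) (m 6 0) ==> m 6 1 = int k ==> m 7 0 + int k + int (length l) + 10 < int w ==> \<forall>a\<in>set l. int_size a \<le> w ==>
  \<exists>m'. runs store_loop m ((length l + 1) * (100 * w)) m' \<and> (\<forall>j<length l. m' 2 (int k + int j) = l ! j) \<and> (\<forall>j<k. m' 2 (int j) = m 2 (int j))"
proof (induction l arbitrary: m k)
 case Nil
 have b: "0 \<le> m 6 0" "m 6 0 < m 7 0" "m 5 (m 6 0) = m 6 0" using Nil(1) by simp_all
 have sm: "int_size p \<le> w" if "0 \<le> p" "p \<le> m 7 0" for p by (rule pointer_size) (use that Nil w in auto)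
 have "eval_cost m (Minus (reg 0) (Read 5 (reg 0))) \<le> 10 * w"
  using eval_cost_small[of m w "Minus (reg 0) (Read 5 (reg 0))"] b sm[of 0] sm[of "m 6 0"] by simp
 hence "runs store_loop m (1 * (100 * w)) m"
  unfolding store_loop_def by (intro runs_mono[OF runs_While_False]) (use b w in auto)
 thus ?case by (intro exI[of _ m]) simp
next
 case (Cons a l)
 have b: "0 \<le> m 6 0" "m 6 0 < m 7 0" "m 5 (m 6 0) < m 6 0" "rep m (VInt a) (m 4 (m 6 0))" "rep m (enc l) (m 5 (m 6 0))"
  using Cons.prems(1) by (simp_all add: enc_int_def)
 have p4: "0 \<le> m 4 (m 6 0)" "m 4 (m 6 0) < m 7 0" "m 3 (m 4 (m 6 0)) = a" using b(4) by simp_all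
 have p5: "0 \<le> m 5 (m 6 0)" using rep_bounds[OF b(5)] by simp
 have sm: "int_size p \<le> w" if "0 \<le> p" "p \<le> m 7 0 + int k + 10" for p by (rule pointer_size) (use that Cons.prems in auto)
 have h0: "0 \<le> m 7 0" using b by simp
 let ?m1 = "m(2 := (m 2)(int k := a))"
 let ?m2 = "?m1(6 := (m 6)(int 1 := int k + 1))"
 let ?m3 = "?m2(6 := (?m2 6)(int 0 := m 5 (m 6 0)))"
 have ca: "int_size a \<le> w" using Cons.prems(4) by simp
 have r1: "runs (Write 2 (reg 1) (Read 3 (Read 4 (reg 0)))) m (13 * w) ?m1"
  using runs_Write[of m w "reg 1" "Read 3 (Read 4 (reg 0))" 2] Cons.prems(2) p4 b(1,2) h0 ca sm[of 0] sm[of 1] sm[of "int k"] sm[of "m 6 0"] sm[of "m 4 (m 6 0)"] by simp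
 have r2: "runs (setreg 1 (Plus (reg 1) (Const 1))) ?m1 (10 * w) ?m2"
  using runs_setreg[of ?m1 w "Plus (reg 1) (Const 1)" 1] Cons.prems(2) h0 sm[of 1] sm[of "int k"] sm[of "int k + 1"] by simp
 have r3: "runs (setreg 0 (Read 5 (reg 0))) ?m2 (9 * w) ?m3"
  using runs_setreg[of ?m2 w "Read 5 (reg 0)" 0] b p5 h0 sm[of 0] sm[of "m 6 0"] sm[of "m 5 (m 6 0)"] by simp
 have body: "runs (Seq (Write 2 (reg 1) (Read 3 (Read 4 (reg 0)))) (Seq (setreg 1 (Plus (reg 1) (Const 1))) (setreg 0 (Read 5 (reg 0))))) m (50 * w) ?m3"
  by (rule runs_mono[OF runs_Seq[OF r1 runs_Seq[OF r2 r3]]]) (use w in simp)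
 have rp: "rep (m'(6 := f)) v p = rep m' v p" for m' f v p by (rule rep_setreg)
 have r2': "rep (m'(2 := f)) v p = rep m' v p" for m' f v p by (induction v arbitrary: p) auto
 have "\<exists>m'. runs store_loop ?m3 ((length l + 1) * (100 * w)) m' \<and> (\<forall>j<length l. m' 2 (int (Suc k) + int j) = l ! j) \<and> (\<forall>j<Suc k. m' 2 (int j) = ?m3 2 (int j))"
 proof (rule Cons.IH)
  have "rep ?m3 (enc l) (m 5 (m 6 0))" unfolding rp r2' by (rule b(5))
  thus "rep ?m3 (enc l) (?m3 6 0)" by simp
 qed (use Cons.prems in auto)
 then obtain m' where m': "runs store_loop ?m3 ((length l + 1) * (100 * w)) m'"
  "\<forall>j<length l. m' 2 (int (Suc k) + int j) = l ! j" "\<forall>j<Suc k. m' 2 (int j) = ?m3 2 (int j)" by blast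
 have c: "eval_cost m (Minus (reg 0) (Read 5 (reg 0))) \<le> 10 * w"
  using eval_cost_small[of m w "Minus (reg 0) (Read 5 (reg 0))"] b p5 h0 sm[of 0] sm[of "m 6 0"] sm[of "m 5 (m 6 0)"] sm[of "m 6 0 - m 5 (m 6 0)"] by simp
 have "eval m (Minus (reg 0) (Read 5 (reg 0))) > 0" using b by simp
 from runs_While_True[OF this body m'(1)[unfolded store_loop_def], folded store_loop_def]
 have run: "runs store_loop m ((length (a # l) + 1) * (100 * w)) m'"
  by (rule runs_mono) (use c w in simp)
 have out: "m' 2 (int k + int j) = (a # l) ! j" if "j < length (a # l)" for j
 proof (cases j)
  case 0
  thus ?thesis using spec[OF m'(3), of k] by simp
 next
  case (Suc j')
  thus ?thesis using spec[OF m'(2), of j'] that by (simp add: add.assoc add.left_commute)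
 qed
 have "m' 2 (int j) = m 2 (int j)" if "j < k" for j using spec[OF m'(3), of j] that by simp
 thus ?case using run out by blast
qed

lemma rep_cong: "m' 3 = m 3 ==> m' 4 = m 4 ==> m' 5 = m 5 ==> m' 7 = m 7 ==> rep m' v p = rep m v p"
 by (induction v arbitrary: p) auto

text \<open>The tape does not state its length, so it is computed from \<open>n\<close> in cell 0:
  two header cells and two cells for each of the \<open>2 * (n * n + n)\<close> rationals.\<close>

definition frontend :: com where
 "frontend =
   Seq (setreg 1 (Plus (Const 2) (Times (Const 4) (Plus (Times (Read 0 (Const 0)) (Read 0 (Const 0))) (Read 0 (Const 0))))))
  (Seq (alloc_int 0 (Const 0))
  (Seq load_loop
  (Seq (setreg 1 (Const 1))
  (Seq (setreg 2 (Read 1 (Const 0)))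
  (Seq (setreg 3 (Const 0))
  (Seq digit_loop
  (Seq (alloc_int 2 (reg 2))
  (Seq (alloc_int 1 (reg 1))
  (Seq (alloc_pair 1 2 1) (alloc_pair 0 0 1))))))))))"

lemma frontend:
 fixes L :: "int list" and \<epsilon> :: real
 assumes L: "length L = 2 + 4 * (n * n + n)" "L ! 0 = int n" "\<forall>a\<in>set L. int_size a \<le> w"
  and \<epsilon>: "0 < \<epsilon>" "\<epsilon> \<le> 1" "8 \<le> \<lfloor>2 ^ I * \<epsilon>\<rfloor>" and w: "2 * length L + I + 100 < w"
 defines "m \<equiv> initial_memory L \<epsilon>"
 shows "\<exists>m' i a. runs frontend m ((length L + I + 10) * (300 * w)) m' \<and> i \<le> I \<and> a = \<lfloor>2 ^ i * \<epsilon>\<rfloor> \<and> 8 \<le> a \<and> a < 16 \<and>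
  rep m' (enc (L, (a, (2::int) ^ i))) (m' 6 0) \<and> m' 7 0 = 2 * int (length L) + 5"
proof -
 define N where "N = length L"
 have N: "int N = 2 + 4 * (int n * int n + int n)" using L(1) by (simp add: N_def)
 have sm: "int_size p \<le> w" if "0 \<le> p" "p \<le> 2 * int N + 100" for p
  by (rule pointer_size) (use that w in \<open>simp_all add: N_def\<close>)
 have cst: "int_size k \<le> w" if "0 \<le> k" "k \<le> 7" for k by (rule sm) (use that in auto)
 have m_simps: "m 7 0 = 0" "\<forall>j<length L. m 0 (int j) = L ! j" "\<forall>i. m 1 (int i) = binary_digit \<epsilon> i"
  by (simp_all add: m_def initial_memory_def)
 have mn: "m 0 0 = int n" using m_simps(2) L(1,2) by auto
 have nn: "0 \<le> int n * int n" by simp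
 have sN: "int_size p \<le> w" if "0 \<le> p" "p \<le> 2 + 4 * (int n * int n + int n)" for p
  by (rule sm) (use that N in linarith)+
 have sizes: "int_size (int n) \<le> w" "int_size (int n * int n) \<le> w" "int_size (int n * int n + int n) \<le> w"
   "int_size (4 * (int n * int n + int n)) \<le> w" "int_size (2 + 4 * (int n * int n + int n)) \<le> w"
  using nn by (simp_all add: sN)
 define m1 where "m1 = m(6 := (m 6)(int 1 := int N))"
 have r1: "runs (setreg 1 (Plus (Const 2) (Times (Const 4) (Plus (Times (Read 0 (Const 0)) (Read 0 (Const 0))) (Read 0 (Const 0)))))) m (23 * w) m1"
  using runs_setreg[of m w "Plus (Const 2) (Times (Const 4) (Plus (Times (Read 0 (Const 0)) (Read 0 (Const 0))) (Read 0 (Const 0))))" 1]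
   sizes cst[of 0] cst[of 1] cst[of 2] cst[of 4] by (simp add: mn N m1_def)
 obtain m2 where m2: "runs (alloc_int 0 (Const 0)) m1 ((50 + len (Const 0)) * w) m2" "rep m2 (VInt (eval m1 (Const 0))) (m2 6 (int 0))"
   "m2 7 0 = m1 7 0 + 1" "\<And>r. r \<noteq> 0 ==> m2 6 (int r) = m1 6 (int r)"
 proof (rule alloc_int[of m1 w "Const 0" 0])
  show "small m1 w (Const 0)" using cst[of 0] by simp
  show "0 \<le> m1 7 0" "m1 7 0 + 2 \<le> int w" using w m_simps by (simp_all add: m1_def)
 qed (use cst in auto)
 have wr: "writes (alloc_int d e) = {3, 4, 5, 6, 7}" "writes (alloc_pair d p q) = {3, 4, 5, 6, 7}" for d e p q
  by (auto simp: alloc_int_def alloc_pair_def)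
 have a2: "m2 0 = m 0" "m2 1 = m 1" using runs_writes[OF m2(1), of 0] runs_writes[OF m2(1), of 1] wr by (simp_all add: m1_def)
 have "\<exists>m'. runs load_loop m2 ((N + 1) * (300 * w)) m' \<and> rep m' (enc L) (m' 6 0) \<and> m' 7 0 = m2 7 0 + 2 * int N"
 proof (rule load_loop[OF L(3)])
  show "m2 6 1 = int N" using m2(4)[of 1] by (simp add: m1_def)
  show "\<forall>j<length L. m2 0 (int j) = L ! j" using m_simps a2 by simp
  show "rep m2 (enc (drop N L)) (m2 6 0)" using m2(2) by (simp add: N_def)
  show "m2 7 0 + 2 * int N + 10 < int w" using m2(3) w m_simps by (simp add: m1_def N_def)
 qed (simp add: N_def)
 then obtain m3 where m3: "runs load_loop m2 ((N + 1) * (300 * w)) m3" "rep m3 (enc L) (m3 6 0)" "m3 7 0 = m2 7 0 + 2 * int N" by blast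
 have "writes load_loop = {3, 4, 5, 6, 7}" by (auto simp: load_loop_def wr)
 hence a3: "m3 1 = m 1" using runs_writes[OF m3(1), of 1] a2 by simp
 define m4 where "m4 = m3(6 := (m3 6)(int 1 := 1))"
 define m5 where "m5 = m4(6 := (m4 6)(int 2 := binary_digit \<epsilon> 0))"
 define m6 where "m6 = m5(6 := (m5 6)(int 3 := 0))"
 have m45: "m4 1 = m 1" "m5 1 = m 1" using a3 by (simp_all add: m4_def m5_def)
 have bd: "0 \<le> binary_digit \<epsilon> 0" "binary_digit \<epsilon> 0 \<le> 1" by (rule binary_digit_range)+
 have m10: "m 1 0 = binary_digit \<epsilon> 0" using spec[OF m_simps(3), of 0] by simp
 have r4: "runs (setreg 1 (Const 1)) m3 (5 * w) m4"
  using runs_setreg[of m3 w "Const 1" 1] cst[of 1] by (simp add: m4_def)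
 have r5: "runs (setreg 2 (Read 1 (Const 0))) m4 (7 * w) m5"
  using runs_setreg[of m4 w "Read 1 (Const 0)" 2] cst[of 0] cst[of 2] cst[of "binary_digit \<epsilon> 0"] bd by (simp add: m5_def m45[simplified] m10[simplified])
 have r6: "runs (setreg 3 (Const 0)) m5 (5 * w) m6"
  using runs_setreg[of m5 w "Const 0" 3] cst[of 0] cst[of 3] by (simp add: m6_def)
 have fl0: "binary_digit \<epsilon> 0 = \<lfloor>2 ^ 0 * \<epsilon>\<rfloor>" "\<lfloor>2 ^ 0 * \<epsilon>\<rfloor> < 16"
 proof -
  have f: "0 \<le> \<lfloor>\<epsilon>\<rfloor>" "\<lfloor>\<epsilon>\<rfloor> \<le> 1" using \<epsilon> by linarith+
  thus "binary_digit \<epsilon> 0 = \<lfloor>2 ^ 0 * \<epsilon>\<rfloor>" "\<lfloor>2 ^ 0 * \<epsilon>\<rfloor> < 16" by (simp_all add: binary_digit_def)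
 qed
 have "\<exists>m' i'. runs digit_loop m6 ((I + 1) * (100 * w)) m' \<and> i' \<le> I \<and> 8 \<le> \<lfloor>2 ^ i' * \<epsilon>\<rfloor> \<and> \<lfloor>2 ^ i' * \<epsilon>\<rfloor> < 16 \<and>
   m' 6 2 = \<lfloor>2 ^ i' * \<epsilon>\<rfloor> \<and> m' 6 1 = 2 ^ i' \<and> m' 6 0 = m6 6 0 \<and> (\<forall>a. a \<noteq> 6 --> m' a = m6 a)"
 proof (rule digit_loop[OF \<epsilon>(3,1), of w 0 I m6])
  show "I + 100 < w" using w by simp
  show "\<forall>i. m6 1 (int i) = binary_digit \<epsilon> i" using m_simps(3) a3 by (simp add: m6_def m5_def m4_def)
  show "m6 6 2 = \<lfloor>2 ^ 0 * \<epsilon>\<rfloor>" unfolding fl0(1)[symmetric] by (simp add: m6_def m5_def)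
 qed (use fl0 in \<open>simp_all add: m6_def m5_def m4_def\<close>)
 then obtain m7 i where m7: "runs digit_loop m6 ((I + 1) * (100 * w)) m7" "i \<le> I" "8 \<le> \<lfloor>2 ^ i * \<epsilon>\<rfloor>" "\<lfloor>2 ^ i * \<epsilon>\<rfloor> < 16"
   "m7 6 2 = \<lfloor>2 ^ i * \<epsilon>\<rfloor>" "m7 6 1 = 2 ^ i" "m7 6 0 = m6 6 0" "\<forall>a. a \<noteq> 6 --> m7 a = m6 a" by blast
 define a where "a = \<lfloor>2 ^ i * \<epsilon>\<rfloor>"
 have same: "m7 3 = m3 3" "m7 4 = m3 4" "m7 5 = m3 5" "m7 7 = m3 7" "m7 6 0 = m3 6 0"
  using m7(7,8) by (simp_all add: m6_def m5_def m4_def)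
 have e7: "rep m7 (enc L) (m7 6 0)"
  unfolding rep_cong[OF same(1-4)] same(5) by (rule m3(2))
 have h7: "m7 7 0 = 2 * int N + 1"
  using m7(8) m3(3) m2(3) m_simps(1) by (simp add: m6_def m5_def m4_def m1_def)
 have wN: "2 * int N + int I + 100 < int w" using w by (simp add: N_def)
 have as: "int_size a \<le> w" using m7(3,4) unfolding a_def by (intro sm) linarith+
 obtain m8 where m8: "runs (alloc_int 2 (reg 2)) m7 ((50 + len (reg 2)) * w) m8" "rep m8 (VInt (eval m7 (reg 2))) (m8 6 (int 2))"
   "extends 2 m7 m8" "m8 7 0 = m7 7 0 + 1" "\<And>r. r \<noteq> 2 ==> m8 6 (int r) = m7 6 (int r)"
 proof (rule alloc_int[of m7 w "reg 2" 2])
  show "small m7 w (reg 2)" using cst[of 2] as m7(5) by (simp add: a_def)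
  show "0 \<le> m7 7 0" "m7 7 0 + 2 \<le> int w" using wN h7 by simp_all
 qed (use cst in auto)
 have ps: "int_size (2 ^ i) \<le> w" unfolding int_size_pow2 using m7(2) w by simp
 obtain m9 where m9: "runs (alloc_int 1 (reg 1)) m8 ((50 + len (reg 1)) * w) m9" "rep m9 (VInt (eval m8 (reg 1))) (m9 6 (int 1))"
   "extends 1 m8 m9" "m9 7 0 = m8 7 0 + 1" "\<And>r. r \<noteq> 1 ==> m9 6 (int r) = m8 6 (int r)"
 proof (rule alloc_int[of m8 w "reg 1" 1])
  show "small m8 w (reg 1)" using cst[of 1] ps m7(6) m8(5)[of 1] by simp
  show "0 \<le> m8 7 0" "m8 7 0 + 2 \<le> int w" using wN h7 m8(4) by simp_all
 qed (use cst in auto)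
 have a9: "rep m9 (enc a) (m9 6 (int 2))"
  using rep_mono[OF m9(3) m8(2)] m9(5)[of 2] m7(5) by (simp add: enc_int_def a_def)
 have p9: "rep m9 (enc ((2::int) ^ i)) (m9 6 (int 1))" using m9(2) m7(6) m8(5)[of 1] by (simp add: enc_int_def)
 have L9: "rep m9 (enc L) (m9 6 (int 0))"
  using rep_mono[OF m9(3) rep_mono[OF m8(3) e7]] m9(5)[of 0] m8(5)[of 0] by simp
 obtain m10 where m10: "runs (alloc_pair 1 2 1) m9 (60 * w) m10" "rep m10 (VPair (enc a) (enc ((2::int) ^ i))) (m10 6 (int 1))"
   "extends 1 m9 m10" "m10 7 0 = m9 7 0 + 1" "\<And>r. r \<noteq> 1 ==> m10 6 (int r) = m9 6 (int r)"
  by (rule alloc_pair[OF a9 p9, of w 1]) (use cst wN h7 m8(4) m9(4) in auto)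
 have L10: "rep m10 (enc L) (m10 6 (int 0))" using rep_mono[OF m10(3) L9] m10(5)[of 0] by simp
 obtain m11 where m11: "runs (alloc_pair 0 0 1) m10 (60 * w) m11" "rep m11 (VPair (enc L) (VPair (enc a) (enc ((2::int) ^ i)))) (m11 6 (int 0))"
   "m11 7 0 = m10 7 0 + 1"
  by (rule alloc_pair[OF L10 m10(2), of w 0]) (use cst wN h7 m8(4) m9(4) m10(4) in auto)
 note all = runs_Seq[OF r1 runs_Seq[OF m2(1) runs_Seq[OF m3(1) runs_Seq[OF r4 runs_Seq[OF r5 runs_Seq[OF r6 runs_Seq[OF m7(1)
  runs_Seq[OF m8(1) runs_Seq[OF m9(1) runs_Seq[OF m10(1) m11(1)]]]]]]]]]]
 have "runs frontend m ((length L + I + 10) * (300 * w)) m11"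
  unfolding frontend_def
 proof (rule runs_mono[OF all])
  have "1 \<le> w" using w by simp
  thus "1 + 23 * w + (1 + (50 + len (Const 0)) * w + (1 + (N + 1) * (300 * w) + (1 + 5 * w + (1 + 7 * w + (1 + 5 * w + (1 + (I + 1) * (100 * w) +
    (1 + (50 + len (reg 2)) * w + (1 + (50 + len (reg 1)) * w + (1 + 60 * w + 60 * w))))))))) \<le> (length L + I + 10) * (300 * w)"
   unfolding N_def[symmetric] by (simp add: algebra_simps)
 qed
 moreover have "m11 7 0 = 2 * int (length L) + 5" using m11(3) m10(4) m9(4) m8(4) h7 by (simp add: N_def)
 moreover have "rep m11 (enc (L, (a, (2::int) ^ i))) (m11 6 0)" using m11(2) by simp
 ultimately show ?thesis using m7(2-4) unfolding a_def[symmetric]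
  by (intro exI[of _ m11] exI[of _ i] exI[of _ a]) (simp add: a_def)
qed

lemma PB_sz_bound: "PB S b ==> \<exists>k. \<forall>x\<in>S. b x \<le> (sz x + 1) ^ k"
 by (simp add: PB_def)

lemma sz_int_list: "sz (L :: int list) = 1 + length L + sum_list (map int_size L)"
 by (induction L) (simp_all add: sz_Nil sz_Cons sz_int)

text \<open>The digit loop itself decides where to stop, so the approximation
  \<open>a / 2 ^ i\<close> is part of the conclusion, and \<open>S\<close> has to contain the input
  with every possible one. \<open>I\<close> bounds the number of digits read and thereby their share
  of the input size.\<close>

lemma program:
 fixes alg :: "int list \<times> int \<times> int => int list"
 assumes alg: "FP S alg"
 shows "\<exists>prog c k. \<forall>L \<epsilon> n I. length L = 2 + 4 * (n * n + n) --> L ! 0 = int n --> 0 < \<epsilon> --> \<epsilon> \<le> 1 -->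
   8 \<le> \<lfloor>2 ^ I * \<epsilon>\<rfloor> --> (\<forall>i a. (L, (a, 2 ^ i)) \<in> S) -->
  (\<exists>t m i a. run prog (initial_memory L \<epsilon>) t m \<and> a = \<lfloor>2 ^ i * \<epsilon>\<rfloor> \<and> 8 \<le> a \<and>
   (\<forall>j<length (alg (L, (a, 2 ^ i))). m 2 (int j) = alg (L, (a, 2 ^ i)) ! j) \<and>
   t \<le> c * (sum_list (map int_size L) + I + 100) ^ k)"
proof -
 obtain F where F: "\<And>x. x \<in> S ==> sem F (enc x) = enc (alg x)" "PB S (%x. cost F (enc x))"
  by (rule FP_E[OF alg]) blast
 obtain k where k: "\<forall>x\<in>S. cost F (enc x) \<le> (sz x + 1) ^ k" using PB_sz_bound[OF F(2)] by blast
 obtain K where K: "compiles F 0 K" using compiles_exists by blast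
 define prog where "prog = Seq frontend (Seq (compile F 0) (Seq (setreg 1 (Const 0)) store_loop))"
 define c where "c = (10000 + K) * 2 * 3 ^ (2 * (k + 1))"
 show ?thesis
 proof (rule exI[of _ prog], rule exI[of _ c], rule exI[of _ "2 * (k + 1)"], intro allI impI)
  fix L :: "int list" and \<epsilon> :: real and n I
  assume L: "length L = 2 + 4 * (n * n + n)" "L ! 0 = int n" and \<epsilon>: "0 < \<epsilon>" "\<epsilon> \<le> 1" "8 \<le> \<lfloor>2 ^ I * \<epsilon>\<rfloor>"
   and S: "\<forall>i a. (L, (a, 2 ^ i)) \<in> S"
  define s where "s = sum_list (map int_size L)"
  define Y where "Y = 3 * (s + I + 100)"
  define w where "w = s + 2 * length L + I + 101"
  have Ls: "length L \<le> s" unfolding s_def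
  proof (induction L)
   case (Cons a L)
   thus ?case using int_size_pos[of a] by simp
  qed simp
  have ent: "\<forall>a\<in>set L. int_size a \<le> w"
  proof
   fix a assume "a \<in> set L"
   hence "int_size a \<le> s" unfolding s_def by (intro member_le_sum_list) auto
   thus "int_size a \<le> w" by (simp add: w_def)
  qed
  have wI: "2 * length L + I + 100 < w" by (simp add: w_def)
  from frontend[OF L ent \<epsilon> wI] obtain m1 i a where m1: "runs frontend (initial_memory L \<epsilon>) ((length L + I + 10) * (300 * w)) m1" "i \<le> I" "a = \<lfloor>2 ^ i * \<epsilon>\<rfloor>" "8 \<le> a" "a < 16"
   "rep m1 (enc (L, (a, (2::int) ^ i))) (m1 6 0)" "m1 7 0 = 2 * int (length L) + 5"
   by (elim exE conjE)
  define x where "x = (L, (a, (2::int) ^ i))"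
  have xS: "x \<in> S" unfolding x_def by (rule S[rule_format])
  define C where "C = cost F (enc x)"
  have "int_size a \<le> 17" using int_size_le[of a 16] m1(4,5) by simp
  hence szx: "sz x + 1 \<le> Y"
   using Ls m1(2) by (simp add: x_def sz_Pair sz_int sz_int_list int_size_pow2 Y_def s_def[symmetric])
  have CY: "C \<le> Y ^ k" using bspec[OF k xS] power_mono[OF szx, of k] by (simp add: C_def)
  \<comment> \<open>\<open>Z\<close> dominates the input, the cost of \<open>F\<close> and half of
    the address bound \<open>B\<close>, so every phase takes at most a constant times
    \<open>Z * Z\<close>.\<close>
  define Z where "Z = Y ^ (k + 1)"
  have Y1: "300 \<le> Y" by (simp add: Y_def)
  have YZ: "Y \<le> Z" unfolding Z_def using Y1 by (intro self_le_power) auto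
  have CZ: "C \<le> Z" unfolding Z_def by (rule order.trans[OF CY power_increasing]) (use Y1 in auto)
  define B where "B = 2 * length L + 5 + C"
  have BZ: "B \<le> 2 * Z" using Ls YZ CZ by (simp add: B_def Y_def)
  obtain m2 where m2: "runs (compile F 0) m1 (K * (C * B)) m2" "rep m2 (sem F (enc x)) (m2 6 (int 0))" "m2 7 0 \<le> m1 7 0 + int C"
   by (rule compilesE[OF K, of m1 "enc x" B]) (use m1(6,7) in \<open>simp_all add: x_def C_def B_def\<close>)
  define l where "l = alg x"
  have l2: "rep m2 (enc l) (m2 6 (int 0))" using m2(2) F(1)[OF xS] by (simp add: l_def)
  have szl: "sz l \<le> C" using vsize_sem_le[of F "enc x"] F(1)[OF xS] by (simp add: sz_def C_def l_def)
  define v where "v = 10 * Z"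
  let ?m3 = "m2(6 := (m2 6)(int 1 := 0))"
  have v100: "100 < v" using YZ Y1 by (simp add: v_def)
  have r3: "runs (setreg 1 (Const 0)) m2 (5 * v) ?m3"
   using runs_setreg[of m2 v "Const 0" 1] pointer_size[of 0 v] pointer_size[of 1 v] v100 by simp
  have "\<exists>m'. runs store_loop ?m3 ((length l + 1) * (100 * v)) m' \<and> (\<forall>j<length l. m' 2 (int 0 + int j) = l ! j) \<and> (\<forall>j<0. m' 2 (int j) = ?m3 2 (int j))"
  proof (rule store_loop)
   show "10 < v" using v100 by simp
   show "rep ?m3 (enc l) (?m3 6 0)" using l2 by (simp add: rep_setreg)
   show "?m3 6 1 = int 0" by simp
   have "m2 7 0 + int (length l) + 10 < int v"
    using m2(3) m1(7) length_le_sz[of l] szl Ls CZ YZ Y1 by (simp add: v_def Y_def)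
   thus "?m3 7 0 + int 0 + int (length l) + 10 < int v" by simp
   show "\<forall>a\<in>set l. int_size a \<le> v"
   proof
    fix a assume "a \<in> set l"
    hence "int_size a \<le> sz l" using sz_mem[of a l] by (simp add: sz_int)
    thus "int_size a \<le> v" using szl CZ by (simp add: v_def)
   qed
  qed
  then obtain m4 where m4: "runs store_loop ?m3 ((length l + 1) * (100 * v)) m4" "\<forall>j<length l. m4 2 (int j) = l ! j" by auto
  have "runs prog (initial_memory L \<epsilon>) (1 + (length L + I + 10) * (300 * w) + (1 + K * (C * B) + (1 + 5 * v + (length l + 1) * (100 * v)))) m4"
   unfolding prog_def by (rule runs_Seq[OF m1(1) runs_Seq[OF m2(1) runs_Seq[OF r3 m4(1)]]])
  then obtain t where t: "run prog (initial_memory L \<epsilon>) t m4"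
   "t \<le> 1 + (length L + I + 10) * (300 * w) + (1 + K * (C * B) + (1 + 5 * v + (length l + 1) * (100 * v)))" unfolding runs_def by blast
  have "t \<le> c * (s + I + 100) ^ (2 * (k + 1))"
  proof -
   have "(length L + I + 10) * (300 * w) \<le> Z * (300 * Z)"
    using Ls YZ by (intro mult_le_mono) (simp_all add: w_def Y_def)
   hence 1: "(length L + I + 10) * (300 * w) \<le> 300 * (Z * Z)" by (simp only: mult.left_commute)
   have "K * (C * B) \<le> K * (Z * (2 * Z))" by (intro mult_le_mono le_refl CZ BZ)
   hence 2: "K * (C * B) \<le> 2 * (K * (Z * Z))" by (simp only: mult.left_commute)
   have Z1: "1 \<le> Z" using YZ Y1 by simp
   have "length l + 1 \<le> 2 * Z" using length_le_sz[of l] szl CZ Z1 by simp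
   hence "(length l + 1) * (100 * v) \<le> 2 * Z * (1000 * Z)" by (rule mult_le_mono) (simp add: v_def)
   hence 3: "(length l + 1) * (100 * v) \<le> 2000 * (Z * Z)" by simp
   have 4: "3 + 5 * v \<le> 53 * (Z * Z)"
   proof -
    have "Z * 1 \<le> Z * Z" using Z1 by (intro mult_le_mono) auto
    thus ?thesis using Z1 unfolding v_def by linarith
   qed
   have "0 \<le> Z * Z" by simp
   hence "t \<le> 20000 * (Z * Z) + 2 * (K * (Z * Z))" using t(2) 1 2 3 4 by linarith
   hence "t \<le> ((10000 + K) * 2) * (Z * Z)" by (simp only: distrib_right distrib_left mult.assoc mult.commute[of K 2])
   also have "Z * Z = Y ^ (2 * (k + 1))" by (simp only: Z_def mult_2 power_add)
   also have "\<dots> = 3 ^ (2 * (k + 1)) * (s + I + 100) ^ (2 * (k + 1))" by (simp only: Y_def power_mult_distrib)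
   finally show ?thesis unfolding c_def by (simp only: mult.assoc)
  qed
  thus "\<exists>t m i a. run prog (initial_memory L \<epsilon>) t m \<and> a = \<lfloor>2 ^ i * \<epsilon>\<rfloor> \<and> 8 \<le> a \<and>
   (\<forall>j<length (alg (L, (a, 2 ^ i))). m 2 (int j) = alg (L, (a, 2 ^ i)) ! j) \<and>
   t \<le> c * (sum_list (map int_size L) + I + 100) ^ (2 * (k + 1))"
   using t(1) m4(2) m1(3,4) unfolding l_def x_def s_def by blast
 qed
qed

section \<open>Decoding the input\<close>

text \<open>The cap \<open>length L\<close> keeps the unary result of linear size; it is inactive on inputs from the tape.\<close>

definition intnat :: "int list => int => nat" where
 "intnat L z = foldl (%k _. if int k < z then Suc k else k) 0 L"

definition ent :: "int list => nat => rat" where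
 "ent L j = Rat.Fract (elt 0 L j) (elt 0 L (Suc j))"

definition emat where
 "emat n L s = tab n (%i. tab n (%j. ent L (s + 2 * (i * n + j))))"

definition evec where
 "evec n L s = tab n (%i. ent L (s + 2 * i))"

text \<open>The offsets follow the layout of \<open>encode_miqp\<close>, with two cells for each
  rational.\<close>

definition alg2 :: "nat => nat => int list => rat => int list" where
 "alg2 n p L e = solve n p (emat n L 2) (evec n L (2 + 2 * (n * n))) (emat n L (2 + 2 * (n * n) + 2 * n))
   (evec n L (2 + 4 * (n * n) + 2 * n)) e"

definition alg :: "int list \<times> int \<times> int => int list" where
 "alg x = alg2 (intnat (fst x) (elt 0 (fst x) 0)) (intnat (fst x) (elt 0 (fst x) 1)) (fst x) (Rat.Fract (fst (snd x)) (snd (snd x)))"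

lemma foldl_count: "foldl (%k _. if int k < z then Suc k else k) s L = (if int s < z then min (s + length L) (nat z) else s)"
 by (induction L arbitrary: s) auto

lemma intnat: "intnat L z = min (length L) (nat z)"
 by (simp add: intnat_def foldl_count)

lemma FP_intnat:
 assumes L: "FP S L" and z: "FP S z"
 shows "FP S (%x. intnat (L x) (z x))"
 unfolding intnat_def
proof (rule FP_foldl[where T = "S \<times> UNIV"])
 show "FP (S \<times> UNIV) (%w. if int (fst (snd w)) < z (fst w) then Suc (fst (snd w)) else fst (snd w))"
  by (intro FP_If FP_int_less FP_of_nat FP_Suc FP_compose[OF z] FP_fst FP_snd FP_id; auto)
 show "FP S L" by (rule L)
 show "FP S (%x. 0::nat)" by (rule FP_const)
 show "PB S (%x. 2 * sz (L x) + 1)" by (intro PB_add PB_mult PB_const FP_sz[OF L])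
 fix x i assume x: "x \<in> S"
 show "(x, foldl (%k _. if int k < z x then Suc k else k) 0 (take i (L x)), L x ! i) \<in> S \<times> UNIV" using x by simp
 have "foldl (%k _. if int k < z x then Suc k else k) 0 (take i (L x)) \<le> length (L x)"
  by (simp add: foldl_count min.coboundedI1)
 thus "sz (foldl (%k _. if int k < z x then Suc k else k) 0 (take i (L x))) \<le> 2 * sz (L x) + 1"
  using length_le_sz[of "L x"] unfolding sz_nat by linarith
qed

lemma FP_ent: "FP S L ==> FP S j ==> FP S (%x. ent (L x) (j x))"
 unfolding ent_def by (intro FP_Fract FP_elt FP_Suc)

lemma FP_emat:
 assumes "FP S n" "FP S L" "FP S s"
 shows "FP S (%x. emat (n x) (L x) (s x))"
 unfolding emat_def
 by (intro FP_tabI FP_ent FP_nat_add FP_nat_mult FP_const assms assms(1,2,3)[THEN FP_compose]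
  FP_fst FP_snd FP_id; auto)

lemma FP_evec:
 assumes "FP S n" "FP S L" "FP S s"
 shows "FP S (%x. evec (n x) (L x) (s x))"
 unfolding evec_def
 by (intro FP_tabI FP_ent FP_nat_add FP_nat_mult FP_const assms assms(2,3)[THEN FP_compose]
  FP_fst FP_snd FP_id; auto)

lemma nth_concat_eq:
 assumes "\<And>xs. xs \<in> set xss ==> length xs = m" "i < length xss" "j < m"
 shows "concat xss ! (i * m + j) = xss ! i ! j"
 using assms
proof (induction xss arbitrary: i)
 case (Cons xs xss)
 hence l: "length xs = m" by simp
 show ?case
 proof (cases i)
  case 0
  thus ?thesis using Cons.prems l by (simp add: nth_append)
 next
  case (Suc i')
  have "concat xss ! (i' * m + j) = xss ! i' ! j" using Cons.prems Suc by (intro Cons.IH) auto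
  thus ?thesis using l Suc by (simp add: nth_append)
 qed
qed simp

lemma length_concat_eq: "(\<And>xs. xs \<in> set xss ==> length xs = m) ==> length (concat xss) = length xss * m"
 by (induction xss) auto

lemma length_encode_vec: "length (encode_vec v) = 2 * dim_vec v"
proof -
 have "length (encode_vec v) = length (map encode_rat (list_of_vec v)) * 2"
  unfolding encode_vec_def by (rule length_concat_eq) (auto simp: encode_rat_def)
 thus ?thesis by simp
qed

lemma nth_encode_vec:
 assumes i: "i < dim_vec v"
 shows "encode_vec v ! (2 * i) = fst (quotient_of (v $ i))" "encode_vec v ! (2 * i + 1) = snd (quotient_of (v $ i))"
proof -
 have l: "length xs = 2" if "xs \<in> set (map encode_rat (list_of_vec v))" for xs using that by (auto simp: encode_rat_def)
 have "encode_vec v ! (i * 2 + j) = map encode_rat (list_of_vec v) ! i ! j" if "j < 2" for j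
  unfolding encode_vec_def by (rule nth_concat_eq[OF l]) (use i that in auto)
 from this[of 0] this[of 1] show "encode_vec v ! (2 * i) = fst (quotient_of (v $ i))" "encode_vec v ! (2 * i + 1) = snd (quotient_of (v $ i))"
  using i by (simp_all add: encode_rat_def mult.commute list_of_vec_index)
qed

lemma rows_lengths: "A \<in> carrier_mat n n ==> xs \<in> set (map encode_vec (rows A)) ==> length xs = 2 * n"
 by (auto simp: length_encode_vec rows_def)

lemma length_encode_mat: assumes A: "A \<in> carrier_mat n n" shows "length (encode_mat A) = 2 * (n * n)"
proof -
 have "length (encode_mat A) = length (map encode_vec (rows A)) * (2 * n)"
  unfolding encode_mat_def by (rule length_concat_eq[OF rows_lengths[OF A]])
 thus ?thesis using A by simp
qed

lemma nth_encode_mat: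
 assumes A: "A \<in> carrier_mat n n" and ij: "i < n" "j < n"
 shows "encode_mat A ! (2 * (i * n + j)) = fst (quotient_of (A $$ (i, j)))"
  "encode_mat A ! (2 * (i * n + j) + 1) = snd (quotient_of (A $$ (i, j)))"
proof -
 have 1: "encode_mat A ! (i * (2 * n) + l) = map encode_vec (rows A) ! i ! l" if "l < 2 * n" for l
  unfolding encode_mat_def by (rule nth_concat_eq[OF rows_lengths[OF A]]) (use A ij that in auto)
 have e: "2 * (i * n + j) = i * (2 * n) + 2 * j" by (simp add: algebra_simps)
 have r: "map encode_vec (rows A) ! i = encode_vec (row A i)" using A ij by simp
 have d: "j < dim_vec (row A i)" using A ij by simp
 have v: "row A i $ j = A $$ (i, j)" using A ij by simp
 show "encode_mat A ! (2 * (i * n + j)) = fst (quotient_of (A $$ (i, j)))"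
  unfolding e using 1[of "2 * j"] ij by (simp only: r nth_encode_vec(1)[OF d] v)
 show "encode_mat A ! (2 * (i * n + j) + 1) = snd (quotient_of (A $$ (i, j)))"
  unfolding e add.assoc using 1[of "2 * j + 1"] ij by (simp only: r nth_encode_vec(2)[OF d] v)
qed

lemma Fract_quotient_of: "Rat.Fract (fst (quotient_of r)) (snd (quotient_of r)) = r"
 using quotient_of_div[of r] by (simp add: Fract_of_int_quotient prod_eq_iff)

lemma ent_append:
 assumes "j + 1 < length xs" "xs ! j = fst (quotient_of r)" "xs ! (j + 1) = snd (quotient_of r)" "length pre = s"
 shows "ent (pre @ xs @ post) (s + j) = r"
 using assms Fract_quotient_of[of r] by (simp add: ent_def elt_def nth_append)

context
 fixes n p :: nat and H Q :: "rat mat" and h c :: "rat vec"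
 assumes H: "H \<in> carrier_mat n n" and h: "h \<in> carrier_vec n" and Q: "Q \<in> carrier_mat n n" and c: "c \<in> carrier_vec n" and pn: "p \<le> n"
begin

abbreviation (input) "inp \<equiv> encode_miqp n p H h Q c"

lemma length_inp: "length inp = 2 + 4 * (n * n + n)"
 using length_encode_mat[OF H] length_encode_mat[OF Q] h c by (simp add: encode_miqp_def length_encode_vec)

lemma inp_head: "inp ! 0 = int n" "inp ! 1 = int p"
 by (simp_all add: encode_miqp_def)

lemma double_less: "i < k ==> 2 * i + 1 < 2 * k" for i k :: nat by simp

lemma pair_less: assumes "i < n" "j < n" shows "i * n + j < n * n"
proof -
 have "i * n + j < i * n + n" using assms by simp
 also have "\<dots> = (i + 1) * n" by simp
 also have "\<dots> \<le> n * n" using assms by (intro mult_le_mono1) simp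
 finally show ?thesis .
qed

lemma dec_H: assumes "i < n" "j < n" shows "mx (emat n inp 2) i j = H $$ (i, j)"
proof -
 have "ent ([int n, int p] @ encode_mat H @ (encode_vec h @ encode_mat Q @ encode_vec c)) (2 + 2 * (i * n + j)) = H $$ (i, j)"
  by (rule ent_append) (use length_encode_mat[OF H] nth_encode_mat[OF H assms] double_less[OF pair_less[OF assms]] in simp_all)
 thus ?thesis using assms by (simp add: emat_def mx_tab encode_miqp_def)
qed

lemma dec_h: assumes "i < n" shows "vx (evec n inp (2 + 2 * (n * n))) i = h $ i"
proof -
 have "ent (([int n, int p] @ encode_mat H) @ encode_vec h @ (encode_mat Q @ encode_vec c)) (2 + 2 * (n * n) + 2 * i) = h $ i"
  by (rule ent_append) (use h length_encode_vec[of h] length_encode_mat[OF H] nth_encode_vec[of i h] double_less[OF assms] assms in simp_all)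
 thus ?thesis using assms by (simp add: evec_def encode_miqp_def)
qed

lemma dec_Q: assumes "i < n" "j < n" shows "mx (emat n inp (2 + 2 * (n * n) + 2 * n)) i j = Q $$ (i, j)"
proof -
 have "ent (([int n, int p] @ encode_mat H @ encode_vec h) @ encode_mat Q @ encode_vec c) (2 + 2 * (n * n) + 2 * n + 2 * (i * n + j)) = Q $$ (i, j)"
  by (rule ent_append) (use h length_encode_vec[of h] length_encode_mat[OF H] length_encode_mat[OF Q] nth_encode_mat[OF Q assms] double_less[OF pair_less[OF assms]] in simp_all)
 thus ?thesis using assms by (simp add: emat_def mx_tab encode_miqp_def)
qed

lemma dec_c: assumes "i < n" shows "vx (evec n inp (2 + 4 * (n * n) + 2 * n)) i = c $ i"
proof -
 have "ent (([int n, int p] @ encode_mat H @ encode_vec h @ encode_mat Q) @ encode_vec c @ []) (2 + 4 * (n * n) + 2 * n + 2 * i) = c $ i"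
  by (rule ent_append) (use h c length_encode_vec[of h] length_encode_vec[of c] length_encode_mat[OF H] length_encode_mat[OF Q] nth_encode_vec[of i c] double_less[OF assms] assms in simp_all)
 thus ?thesis using assms by (simp add: evec_def encode_miqp_def)
qed

lemma alg_inp: "alg (inp, (a, b)) = alg2 n p inp (Rat.Fract a b)"
proof -
 have "intnat inp (elt 0 inp 0) = n" "intnat inp (elt 0 inp 1) = p"
  using inp_head length_inp pn by (simp_all add: intnat elt_def)
 thus ?thesis by (simp add: alg_def)
qed

lemma intnat_inp: "intnat inp (elt 0 inp 0) = n" "intnat inp (elt 0 inp 1) = p"
 using inp_head length_inp pn by (simp_all add: intnat elt_def)

end

section \<open>Valid instances as the domain of the algorithm\<close>

definition miqp_ok :: "nat => nat => rat mat => rat vec => rat mat => rat vec => bool" where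
 "miqp_ok n p H h Q c \<longleftrightarrow> p \<le> n \<and> H \<in> carrier_mat n n \<and> transpose_mat H = H \<and> h \<in> carrier_vec n \<and>
   Q \<in> carrier_mat n n \<and> pos_def_mat n (map_mat of_rat Q) \<and> c \<in> carrier_vec n"

lemma scalar_prod_mat:
 fixes A :: "real mat"
 assumes "A \<in> carrier_mat n n" "x \<in> carrier_vec n" "y \<in> carrier_vec n"
 shows "x \<bullet> (A *\<^sub>v y) = bil n (%i j. A $$ (i, j)) (vec_index x) (vec_index y)"
proof -
 have "x \<bullet> (A *\<^sub>v y) = (\<Sum>i<n. x $ i * (\<Sum>j<n. A $$ (i, j) * y $ j))"
  using assms by (simp add: scalar_prod_def lessThan_atLeast0)
 thus ?thesis by (simp only: bil_def sum_distrib_left mult.assoc)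
qed

lemma scalar_prod_dt: "y \<in> carrier_vec n ==> x \<bullet> y = dt n (vec_index x) (vec_index y)" for x y :: "real vec"
 by (simp add: scalar_prod_def dt_def lessThan_atLeast0)

lemma miqp_okD:
 assumes ok: "miqp_ok n p H h Q c"
 defines "L \<equiv> encode_miqp n p H h Q c"
 shows "symm n (mx (emat n L 2))" "symm n (mx (emat n L (2 + 2 * (n * n) + 2 * n)))"
  "\<exists>i<n. z i \<noteq> 0 ==> 0 < bil n (rm (emat n L (2 + 2 * (n * n) + 2 * n))) z z"
proof -
 have a: "p \<le> n" "H \<in> carrier_mat n n" "transpose_mat H = H" "h \<in> carrier_vec n" "Q \<in> carrier_mat n n"
  "pos_def_mat n (map_mat of_rat Q)" "c \<in> carrier_vec n" using ok by (auto simp: miqp_ok_def)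
 note dH = dec_H[OF a(2,4,5,7,1), folded L_def]
 define Q' where "Q' = emat n L (2 + 2 * (n * n) + 2 * n)"
 have dQ: "mx Q' i j = Q $$ (i, j)" if "i < n" "j < n" for i j
  unfolding Q'_def L_def by (rule dec_Q[OF a(2,4,5,7,1) that])
 have "H $$ (i, j) = H $$ (j, i)" if "i < n" "j < n" for i j
  using arg_cong[OF a(3), of "%A. A $$ (i, j)"] a(2) that by simp
 thus "symm n (mx (emat n L 2))" by (simp add: symm_def dH)
 have tQ: "transpose_mat (map_mat of_rat Q :: real mat) = map_mat of_rat Q" using a(6) by (simp add: pos_def_mat_def)
 have "Q $$ (i, j) = Q $$ (j, i)" if "i < n" "j < n" for i j
  using arg_cong[OF tQ, of "%A. A $$ (i, j)"] a(5) that by simp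
 thus "symm n (mx (emat n L (2 + 2 * (n * n) + 2 * n)))" unfolding Q'_def[symmetric] by (simp add: symm_def dQ)
 show "0 < bil n (rm (emat n L (2 + 2 * (n * n) + 2 * n))) z z" if z: "\<exists>i<n. z i \<noteq> 0"
 proof -
  have "vec n z \<noteq> 0\<^sub>v n"
  proof
   assume "vec n z = 0\<^sub>v n"
   hence "vec n z $ i = 0" if "i < n" for i using that by simp
   thus False using z by auto
  qed
  hence "0 < vec n z \<bullet> (map_mat of_rat Q *\<^sub>v vec n z)" using a(6) by (simp add: pos_def_mat_def)
  also have "\<dots> = bil n (%i j. map_mat of_rat Q $$ (i, j)) (vec_index (vec n z)) (vec_index (vec n z))"
   by (rule scalar_prod_mat) (use a(5) in simp_all)
  also have "\<dots> = bil n (rm (emat n L (2 + 2 * (n * n) + 2 * n))) z z" unfolding Q'_def[symmetric]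
   by (rule bil_cong) (use a(5) in \<open>simp_all add: rm_def dQ\<close>)
  finally show ?thesis .
 qed
qed

text \<open>The two numbers that encode the approximation of \<epsilon> are left free, since
  \<open>program\<close> asks for membership with all of them.\<close>

definition dom :: "(int list \<times> int \<times> int) set" where
 "dom = {x. \<exists>n p H h Q c. miqp_ok n p H h Q c \<and> fst x = encode_miqp n p H h Q c}"

lemma FP_alg: "FP dom alg"
proof -
 define cnt where "cnt x = intnat (fst x) (elt 0 (fst x) 0)" for x :: "int list \<times> int \<times> int"
 define prt where "prt x = intnat (fst x) (elt 0 (fst x) 1)" for x :: "int list \<times> int \<times> int"
 have L: "FP dom (%x. fst x)" by (intro FP_fst FP_id)
 have np: "FP dom cnt" "FP dom prt" unfolding cnt_def prt_def by (intro FP_intnat FP_elt FP_const L)+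
 have e: "FP dom (%x. Rat.Fract (fst (snd x)) (snd (snd x)))" by (intro FP_Fract FP_fst FP_snd FP_id)
 have ok: "\<exists>n p H h Q c. miqp_ok n p H h Q c \<and> fst x = encode_miqp n p H h Q c \<and> cnt x = n \<and> prt x = p" if "x \<in> dom" for x
 proof -
  obtain n p H h Q c where o: "miqp_ok n p H h Q c" "fst x = encode_miqp n p H h Q c" using \<open>x \<in> dom\<close> by (auto simp: dom_def)
  hence "cnt x = n" "prt x = p"
   using intnat_inp[of H n h Q c p] by (simp_all add: cnt_def prt_def miqp_ok_def)
  thus ?thesis using o by blast
 qed
 have "FP dom (%x. solve (cnt x) (prt x) (emat (cnt x) (fst x) 2) (evec (cnt x) (fst x) (2 + 2 * (cnt x * cnt x)))
   (emat (cnt x) (fst x) (2 + 2 * (cnt x * cnt x) + 2 * cnt x)) (evec (cnt x) (fst x) (2 + 4 * (cnt x * cnt x) + 2 * cnt x)) (Rat.Fract (fst (snd x)) (snd (snd x))))"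
 proof (rule FP_solve[OF np _ _ _ _ e])
  show "FP dom (%x. emat (cnt x) (fst x) 2)" "FP dom (%x. evec (cnt x) (fst x) (2 + 2 * (cnt x * cnt x)))"
   "FP dom (%x. emat (cnt x) (fst x) (2 + 2 * (cnt x * cnt x) + 2 * cnt x))" "FP dom (%x. evec (cnt x) (fst x) (2 + 4 * (cnt x * cnt x) + 2 * cnt x))"
   by (intro FP_emat FP_evec FP_nat_add FP_nat_mult FP_const np L)+
 next
  fix x assume "x \<in> dom"
  then obtain n p H h Q c where o: "miqp_ok n p H h Q c" "fst x = encode_miqp n p H h Q c" "cnt x = n" "prt x = p" using ok by blast
  show "symm (cnt x) (mx (emat (cnt x) (fst x) 2))" "symm (cnt x) (mx (emat (cnt x) (fst x) (2 + 2 * (cnt x * cnt x) + 2 * cnt x)))"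
   unfolding o(2-4) by (rule miqp_okD[OF o(1)])+
  show "prt x \<le> cnt x" unfolding o(3,4) using o(1) by (simp add: miqp_ok_def)
  show "0 < bil (cnt x) (rm (emat (cnt x) (fst x) (2 + 2 * (cnt x * cnt x) + 2 * cnt x))) z z" if "\<exists>i<cnt x. z i \<noteq> 0" for z
   using that unfolding o(2-4) by (rule miqp_okD(3)[OF o(1)])
 qed
 thus ?thesis unfolding alg_def[abs_def] alg2_def cnt_def prt_def .
qed

section \<open>Back to vectors and matrices\<close>

text \<open>Moving the origin to the centre of the ellipsoid changes the objective by a constant,
  which has to be taken out of infimum and supremum.\<close>

lemma Inf_shift:
 fixes A :: "real set"
 assumes "A \<noteq> {}" "bdd_below A"
 shows "Inf ((%t. k + t) ` A) = k + Inf A"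
proof (rule cInf_eq_non_empty)
 show "k + Inf A \<le> x" if "x \<in> (%t. k + t) ` A" for x using that assms by (auto intro: cInf_lower)
 show "y \<le> k + Inf A" if "\<And>x. x \<in> (%t. k + t) ` A ==> y \<le> x" for y
 proof -
  have "y - k \<le> Inf A" by (rule cInf_greatest[OF assms(1)]) (use that in \<open>fastforce simp: diff_le_eq add.commute\<close>)
  thus ?thesis by simp
 qed
qed (use assms in auto)

lemma Sup_shift:
 fixes A :: "real set"
 assumes "A \<noteq> {}" "bdd_above A"
 shows "Sup ((%t. k + t) ` A) = k + Sup A"
proof (rule cSup_eq_non_empty)
 show "x \<le> k + Sup A" if "x \<in> (%t. k + t) ` A" for x using that assms by (auto intro: cSup_upper)
 show "k + Sup A \<le> y" if "\<And>x. x \<in> (%t. k + t) ` A ==> x \<le> y" for y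
 proof -
  have "Sup A \<le> y - k" by (rule cSup_least[OF assms(1)]) (use that in \<open>fastforce simp: le_diff_eq add.commute\<close>)
  thus ?thesis by simp
 qed
qed (use assms in auto)

lemma outputs_point_interleave:
 assumes "\<forall>j<length (0 # interleave y). m 2 (int j) = (0 # interleave y) ! j"
 shows "outputs_point m (vec_of_list y)"
 unfolding outputs_point_def
proof (intro conjI allI impI)
 show "m 2 0 = 0" using spec[OF assms, of 0] by simp
 fix i assume "i < dim_vec (vec_of_list y)"
 hence i: "i < length y" by simp
 have "m 2 (int (Suc (2 * i))) = nu (y ! i)" "m 2 (int (Suc (2 * i + 1))) = de (y ! i)"
  using spec[OF assms, of "Suc (2 * i)"] spec[OF assms, of "Suc (2 * i + 1)"] i nth_interleave[OF i] by (simp_all add: length_interleave)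
 thus "holds_rat m (1 + 2 * int i) (vec_of_list y $ i)"
  using nu_de[of "y ! i"] de_pos[of "y ! i"] by (simp add: holds_rat_def vec_of_list_index add.commute)
qed

lemma outputs_direction_list:
 assumes "\<forall>j<length (1 # (list_of_vec d @ [nu \<rho>, de \<rho>])). m 2 (int j) = (1 # (list_of_vec d @ [nu \<rho>, de \<rho>])) ! j"
 shows "outputs_direction m d \<rho>"
 unfolding outputs_direction_def
proof (intro conjI allI impI)
 show "m 2 0 = 1" using spec[OF assms, of 0] by simp
 show "m 2 (1 + int i) = d $ i" if "i < dim_vec d" for i
  using spec[OF assms, of "Suc i"] that by (simp add: nth_append list_of_vec_index add.commute)
 have "m 2 (int (Suc (dim_vec d))) = nu \<rho>" "m 2 (int (Suc (Suc (dim_vec d)))) = de \<rho>"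
  using spec[OF assms, of "Suc (dim_vec d)"] spec[OF assms, of "Suc (Suc (dim_vec d))"] by (simp_all add: nth_append)
 thus "holds_rat m (1 + int (dim_vec d)) \<rho>"
  using nu_de[of \<rho>] de_pos[of \<rho>] by (simp add: holds_rat_def add.commute)
qed

definition correct_output :: "nat => nat => rat mat => rat vec => rat mat => rat vec => real => memory => bool" where
 "correct_output n p H h Q c \<epsilon> m \<longleftrightarrow>
    ((\<exists>x \<in> carrier_vec n. outputs_point m x \<and>
      approx_solution \<epsilon>
       (quadratic_objective (map_mat of_rat H) (map_vec of_rat h))
       (ellipsoid (map_vec of_rat c) (map_mat of_rat Q) \<inter> mixed_integer_points n p)
       (map_vec of_rat x)) \<or>
     (\<exists>d \<in> carrier_vec n. \<exists>\<rho>. outputs_direction m d \<rho> \<and>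
      d \<noteq> 0\<^sub>v n \<and> (\<forall>i. p \<le> i \<and> i < n --> d $ i = 0) \<and>
      (%x. map_vec of_int d \<bullet> x) ` ellipsoid (map_vec of_rat c) (map_mat of_rat Q)
       \<subseteq> {of_rat \<rho> .. of_rat \<rho> + 19 * real p * 2 powr (real p * (real p - 1) / 4) / \<epsilon>}))"

lemma solve_cases:
 assumes ok: "miqp_ok n p H h Q c" and e: "0 < e" "of_rat e \<le> \<epsilon>" "\<epsilon> \<le> 1" "\<epsilon> \<le> 9 / 8 * of_rat e"
 defines "L \<equiv> encode_miqp n p H h Q c"
 assumes out: "\<forall>j<length (alg2 n p L e). m 2 (int j) = alg2 n p L e ! j"
 shows "correct_output n p H h Q c \<epsilon> m"
proof -
 have a: "p \<le> n" "H \<in> carrier_mat n n" "transpose_mat H = H" "h \<in> carrier_vec n" "Q \<in> carrier_mat n n"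
  "pos_def_mat n (map_mat of_rat Q)" "c \<in> carrier_vec n" using ok by (auto simp: miqp_ok_def)
 define fob where "fob = quadratic_objective (map_mat of_rat H) (map_vec of_rat h)"
 define dmn where "dmn = ellipsoid (map_vec of_rat c) (map_mat of_rat Q) \<inter> mixed_integer_points n p"
 define H' where "H' = emat n L 2"
 define h' where "h' = evec n L (2 + 2 * (n * n))"
 define Q' where "Q' = emat n L (2 + 2 * (n * n) + 2 * n)"
 define c' where "c' = evec n L (2 + 4 * (n * n) + 2 * n)"
 have dH: "mx H' i j = H $$ (i, j)" if "i < n" "j < n" for i j
  unfolding H'_def L_def by (rule dec_H[OF a(2,4,5,7,1) that])
 have dQ: "mx Q' i j = Q $$ (i, j)" if "i < n" "j < n" for i j
  unfolding Q'_def L_def by (rule dec_Q[OF a(2,4,5,7,1) that])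
 have dh: "vx h' i = h $ i" if "i < n" for i
  unfolding h'_def L_def by (rule dec_h[OF a(2,4,5,7,1) that])
 have dc: "vx c' i = c $ i" if "i < n" for i
  unfolding c'_def L_def by (rule dec_c[OF a(2,4,5,7,1) that])
 have symH: "symm n (mx H')" unfolding H'_def L_def by (rule miqp_okD(1)[OF ok])
 have symQ: "symm n (mx Q')" unfolding Q'_def L_def by (rule miqp_okD(2)[OF ok])
 have posQ: "0 < bil n (rm Q') z z" if "\<exists>i<n. z i \<noteq> 0" for z
  unfolding Q'_def L_def by (rule miqp_okD(3)[OF ok that])
 define R where "R = minv n Q' (gso n Q' (units n n))"
 define W where "W = lll n p R"
 define b where "b = bvec n H' h' c'"
 have symR: "symm n (mx R)" unfolding R_def by (rule symm_minv)
 have posR: "0 < bil n (mx R) v v" if "\<exists>i<n. v i \<noteq> 0" for v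
  by (rule pos_R_rat[OF symQ posQ R_def that])
 have W: "linv n p R W" "reduced n p R W"
  unfolding W_def using lll_spec(1)[OF a(1) symR posR] lll_spec(2)[OF a(1) symR posR] by simp_all
 have sol: "alg2 n p L e = solve3 n p H' b Q' R c' e W (gso n R W)"
  by (simp add: alg2_def solve_def solve1_def solve2_def H'_def h'_def Q'_def c'_def b_def R_def W_def)
 note ctx = symH symQ posQ R_def a(1) W e
 define B where "B = ball n Q'"
 define F where "F = feas n p Q' c'"
 have ball: "u \<in> B \<longleftrightarrow> bil n (rm Q') u u \<le> 1" for u
  unfolding B_def by (simp add: ball_def[OF ctx] nm_le_1[OF symm_rm[OF symQ] psdQ[OF symH symQ posQ R_def]])
 have feas: "u \<in> F \<longleftrightarrow> u \<in> B \<and> (\<forall>i<p. u i + rx c' i \<in> \<int>)" for u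
  unfolding F_def B_def by (simp add: feas_def[OF ctx])
 have ell: "x \<in> ellipsoid (map_vec of_rat c) (map_mat of_rat Q) \<longleftrightarrow> x \<in> carrier_vec n \<and> (%i. x $ i - rx c' i) \<in> B" for x
 proof (cases "x \<in> carrier_vec n")
  case True
  let ?u = "x - map_vec of_rat c"
  have "?u \<bullet> (map_mat of_rat Q *\<^sub>v ?u) = bil n (%i j. map_mat of_rat Q $$ (i, j)) (vec_index ?u) (vec_index ?u)"
   by (rule scalar_prod_mat) (use True a in simp_all)
  also have "\<dots> = bil n (rm Q') (%i. x $ i - rx c' i) (%i. x $ i - rx c' i)"
   by (rule bil_cong) (use True a in \<open>simp_all add: rm_def rx_def dQ dc\<close>)
  finally show ?thesis using True a unfolding ball ellipsoid_def by simp
 qed (use a in \<open>simp add: ellipsoid_def\<close>)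
 have mixed: "x \<in> dmn \<longleftrightarrow> x \<in> carrier_vec n \<and> (%i. x $ i - rx c' i) \<in> F" for x
  unfolding dmn_def Int_iff ell feas mixed_integer_points_def by auto
 \<comment> \<open>The value of the objective at the centre, the constant term after the change of
   origin.\<close>
 define K where "K = bil n (rm H') (rx c') (rx c') + dt n (rx h') (rx c')"
 have obj: "fob x = K + qf n (rm H') (rx b) (%i. x $ i - rx c' i)" if x: "x \<in> carrier_vec n" for x
 proof -
  define u where "u = (%i. x $ i - rx c' i)"
  have xu: "x $ i = u i + rx c' i" for i by (simp add: u_def)
  have "x \<bullet> (map_mat of_rat H *\<^sub>v x) = bil n (%i j. map_mat of_rat H $$ (i, j)) (vec_index x) (vec_index x)"
   by (rule scalar_prod_mat) (use x a in simp_all)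
  also have "\<dots> = bil n (rm H') (%i. u i + rx c' i) (%i. u i + rx c' i)"
   by (rule bil_cong) (use a in \<open>simp_all add: rm_def dH xu\<close>)
  also have "\<dots> = bil n (rm H') u u + 2 * bil n (rm H') u (rx c') + bil n (rm H') (rx c') (rx c')"
   using bil_sym[OF symm_rm[OF symH], of "rx c'" u] by (simp add: bil_linear)
  finally have 1: "x \<bullet> (map_mat of_rat H *\<^sub>v x) = \<dots>" .
  have "map_vec of_rat h \<bullet> x = dt n (vec_index (map_vec of_rat h)) (vec_index x)" by (rule scalar_prod_dt[OF x])
  also have "\<dots> = dt n (rx h') (%i. u i + rx c' i)"
   by (rule dt_cong) (use a in \<open>simp_all add: rx_def dh u_def\<close>)
  finally have 2: "map_vec of_rat h \<bullet> x = dt n (rx h') u + dt n (rx h') (rx c')" by (simp only: dt_add)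
  have "dt n (rx b) u = dt n u (rx b)" by (rule dt_commute)
  also have "\<dots> = dt n u (%i. 2 * (\<Sum>j<n. rm H' i j * rx c' j) + rx h' i)"
   unfolding b_def bvec_def by (rule dt_cong) (simp_all add: rx_def rm_def of_rat_add of_rat_mult of_rat_sum)
  also have "\<dots> = 2 * bil n (rm H') u (rx c') + dt n (rx h') u"
   unfolding dt_add dt_scale bil_dt by (simp only: dt_commute)
  finally have 3: "dt n (rx b) u = \<dots>" .
  show ?thesis unfolding fob_def quadratic_objective_def 1 2 u_def[symmetric] qf_def 3 K_def by simp
 qed
 have image: "fob ` dmn = (%t. K + t) ` (qf n (rm H') (rx b) ` F)"
 proof (rule subset_antisym; rule subsetI)
  fix t assume "t \<in> fob ` dmn"
  then obtain x where x: "x \<in> dmn" "t = fob x" by blast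
  thus "t \<in> (%t. K + t) ` (qf n (rm H') (rx b) ` F)"
   using obj[of x] unfolding mixed by (auto simp: image_image)
 next
  fix t assume "t \<in> (%t. K + t) ` (qf n (rm H') (rx b) ` F)"
  then obtain u where u: "u \<in> F" "t = K + qf n (rm H') (rx b) u" by blast
  \<comment> \<open>\<open>u\<close> is arbitrary from index \<open>n\<close> on, but objective and
    feasibility depend on its first \<open>n\<close> coordinates only.\<close>
  define x where "x = vec n (%i. u i + rx c' i)"
  have x: "x \<in> carrier_vec n" by (simp add: x_def)
  have xi: "x $ i - rx c' i = u i" if "i < n" for i using that by (simp add: x_def)
  have "bil n (rm Q') (%i. x $ i - rx c' i) (%i. x $ i - rx c' i) = bil n (rm Q') u u"
   by (rule bil_cong) (simp_all add: xi)
  hence "(%i. x $ i - rx c' i) \<in> F" using u(1) a(1) unfolding feas ball by (auto simp: x_def)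
  hence xd: "x \<in> dmn" using x mixed by blast
  have "qf n (rm H') (rx b) (%i. x $ i - rx c' i) = qf n (rm H') (rx b) u"
   unfolding qf_def by (intro arg_cong2[where f = "(+)"] bil_cong dt_cong) (simp_all add: xi)
  hence "t = fob x" using u(2) obj[OF x] by simp
  thus "t \<in> fob ` dmn" using xd by blast
 qed
 show ?thesis
 proof (cases "256 * tau n p R (gso n R W) \<le> e * e")
  case True
  define y where "y = rlist n W (gmat n p R (gso n R W)) p (shrink n c' e (trs n H' b Q' R (tol n H' b Q' e)))"
  define v where "v = (%l. rx y l - rx c' l)"
  have alg: "alg2 n p L e = 0 # interleave y" unfolding sol solve3_def using True by (simp add: y_def)
  have ly: "length y = n" unfolding y_def by (rule solve_point(1)[OF ctx True])
  have vF: "v \<in> F" unfolding v_def y_def F_def by (rule solve_point(2)[OF ctx True])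
  have ap: "qf n (rm H') (rx b) v - (INF u\<in>F. qf n (rm H') (rx b) u) \<le>
    \<epsilon> * ((SUP u\<in>F. qf n (rm H') (rx b) u) - (INF u\<in>F. qf n (rm H') (rx b) u))"
   unfolding v_def y_def F_def by (rule solve_point(3)[OF ctx True])
  have FB: "F \<subseteq> B" using feas by blast
  have bd: "bdd_above (qf n (rm H') (rx b) ` F)" "bdd_below (qf n (rm H') (rx b) ` F)"
   using bdd_above_mono[OF obj_bdd(1)[OF ctx] image_mono[OF FB[unfolded B_def]]]
    bdd_below_mono[OF obj_bdd(2)[OF ctx] image_mono[OF FB[unfolded B_def]]] by simp_all
  define x where "x = (map_vec of_rat (vec_of_list y) :: real vec)"
  have x: "x \<in> carrier_vec n" using ly by (simp add: x_def carrier_vecI)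
  have xv: "x $ i - rx c' i = v i" if "i < n" for i
   using that ly by (simp add: x_def v_def rx_def elt_def vec_of_list_index)
  have "bil n (rm Q') (%i. x $ i - rx c' i) (%i. x $ i - rx c' i) = bil n (rm Q') v v"
   by (rule bil_cong) (simp_all add: xv)
  moreover have "x $ i = v i + rx c' i" if "i < p" for i using xv[of i] that a(1) by simp
  ultimately have "(%i. x $ i - rx c' i) \<in> F" using vF unfolding feas ball by simp
  hence xd: "x \<in> dmn" using x mixed by blast
  have "qf n (rm H') (rx b) (%i. x $ i - rx c' i) = qf n (rm H') (rx b) v"
   unfolding qf_def by (intro arg_cong2[where f = "(+)"] bil_cong dt_cong) (simp_all add: xv)
  hence fx: "fob x = K + qf n (rm H') (rx b) v" using obj[OF x] by simp
  have ne: "qf n (rm H') (rx b) ` F \<noteq> {}" using vF by blast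
  have "approx_solution \<epsilon> fob dmn x"
   unfolding approx_solution_def image Inf_shift[OF ne bd(2)] Sup_shift[OF ne bd(1)] fx using xd ap by simp
  moreover have "outputs_point m (vec_of_list y)"
   by (rule outputs_point_interleave) (use out in \<open>simp only: alg\<close>)
  moreover have "vec_of_list y \<in> carrier_vec n" using ly by (simp add: carrier_vecI)
  ultimately show ?thesis unfolding correct_output_def x_def fob_def dmn_def by blast
 next
  case False
  define \<rho> where "\<rho> = dt n (mx W 0) (vx c') - usqrt (bil n (mx R) (mx W 0) (mx W 0))"
  note dir = solve_direction[OF ctx False, folded \<rho>_def]
  have Wint: "of_int \<lfloor>mx W 0 l\<rfloor> = mx W 0 l" for l
  proof -
   have "mx W 0 l \<in> \<int>" by (rule linvD(2)[OF a(1) symR posR W(1)])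
   thus ?thesis by (auto elim!: Ints_cases)
  qed
  define d where "d = vec n (%l. \<lfloor>mx W 0 l\<rfloor>)"
  have d: "d \<in> carrier_vec n" by (simp add: d_def)
  have ld: "list_of_vec d = tab n (%l. \<lfloor>vx (elt [] W 0) l\<rfloor>)"
   by (rule nth_equalityI) (simp_all add: d_def tab_def mx_def list_of_vec_index)
  have alg: "alg2 n p L e = 1 # (list_of_vec d @ [nu \<rho>, de \<rho>])"
   unfolding sol solve3_def dirout_def \<rho>_def ld using False by simp
  have nz: "d \<noteq> 0\<^sub>v n"
  proof
   assume d0: "d = 0\<^sub>v n"
   obtain i where i: "i < n" "mx W 0 i \<noteq> 0" using dir(2) by blast
   have "d $ i = 0" unfolding d0 using i by simp
   hence "\<lfloor>mx W 0 i\<rfloor> = 0" using i by (simp add: d_def)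
   thus False using Wint[of i] i by simp
  qed
  have tail: "d $ i = 0" if "p \<le> i" "i < n" for i
   using linvD(3)[OF a(1) symR posR W(1) that(1), of 0] that by (simp add: d_def)
  have "of_rat \<rho> \<le> map_vec of_int d \<bullet> x \<and> map_vec of_int d \<bullet> x \<le> of_rat \<rho> + 19 * lwidth p / \<epsilon>"
   if x: "x \<in> ellipsoid (map_vec of_rat c) (map_mat of_rat Q)" for x
  proof -
   have xc: "x \<in> carrier_vec n" and xB: "(%i. x $ i - rx c' i) \<in> B" using x ell by auto
   have n1: "nm n (rm Q') (%i. x $ i - rx c' i) \<le> 1"
    using xB unfolding ball by (simp add: nm_le_1[OF symm_rm[OF symQ] psdQ[OF symH symQ posQ R_def]])
   have "map_vec of_int d \<bullet> x = dt n (vec_index (map_vec of_int d)) (vec_index x)" by (rule scalar_prod_dt[OF xc])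
   also have "\<dots> = dt n (rm W 0) (vec_index x)"
   proof (rule dt_cong)
    fix i assume "i < n"
    hence "map_vec real_of_int d $ i = of_rat (of_int \<lfloor>mx W 0 i\<rfloor>)" by (simp add: d_def)
    thus "map_vec real_of_int d $ i = rm W 0 i" unfolding Wint rm_def .
   qed simp
   moreover have "of_rat \<rho> \<le> dt n (rm W 0) (vec_index x) \<and>
     dt n (rm W 0) (vec_index x) \<le> of_rat \<rho> + 19 * lwidth p / \<epsilon>"
    unfolding \<rho>_def by (rule solve_direction(3)[OF ctx False n1])
   ultimately show ?thesis by simp
  qed
  hence "(%x. map_vec of_int d \<bullet> x) ` ellipsoid (map_vec of_rat c) (map_mat of_rat Q)
    \<subseteq> {of_rat \<rho> .. of_rat \<rho> + 19 * real p * 2 powr (real p * (real p - 1) / 4) / \<epsilon>}"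
   by (auto simp: lwidth_def mult.assoc)
  moreover have "outputs_direction m d \<rho>"
   by (rule outputs_direction_list) (use out in \<open>simp only: alg\<close>)
  ultimately show ?thesis unfolding correct_output_def using d nz tail by blast
 qed
qed

section \<open>Assembling the running time polynomial\<close>

text \<open>The rounded logarithm provides enough digits to reach 1, and three more to reach
  8.\<close>

lemma exponent_bound:
 assumes "0 < \<epsilon>" "\<epsilon> \<le> 1"
 shows "8 \<le> \<lfloor>2 ^ (nat \<lceil>log 2 (1 / \<epsilon>)\<rceil> + 3) * \<epsilon>\<rfloor>" "real (nat \<lceil>log 2 (1 / \<epsilon>)\<rceil> + 3) \<le> log 2 (1 / \<epsilon>) + 4"
proof -
 define j where "j = nat \<lceil>log 2 (1 / \<epsilon>)\<rceil>"
 have l0: "0 \<le> log 2 (1 / \<epsilon>)" using assms by simp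
 have j: "log 2 (1 / \<epsilon>) \<le> real j" "real j \<le> log 2 (1 / \<epsilon>) + 1" using l0 unfolding j_def by linarith+
 have "1 / \<epsilon> = 2 powr log 2 (1 / \<epsilon>)" using assms by simp
 also have "\<dots> \<le> 2 powr real j" using j(1) by (rule powr_mono) simp
 also have "\<dots> = 2 ^ j" by (simp add: powr_realpow)
 finally have "1 \<le> 2 ^ j * \<epsilon>" using assms by (simp add: divide_le_eq)
 hence "8 \<le> 2 ^ (j + 3) * \<epsilon>" by (simp add: power_add)
 thus "8 \<le> \<lfloor>2 ^ (nat \<lceil>log 2 (1 / \<epsilon>)\<rceil> + 3) * \<epsilon>\<rfloor>" unfolding j_def[symmetric] by (simp add: le_floor_iff)
 show "real (nat \<lceil>log 2 (1 / \<epsilon>)\<rceil> + 3) \<le> log 2 (1 / \<epsilon>) + 4" unfolding j_def[symmetric] using j(2) by simp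
qed

lemma correct_program:
 "\<exists>(prog :: com) (P :: real poly poly). \<forall>n p H h Q c \<epsilon>. miqp_ok n p H h Q c \<and> 0 < \<epsilon> \<and> \<epsilon> \<le> 1 -->
  (\<exists>t m. run prog (initial_memory (encode_miqp n p H h Q c) \<epsilon>) t m \<and>
    real t \<le> poly (poly P [:log 2 (1 / \<epsilon>):]) (real (miqp_size n p H h Q c)) \<and> correct_output n p H h Q c \<epsilon> m)"
proof -
 from program[OF FP_alg] obtain prog cc k where prog: "\<forall>L \<epsilon> n I. length L = 2 + 4 * (n * n + n) --> L ! 0 = int n --> 0 < \<epsilon> --> \<epsilon> \<le> 1 -->
   8 \<le> \<lfloor>2 ^ I * \<epsilon>\<rfloor> --> (\<forall>i a. (L, (a, 2 ^ i)) \<in> dom) -->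
  (\<exists>t m i a. run prog (initial_memory L \<epsilon>) t m \<and> a = \<lfloor>2 ^ i * \<epsilon>\<rfloor> \<and> 8 \<le> a \<and>
   (\<forall>j<length (alg (L, (a, 2 ^ i))). m 2 (int j) = alg (L, (a, 2 ^ i)) ! j) \<and>
   t \<le> cc * (sum_list (map int_size L) + I + 100) ^ k)"
  by (elim exE)
 \<comment> \<open>The inner variable stands for the size, the outer one for the logarithm. The 104
   is 100 from \<open>program\<close> plus 4 from \<open>exponent_bound\<close>.\<close>
 define P :: "real poly poly" where "P = [:[:of_nat cc:]:] * [:[:104, 1:], [:1:]:] ^ k"
 show ?thesis
 proof (rule exI[of _ prog], rule exI[of _ P], intro allI impI)
  fix n p :: nat and H Q :: "rat mat" and h c :: "rat vec" and \<epsilon> :: real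
  assume "miqp_ok n p H h Q c \<and> 0 < \<epsilon> \<and> \<epsilon> \<le> 1"
  hence ok: "miqp_ok n p H h Q c" and \<epsilon>: "0 < \<epsilon>" "\<epsilon> \<le> 1" by simp_all
  have cs: "H \<in> carrier_mat n n" "h \<in> carrier_vec n" "Q \<in> carrier_mat n n" "c \<in> carrier_vec n" "p \<le> n"
   using ok by (simp_all add: miqp_ok_def)
  define L where "L = encode_miqp n p H h Q c"
  define I where "I = nat \<lceil>log 2 (1 / \<epsilon>)\<rceil> + 3"
  note I = exponent_bound[OF \<epsilon>, folded I_def]
  have "\<exists>t m i a. run prog (initial_memory L \<epsilon>) t m \<and> a = \<lfloor>2 ^ i * \<epsilon>\<rfloor> \<and> 8 \<le> a \<and>
   (\<forall>j<length (alg (L, (a, 2 ^ i))). m 2 (int j) = alg (L, (a, 2 ^ i)) ! j) \<and>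
   t \<le> cc * (sum_list (map int_size L) + I + 100) ^ k"
  proof (rule prog[rule_format, OF _ _ \<epsilon> I(1)])
   show "length L = 2 + 4 * (n * n + n)" unfolding L_def by (rule length_inp[OF cs])
   show "L ! 0 = int n" unfolding L_def by (rule inp_head(1)[OF cs])
   show "(L, (a, 2 ^ i)) \<in> dom" for a i using ok unfolding dom_def L_def mem_Collect_eq fst_conv by blast
  qed
  then obtain t m i a where t: "run prog (initial_memory L \<epsilon>) t m" "a = \<lfloor>2 ^ i * \<epsilon>\<rfloor>" "8 \<le> a"
   "\<forall>j<length (alg (L, (a, 2 ^ i))). m 2 (int j) = alg (L, (a, 2 ^ i)) ! j"
   "t \<le> cc * (sum_list (map int_size L) + I + 100) ^ k" by (elim exE conjE)
  define e where "e = Rat.Fract a (2 ^ i)"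
  have e_eq: "of_rat e = of_int a / (2 ^ i :: real)" by (simp add: e_def of_rat_rat)
  have fl: "of_int a \<le> 2 ^ i * \<epsilon>" "2 ^ i * \<epsilon> < of_int a + 1" unfolding t(2) by linarith+
  have e: "0 < e" "of_rat e \<le> \<epsilon>" "\<epsilon> \<le> 9 / 8 * of_rat e"
  proof -
   have "0 < (of_rat e :: real)" unfolding e_eq using t(3) by simp
   thus "0 < e" by simp
   show "of_rat e \<le> \<epsilon>" unfolding e_eq using fl(1) by (simp add: divide_le_eq mult.commute)
   \<comment> \<open>Truncation loses less than one unit, which is at most an eighth of
     \<open>a\<close>.\<close>
   have "(8::real) \<le> of_int a" using t(3) by simp
   hence "2 ^ i * \<epsilon> \<le> 9 / 8 * of_int a" using fl(2) by simp
   thus "\<epsilon> \<le> 9 / 8 * of_rat e" unfolding e_eq by (simp add: le_divide_eq mult.commute)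
  qed
  have al: "alg (L, (a, 2 ^ i)) = alg2 n p L e" unfolding L_def e_def by (rule alg_inp[OF cs])
  have "real t \<le> poly (poly P [:log 2 (1 / \<epsilon>):]) (real (miqp_size n p H h Q c))"
  proof -
   have s: "sum_list (map int_size L) = miqp_size n p H h Q c" by (simp add: miqp_size_def L_def)
   have "real t \<le> real (cc * (sum_list (map int_size L) + I + 100) ^ k)" using t(5) by (simp only: of_nat_le_iff)
   also have "\<dots> = real cc * (real (miqp_size n p H h Q c) + real I + 100) ^ k" by (simp add: s)
   also have "\<dots> \<le> real cc * (104 + real (miqp_size n p H h Q c) + log 2 (1 / \<epsilon>)) ^ k"
    using I(2) by (intro mult_left_mono power_mono) auto
   also have "\<dots> = poly (poly P [:log 2 (1 / \<epsilon>):]) (real (miqp_size n p H h Q c))"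
    by (simp add: P_def poly_power add_ac)
   finally show ?thesis .
  qed
  moreover have "correct_output n p H h Q c \<epsilon> m"
   by (rule solve_cases[OF ok e(1,2) \<epsilon>(2) e(3), folded L_def]) (use t(4) in \<open>simp only: al\<close>)
  ultimately show "\<exists>t m. run prog (initial_memory (encode_miqp n p H h Q c) \<epsilon>) t m \<and>
    real t \<le> poly (poly P [:log 2 (1 / \<epsilon>):]) (real (miqp_size n p H h Q c)) \<and> correct_output n p H h Q c \<epsilon> m"
   using t(1) unfolding L_def by blast
 qed
qed

theorem proposition2:
  shows "\<exists>(prog :: com) (P :: real poly poly).
    \<forall>(n :: nat) (p :: nat) (H :: rat mat) (h :: rat vec) (Q :: rat mat) (c :: rat vec) (\<epsilon> :: real).
      p \<le> n \<and>
      H \<in> carrier_mat n n \<and> transpose_mat H = H \<and> h \<in> carrier_vec n \<and>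
      Q \<in> carrier_mat n n \<and> pos_def_mat n (map_mat of_rat Q) \<and> c \<in> carrier_vec n \<and>
      0 < \<epsilon> \<and> \<epsilon> \<le> 1 \<longrightarrow>
      (\<exists>t m. run prog (initial_memory (encode_miqp n p H h Q c) \<epsilon>) t m \<and>
        real t \<le> poly (poly P [:log 2 (1 / \<epsilon>):]) (real (miqp_size n p H h Q c)) \<and>
        ((\<exists>x \<in> carrier_vec n. outputs_point m x \<and>
            approx_solution \<epsilon>
              (quadratic_objective (map_mat of_rat H) (map_vec of_rat h))
              (ellipsoid (map_vec of_rat c) (map_mat of_rat Q) \<inter> mixed_integer_points n p)
              (map_vec of_rat x)) \<or>
         (\<exists>d \<in> carrier_vec n. \<exists>\<rho>. outputs_direction m d \<rho> \<and>
            d \<noteq> 0\<^sub>v n \<and> (\<forall>i. p \<le> i \<and> i < n \<longrightarrow> d $ i = 0) \<and>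
            (\<lambda>x. map_vec of_int d \<bullet> x) ` ellipsoid (map_vec of_rat c) (map_mat of_rat Q)
              \<subseteq> {of_rat \<rho> .. of_rat \<rho> + 19 * real p * 2 powr (real p * (real p - 1) / 4) / \<epsilon>})))"
  using correct_program unfolding miqp_ok_def correct_output_def conj_assoc .

end
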